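(* Let $\varphi$ and $\psi$ be strictly positive quantified modal formulas. Then $\varphi\vdash_{\mathrm{QRC}_1}\psi$ if and only if for every arithmetical realization $\cdot^*$ we have $\mathrm{HA}\vdash \varphi^{*\mathrm{HA}}\rightarrow\psi^{*\mathrm{HA}}$.
   Context: Fix a signature of relation symbols (with arities) and individual constants; no function symbols or equality. Terms are variables $x_i$ or constants $c_i$. Strictly positive formulas: $\varphi ::= \top \mid S(\mathbf{t}) \mid (\varphi\wedge\varphi) \mid \forall x\,\varphi \mid \Diamond\varphi$. $\mathrm{QRC}_1$ derives sequents $\varphi\vdash\psi$ by: (i) $\varphi\vdash\top$, $\varphi\vdash\varphi$; (ii) $\varphi\wedge\psi\vdash\varphi$, $\varphi\wedge\psi\vdash\psi$; (iii) from $\varphi\vdash\psi$ and $\varphi\vdash\chi$ infer $\varphi\vdash\psi\wedge\chi$; (iv) from $\varphi\vdash\psi$ and $\psi\vdash\chi$ infer $\varphi\vdash\chi$; (v) from $\varphi\vdash\psi$ infer $\Diamond\varphi\vdash\Diamond\psi$; (vi) $\Diamond\Diamond\varphi\vdash\Diamond\varphi$; (vii) from $\varphi\vdash\psi$ infer $\varphi\vdash\forall x\psi$ if $x$ is not free in $\varphi$; (viii) from $\varphi[x\leftarrow t]\vdash\psi$ infer $\forall x\varphi\vdash\psi$, $t$ free for $x$ in $\varphi$; (ix) from $\varphi\vdash\psi$ infer $\varphi[x\leftarrow t]\vdash\psi[x\leftarrow t]$, $t$ free for $x$ in $\varphi$ and $\psi$; (x) from $\varphi[x\leftarrow c]\vdash\psi[x\leftarrow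 c]$ infer $\varphi\vdash\psi$, for a constant $c$ not occurring in $\varphi$ nor $\psi$. An arithmetical realization $\cdot^*$ assigns to each $n$-ary relation symbol $S$ an arithmetical formula with $n$ free variables, applied so that in $S(\mathbf{t})^*$ the modal variable $x_k$ is translated to the arithmetical variable $y_k$ and the constant $c_k$ to the arithmetical variable $z_k$. For a c.e. theory $T$ with formalized provability predicate $\Box_T$ (applied to formulas with free variables by substituting numerals for their values), $\cdot^{*T}$ is: $S(\mathbf{t})^{*T}:=S(\mathbf{t})^*$, $\top^{*T}$ a trivially true sentence, commutes with $\wedge$, $(\forall x_k\varphi)^{*T}:=\forall y_k\,\varphi^{*T}$, $(\Diamond\varphi)^{*T}:=\neg\Box_T\neg\varphi^{*T}$. HA is Heyting Arithmetic; provability of a formula with free variables is equivalent to provability of its universal closure. *)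

theory Defs
  imports Main
begin

section \<open>Strictly positive quantified modal formulas and QRC1\<close>

datatype mtrm = MVar nat | MConst nat

datatype 'r spf =
    STop
  | SRel 'r "mtrm list"
  | SAnd "'r spf" "'r spf"
  | SAll nat "'r spf"
  | SDia "'r spf"

text \<open>A signature consists of a partial map \<open>ar\<close>, which gives the arity of each of its relation
  symbols, and the set \<open>C\<close> of the indices \<open>k\<close> of its constants \<open>c\<^sub>k\<close>.\<close>

fun wf_mtrm :: "nat set \<Rightarrow> mtrm \<Rightarrow> bool" where
  "wf_mtrm C (MVar k) = True"
| "wf_mtrm C (MConst k) = (k \<in> C)"

fun wf_spf :: "('r \<Rightarrow> nat option) \<Rightarrow> nat set \<Rightarrow> 'r spf \<Rightarrow> bool" where
  "wf_spf ar C STop = True"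
| "wf_spf ar C (SRel S ts) = (ar S = Some (length ts) \<and> (\<forall>t \<in> set ts. wf_mtrm C t))"
| "wf_spf ar C (SAnd \<phi> \<psi>) = (wf_spf ar C \<phi> \<and> wf_spf ar C \<psi>)"
| "wf_spf ar C (SAll x \<phi>) = wf_spf ar C \<phi>"
| "wf_spf ar C (SDia \<phi>) = wf_spf ar C \<phi>"

fun sfree :: "'r spf \<Rightarrow> nat set" where
  "sfree STop = {}"
| "sfree (SRel S ts) = {x. MVar x \<in> set ts}"
| "sfree (SAnd \<phi> \<psi>) = sfree \<phi> \<union> sfree \<psi>"
| "sfree (SAll x \<phi>) = sfree \<phi> - {x}"
| "sfree (SDia \<phi>) = sfree \<phi>"

fun sconsts :: "'r spf \<Rightarrow> nat set" where
  "sconsts STop = {}"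
| "sconsts (SRel S ts) = {c. MConst c \<in> set ts}"
| "sconsts (SAnd \<phi> \<psi>) = sconsts \<phi> \<union> sconsts \<psi>"
| "sconsts (SAll x \<phi>) = sconsts \<phi>"
| "sconsts (SDia \<phi>) = sconsts \<phi>"

text \<open>\<open>ssubst x t \<phi>\<close> replaces the free occurrences of \<open>x\<close> without renaming bound variables; the
  rules use it only where \<open>t\<close> is free for \<open>x\<close>.\<close>

fun ssubst :: "nat \<Rightarrow> mtrm \<Rightarrow> 'r spf \<Rightarrow> 'r spf" where
  "ssubst x t STop = STop"
| "ssubst x t (SRel S ts) = SRel S (map (\<lambda>s. if s = MVar x then t else s) ts)"
| "ssubst x t (SAnd \<phi> \<psi>) = SAnd (ssubst x t \<phi>) (ssubst x t \<psi>)"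
| "ssubst x t (SAll y \<phi>) = (if y = x then SAll y \<phi> else SAll y (ssubst x t \<phi>))"
| "ssubst x t (SDia \<phi>) = SDia (ssubst x t \<phi>)"

fun free_for :: "mtrm \<Rightarrow> nat \<Rightarrow> 'r spf \<Rightarrow> bool" where
  "free_for t x STop = True"
| "free_for t x (SRel S ts) = True"
| "free_for t x (SAnd \<phi> \<psi>) = (free_for t x \<phi> \<and> free_for t x \<psi>)"
| "free_for t x (SAll y \<phi>) = (x \<notin> sfree (SAll y \<phi>) \<or> (t \<noteq> MVar y \<and> free_for t x \<phi>))"
| "free_for t x (SDia \<phi>) = free_for t x \<phi>"

inductive QRC1 :: "('r \<Rightarrow> nat option) \<Rightarrow> nat set \<Rightarrow> 'r spf \<Rightarrow> 'r spf \<Rightarrow> bool"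
  for ar :: "'r \<Rightarrow> nat option" and C :: "nat set" where
  qrc_top: "wf_spf ar C \<phi> \<Longrightarrow> QRC1 ar C \<phi> STop"
| qrc_refl: "wf_spf ar C \<phi> \<Longrightarrow> QRC1 ar C \<phi> \<phi>"
| qrc_conjE1: "wf_spf ar C \<phi> \<Longrightarrow> wf_spf ar C \<psi> \<Longrightarrow> QRC1 ar C (SAnd \<phi> \<psi>) \<phi>"
| qrc_conjE2: "wf_spf ar C \<phi> \<Longrightarrow> wf_spf ar C \<psi> \<Longrightarrow> QRC1 ar C (SAnd \<phi> \<psi>) \<psi>"
| qrc_conjI: "QRC1 ar C \<phi> \<psi> \<Longrightarrow> QRC1 ar C \<phi> \<chi> \<Longrightarrow> QRC1 ar C \<phi> (SAnd \<psi> \<chi>)"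
| qrc_cut: "QRC1 ar C \<phi> \<psi> \<Longrightarrow> QRC1 ar C \<psi> \<chi> \<Longrightarrow> QRC1 ar C \<phi> \<chi>"
| qrc_nec: "QRC1 ar C \<phi> \<psi> \<Longrightarrow> QRC1 ar C (SDia \<phi>) (SDia \<psi>)"
| qrc_trans: "wf_spf ar C \<phi> \<Longrightarrow> QRC1 ar C (SDia (SDia \<phi>)) (SDia \<phi>)"
| qrc_allR: "QRC1 ar C \<phi> \<psi> \<Longrightarrow> x \<notin> sfree \<phi> \<Longrightarrow> QRC1 ar C \<phi> (SAll x \<psi>)"
| qrc_allL: "QRC1 ar C (ssubst x t \<phi>) \<psi> \<Longrightarrow> wf_mtrm C t \<Longrightarrow> free_for t x \<phi> \<Longrightarrow>
    QRC1 ar C (SAll x \<phi>) \<psi>"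
| qrc_inst: "QRC1 ar C \<phi> \<psi> \<Longrightarrow> wf_mtrm C t \<Longrightarrow> free_for t x \<phi> \<Longrightarrow> free_for t x \<psi> \<Longrightarrow>
    QRC1 ar C (ssubst x t \<phi>) (ssubst x t \<psi>)"
| qrc_const: "QRC1 ar C (ssubst x (MConst c) \<phi>) (ssubst x (MConst c) \<psi>) \<Longrightarrow> c \<in> C \<Longrightarrow>
    c \<notin> sconsts \<phi> \<Longrightarrow> c \<notin> sconsts \<psi> \<Longrightarrow> QRC1 ar C \<phi> \<psi>"


section \<open>The language of arithmetic\<close>

text \<open>Variables are de Bruijn indices: below \<open>d\<close> quantifiers, the index \<open>d + i\<close> stands for the free
  variable \<open>i\<close>. Substitution is simultaneous and avoids capture.\<close>

datatype trm = Var nat | Zero | Succ trm | Plus trm trm | Times trm trm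

datatype fm = Eq trm trm | Bot | And fm fm | Or fm fm | Imp fm fm | Forall fm | Exists fm

abbreviation Neg :: "fm \<Rightarrow> fm" where "Neg A \<equiv> Imp A Bot"
abbreviation Verum :: fm where "Verum \<equiv> Imp Bot Bot"

fun numeral_trm :: "nat \<Rightarrow> trm" where
  "numeral_trm 0 = Zero"
| "numeral_trm (Suc n) = Succ (numeral_trm n)"

fun tfree :: "trm \<Rightarrow> nat set" where
  "tfree (Var i) = {i}"
| "tfree Zero = {}"
| "tfree (Succ t) = tfree t"
| "tfree (Plus s t) = tfree s \<union> tfree t"
| "tfree (Times s t) = tfree s \<union> tfree t"

fun ffree :: "fm \<Rightarrow> nat set" where
  "ffree (Eq s t) = tfree s \<union> tfree t"
| "ffree Bot = {}"
| "ffree (And A B) = ffree A \<union> ffree B"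
| "ffree (Or A B) = ffree A \<union> ffree B"
| "ffree (Imp A B) = ffree A \<union> ffree B"
| "ffree (Forall A) = {i. Suc i \<in> ffree A}"
| "ffree (Exists A) = {i. Suc i \<in> ffree A}"

fun tsubst :: "(nat \<Rightarrow> trm) \<Rightarrow> trm \<Rightarrow> trm" where
  "tsubst \<sigma> (Var i) = \<sigma> i"
| "tsubst \<sigma> Zero = Zero"
| "tsubst \<sigma> (Succ t) = Succ (tsubst \<sigma> t)"
| "tsubst \<sigma> (Plus s t) = Plus (tsubst \<sigma> s) (tsubst \<sigma> t)"
| "tsubst \<sigma> (Times s t) = Times (tsubst \<sigma> s) (tsubst \<sigma> t)"

definition tlift :: "trm \<Rightarrow> trm" where
  "tlift = tsubst (\<lambda>i. Var (Suc i))"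

definition up :: "(nat \<Rightarrow> trm) \<Rightarrow> nat \<Rightarrow> trm" where
  "up \<sigma> = case_nat (Var 0) (\<lambda>i. tlift (\<sigma> i))"

fun fsubst :: "(nat \<Rightarrow> trm) \<Rightarrow> fm \<Rightarrow> fm" where
  "fsubst \<sigma> (Eq s t) = Eq (tsubst \<sigma> s) (tsubst \<sigma> t)"
| "fsubst \<sigma> Bot = Bot"
| "fsubst \<sigma> (And A B) = And (fsubst \<sigma> A) (fsubst \<sigma> B)"
| "fsubst \<sigma> (Or A B) = Or (fsubst \<sigma> A) (fsubst \<sigma> B)"
| "fsubst \<sigma> (Imp A B) = Imp (fsubst \<sigma> A) (fsubst \<sigma> B)"
| "fsubst \<sigma> (Forall A) = Forall (fsubst (up \<sigma>) A)"
| "fsubst \<sigma> (Exists A) = Exists (fsubst (up \<sigma>) A)"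

definition flift :: "fm \<Rightarrow> fm" where
  "flift = fsubst (\<lambda>i. Var (Suc i))"

text \<open>\<open>finst t A\<close> is the instance of \<open>Forall A\<close> and \<open>Exists A\<close> at the term \<open>t\<close>.\<close>

definition finst :: "trm \<Rightarrow> fm \<Rightarrow> fm" where
  "finst t = fsubst (case_nat t Var)"

definition fsucc :: "fm \<Rightarrow> fm" where
  "fsucc = fsubst (case_nat (Succ (Var 0)) (\<lambda>i. Var (Suc i)))"

text \<open>Quantification over the free variable with index \<open>k\<close>: after binding, that variable is the
  index 0, and all other variables are lifted.\<close>

definition bind_var :: "nat \<Rightarrow> fm \<Rightarrow> fm" where
  "bind_var k = fsubst (\<lambda>i. if i = k then Var 0 else Var (Suc i))"

definition All_var :: "nat \<Rightarrow> fm \<Rightarrow> fm" where "All_var k A = Forall (bind_var k A)"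
definition Ex_var :: "nat \<Rightarrow> fm \<Rightarrow> fm" where "Ex_var k A = Exists (bind_var k A)"


section \<open>Heyting Arithmetic\<close>

definition arith_axioms :: "fm list" where
  "arith_axioms =
    [Neg (Eq (Succ (Var 0)) Zero),
     Imp (Eq (Succ (Var 0)) (Succ (Var 1))) (Eq (Var 0) (Var 1)),
     Eq (Plus (Var 0) Zero) (Var 0),
     Eq (Plus (Var 0) (Succ (Var 1))) (Succ (Plus (Var 0) (Var 1))),
     Eq (Times (Var 0) Zero) Zero,
     Eq (Times (Var 0) (Succ (Var 1))) (Plus (Times (Var 0) (Var 1)) (Var 0))]"

text \<open>A Hilbert calculus for open formulas. In \<open>HA_allI\<close> and \<open>HA_exE\<close> the lifting expresses that the
  quantified variable does not occur in the formula outside the scope of the quantifier.\<close>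

inductive HA :: "fm \<Rightarrow> bool" where
  HA_K: "HA (Imp A (Imp B A))"
| HA_S: "HA (Imp (Imp A (Imp B D)) (Imp (Imp A B) (Imp A D)))"
| HA_andE1: "HA (Imp (And A B) A)"
| HA_andE2: "HA (Imp (And A B) B)"
| HA_andI: "HA (Imp A (Imp B (And A B)))"
| HA_orI1: "HA (Imp A (Or A B))"
| HA_orI2: "HA (Imp B (Or A B))"
| HA_orE: "HA (Imp (Imp A D) (Imp (Imp B D) (Imp (Or A B) D)))"
| HA_botE: "HA (Imp Bot A)"
| HA_allE: "HA (Imp (Forall A) (finst t A))"
| HA_exI: "HA (Imp (finst t A) (Exists A))"
| HA_eq_refl: "HA (Eq t t)"
| HA_eq_subst: "HA (Imp (Eq s t) (Imp (finst s A) (finst t A)))"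
| HA_arith: "A \<in> set arith_axioms \<Longrightarrow> HA A"
| HA_ind: "HA (Imp (finst Zero A) (Imp (Forall (Imp A (fsucc A))) (Forall A)))"
| HA_mp: "HA (Imp A B) \<Longrightarrow> HA A \<Longrightarrow> HA B"
| HA_allI: "HA (Imp (flift A) B) \<Longrightarrow> HA (Imp A (Forall B))"
| HA_exE: "HA (Imp A (flift B)) \<Longrightarrow> HA (Imp (Exists A) B)"


section \<open>Coding of syntax\<close>

text \<open>The map \<open>(x, y) \<mapsto> (x + y)\<^sup>2 + x\<close> is injective and monotone, and it is given by a term of
  the language, so that no formula is needed for pairing.\<close>

definition pair :: "nat \<Rightarrow> nat \<Rightarrow> nat" where
  "pair x y = (x + y) * (x + y) + x"

definition pair_trm :: "trm \<Rightarrow> trm \<Rightarrow> trm" where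
  "pair_trm s t = Plus (Times (Plus s t) (Plus s t)) s"

fun tcode :: "trm \<Rightarrow> nat" where
  "tcode (Var i) = pair 0 i"
| "tcode Zero = pair 1 0"
| "tcode (Succ t) = pair 2 (tcode t)"
| "tcode (Plus s t) = pair 3 (pair (tcode s) (tcode t))"
| "tcode (Times s t) = pair 4 (pair (tcode s) (tcode t))"

fun fcode :: "fm \<Rightarrow> nat" where
  "fcode (Eq s t) = pair 5 (pair (tcode s) (tcode t))"
| "fcode Bot = pair 6 0"
| "fcode (And A B) = pair 7 (pair (fcode A) (fcode B))"
| "fcode (Or A B) = pair 8 (pair (fcode A) (fcode B))"
| "fcode (Imp A B) = pair 9 (pair (fcode A) (fcode B))"
| "fcode (Forall A) = pair 10 (fcode A)"
| "fcode (Exists A) = pair 11 (fcode A)"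

text \<open>The terms of arithmetic that compute the code of a compound expression from the codes of its
  parts.\<close>

definition tag1 :: "nat \<Rightarrow> trm \<Rightarrow> trm" where
  "tag1 k t = pair_trm (numeral_trm k) t"

definition tag2 :: "nat \<Rightarrow> trm \<Rightarrow> trm \<Rightarrow> trm" where
  "tag2 k s t = pair_trm (numeral_trm k) (pair_trm s t)"

abbreviation (input) "cVar \<equiv> tag1 0"
abbreviation (input) "cZero \<equiv> tag1 1 Zero"
abbreviation (input) "cSucc \<equiv> tag1 2"
abbreviation (input) "cEq \<equiv> tag2 5"
abbreviation (input) "cBot \<equiv> tag1 6 Zero"
abbreviation (input) "cAnd \<equiv> tag2 7"
abbreviation (input) "cOr \<equiv> tag2 8"
abbreviation (input) "cImp \<equiv> tag2 9"
abbreviation (input) "cAll \<equiv> tag1 10"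
abbreviation (input) "cEx \<equiv> tag1 11"


section \<open>The formalized provability predicate of HA\<close>

text \<open>Syntax and provability are arithmetized together, as one inductive definition on codes of
  judgements:
  \<open>NUM n a\<close>: \<open>a\<close> codes the numeral of \<open>n\<close>;
  \<open>TRM a\<close>, \<open>FML a\<close>: \<open>a\<close> codes a term, a formula;
  \<open>SUB d t e a b\<close>: \<open>b\<close> codes the result of replacing, in the expression with code \<open>a\<close>, the index
  \<open>d\<close> by the term with code \<open>t\<close> and every index \<open>d + 1 + j\<close> by \<open>d + j + e\<close>;
  \<open>PRV a\<close>: \<open>a\<close> codes a formula provable in HA.
  With \<open>d = 0\<close> outside of all quantifiers, \<open>SUB\<close> represents \<open>finst t\<close> for \<open>e = 0\<close>, \<open>fsucc\<close> for
  \<open>e = 1\<close> and \<open>t\<close> coding \<open>Succ (Var 0)\<close>, and lifting for \<open>e = 2\<close> and \<open>t\<close> coding \<open>Var 1\<close>.\<close>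

abbreviation (input) NUM :: "trm \<Rightarrow> trm \<Rightarrow> trm" where "NUM n a \<equiv> tag2 0 n a"
abbreviation (input) TRM :: "trm \<Rightarrow> trm" where "TRM a \<equiv> tag1 1 a"
abbreviation (input) FML :: "trm \<Rightarrow> trm" where "FML a \<equiv> tag1 2 a"
abbreviation (input) SUB :: "trm \<Rightarrow> trm \<Rightarrow> trm \<Rightarrow> trm \<Rightarrow> trm \<Rightarrow> trm" where
  "SUB d t e a b \<equiv> tag2 3 (pair_trm d (pair_trm t e)) (pair_trm a b)"
abbreviation (input) PRV :: "trm \<Rightarrow> trm" where "PRV a \<equiv> tag1 4 a"

abbreviation (input) INST :: "trm \<Rightarrow> trm \<Rightarrow> trm \<Rightarrow> trm" where
  "INST t a b \<equiv> SUB Zero t Zero a b"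
abbreviation (input) SUCC :: "trm \<Rightarrow> trm \<Rightarrow> trm" where
  "SUCC a b \<equiv> SUB Zero (cSucc (cVar Zero)) (numeral_trm 1) a b"
abbreviation (input) LIFT :: "trm \<Rightarrow> trm \<Rightarrow> trm" where
  "LIFT a b \<equiv> SUB Zero (cVar (numeral_trm 1)) (numeral_trm 2) a b"

text \<open>A clause \<open>(h, bs)\<close> says, for all values of its variables: if all judgements in \<open>bs\<close> are
  derivable, then so is \<open>h\<close>.\<close>

type_synonym clause = "trm \<times> trm list"

definition syntax_clauses :: "clause list" where
  "syntax_clauses =
    (let a = Var 0; b = Var 1; a' = Var 2; b' = Var 3; d = Var 4; t = Var 5; e = Var 6;
         i = Var 7; u = Var 8
     in
      [(NUM Zero cZero, []),
       (NUM (Succ i) (cSucc a), [NUM i a]),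
       (TRM (cVar i), []),
       (TRM cZero, []),
       (TRM (cSucc a), [TRM a])]
    @ map (\<lambda>k. (TRM (tag2 k a b), [TRM a, TRM b])) [3, 4]
    @ [(FML (cEq a b), [TRM a, TRM b]),
       (FML cBot, [])]
    @ map (\<lambda>k. (FML (tag2 k a b), [FML a, FML b])) [7, 8, 9]
    @ map (\<lambda>k. (FML (tag1 k a), [FML a])) [10, 11]
    @ [(SUB (Succ (Plus i d)) t e (cVar i) (cVar i), []),
       (SUB d t e (cVar d) t, []),
       (SUB d t e (cVar (Succ (Plus d i))) (cVar (Plus (Plus d i) e)), []),
       (SUB d t e cZero cZero, []),
       (SUB d t e cBot cBot, []),
       (SUB d t e (cSucc a) (cSucc b), [SUB d t e a b])]
    @ map (\<lambda>k. (SUB d t e (tag2 k a b) (tag2 k a' b'), [SUB d t e a a', SUB d t e b b']))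
        [3, 4, 5, 7, 8, 9]
    @ map (\<lambda>k. (SUB d t e (tag1 k a) (tag1 k b), [LIFT t u, SUB (Succ d) u e a b])) [10, 11])"

definition HA_clauses :: "clause list" where
  "HA_clauses =
    (let a = Var 0; b = Var 1; d = Var 2; s = Var 3; t = Var 4; u = Var 5
     in
      [(PRV (cImp a (cImp b a)), [FML a, FML b]),
       (PRV (cImp (cImp a (cImp b d)) (cImp (cImp a b) (cImp a d))), [FML a, FML b, FML d]),
       (PRV (cImp (cAnd a b) a), [FML a, FML b]),
       (PRV (cImp (cAnd a b) b), [FML a, FML b]),
       (PRV (cImp a (cImp b (cAnd a b))), [FML a, FML b]),
       (PRV (cImp a (cOr a b)), [FML a, FML b]),
       (PRV (cImp b (cOr a b)), [FML a, FML b]),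
       (PRV (cImp (cImp a d) (cImp (cImp b d) (cImp (cOr a b) d))), [FML a, FML b, FML d]),
       (PRV (cImp cBot a), [FML a]),
       (PRV (cImp (cAll a) b), [FML a, TRM t, INST t a b]),
       (PRV (cImp b (cEx a)), [FML a, TRM t, INST t a b]),
       (PRV (cEq t t), [TRM t]),
       (PRV (cImp (cEq s t) (cImp b d)), [FML a, TRM s, TRM t, INST s a b, INST t a d])]
    @ map (\<lambda>A. (PRV (numeral_trm (fcode A)), [])) arith_axioms
    @ [(PRV (cImp b (cImp (cAll (cImp a d)) (cAll a))), [FML a, INST cZero a b, SUCC a d]),
       (PRV b, [PRV (cImp a b), PRV a]),
       (PRV (cImp a (cAll b)), [FML a, LIFT a u, PRV (cImp u b)]),
       (PRV (cImp (cEx a) b), [FML b, LIFT b u, PRV (cImp a u)])])"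

text \<open>Derivability from the clauses is expressed by the existence of a finite set of pairs \<open>(r, x)\<close>,
  to be read as: \<open>x\<close> has a derivation of height at most \<open>r\<close>. The numbers \<open>p\<close>, \<open>q\<close>, \<open>m\<close> code the set
  of all \<open>n \<le> m\<close> such that \<open>1 + (n + 1) q\<close> divides \<open>p\<close>. In the formula \<open>Der_fm\<close> below, the variables
  0 to 5 stand for \<open>x\<close>, \<open>p\<close>, \<open>q\<close>, \<open>m\<close>, a member of the set and a height; the variable \<open>i\<close> of a clause
  becomes the variable \<open>6 + i\<close>.\<close>

definition Le :: "trm \<Rightarrow> trm \<Rightarrow> fm" where
  "Le s t = Exists (Eq (Plus (tlift s) (Var 0)) (tlift t))"

definition Mem :: "trm \<Rightarrow> fm" where
  "Mem t = And (Le t (Var 3))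
    (Exists (And (Le (Var 0) (tlift (Var 1)))
      (Eq (Times (Var 0) (Succ (Times (Succ (tlift t)) (tlift (Var 2))))) (tlift (Var 1)))))"

definition Conj :: "fm list \<Rightarrow> fm" where "Conj As = foldr And As Verum"
definition Disj :: "fm list \<Rightarrow> fm" where "Disj As = foldr Or As Bot"

definition Ex_bounded :: "nat \<Rightarrow> fm \<Rightarrow> fm" where
  "Ex_bounded k A = Ex_var k (And (Le (Var k) (Var 3)) A)"

definition clause_bound :: "clause \<Rightarrow> nat" where
  "clause_bound c = (LEAST n. \<forall>t \<in> insert (fst c) (set (snd c)). tfree t \<subseteq> {..<n})"

definition Clause_fm :: "clause \<Rightarrow> fm" where
  "Clause_fm c = foldr Ex_bounded [5..<6 + clause_bound c]
    (And (Eq (Var 4) (pair_trm (Succ (Var 5)) (tsubst (\<lambda>i. Var (6 + i)) (fst c))))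
      (Conj (map (\<lambda>t. Mem (pair_trm (Var 5) (tsubst (\<lambda>i. Var (6 + i)) t))) (snd c))))"

definition Der_fm :: fm where
  "Der_fm = Ex_var 1 (Ex_var 2 (Ex_var 3
    (And (Ex_var 5 (Mem (pair_trm (Var 5) (Var 0))))
      (All_var 4 (Imp (Mem (Var 4))
        (Disj (map Clause_fm (syntax_clauses @ HA_clauses))))))))"

definition Der :: "trm \<Rightarrow> fm" where
  "Der t = fsubst (case_nat t Var) Der_fm"

definition Prov :: "trm \<Rightarrow> fm" where
  "Prov t = Der (PRV t)"

text \<open>\<open>Prov_inst ts a\<close> expresses that the formula with code \<open>a\<close> becomes provable when its free
  variables 0, 1, ... are replaced by the numerals of the values of the terms \<open>ts\<close>. (Each
  instantiation of the variable 0 moves the next variable to position 0.)\<close>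

fun Prov_inst :: "trm list \<Rightarrow> trm \<Rightarrow> fm" where
  "Prov_inst [] a = Prov a"
| "Prov_inst (t # ts) a =
    Exists (Exists (And (Der (NUM (tlift (tlift t)) (Var 1)))
      (And (Der (INST (Var 1) (tlift (tlift a)) (Var 0)))
        (Prov_inst (map (\<lambda>s. tlift (tlift s)) ts) (Var 0)))))"

definition free_bound :: "fm \<Rightarrow> nat" where
  "free_bound A = (LEAST n. ffree A \<subseteq> {..<n})"

text \<open>Indices below \<open>free_bound A\<close> that are not free in \<open>A\<close> are instantiated with 0, so that
  \<open>Box A\<close> has the same free variables as \<open>A\<close>.\<close>

definition Box :: "fm \<Rightarrow> fm" where
  "Box A = Prov_inst (map (\<lambda>i. if i \<in> ffree A then Var i else Zero) [0..<free_bound A])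
    (numeral_trm (fcode A))"


section \<open>Arithmetical realizations\<close>

text \<open>The arithmetical variables \<open>y\<^sub>k\<close> and \<open>z\<^sub>k\<close> are the indices \<open>2 * k\<close> and \<open>2 * k + 1\<close>.\<close>

fun var_of :: "mtrm \<Rightarrow> trm" where
  "var_of (MVar k) = Var (2 * k)"
| "var_of (MConst k) = Var (2 * k + 1)"

definition realization :: "('r \<Rightarrow> nat option) \<Rightarrow> ('r \<Rightarrow> fm) \<Rightarrow> bool" where
  "realization ar \<rho> \<longleftrightarrow> (\<forall>S n. ar S = Some n \<longrightarrow> ffree (\<rho> S) \<subseteq> {..<n})"

fun translate :: "('r \<Rightarrow> fm) \<Rightarrow> 'r spf \<Rightarrow> fm" where
  "translate \<rho> STop = Verum"
| "translate \<rho> (SRel S ts) = fsubst (\<lambda>i. if i < length ts then var_of (ts ! i) else Var i) (\<rho> S)"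
| "translate \<rho> (SAnd \<phi> \<psi>) = And (translate \<rho> \<phi>) (translate \<rho> \<psi>)"
| "translate \<rho> (SAll k \<phi>) = All_var (2 * k) (translate \<rho> \<phi>)"
| "translate \<rho> (SDia \<phi>) = Neg (Box (Neg (translate \<rho> \<phi>)))"

end

theory Submission
  imports Defs "HOL-Library.Countable_Set" "HOL-Library.Sublist" "HOL-Library.FuncSet"
begin

text \<open>Soundness rests on the derivability conditions, which in turn need many facts about the
  provability predicate to be theorems of HA. All of them are implications between existential
  formulas with decidable matrix. Such an implication is provable in HA as soon as it holds in all
  models of Peano arithmetic, by the completeness theorem and Friedman's translation. So the
  provability predicate is analysed semantically, inside an arbitrary model.

  For completeness, an underivable sequent has a counterexample on a finite irreflexive transitive
  Kripke model with constant domain: the worlds are instances of subformulas, and \<open>\<pi>\<close> sees \<open>\<rho>\<close> when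
  \<open>\<pi>\<close> derives \<open>\<diamond>\<rho>\<close>. The model is unravelled to a tree. A variant of Solovay's construction provides a
  sentence for each node such that, provably in HA, the sentence of a node excludes those of all
  other nodes, implies that those of its descendants are consistent, and implies that whatever they
  all refute is refutable. The sentence of the root of the model is consistent. HA need not prove
  the disjunction of these sentences. The truth lemma is nevertheless available, since the
  sentence of a node decides the translation of every strictly positive formula: with the numbers
  partitioned into finitely many classes, one for each element of the domain, the universal
  quantifier is a finite conjunction.\<close>

section \<open>Substitution\<close>

text \<open>Whether a given number codes a refutation is decidable, but whether a refutation exists
  is not, so HA cannot decide where a Solovay walk ends. What survives is that a negation may be
  derived by cases that are only weakly exhaustive, and strictly positive formulas ask for no more:
  their negative facts concern refutability, \<open>Box (Neg A)\<close>. Free variables below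
  \<open>Box\<close> are a second obstacle. The hypotheses that place a variable in its class are
  decidable, hence provable once true, and so they can be carried into the scope of
  \<open>Box\<close>. A tree makes the path part of the node, so that reaching a node is a finite
  conjunction of existential formulas and no function with a history has to be formalized.
  Friedman's translation replaces falsity by the conclusion \<open>Q\<close> of an implication:
  double negation elimination then becomes a theorem, and the translated \<open>Q\<close> gives back
  \<open>Q\<close>. Inside a possibly nonstandard model induction is available for definable
  predicates only, which is why so many relations are shown to be definable.\<close>

lemma tsubst_Var [simp]: "tsubst Var t = t"
  by (induction t) auto

lemma tsubst_tsubst: "tsubst \<sigma> (tsubst \<tau> t) = tsubst (\<lambda>i. tsubst \<sigma> (\<tau> i)) t"
  by (induction t) auto

lemma tsubst_cong: "(\<And>i. i \<in> tfree t \<Longrightarrow> \<sigma> i = \<tau> i) \<Longrightarrow> tsubst \<sigma> t = tsubst \<tau> t"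
  by (induction t) auto

lemma tfree_tsubst: "tfree (tsubst \<sigma> t) = (\<Union>i\<in>tfree t. tfree (\<sigma> i))"
  by (induction t) auto

lemma tlift_simps [simp]:
  "tlift (Var i) = Var (Suc i)" "tlift Zero = Zero" "tlift (Succ t) = Succ (tlift t)"
  "tlift (Plus s t) = Plus (tlift s) (tlift t)" "tlift (Times s t) = Times (tlift s) (tlift t)"
  by (auto simp: tlift_def)

lemma up_simps [simp]: "up \<sigma> 0 = Var 0" "up \<sigma> (Suc i) = tlift (\<sigma> i)"
  by (auto simp: up_def)

lemma up_Var [simp]: "up Var = Var"
  by (rule ext) (auto simp: up_def split: nat.splits)

lemma tsubst_up_tlift: "tsubst (up \<sigma>) (tlift t) = tlift (tsubst \<sigma> t)"
  by (induction t) auto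

lemma up_comp: "(\<lambda>i. tsubst (up \<sigma>) (up \<tau> i)) = up (\<lambda>i. tsubst \<sigma> (\<tau> i))"
  by (rule ext) (auto simp: up_def tsubst_up_tlift[unfolded up_def] split: nat.splits)

lemma fsubst_Var [simp]: "fsubst Var A = A"
  by (induction A) auto

lemma fsubst_fsubst: "fsubst \<sigma> (fsubst \<tau> A) = fsubst (\<lambda>i. tsubst \<sigma> (\<tau> i)) A"
  by (induction A arbitrary: \<sigma> \<tau>) (auto simp: tsubst_tsubst up_comp)

lemma fsubst_cong: "(\<And>i. i \<in> ffree A \<Longrightarrow> \<sigma> i = \<tau> i) \<Longrightarrow> fsubst \<sigma> A = fsubst \<tau> A"
proof (induction A arbitrary: \<sigma> \<tau>)
  case (Eq s t) then show ?case by (auto intro: tsubst_cong)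
next
  case (Forall A)
  have "fsubst (up \<sigma>) A = fsubst (up \<tau>) A"
    by (rule Forall.IH) (use Forall.prems in \<open>auto simp: up_def split: nat.splits\<close>)
  then show ?case by simp
next
  case (Exists A)
  have "fsubst (up \<sigma>) A = fsubst (up \<tau>) A"
    by (rule Exists.IH) (use Exists.prems in \<open>auto simp: up_def split: nat.splits\<close>)
  then show ?case by simp
next
  case (And A B) then show ?case unfolding fsubst.simps ffree.simps by (metis UnCI)
next
  case (Or A B) then show ?case unfolding fsubst.simps ffree.simps by (metis UnCI)
next
  case (Imp A B) then show ?case unfolding fsubst.simps ffree.simps by (metis UnCI)
qed simp

lemma fsubst_idem: "(\<And>i. i \<in> ffree A \<Longrightarrow> \<sigma> i = Var i) \<Longrightarrow> fsubst \<sigma> A = A"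
  using fsubst_cong[of A \<sigma> Var] by simp

lemma tfree_up: "(\<exists>j\<in>A. Suc i \<in> tfree (up \<sigma> j)) \<longleftrightarrow> (\<exists>j. Suc j \<in> A \<and> i \<in> tfree (\<sigma> j))"
proof -
  have "Suc i \<in> tfree (up \<sigma> j) \<longleftrightarrow> (\<exists>k. j = Suc k \<and> i \<in> tfree (\<sigma> k))" for j
    by (cases j) (auto simp: tlift_def tfree_tsubst)
  then show ?thesis by auto
qed

lemma ffree_fsubst: "ffree (fsubst \<sigma> A) = (\<Union>i\<in>ffree A. tfree (\<sigma> i))"
  by (induction A arbitrary: \<sigma>) (auto simp: tfree_tsubst tfree_up)

lemma finite_tfree [simp]: "finite (tfree t)"
  by (induction t) auto

lemma finite_ffree [simp]: "finite (ffree A)"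
proof (induction A)
  case (Forall A)
  have "{i. Suc i \<in> ffree A} = Suc -` ffree A" by auto
  with Forall show ?case by (simp add: finite_vimageI)
next
  case (Exists A)
  have "{i. Suc i \<in> ffree A} = Suc -` ffree A" by auto
  with Exists show ?case by (simp add: finite_vimageI)
qed auto

lemma ffree_bounded: "\<exists>n. ffree A \<subseteq> {..<n}"
  by (meson finite_ffree finite_nat_iff_bounded)

lemma flift_simps [simp]:
  "flift (Eq s t) = Eq (tlift s) (tlift t)" "flift Bot = Bot"
  "flift (And A B) = And (flift A) (flift B)" "flift (Or A B) = Or (flift A) (flift B)"
  "flift (Imp A B) = Imp (flift A) (flift B)"
  by (auto simp: flift_def tlift_def)

lemma finst_simps [simp]:
  "finst u (Eq s t) = Eq (tsubst (case_nat u Var) s) (tsubst (case_nat u Var) t)"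
  "finst u Bot = Bot"
  "finst u (And A B) = And (finst u A) (finst u B)" "finst u (Or A B) = Or (finst u A) (finst u B)"
  "finst u (Imp A B) = Imp (finst u A) (finst u B)"
  by (auto simp: finst_def)

lemma tsubst_case_nat_tlift [simp]: "tsubst (case_nat u \<sigma>) (tlift t) = tsubst \<sigma> t"
  by (simp add: tlift_def tsubst_tsubst)

lemma finst_fsubst_up: "finst t (fsubst (up \<sigma>) A) = fsubst (case_nat t \<sigma>) A"
  unfolding finst_def fsubst_fsubst by (rule fsubst_cong) (auto simp: up_def split: nat.splits)

lemma fsubst_finst: "fsubst \<sigma> (finst t A) = finst (tsubst \<sigma> t) (fsubst (up \<sigma>) A)"
  unfolding finst_fsubst_up unfolding finst_def fsubst_fsubst
  by (rule fsubst_cong) (auto split: nat.splits)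

lemma finst_flift [simp]: "finst t (flift A) = A"
  by (simp add: finst_def flift_def fsubst_fsubst)

lemma fsubst_flift: "fsubst (up \<sigma>) (flift A) = flift (fsubst \<sigma> A)"
  by (simp add: flift_def fsubst_fsubst tlift_def)

lemma fsubst_case_flift [simp]: "fsubst (case_nat u \<sigma>) (flift A) = fsubst \<sigma> A"
  by (simp add: flift_def fsubst_fsubst)

lemma fsucc_flift [simp]: "fsucc (flift A) = flift A"
  by (simp add: fsucc_def) (simp add: flift_def)

text \<open>A quantified formula that has been lifted is usually instantiated at the fresh variable
  0. The two index shifts cancel, so its body comes back literally.\<close>

lemma finst_skip [simp]: "finst (Var 0) (fsubst (up (\<lambda>i. Var (Suc i))) A) = A"
  by (simp add: finst_fsubst_up) (rule fsubst_idem, auto split: nat.splits)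

lemma numeral_trm_closed [simp]: "tsubst \<sigma> (numeral_trm n) = numeral_trm n"
  "tlift (numeral_trm n) = numeral_trm n" "tfree (numeral_trm n) = {}"
  by (induction n) auto

lemma fsubst_Le [simp]: "fsubst \<sigma> (Le s t) = Le (tsubst \<sigma> s) (tsubst \<sigma> t)"
  by (simp add: Le_def tsubst_up_tlift)

lemma finst_Le [simp]: "finst u (Le s t) = Le (tsubst (case_nat u Var) s) (tsubst (case_nat u Var) t)"
  by (simp add: finst_def)

lemma flift_Le [simp]: "flift (Le s t) = Le (tlift s) (tlift t)"
  by (simp add: flift_def tlift_def)

lemma fsubst_All_var: "fsubst \<sigma> (All_var k A) =
  Forall (fsubst (\<lambda>i. if i = k then Var 0 else tlift (\<sigma> i)) A)"
  unfolding All_var_def bind_var_def fsubst.simps fsubst_fsubst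
  by (rule arg_cong[of _ _ Forall], rule fsubst_cong) auto

lemma ffree_bind_var: "Suc i \<in> ffree (bind_var k A) \<longleftrightarrow> i \<in> ffree A - {k}"
  by (auto simp: bind_var_def ffree_fsubst split: if_splits)

lemma ffree_All_var [simp]: "ffree (All_var k A) = ffree A - {k}"
  by (auto simp: All_var_def ffree_bind_var)

lemma ffree_Ex_var [simp]: "ffree (Ex_var k A) = ffree A - {k}"
  by (auto simp: Ex_var_def ffree_bind_var)

section \<open>Natural deduction for HA\<close>

lemma HA_imp_refl: "HA (Imp A A)"
  by (rule HA_mp[OF HA_mp[OF HA_S HA_K] HA_K[of A A]])

lemma HA_imp_trans: "HA (Imp A B) \<Longrightarrow> HA (Imp B D) \<Longrightarrow> HA (Imp A D)"
  by (rule HA_mp[OF HA_mp[OF HA_S HA_mp[OF HA_K]]])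

lemma HA_foldr_weaken: "HA A \<Longrightarrow> HA (foldr Imp xs A)"
  by (induction xs) (auto intro: HA_mp[OF HA_K])

lemma HA_foldr_S: "HA (Imp (foldr Imp xs (Imp A B)) (Imp (foldr Imp xs A) (foldr Imp xs B)))"
proof (induction xs)
  case (Cons x xs)
  let ?p = "foldr Imp xs (Imp A B)" and ?q = "foldr Imp xs A" and ?r = "foldr Imp xs B"
  have 1: "HA (Imp x (Imp ?p (Imp ?q ?r)))" by (rule HA_mp[OF HA_K Cons])
  have "HA (Imp (Imp x ?p) (Imp x (Imp ?q ?r)))" by (rule HA_mp[OF HA_S 1])
  moreover have "HA (Imp (Imp x (Imp ?q ?r)) (Imp (Imp x ?q) (Imp x ?r)))" by (rule HA_S)
  ultimately have "HA (Imp (Imp x ?p) (Imp (Imp x ?q) (Imp x ?r)))"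
    by (rule HA_imp_trans)
  then show ?case by simp
qed (simp add: HA_imp_refl)

lemma HA_foldr_mp: "HA (foldr Imp xs (Imp A B)) \<Longrightarrow> HA (foldr Imp xs A) \<Longrightarrow> HA (foldr Imp xs B)"
  by (rule HA_mp[OF HA_mp[OF HA_foldr_S]])

lemma HA_foldr_member: "A \<in> set xs \<Longrightarrow> HA (foldr Imp xs A)"
proof (induction xs)
  case (Cons x xs)
  show ?case
  proof (cases "A = x")
    case True
    have "HA (Imp x (foldr Imp xs x))"
    proof (induction xs)
      case (Cons y xs)
      then show ?case using HA_imp_trans[OF _ HA_K] by simp
    qed (simp add: HA_imp_refl)
    then show ?thesis using True by simp
  next
    case False
    then show ?thesis using Cons by (auto intro: HA_mp[OF HA_K])
  qed
qed simp

lemma HA_foldr_mono: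
  assumes "HA (foldr Imp xs B)" "set xs \<subseteq> set ys"
  shows "HA (foldr Imp ys B)"
proof -
  have "HA (foldr Imp ys (foldr Imp xs B)) \<Longrightarrow> set xs \<subseteq> set ys \<Longrightarrow> HA (foldr Imp ys B)" for xs
  proof (induction xs)
    case (Cons a xs)
    have "HA (foldr Imp ys (foldr Imp xs B))"
      by (rule HA_foldr_mp[of ys a]) (use Cons.prems in \<open>auto intro: HA_foldr_member\<close>)
    then show ?case using Cons by simp
  qed simp
  then show ?thesis using assms HA_foldr_weaken by blast
qed

text \<open>Hypotheses are finitely many antecedents, so their free variables stay fixed and the
  deduction theorem holds without side conditions. The context may be infinite, as it has to be for
  classical logic, for maximal theories and for the class assignments of all variables.\<close>

definition entails :: "fm set \<Rightarrow> fm \<Rightarrow> bool" (infix \<open>\<turnstile>\<close> 50) where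
  "G \<turnstile> A \<longleftrightarrow> (\<exists>xs. set xs \<subseteq> G \<and> HA (foldr Imp xs A))"

lemma entails_empty_iff: "{} \<turnstile> A \<longleftrightarrow> HA A"
  by (auto simp: entails_def)

lemma entails_HA: "HA A \<Longrightarrow> G \<turnstile> A"
  unfolding entails_def by (rule exI[of _ "[]"]) simp

lemma entails_assm: "A \<in> G \<Longrightarrow> G \<turnstile> A"
  unfolding entails_def by (rule exI[of _ "[A]"]) (simp add: HA_imp_refl)

lemma entails_assm_simps [simp]: "insert A G \<turnstile> A" "insert B (insert A G) \<turnstile> A"
  "insert D (insert B (insert A G)) \<turnstile> A"
  by (auto intro: entails_assm)

lemma entails_mono: "G \<turnstile> A \<Longrightarrow> G \<subseteq> H \<Longrightarrow> H \<turnstile> A"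
  unfolding entails_def by blast

lemma entails_mp: "G \<turnstile> Imp A B \<Longrightarrow> G \<turnstile> A \<Longrightarrow> G \<turnstile> B"
proof -
  assume "G \<turnstile> Imp A B" "G \<turnstile> A"
  then obtain xs ys where *: "set xs \<subseteq> G" "HA (foldr Imp xs (Imp A B))"
    "set ys \<subseteq> G" "HA (foldr Imp ys A)"
    unfolding entails_def by blast
  have "HA (foldr Imp (xs @ ys) (Imp A B))" "HA (foldr Imp (xs @ ys) A)"
    using * by (auto intro: HA_foldr_mono simp del: foldr_append)
  then have "HA (foldr Imp (xs @ ys) B)" by (rule HA_foldr_mp)
  then show ?thesis unfolding entails_def using * by (intro exI[of _ "xs @ ys"]) auto
qed

text \<open>As a rewrite rule the deduction theorem moves antecedents, including those of negations,
  into the context. Proofs that need an implication in one piece remove the rule.\<close>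

lemma entails_Imp [simp]: "G \<turnstile> Imp A B \<longleftrightarrow> insert A G \<turnstile> B"
proof
  assume "G \<turnstile> Imp A B"
  then have "insert A G \<turnstile> Imp A B" by (rule entails_mono) auto
  then show "insert A G \<turnstile> B" by (rule entails_mp) simp
next
  assume "insert A G \<turnstile> B"
  then obtain xs where xs: "set xs \<subseteq> insert A G" "HA (foldr Imp xs B)"
    unfolding entails_def by blast
  let ?ys = "filter (\<lambda>x. x \<noteq> A) xs"
  have "HA (foldr Imp (?ys @ [A]) B)"
    by (rule HA_foldr_mono[OF xs(2)]) auto
  then show "G \<turnstile> Imp A B" unfolding entails_def using xs(1)
    by (intro exI[of _ ?ys]) auto
qed

lemma HA_Imp_iff: "HA (Imp A B) \<longleftrightarrow> {A} \<turnstile> B"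
  using entails_Imp[of "{}" A B] entails_empty_iff by metis

lemma entails_cut: "G \<turnstile> A \<Longrightarrow> insert A G \<turnstile> B \<Longrightarrow> G \<turnstile> B"
  using entails_mp entails_Imp by metis

lemma entails_HA_mp: "HA (Imp A B) \<Longrightarrow> G \<turnstile> A \<Longrightarrow> G \<turnstile> B"
  using entails_mp entails_HA by blast

lemma entails_And [simp]: "G \<turnstile> And A B \<longleftrightarrow> G \<turnstile> A \<and> G \<turnstile> B"
  using entails_HA_mp[OF HA_andE1] entails_HA_mp[OF HA_andE2] entails_HA_mp[OF HA_andI] entails_mp
  by blast

lemma entails_OrI1: "G \<turnstile> A \<Longrightarrow> G \<turnstile> Or A B"
  and entails_OrI2: "G \<turnstile> B \<Longrightarrow> G \<turnstile> Or A B"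
  by (auto intro: entails_HA_mp HA_orI1 HA_orI2)

lemma entails_OrE: "G \<turnstile> Or A B \<Longrightarrow> insert A G \<turnstile> D \<Longrightarrow> insert B G \<turnstile> D \<Longrightarrow> G \<turnstile> D"
  using entails_HA[OF HA_orE] entails_mp entails_Imp by metis

lemma entails_botE: "G \<turnstile> Bot \<Longrightarrow> G \<turnstile> A"
  by (rule entails_HA_mp[OF HA_botE])

lemma entails_insert_And [simp]: "insert (And A B) G \<turnstile> D \<longleftrightarrow> insert A (insert B G) \<turnstile> D"
proof
  assume "insert (And A B) G \<turnstile> D"
  then have "insert A (insert B G) \<turnstile> Imp (And A B) D"
    unfolding entails_Imp by (rule entails_mono) auto
  then show "insert A (insert B G) \<turnstile> D" by (rule entails_mp) simp
next
  assume *: "insert A (insert B G) \<turnstile> D"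
  have "insert (And A B) G \<turnstile> Imp B (Imp A D)" unfolding entails_Imp
    by (rule entails_mono[OF *]) auto
  moreover have "insert (And A B) G \<turnstile> And A B" by (rule entails_assm) simp
  ultimately show "insert (And A B) G \<turnstile> D"
    unfolding entails_And using entails_mp by blast
qed

lemma entails_insert_Or [simp]:
  "insert (Or A B) G \<turnstile> D \<longleftrightarrow> insert A G \<turnstile> D \<and> insert B G \<turnstile> D"
proof
  assume *: "insert (Or A B) G \<turnstile> D"
  have "G \<turnstile> Imp (Or A B) D" using * by simp
  then have 1: "insert A G \<turnstile> Imp (Or A B) D" "insert B G \<turnstile> Imp (Or A B) D"
    by (blast intro: entails_mono)+
  then show "insert A G \<turnstile> D \<and> insert B G \<turnstile> D"
    by (blast intro: entails_mp entails_OrI1 entails_OrI2 entails_assm)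
next
  assume *: "insert A G \<turnstile> D \<and> insert B G \<turnstile> D"
  show "insert (Or A B) G \<turnstile> D"
    by (rule entails_OrE[of _ A B]) (auto intro: entails_mono[of "insert A G"]
        entails_mono[of "insert B G"] simp: *)
qed

text \<open>The quantifier rules of the calculus allow a single formula on the left, so a context
  must be packed into one conjunction before they apply.\<close>

lemma HA_foldr_And: "HA (foldr Imp xs A) \<longleftrightarrow> {foldr And xs Verum} \<turnstile> A"
proof -
  have "(set xs \<union> G \<turnstile> A) \<longleftrightarrow> insert (foldr And xs Verum) G \<turnstile> A" for G
  proof (induction xs arbitrary: G)
    case Nil
    have "G \<turnstile> Verum" by simp
    then have "insert Verum G \<turnstile> A \<Longrightarrow> G \<turnstile> A" by (rule entails_cut)
    moreover have "G \<turnstile> A \<Longrightarrow> insert Verum G \<turnstile> A" by (rule entails_mono) auto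
    ultimately show ?case by auto
  next
    case (Cons x xs)
    show ?case using Cons[of "insert x G"] by (simp add: insert_commute)
  qed
  from this[of "{}"] have "(set xs \<turnstile> A) \<longleftrightarrow> {foldr And xs Verum} \<turnstile> A" by simp
  moreover have "(set xs \<turnstile> A) \<longleftrightarrow> HA (foldr Imp xs A)"
    unfolding entails_def by (auto intro: HA_foldr_mono)
  ultimately show ?thesis by simp
qed

lemma entails_allI: "flift ` G \<turnstile> A \<Longrightarrow> G \<turnstile> Forall A"
proof -
  assume "flift ` G \<turnstile> A"
  then obtain xs where xs: "set xs \<subseteq> flift ` G" "HA (foldr Imp xs A)" unfolding entails_def by blast
  have "\<exists>ys. xs = map flift ys \<and> set ys \<subseteq> G"
    using xs(1)
  proof (induction xs)
    case (Cons x xs)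
    then obtain y ys where "x = flift y" "y \<in> G" "xs = map flift ys" "set ys \<subseteq> G" by auto
    then show ?case by (intro exI[of _ "y # ys"]) auto
  qed simp
  then obtain ys where ys: "xs = map flift ys" "set ys \<subseteq> G" by blast
  have "foldr And xs Verum = flift (foldr And ys Verum)"
    unfolding ys by (induction ys) auto
  then have "HA (Imp (flift (foldr And ys Verum)) A)"
    using xs(2) unfolding HA_foldr_And HA_Imp_iff by simp
  then have "HA (Imp (foldr And ys Verum) (Forall A))" by (rule HA_allI)
  then have "HA (foldr Imp ys (Forall A))" unfolding HA_foldr_And HA_Imp_iff .
  then show ?thesis using ys(2) unfolding entails_def by blast
qed

lemma entails_allE: "G \<turnstile> Forall A \<Longrightarrow> G \<turnstile> finst t A"
  by (rule entails_HA_mp[OF HA_allE])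

lemma HA_Forall: "HA A \<Longrightarrow> HA (Forall A)"
  using entails_allI[of "{}" A] by (simp add: entails_empty_iff)

lemma HA_instances:
  "HA ((Forall ^^ n) A) \<Longrightarrow> HA (fsubst (\<lambda>i. if i < n then \<sigma> i else Var (i - n)) A)"
proof (induction n arbitrary: A \<sigma>)
  case (Suc n)
  let ?\<tau> = "\<lambda>i. if i < n then \<sigma> (Suc i) else Var (i - n)"
  have "HA ((Forall ^^ n) (Forall A))" using Suc.prems by (simp add: funpow_swap1)
  then have "HA (Forall (fsubst (up ?\<tau>) A))" using Suc.IH[of "Forall A" "\<lambda>i. \<sigma> (Suc i)"] by simp
  then have "HA (finst (\<sigma> 0) (fsubst (up ?\<tau>) A))" using HA_allE HA_mp by blast
  then have "HA (fsubst (case_nat (\<sigma> 0) ?\<tau>) A)" by (simp add: finst_fsubst_up)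
  moreover have "fsubst (case_nat (\<sigma> 0) ?\<tau>) A = fsubst (\<lambda>i. if i < Suc n then \<sigma> i else Var (i - Suc n)) A"
    by (rule fsubst_cong) (auto split: nat.splits)
  ultimately show ?case by simp
qed simp

text \<open>The calculus has no substitution rule. All free variables are generalized one after
  another and then instantiated simultaneously; as \<open>n\<close> bounds them, the shift of the
  indices from \<open>n\<close> on has no effect.\<close>

lemma HA_fsubst: "HA A \<Longrightarrow> HA (fsubst \<sigma> A)"
proof -
  assume "HA A"
  obtain n where n: "ffree A \<subseteq> {..<n}" using ffree_bounded by blast
  have "HA ((Forall ^^ n) A)" using \<open>HA A\<close> by (induction n) (auto intro: HA_Forall)
  then have "HA (fsubst (\<lambda>i. if i < n then \<sigma> i else Var (i - n)) A)" by (rule HA_instances)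
  moreover have "fsubst (\<lambda>i. if i < n then \<sigma> i else Var (i - n)) A = fsubst \<sigma> A"
    by (rule fsubst_cong) (use n in auto)
  ultimately show ?thesis by simp
qed

lemma entails_fsubst: "G \<turnstile> A \<Longrightarrow> fsubst \<sigma> ` G \<turnstile> fsubst \<sigma> A"
proof -
  assume "G \<turnstile> A"
  then obtain xs where xs: "set xs \<subseteq> G" "HA (foldr Imp xs A)" unfolding entails_def by blast
  have "fsubst \<sigma> (foldr Imp xs A) = foldr Imp (map (fsubst \<sigma>) xs) (fsubst \<sigma> A)"
    by (induction xs) auto
  then have "HA (foldr Imp (map (fsubst \<sigma>) xs) (fsubst \<sigma> A))" using HA_fsubst[OF xs(2), of \<sigma>] by simp
  then show ?thesis unfolding entails_def using xs(1) by (intro exI[of _ "map (fsubst \<sigma>) xs"]) auto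
qed

lemma entails_lift: "G \<turnstile> A \<Longrightarrow> flift ` G \<turnstile> flift A"
  unfolding flift_def by (rule entails_fsubst)

lemma entails_exI: "G \<turnstile> finst t A \<Longrightarrow> G \<turnstile> Exists A"
  by (rule entails_HA_mp[OF HA_exI])

text \<open>The rule \<open>HA_exE\<close> has no context. The context is therefore first spent on
  the universal statement that each witness yields \<open>B\<close>, and this statement becomes an
  antecedent of the conclusion of \<open>HA_exE\<close>.\<close>

lemma entails_insert_Exists: "insert A (flift ` G) \<turnstile> flift B \<Longrightarrow> insert (Exists A) G \<turnstile> B"
proof -
  assume "insert A (flift ` G) \<turnstile> flift B"
  then have "flift ` G \<turnstile> Imp A (flift B)" by simp
  then have "G \<turnstile> Forall (Imp A (flift B))" by (rule entails_allI)
  then have 1: "insert (Exists A) G \<turnstile> Forall (Imp A (flift B))" by (rule entails_mono) auto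
  have "HA (Imp (Forall (Imp A (flift B))) (Imp (Exists A) B))"
  proof -
    let ?F = "Forall (Imp A (flift B))"
    have "{flift ?F, A} \<turnstile> finst (Var 0) (fsubst (up (\<lambda>i. Var (Suc i))) (Imp A (flift B)))"
      by (rule entails_allE) (simp add: flift_def entails_assm)
    then have "{flift ?F, A} \<turnstile> Imp A (flift B)" by (simp only: finst_skip)
    then have "{flift ?F, A} \<turnstile> flift B" by (rule entails_mp) simp
    then have "HA (Imp A (flift (Imp ?F B)))" by (simp add: HA_Imp_iff insert_commute)
    then have "HA (Imp (Exists A) (Imp ?F B))" by (rule HA_exE)
    then show ?thesis by (simp add: HA_Imp_iff insert_commute)
  qed
  from entails_HA_mp[OF this 1] show ?thesis by (rule entails_mp) simp
qed

lemma entails_allE_lifted: "G \<turnstile> flift (Forall A) \<Longrightarrow> G \<turnstile> A"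
proof -
  assume "G \<turnstile> flift (Forall A)"
  then have "G \<turnstile> finst (Var 0) (fsubst (up (\<lambda>i. Var (Suc i))) A)"
    by (intro entails_allE) (simp add: flift_def)
  then show ?thesis by simp
qed

lemma entails_exI_lifted: "G \<turnstile> A \<Longrightarrow> G \<turnstile> flift (Exists A)"
proof -
  assume "G \<turnstile> A"
  then have "G \<turnstile> finst (Var 0) (fsubst (up (\<lambda>i. Var (Suc i))) A)" by simp
  from entails_exI[OF this] show ?thesis by (simp add: flift_def)
qed

abbreviation Iff :: "fm \<Rightarrow> fm \<Rightarrow> fm" where "Iff A B \<equiv> And (Imp A B) (Imp B A)"

lemma HA_Iff_Forall: "HA (Iff A B) \<Longrightarrow> HA (Iff (Forall A) (Forall B))"
proof -
  assume "HA (Iff A B)"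
  then have AB: "G \<turnstile> A \<Longrightarrow> G \<turnstile> B" "G \<turnstile> B \<Longrightarrow> G \<turnstile> A" for G
    using entails_HA[of "Iff A B" G] entails_mp unfolding entails_And by blast+
  have "{Forall A} \<turnstile> Forall B" "{Forall B} \<turnstile> Forall A"
    by (rule entails_allI, rule AB, rule entails_allE_lifted, simp)+
  then show ?thesis by (simp add: entails_empty_iff[symmetric])
qed

section \<open>Equality and bounded quantification in HA\<close>

lemma entails_eq_subst: "G \<turnstile> Eq s t \<Longrightarrow> G \<turnstile> finst s A \<Longrightarrow> G \<turnstile> finst t A"
  using entails_HA[OF HA_eq_subst] entails_mp by blast

lemma entails_eq_refl [simp]: "G \<turnstile> Eq t t"
  by (rule entails_HA[OF HA_eq_refl])

lemma entails_eq_sym: "G \<turnstile> Eq s t \<Longrightarrow> G \<turnstile> Eq t s"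
  using entails_eq_subst[of G s t "Eq (Var 0) (tlift s)"] by simp

lemma entails_eq_trans: "G \<turnstile> Eq s t \<Longrightarrow> G \<turnstile> Eq t u \<Longrightarrow> G \<turnstile> Eq s u"
  using entails_eq_subst[of G t u "Eq (tlift s) (Var 0)"] by simp

lemma entails_eq_Succ: "G \<turnstile> Eq s t \<Longrightarrow> G \<turnstile> Eq (Succ s) (Succ t)"
  using entails_eq_subst[of G s t "Eq (Succ (tlift s)) (Succ (Var 0))"] by simp

lemma entails_eq_Plus: "G \<turnstile> Eq s t \<Longrightarrow> G \<turnstile> Eq s' t' \<Longrightarrow> G \<turnstile> Eq (Plus s s') (Plus t t')"
  using entails_eq_subst[of G s t "Eq (Plus (tlift s) (tlift s')) (Plus (Var 0) (tlift s'))"]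
    entails_eq_subst[of G s' t' "Eq (Plus (tlift s) (tlift s')) (Plus (tlift t) (Var 0))"] by simp

lemma entails_eq_Times: "G \<turnstile> Eq s t \<Longrightarrow> G \<turnstile> Eq s' t' \<Longrightarrow> G \<turnstile> Eq (Times s s') (Times t t')"
  using entails_eq_subst[of G s t "Eq (Times (tlift s) (tlift s')) (Times (Var 0) (tlift s'))"]
    entails_eq_subst[of G s' t' "Eq (Times (tlift s) (tlift s')) (Times (tlift t) (Var 0))"] by simp

lemma HA_axiom_instances:
  "HA (Neg (Eq (Succ s) Zero))" "HA (Imp (Eq (Succ s) (Succ t)) (Eq s t))"
  "HA (Eq (Plus s Zero) s)" "HA (Eq (Plus s (Succ t)) (Succ (Plus s t)))"
  "HA (Eq (Times s Zero) Zero)" "HA (Eq (Times s (Succ t)) (Plus (Times s t) s))"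
proof -
  have "\<forall>A\<in>set arith_axioms. HA (fsubst (case_nat s (\<lambda>_. t)) A)"
    by (intro ballI HA_fsubst HA_arith)
  then show "HA (Neg (Eq (Succ s) Zero))" "HA (Imp (Eq (Succ s) (Succ t)) (Eq s t))"
    "HA (Eq (Plus s Zero) s)" "HA (Eq (Plus s (Succ t)) (Succ (Plus s t)))"
    "HA (Eq (Times s Zero) Zero)" "HA (Eq (Times s (Succ t)) (Plus (Times s t) s))"
    unfolding arith_axioms_def by simp_all
qed

lemma entails_Succ_Zero: "G \<turnstile> Eq (Succ s) Zero \<Longrightarrow> G \<turnstile> A"
  using entails_HA_mp[OF HA_axiom_instances(1)] entails_botE by blast

lemma entails_Succ_inject: "G \<turnstile> Eq (Succ s) (Succ t) \<Longrightarrow> G \<turnstile> Eq s t"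
  by (rule entails_HA_mp[OF HA_axiom_instances(2)])

lemma entails_Plus_Zero: "G \<turnstile> Eq (Plus s Zero) s"
  and entails_Plus_Succ: "G \<turnstile> Eq (Plus s (Succ t)) (Succ (Plus s t))"
  by (rule entails_HA, rule HA_axiom_instances)+

lemma entails_induct:
  "G \<turnstile> finst Zero A \<Longrightarrow> insert A (flift ` G) \<turnstile> fsucc A \<Longrightarrow> G \<turnstile> Forall A"
proof -
  assume 1: "G \<turnstile> finst Zero A" "insert A (flift ` G) \<turnstile> fsucc A"
  then have "G \<turnstile> Forall (Imp A (fsucc A))" by (intro entails_allI) simp
  moreover have "G \<turnstile> Imp (finst Zero A) (Imp (Forall (Imp A (fsucc A))) (Forall A))"
    by (rule entails_HA[OF HA_ind])
  ultimately show ?thesis using 1(1) entails_mp by blast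
qed

lemma fsucc_simps [simp]:
  "fsucc (Eq s t) = Eq (tsubst (case_nat (Succ (Var 0)) (\<lambda>i. Var (Suc i))) s)
    (tsubst (case_nat (Succ (Var 0)) (\<lambda>i. Var (Suc i))) t)"
  "fsucc Bot = Bot"
  "fsucc (And A B) = And (fsucc A) (fsucc B)" "fsucc (Or A B) = Or (fsucc A) (fsucc B)"
  "fsucc (Imp A B) = Imp (fsucc A) (fsucc B)"
  by (auto simp: fsucc_def)

lemma HA_zero_or_succ: "HA (Or (Eq t Zero) (Exists (Eq (tlift t) (Succ (Var 0)))))"
proof -
  let ?A = "Or (Eq (Var 0) Zero) (Exists (Eq (Var 1) (Succ (Var 0))))"
  have "{} \<turnstile> Forall ?A"
  proof (rule entails_induct)
    show "{} \<turnstile> finst Zero ?A" by (simp add: entails_OrI1)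
    show "insert ?A (flift ` {}) \<turnstile> fsucc ?A"
      by (simp, intro conjI; rule entails_OrI2; simp add: fsucc_def; rule entails_exI[of _ "Var 0"]; simp)
  qed
  then have "{} \<turnstile> finst t ?A" by (rule entails_allE)
  then show ?thesis by (simp add: entails_empty_iff finst_def up_def)
qed

lemma entails_nat_cases:
  assumes "insert (Eq t Zero) G \<turnstile> A"
    and "insert (Eq (tlift t) (Succ (Var 0))) (flift ` G) \<turnstile> flift A"
  shows "G \<turnstile> A"
  using entails_OrE[OF entails_HA[OF HA_zero_or_succ[of t]] assms(1)]
    entails_insert_Exists[OF assms(2)] by blast

text \<open>The ultimate source of every constructive case distinction below. Induction on one
  variable with the other universally quantified; both parts split the other variable into zero and
  successor, and injectivity of the successor links the cases.\<close>

lemma HA_eq_decidable: "HA (Or (Eq s t) (Neg (Eq s t)))"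
proof -
  let ?A = "Or (Eq (Var 1) (Var 0)) (Neg (Eq (Var 1) (Var 0)))"
  let ?B = "Or (Eq (Succ (Var 1)) (Var 0)) (Neg (Eq (Succ (Var 1)) (Var 0)))"
  have "{} \<turnstile> Forall (Forall ?A)"
  proof (rule entails_induct)
    have "{} \<turnstile> Or (Eq Zero (Var 0)) (Neg (Eq Zero (Var 0)))"
    proof (rule entails_nat_cases[of "Var 0"])
      show "insert (Eq (Var 0) Zero) {} \<turnstile> Or (Eq Zero (Var 0)) (Neg (Eq Zero (Var 0)))"
        by (rule entails_OrI1, rule entails_eq_sym, simp)
      show "insert (Eq (tlift (Var 0)) (Succ (Var 0))) (flift ` {}) \<turnstile>
          flift (Or (Eq Zero (Var 0)) (Neg (Eq Zero (Var 0))))"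
        by (simp, rule entails_OrI2, simp, rule entails_Succ_Zero[of _ "Var 0"], rule entails_eq_sym,
            rule entails_eq_trans[of _ _ "Var 1"]) (simp_all)
    qed
    then show "{} \<turnstile> finst Zero (Forall ?A)"
      using entails_allI[of "{}"] by (simp add: finst_def up_def)
    have "{flift (Forall ?A)} \<turnstile> ?B"
    proof (rule entails_nat_cases[of "Var 0"])
      show "insert (Eq (Var 0) Zero) {flift (Forall ?A)} \<turnstile> ?B"
        by (rule entails_OrI2, simp, rule entails_Succ_Zero[of _ "Var 1"],
            rule entails_eq_trans[of _ _ "Var 0"]) simp_all
      let ?G = "insert (Eq (tlift (Var 0)) (Succ (Var 0))) (flift ` {flift (Forall ?A)})"
      have "?G \<turnstile> flift (flift (Forall ?A))" by (rule entails_assm) simp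
      then have "?G \<turnstile> finst (Var 0) (Or (Eq (Var 3) (Var 0)) (Neg (Eq (Var 3) (Var 0))))"
        by (intro entails_allE) (simp add: flift_def up_def eval_nat_numeral)
      then have 1: "?G \<turnstile> Or (Eq (Var 2) (Var 0)) (Neg (Eq (Var 2) (Var 0)))"
        by (simp add: eval_nat_numeral)
      show "?G \<turnstile> flift ?B"
        apply (rule entails_OrE[OF 1])
         apply (simp add: eval_nat_numeral, rule entails_OrI1)
         apply (rule entails_eq_trans[OF entails_eq_Succ[of _ _ "Var 0"]], simp, rule entails_eq_sym, simp)
        apply (simp add: eval_nat_numeral, rule entails_OrI2, simp)
        apply (rule entails_mp[of _ "Eq (Var (Suc (Suc 0))) (Var 0)"], rule entails_assm, simp)
        apply (rule entails_Succ_inject, rule entails_eq_trans[of _ _ "Var 1"], simp, simp)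
        done
    qed
    then show "insert (Forall ?A) (flift ` {}) \<turnstile> fsucc (Forall ?A)"
      using entails_allI[of "{Forall ?A}"] by (simp add: fsucc_def up_def flift_def)
  qed
  then have "{} \<turnstile> finst s (Forall ?A)" by (rule entails_allE)
  then have "{} \<turnstile> Forall (Or (Eq (tlift s) (Var 0)) (Neg (Eq (tlift s) (Var 0))))"
    by (simp add: finst_def up_def)
  then have "{} \<turnstile> finst t (Or (Eq (tlift s) (Var 0)) (Neg (Eq (tlift s) (Var 0))))"
    by (rule entails_allE)
  then have "{} \<turnstile> Or (Eq s t) (Neg (Eq s t))" by (simp del: entails_Imp)
  then show ?thesis unfolding entails_empty_iff .
qed

section \<open>Order and bounded quantification\<close>

lemma entails_LeI: "G \<turnstile> Eq (Plus s u) t \<Longrightarrow> G \<turnstile> Le s t"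
  unfolding Le_def by (rule entails_exI[of _ u]) simp

lemma entails_insert_Le:
  "insert (Eq (Plus (tlift s) (Var 0)) (tlift t)) (flift ` G) \<turnstile> flift A \<Longrightarrow> insert (Le s t) G \<turnstile> A"
  unfolding Le_def by (rule entails_insert_Exists)

lemma entails_Le_refl: "G \<turnstile> Le s s"
  by (rule entails_LeI[of _ _ Zero]) (rule entails_Plus_Zero)

lemma HA_Le_Zero: "HA (Imp (Le s Zero) (Eq s Zero))"
  unfolding HA_Imp_iff
proof (rule entails_insert_Le, simp, rule entails_nat_cases[of "Var 0"])
  let ?s = "tlift s"
  let ?G = "insert (Eq (Var 0) Zero) {Eq (Plus ?s (Var 0)) Zero}"
  have "?G \<turnstile> Eq (Plus ?s (Var 0)) (Plus ?s Zero)" by (rule entails_eq_Plus) auto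
  then have "?G \<turnstile> Eq (Plus ?s (Var 0)) ?s" using entails_Plus_Zero entails_eq_trans by blast
  moreover have "?G \<turnstile> Eq (Plus ?s (Var 0)) Zero" by simp
  ultimately show "?G \<turnstile> Eq ?s Zero" using entails_eq_sym entails_eq_trans by blast
  let ?t = "tlift ?s"
  let ?H = "insert (Eq (tlift (Var 0)) (Succ (Var 0))) (flift ` {Eq (Plus ?s (Var 0)) Zero})"
  have "?H \<turnstile> Eq (Plus ?t (Var 1)) (Plus ?t (Succ (Var 0)))" by (rule entails_eq_Plus) auto
  then have "?H \<turnstile> Eq (Plus ?t (Var 1)) (Succ (Plus ?t (Var 0)))"
    using entails_Plus_Succ entails_eq_trans by blast
  moreover have "?H \<turnstile> Eq (Plus ?t (Var 1)) Zero" by simp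
  ultimately show "?H \<turnstile> flift (Eq ?s Zero)"
    using entails_eq_sym entails_eq_trans entails_Succ_Zero by blast
qed

lemma HA_Le_Succ: "HA (Imp (Le s (Succ t)) (Or (Le s t) (Eq s (Succ t))))"
  unfolding HA_Imp_iff
proof (rule entails_insert_Le, simp, rule entails_nat_cases[of "Var 0"])
  let ?s = "tlift s" and ?t = "tlift t"
  let ?E = "Eq (Plus ?s (Var 0)) (Succ ?t)"
  let ?G = "insert (Eq (Var 0) Zero) {?E}"
  have "?G \<turnstile> Eq (Plus ?s (Var 0)) (Plus ?s Zero)" by (rule entails_eq_Plus) auto
  then have "?G \<turnstile> Eq (Plus ?s (Var 0)) ?s" using entails_Plus_Zero entails_eq_trans by blast
  moreover have "?G \<turnstile> ?E" by simp
  ultimately have "?G \<turnstile> Eq ?s (Succ ?t)" using entails_eq_sym entails_eq_trans by blast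
  then show "?G \<turnstile> Or (Le ?s ?t) (Eq ?s (Succ ?t))" by (rule entails_OrI2)
  let ?H = "insert (Eq (tlift (Var 0)) (Succ (Var 0))) (flift ` {?E})"
  have "?H \<turnstile> Eq (Plus (tlift ?s) (Var 1)) (Plus (tlift ?s) (Succ (Var 0)))"
    by (rule entails_eq_Plus) auto
  then have "?H \<turnstile> Eq (Plus (tlift ?s) (Var 1)) (Succ (Plus (tlift ?s) (Var 0)))"
    using entails_Plus_Succ entails_eq_trans by blast
  moreover have "?H \<turnstile> Eq (Plus (tlift ?s) (Var 1)) (Succ (tlift ?t))" by simp
  ultimately have "?H \<turnstile> Eq (Plus (tlift ?s) (Var 0)) (tlift ?t)"
    using entails_eq_sym entails_eq_trans entails_Succ_inject by blast
  then have "?H \<turnstile> Le (tlift ?s) (tlift ?t)" by (rule entails_LeI)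
  then show "?H \<turnstile> flift (Or (Le ?s ?t) (Eq ?s (Succ ?t)))" by (simp add: entails_OrI1)
qed

lemma HA_Le_SuccI: "HA (Imp (Le s t) (Le s (Succ t)))"
  unfolding HA_Imp_iff
proof (rule entails_insert_Le, simp)
  let ?s = "tlift s" and ?t = "tlift t"
  let ?G = "{Eq (Plus ?s (Var 0)) ?t}"
  have "?G \<turnstile> Eq (Succ (Plus ?s (Var 0))) (Succ ?t)" by (rule entails_eq_Succ) simp
  then have "?G \<turnstile> Eq (Plus ?s (Succ (Var 0))) (Succ ?t)"
    using entails_Plus_Succ entails_eq_trans by blast
  then show "?G \<turnstile> Le ?s (Succ ?t)" by (rule entails_LeI)
qed

abbreviation BAll :: "trm \<Rightarrow> fm \<Rightarrow> fm" where
  "BAll t A \<equiv> Forall (Imp (Le (Var 0) (tlift t)) A)"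
abbreviation BEx :: "trm \<Rightarrow> fm \<Rightarrow> fm" where
  "BEx t A \<equiv> Exists (And (Le (Var 0) (tlift t)) A)"

lemma entails_eq_subst_var: "G \<turnstile> Eq (tlift s) (Var 0) \<Longrightarrow> G \<turnstile> flift (finst s A) \<Longrightarrow> G \<turnstile> A"
proof -
  assume 1: "G \<turnstile> Eq (tlift s) (Var 0)" "G \<turnstile> flift (finst s A)"
  have "flift (finst s A) = finst (tlift s) (fsubst (up (\<lambda>i. Var (Suc i))) A)"
    unfolding flift_def fsubst_finst by (simp add: tlift_def)
  then show ?thesis using entails_eq_subst[OF 1(1)] 1(2) finst_skip by metis
qed

lemma HA_Ball_Zero: "HA (Imp (finst Zero A) (BAll Zero A))"
  unfolding HA_Imp_iff
proof (rule entails_allI, simp)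
  let ?G = "{Le (Var 0) Zero, flift (finst Zero A)}"
  have "?G \<turnstile> Eq (Var 0) Zero" by (rule entails_HA_mp[OF HA_Le_Zero]) simp
  then have "?G \<turnstile> Eq (tlift Zero) (Var 0)" using entails_eq_sym by simp
  then show "?G \<turnstile> A" by (rule entails_eq_subst_var) simp
qed

text \<open>Together with the case of bound zero this is a recursion for bounded quantification. It
  serves twice: for decidability in HA, and for building proofs of bounded statements with a
  nonstandard bound inside a model.\<close>

lemma HA_Ball_Succ: "HA (Imp (BAll t A) (Imp (finst (Succ t) A) (BAll (Succ t) A)))"
  unfolding HA_Imp_iff
proof (simp, rule entails_allI, simp)
  let ?G = "{Le (Var 0) (Succ (tlift t)), flift (finst (Succ t) A), flift (BAll t A)}"
  have "?G \<turnstile> Or (Le (Var 0) (tlift t)) (Eq (Var 0) (Succ (tlift t)))"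
    by (rule entails_HA_mp[OF HA_Le_Succ]) simp
  then show "?G \<turnstile> A"
  proof (rule entails_OrE)
    have "insert (Le (Var 0) (tlift t)) ?G \<turnstile> Imp (Le (Var 0) (tlift t)) A"
      by (rule entails_allE_lifted) (simp add: entails_assm)
    then show "insert (Le (Var 0) (tlift t)) ?G \<turnstile> A" by (rule entails_mp) simp
    have "insert (Eq (Var 0) (Succ (tlift t))) ?G \<turnstile> Eq (tlift (Succ t)) (Var 0)"
      using entails_eq_sym by simp
    then show "insert (Eq (Var 0) (Succ (tlift t))) ?G \<turnstile> A"
      by (rule entails_eq_subst_var) (simp add: entails_assm)
  qed
qed

lemma entails_dec:
  assumes "HA (Or A (Neg A))" "insert (fsubst \<sigma> A) G \<turnstile> D" "insert (Neg (fsubst \<sigma> A)) G \<turnstile> D"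
  shows "G \<turnstile> D"
  using entails_OrE[OF entails_HA assms(2,3)] HA_fsubst[OF assms(1), of \<sigma>] by simp

text \<open>A bounded search: by induction on the bound, either every value checked so far passes or
  a counterexample has been found.\<close>

lemma HA_bounded_cases:
  assumes "HA (Or A (Neg A))"
  shows "HA (Or (BAll t A) (BEx t (Neg A)))"
proof -
  \<comment> \<open>The bound becomes the variable of the induction and so occupies index 1 below
    the quantifier; \<open>A'\<close> is \<open>A\<close> with its parameters moved past that
    index.\<close>
  define A' where "A' = fsubst (up (\<lambda>i. Var (Suc i))) A"
  have A'_inst: "fsubst (up (case_nat t Var)) A' = A" for t
    by (simp add: A'_def fsubst_fsubst up_comp)
  have A'_succ: "fsubst (up (case_nat (Succ (Var 0)) (\<lambda>i. Var (Suc i)))) A' = A'"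
    by (simp add: A'_def fsubst_fsubst up_comp)
  have dec: "HA (Or A' (Neg A'))" using HA_fsubst[OF assms] by (simp add: A'_def)
  let ?B = "Or (BAll (Var 0) A') (BEx (Var 0) (Neg A'))"
  have inst: "finst t ?B = Or (BAll t A) (BEx t (Neg A))" for t
    by (simp add: finst_def A'_inst)
  have "{} \<turnstile> Forall ?B"
  proof (rule entails_induct)
    show "{} \<turnstile> finst Zero ?B" unfolding inst
    proof (rule entails_dec[OF assms, of "case_nat Zero Var"])
      show "insert (fsubst (case_nat Zero Var) A) {} \<turnstile> Or (BAll Zero A) (BEx Zero (Neg A))"
        by (rule entails_OrI1, rule entails_HA_mp[OF HA_Ball_Zero]) (simp add: finst_def)
      show "insert (Neg (fsubst (case_nat Zero Var) A)) {} \<turnstile> Or (BAll Zero A) (BEx Zero (Neg A))"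
        by (rule entails_OrI2, rule entails_exI[of _ Zero])
          (simp add: finst_def[symmetric] entails_Le_refl del: entails_Imp)
    qed
    have succ: "fsucc ?B = Or (BAll (Succ (Var 0)) A') (BEx (Succ (Var 0)) (Neg A'))"
      by (simp add: fsucc_def A'_succ)
    show "insert ?B (flift ` {}) \<turnstile> fsucc ?B" unfolding succ entails_insert_Or
    proof (intro conjI)
      show "insert (BEx (Var 0) (Neg A')) (flift ` {}) \<turnstile>
          Or (BAll (Succ (Var 0)) A') (BEx (Succ (Var 0)) (Neg A'))"
        apply (rule entails_OrI2, rule entails_insert_Exists, rule entails_exI_lifted)
        apply (simp only: entails_And entails_insert_And tlift_simps)
        apply (rule conjI, rule entails_HA_mp[OF HA_Le_SuccI])
        by (rule entails_assm, simp)+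
      show "insert (BAll (Var 0) A') (flift ` {}) \<turnstile>
          Or (BAll (Succ (Var 0)) A') (BEx (Succ (Var 0)) (Neg A'))"
      proof (rule entails_dec[OF dec, of "case_nat (Succ (Var 0)) Var"])
        let ?G = "insert (fsubst (case_nat (Succ (Var 0)) Var) A') (insert (BAll (Var 0) A') (flift ` {}))"
        have "?G \<turnstile> Imp (finst (Succ (Var 0)) A') (BAll (Succ (Var 0)) A')"
          by (rule entails_HA_mp[OF HA_Ball_Succ]) (simp add: entails_assm del: entails_Imp)
        then show "?G \<turnstile> Or (BAll (Succ (Var 0)) A') (BEx (Succ (Var 0)) (Neg A'))"
          by (rule entails_OrI1[OF entails_mp[of _ "finst (Succ (Var 0)) A'"]]) (simp_all add: finst_def)
        show "insert (Neg (fsubst (case_nat (Succ (Var 0)) Var) A')) (insert (BAll (Var 0) A') (flift ` {}))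
            \<turnstile> Or (BAll (Succ (Var 0)) A') (BEx (Succ (Var 0)) (Neg A'))"
          by (rule entails_OrI2, rule entails_exI[of _ "Succ (Var 0)"])
            (simp add: finst_def[symmetric] entails_Le_refl del: entails_Imp)
      qed
    qed
  qed
  from entails_allE[OF this, of t] show ?thesis unfolding inst entails_empty_iff .
qed

section \<open>Decidable and existential formulas\<close>

text \<open>Closure under provable equivalence admits formulas whose bounded quantifiers are written
  differently, such as bounded existence and the order relation, without a syntactic normal
  form.\<close>

inductive delta0 :: "fm \<Rightarrow> bool" where
  delta0_Eq: "delta0 (Eq s t)"
| delta0_Bot: "delta0 Bot"
| delta0_And: "delta0 A \<Longrightarrow> delta0 B \<Longrightarrow> delta0 (And A B)"
| delta0_Or: "delta0 A \<Longrightarrow> delta0 B \<Longrightarrow> delta0 (Or A B)"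
| delta0_Imp: "delta0 A \<Longrightarrow> delta0 B \<Longrightarrow> delta0 (Imp A B)"
| delta0_Ball: "delta0 A \<Longrightarrow> delta0 (BAll t A)"
| delta0_equiv: "delta0 A \<Longrightarrow> HA (Iff A B) \<Longrightarrow> delta0 B"

lemma HA_Iff_entails: "HA (Iff A B) \<longleftrightarrow> {A} \<turnstile> B \<and> {B} \<turnstile> A"
  unfolding entails_empty_iff[symmetric] by simp

lemma entails_Iff: "HA (Iff A B) \<Longrightarrow> G \<turnstile> A \<longleftrightarrow> G \<turnstile> B"
  using entails_HA[of "Iff A B" G] entails_mp unfolding entails_And by blast

lemma HA_IffI: "(\<And>G. G \<turnstile> A \<Longrightarrow> G \<turnstile> B) \<Longrightarrow> (\<And>G. G \<turnstile> B \<Longrightarrow> G \<turnstile> A) \<Longrightarrow> HA (Iff A B)"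
  unfolding HA_Iff_entails by (auto intro: entails_assm)

lemma delta0_decidable: "delta0 A \<Longrightarrow> HA (Or A (Neg A))"
proof (induction rule: delta0.induct)
  case (delta0_Eq s t) then show ?case by (rule HA_eq_decidable)
next
  case delta0_Bot then show ?case by (simp add: entails_empty_iff[symmetric] entails_OrI2)
next
  case (delta0_And A B)
  have "{} \<turnstile> Or (And A B) (Neg (And A B))"
    apply (rule entails_OrE[OF entails_HA[OF delta0_And.IH(1)]];
        rule entails_OrE[OF entails_HA[OF delta0_And.IH(2)]])
       apply (auto intro: entails_OrI1)[1]
      apply (rule entails_OrI2, simp, rule entails_mp[of _ B]; rule entails_assm, simp)
     apply (rule entails_OrI2, simp, rule entails_mp[of _ A]; rule entails_assm, simp)
    by (rule entails_OrI2, simp, rule entails_mp[of _ A]; rule entails_assm, simp)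
  then show ?case by (simp only: entails_empty_iff)
next
  case (delta0_Or A B)
  have "{} \<turnstile> Or (Or A B) (Neg (Or A B))"
    apply (rule entails_OrE[OF entails_HA[OF delta0_Or.IH(1)]];
        rule entails_OrE[OF entails_HA[OF delta0_Or.IH(2)]])
       apply (rule entails_OrI1, rule entails_OrI1, simp)
      apply (rule entails_OrI1, rule entails_OrI1, simp)
     apply (rule entails_OrI1, rule entails_OrI2, simp)
    apply (rule entails_OrI2, simp, intro conjI)
     apply (rule entails_mp[of _ A]; rule entails_assm, simp)
    by (rule entails_mp[of _ B]; rule entails_assm, simp)
  then show ?case by (simp only: entails_empty_iff)
next
  case (delta0_Imp A B)
  have "{} \<turnstile> Or (Imp A B) (Neg (Imp A B))"
    apply (rule entails_OrE[OF entails_HA[OF delta0_Imp.IH(1)]];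
        rule entails_OrE[OF entails_HA[OF delta0_Imp.IH(2)]])
       apply (auto intro: entails_OrI1)[1]
      apply (rule entails_OrI2, unfold entails_Imp)
      apply (rule entails_mp[of _ B], rule entails_assm, simp)
      apply (rule entails_mp[of _ A]; rule entails_assm, simp)
     apply (rule entails_OrI1, simp)
    apply (rule entails_OrI1, simp)
    apply (rule entails_botE, rule entails_mp[of _ A])
    by (rule entails_assm, simp)+
  then show ?case by (simp only: entails_empty_iff)
next
  case (delta0_Ball A t)
  have "{} \<turnstile> Or (BAll t A) (Neg (BAll t A))"
  proof (rule entails_OrE[OF entails_HA[OF HA_bounded_cases[OF delta0_Ball.IH]]])
    show "insert (BAll t A) {} \<turnstile> Or (BAll t A) (Neg (BAll t A))" by (simp add: entails_OrI1)
    let ?G = "{flift (BAll t A), Le (Var 0) (tlift t), Neg A}"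
    have "?G \<turnstile> Imp (Le (Var 0) (tlift t)) A" by (rule entails_allE_lifted) (simp add: entails_assm)
    then have "?G \<turnstile> A" by (rule entails_mp) (simp add: entails_assm)
    then have "?G \<turnstile> Bot" by (rule entails_mp[rotated]) (rule entails_assm, simp)
    then have "insert (And (Le (Var 0) (tlift t)) (Neg A)) (flift ` {BAll t A}) \<turnstile> flift Bot"
      unfolding entails_insert_And by (rule entails_mono[THEN entails_botE]) auto
    then have "insert (BEx t (Neg A)) {BAll t A} \<turnstile> Bot" by (rule entails_insert_Exists)
    then have "{BEx t (Neg A)} \<turnstile> Neg (BAll t A)" unfolding entails_Imp by (simp only: insert_commute)
    then show "insert (BEx t (Neg A)) {} \<turnstile> Or (BAll t A) (Neg (BAll t A))" by (rule entails_OrI2)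
  qed
  then show ?case by (simp only: entails_empty_iff)
next
  case (delta0_equiv A B)
  have "{A} \<turnstile> B" "{B} \<turnstile> A" using delta0_equiv.hyps(2) unfolding HA_Iff_entails by auto
  have "{} \<turnstile> Or B (Neg B)"
  proof (rule entails_OrE[OF entails_HA[OF delta0_equiv.IH]])
    show "{A} \<turnstile> Or B (Neg B)" using \<open>{A} \<turnstile> B\<close> by (rule entails_OrI1)
    have "{B, Neg A} \<turnstile> A" using \<open>{B} \<turnstile> A\<close> by (rule entails_mono) auto
    then have "{B, Neg A} \<turnstile> Bot" by (rule entails_mp[rotated]) (simp add: entails_assm del: entails_Imp)
    then show "{Neg A} \<turnstile> Or B (Neg B)" by (intro entails_OrI2) simp
  qed
  then show ?case by (simp only: entails_empty_iff)
qed

lemma delta0_Neg: "delta0 A \<Longrightarrow> delta0 (Neg A)"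
  by (intro delta0_Imp delta0_Bot)

text \<open>Obtaining a witness from the negated universal statement is not intuitionistic in
  general; here the bounded search supplies it.\<close>

lemma delta0_Bex:
  assumes "delta0 A" shows "delta0 (BEx t A)"
proof (rule delta0_equiv)
  show "delta0 (Neg (BAll t (Neg A)))" by (intro delta0_Neg delta0_Ball assms)
  have nn: "{Neg (Neg A)} \<turnstile> A"
    by (rule entails_OrE[OF entails_HA[OF delta0_decidable[OF assms]]])
      (auto intro: entails_botE entails_mp[of _ "Neg A"] simp del: entails_Imp intro: entails_assm)
  have 1: "{Neg (BAll t (Neg A))} \<turnstile> BEx t A"
  proof (rule entails_OrE[OF entails_HA[OF HA_bounded_cases[OF delta0_decidable[OF delta0_Neg[OF assms]]]]])
    show "insert (BAll t (Neg A)) {Neg (BAll t (Neg A))} \<turnstile> BEx t A"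
      by (rule entails_botE, rule entails_mp[of _ "BAll t (Neg A)"]) (rule entails_assm, simp)+
    have "insert (And (Le (Var 0) (tlift t)) (Neg (Neg A))) (flift ` {Neg (BAll t (Neg A))}) \<turnstile>
      And (Le (Var 0) (tlift t)) A"
      using entails_mono[OF nn] by simp
    then show "insert (BEx t (Neg (Neg A))) {Neg (BAll t (Neg A))} \<turnstile> BEx t A"
      by (intro entails_insert_Exists entails_exI_lifted)
  qed
  have "{BEx t A} \<turnstile> Neg (BAll t (Neg A))"
  proof -
    let ?G = "{flift (BAll t (Neg A)), Le (Var 0) (tlift t), A}"
    have "?G \<turnstile> Imp (Le (Var 0) (tlift t)) (Neg A)" by (rule entails_allE_lifted) (simp add: entails_assm)
    then have "?G \<turnstile> Neg A" by (rule entails_mp) (simp add: entails_assm)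
    then have "?G \<turnstile> Bot" by (rule entails_mp) (simp add: entails_assm)
    then show ?thesis by (intro entails_insert_Exists) (simp add: insert_commute)
  qed
  with 1 show "HA (Iff (Neg (BAll t (Neg A))) (BEx t A))" unfolding HA_Iff_entails by auto
qed

text \<open>The quantifier inside \<open>Le\<close> is unbounded. The equivalent used is a search
  below \<open>t\<close> for a number equal to \<open>s\<close>.\<close>

lemma delta0_Le: "delta0 (Le s t)"
proof (rule delta0_equiv[OF delta0_Bex[OF delta0_Eq]])
  have "{BEx t (Eq (Var 0) (tlift s))} \<turnstile> Le s t"
  proof (rule entails_insert_Exists, simp)
    let ?G = "{Le (Var 0) (tlift t), Eq (Var 0) (tlift s)}"
    show "?G \<turnstile> Le (tlift s) (tlift t)"
      using entails_eq_subst[of ?G "Var 0" "tlift s" "Le (Var 0) (tlift (tlift t))"] by simp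
  qed
  moreover have "{Le s t} \<turnstile> BEx t (Eq (Var 0) (tlift s))"
    by (rule entails_exI[of _ s]) simp
  ultimately show "HA (Iff (BEx t (Eq (Var 0) (tlift s))) (Le s t))" unfolding HA_Iff_entails by auto
qed

lemma delta0_fsubst: "delta0 A \<Longrightarrow> delta0 (fsubst \<sigma> A)"
proof (induction arbitrary: \<sigma> rule: delta0.induct)
  case (delta0_equiv A B)
  then show ?case using delta0.delta0_equiv HA_fsubst[OF delta0_equiv.hyps(2), of \<sigma>] by simp blast
qed (auto intro: delta0.intros simp: tsubst_up_tlift)

section \<open>Existential formulas\<close>

inductive sigma :: "fm \<Rightarrow> bool" where
  sigma_delta0: "delta0 A \<Longrightarrow> sigma A"
| sigma_And: "sigma A \<Longrightarrow> sigma B \<Longrightarrow> sigma (And A B)"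
| sigma_Or: "sigma A \<Longrightarrow> sigma B \<Longrightarrow> sigma (Or A B)"
| sigma_Exists: "sigma A \<Longrightarrow> sigma (Exists A)"
| sigma_equiv: "sigma A \<Longrightarrow> HA (Iff A B) \<Longrightarrow> sigma B"

lemma sigma_fsubst: "sigma A \<Longrightarrow> sigma (fsubst \<sigma> A)"
proof (induction arbitrary: \<sigma> rule: sigma.induct)
  case (sigma_equiv A B)
  then show ?case using sigma.sigma_equiv HA_fsubst[OF sigma_equiv.hyps(2), of \<sigma>] by simp blast
qed (auto intro: sigma.intros delta0_fsubst)

section \<open>Friedman's translation\<close>

text \<open>The negative translation of Goedel and Gentzen with the parameter \<open>F\<close> in
  place of falsity. As \<open>F\<close> may have free variables, it is lifted when a quantifier is
  passed.\<close>

fun friedman :: "fm \<Rightarrow> fm \<Rightarrow> fm" where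
  "friedman F (Eq s t) = Imp (Imp (Eq s t) F) F"
| "friedman F Bot = F"
| "friedman F (And A B) = And (friedman F A) (friedman F B)"
| "friedman F (Or A B) = Imp (And (Imp (friedman F A) F) (Imp (friedman F B) F)) F"
| "friedman F (Imp A B) = Imp (friedman F A) (friedman F B)"
| "friedman F (Forall A) = Forall (friedman (flift F) A)"
| "friedman F (Exists A) = Imp (Forall (Imp (friedman (flift F) A) (flift F))) F"

lemma friedman_fsubst: "friedman (fsubst \<sigma> F) (fsubst \<sigma> A) = fsubst \<sigma> (friedman F A)"
  by (induction F A arbitrary: \<sigma> rule: friedman.induct) (auto simp: fsubst_flift[symmetric])

lemma friedman_finst: "finst t (friedman (flift F) A) = friedman F (finst t A)"
  using friedman_fsubst[of "case_nat t Var" "flift F" A] by (simp add: finst_def)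

lemma friedman_fsucc: "fsucc (friedman (flift F) A) = friedman (flift F) (fsucc A)"
  using friedman_fsubst[of "case_nat (Succ (Var 0)) (\<lambda>i. Var (Suc i))" "flift F" A]
    fsucc_flift[of F] by (simp add: fsucc_def)

lemma friedman_flift: "friedman (flift F) (flift A) = flift (friedman F A)"
  using friedman_fsubst[of "\<lambda>i. Var (Suc i)" F A] by (simp add: flift_def)

lemma entails_mp_assm: "Imp A B \<in> G \<Longrightarrow> G \<turnstile> A \<Longrightarrow> G \<turnstile> B"
  by (blast intro: entails_mp entails_assm)

lemma entails_friedman_F: "G \<turnstile> F \<Longrightarrow> G \<turnstile> friedman F A"
proof (induction F A arbitrary: G rule: friedman.induct)
  case (1 F s t) then show ?case by (auto intro: entails_mono)
next
  case (4 F A B) then show ?case by (auto intro: entails_mono)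
next
  case (5 F A B) 
  then have "insert (friedman F A) G \<turnstile> friedman F B" by (metis entails_mono subset_insertI)
  then show ?case by simp
next
  case (6 F A)
  then show ?case using entails_lift entails_allI by simp
next
  case (7 F A) then show ?case by (auto intro: entails_mono)
qed auto

text \<open>Double negation elimination with \<open>F\<close> as falsity. Atoms, disjunctions and
  existential formulas are translated to statements ending in \<open>F\<close>, where three
  negations reduce to one; the other connectives inherit stability from their parts.\<close>

lemma entails_friedman_stable:
  "insert (Imp (friedman F A) F) G \<turnstile> F \<Longrightarrow> G \<turnstile> friedman F A"
proof (induction F A arbitrary: G rule: friedman.induct)
  case (1 F s t)
  have *: "insert (Imp (Eq s t) F) G \<turnstile> Imp (friedman F (Eq s t)) F"
    unfolding friedman.simps entails_Imp[of _ "Imp (Imp (Eq s t) F) F"]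
    by (rule entails_mp_assm[of "Imp (Eq s t) F"], simp, rule entails_assm, simp)
  have "insert (Imp (Eq s t) F) G \<turnstile> Imp (Imp (friedman F (Eq s t)) F) F"
    using "1.prems" unfolding entails_Imp[of _ "Imp (friedman F (Eq s t)) F"]
    by (rule entails_mono) auto
  then have "insert (Imp (Eq s t) F) G \<turnstile> F" using * by (rule entails_mp)
  then show ?case by simp
next
  case (2 F)
  then have "G \<turnstile> Imp (Imp F F) F" by simp
  then have "G \<turnstile> F" by (rule entails_mp) simp
  then show ?case by simp
next
  case (3 F A B)
  have "insert (Imp (friedman F A) F) G \<turnstile> F"
  proof -
    have 1: "insert (Imp (friedman F A) F) G \<turnstile> Imp (friedman F (And A B)) F"
      by (simp, rule entails_mp_assm[of "friedman F A"]) auto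
    have "insert (Imp (friedman F A) F) G \<turnstile> Imp (Imp (friedman F (And A B)) F) F"
      using "3.prems" unfolding entails_Imp[of _ "Imp (friedman F (And A B)) F"]
      by (rule entails_mono) auto
    then show ?thesis using 1 by (rule entails_mp)
  qed
  moreover have "insert (Imp (friedman F B) F) G \<turnstile> F"
  proof -
    have 1: "insert (Imp (friedman F B) F) G \<turnstile> Imp (friedman F (And A B)) F"
      by (simp, rule entails_mp_assm[of "friedman F B"]) auto
    have "insert (Imp (friedman F B) F) G \<turnstile> Imp (Imp (friedman F (And A B)) F) F"
      using "3.prems" unfolding entails_Imp[of _ "Imp (friedman F (And A B)) F"]
      by (rule entails_mono) auto
    then show ?thesis using 1 by (rule entails_mp)
  qed
  ultimately show ?case using 3 by simp
next
  case (4 F A B)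
  let ?P = "And (Imp (friedman F A) F) (Imp (friedman F B) F)"
  have 1: "insert ?P G \<turnstile> Imp (friedman F (Or A B)) F"
    unfolding entails_Imp by (rule entails_mp_assm[of ?P]) (auto simp del: entails_And entails_insert_And entails_Imp intro: entails_assm)
  have "insert ?P G \<turnstile> Imp (Imp (friedman F (Or A B)) F) F"
    using "4.prems" unfolding entails_Imp[of _ "Imp (friedman F (Or A B)) F"]
    by (rule entails_mono) auto
  then have "insert ?P G \<turnstile> F" using 1 by (rule entails_mp)
  then have "G \<turnstile> Imp ?P F" unfolding entails_Imp .
  then show ?case unfolding friedman.simps .
next
  case (5 F A B)
  let ?A = "friedman F A" and ?B = "friedman F B"
  let ?G = "insert (Imp ?B F) (insert ?A G)"
  have 1: "?G \<turnstile> Imp (friedman F (Imp A B)) F"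
    unfolding entails_Imp friedman.simps
    by (rule entails_mp_assm[of ?B], simp, rule entails_mp_assm[of ?A]) (auto intro: entails_assm simp del: entails_Imp)
  have "?G \<turnstile> Imp (Imp (friedman F (Imp A B)) F) F"
    using "5.prems" unfolding entails_Imp[of _ "Imp (friedman F (Imp A B)) F"]
    by (rule entails_mono) auto
  then have "?G \<turnstile> F" using 1 by (rule entails_mp)
  then have "insert ?A G \<turnstile> ?B" by (rule "5.IH"(2))
  then show ?case by simp
next
  case (6 F A)
  let ?A = "friedman (flift F) A"
  let ?G = "insert (Imp ?A (flift F)) (flift ` G)"
  have 2: "insert (flift (Forall ?A)) ?G \<turnstile> ?A" by (rule entails_allE_lifted) simp
  have 1: "?G \<turnstile> Imp (flift (Forall ?A)) (flift F)"
    unfolding entails_Imp by (rule entails_mp_assm[of ?A]) (auto intro: 2)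
  have "flift ` (insert (Imp (friedman F (Forall A)) F) G) \<turnstile> flift F"
    by (rule entails_lift[OF "6.prems"])
  then have "flift ` G \<turnstile> Imp (Imp (flift (Forall ?A)) (flift F)) (flift F)" by simp
  then have "?G \<turnstile> Imp (Imp (flift (Forall ?A)) (flift F)) (flift F)" by (rule entails_mono) auto
  then have "?G \<turnstile> flift F" using 1 by (rule entails_mp)
  then have "flift ` G \<turnstile> ?A" by (rule "6.IH")
  then show ?case using entails_allI by simp
next
  case (7 F A)
  let ?P = "Forall (Imp (friedman (flift F) A) (flift F))"
  have 1: "insert ?P G \<turnstile> Imp (friedman F (Exists A)) F"
    unfolding entails_Imp by (rule entails_mp_assm[of ?P]) auto
  have "insert ?P G \<turnstile> Imp (Imp (friedman F (Exists A)) F) F"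
    using "7.prems" unfolding entails_Imp[of _ "Imp (friedman F (Exists A)) F"]
    by (rule entails_mono) auto
  then have "insert ?P G \<turnstile> F" using 1 by (rule entails_mp)
  then show ?case by simp
qed

text \<open>Induction and the quantifier axioms survive because the translation commutes with
  substitution. Eliminating a disjunction or an existential formula, and replacing equals, first
  gives only \<open>F\<close>; stability then removes it.\<close>

lemma HA_friedman: "HA A \<Longrightarrow> HA (friedman F A)"
proof (induction arbitrary: F rule: HA.induct)
  case (HA_S A B D)
  have "HA (Imp (Imp A (Imp B D)) (Imp (Imp A B) (Imp A D)))" for A B D by (rule HA.HA_S)
  then show ?case by simp
next
  case (HA_orI1 A B)
  have "{Imp (friedman F A) F, Imp (friedman F B) F, friedman F A} \<turnstile> F"
    by (rule entails_mp_assm[of "friedman F A"]) auto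
  then show ?case by (simp add: HA_Imp_iff)
next
  case (HA_orI2 B A)
  have "{Imp (friedman F A) F, Imp (friedman F B) F, friedman F B} \<turnstile> F"
    by (rule entails_mp_assm[of "friedman F B"]) auto
  then show ?case by (simp add: HA_Imp_iff)
next
  case (HA_orE A D B)
  let ?A = "friedman F A" and ?B = "friedman F B" and ?D = "friedman F D"
  let ?P = "And (Imp ?A F) (Imp ?B F)"
  let ?G = "{Imp ?D F, Imp ?P F, Imp ?B ?D, Imp ?A ?D}"
  have "?G \<turnstile> Imp ?A F"
    unfolding entails_Imp by (rule entails_mp_assm[of ?D], simp, rule entails_mp_assm[of ?A]) simp_all
  moreover have "?G \<turnstile> Imp ?B F"
    unfolding entails_Imp by (rule entails_mp_assm[of ?D], simp, rule entails_mp_assm[of ?B]) simp_all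
  ultimately have "?G \<turnstile> And (Imp ?A F) (Imp ?B F)" unfolding entails_And by blast
  then have "?G \<turnstile> F" by (rule entails_mp_assm[rotated]) simp
  then have "{Imp ?P F, Imp ?B ?D, Imp ?A ?D} \<turnstile> ?D" by (rule entails_friedman_stable)
  then show ?case unfolding HA_Imp_iff friedman.simps entails_Imp .
next
  case (HA_botE A) then show ?case by (simp add: HA_Imp_iff entails_friedman_F)
next
  case (HA_allE A t)
  then show ?case using HA.HA_allE[of "friedman (flift F) A" t] by (simp add: friedman_finst)
next
  case (HA_exI t A)
  let ?A = "friedman (flift F) A"
  let ?G = "{Forall (Imp ?A (flift F)), friedman F (finst t A)}"
  have "?G \<turnstile> finst t (Imp ?A (flift F))" by (rule entails_allE) simp
  then have "?G \<turnstile> Imp (friedman F (finst t A)) F" by (simp add: friedman_finst)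
  then have "?G \<turnstile> F" by (rule entails_mp) simp
  then show ?case by (simp add: HA_Imp_iff)
next
  case (HA_eq_refl t)
  show ?case by (simp add: HA_Imp_iff) (rule entails_mp_assm[of "Eq t t"], auto)
next
  case (HA_eq_subst s t A)
  let ?S = "friedman F (finst s A)" and ?T = "friedman F (finst t A)"
  let ?G = "{Imp ?T F, ?S, Imp (Imp (Eq s t) F) F}"
  have "insert (Eq s t) ?G \<turnstile> finst t (friedman (flift F) A)"
    by (rule entails_eq_subst[of _ s]) (simp, simp add: friedman_finst entails_assm)
  then have "insert (Eq s t) ?G \<turnstile> ?T" by (simp add: friedman_finst)
  then have "insert (Eq s t) ?G \<turnstile> F" by (rule entails_mp_assm[rotated]) simp
  then have "?G \<turnstile> Imp (Eq s t) F" unfolding entails_Imp .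
  then have "?G \<turnstile> F" by (rule entails_mp_assm[rotated]) simp
  then have "{?S, Imp (Imp (Eq s t) F) F} \<turnstile> ?T" by (rule entails_friedman_stable)
  then show ?case by (simp add: HA_Imp_iff)
next
  case (HA_arith A)
  have *: "G \<turnstile> Imp (Imp (Eq s t) F) F" if "HA (Eq s t)" for G s t
    unfolding entails_Imp by (rule entails_mp_assm[of "Eq s t"], simp) (rule entails_HA[OF that])
  from HA_arith consider s where "A = Neg (Eq (Succ s) Zero)"
    | s t where "A = Imp (Eq (Succ s) (Succ t)) (Eq s t)"
    | s t where "A = Eq s t"
    unfolding arith_axioms_def by auto
  then show ?case
  proof cases
    case 1
    have "{Imp (Imp (Eq (Succ s) Zero) F) F} \<turnstile> F"
      by (rule entails_mp_assm[of "Imp (Eq (Succ s) Zero) F"], simp, unfold entails_Imp,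
          rule entails_Succ_Zero[of _ s]) simp
    then show ?thesis unfolding 1 by (simp add: HA_Imp_iff)
  next
    case 2
    let ?G = "{Imp (Eq s t) F, Imp (Imp (Eq (Succ s) (Succ t)) F) F}"
    have "insert (Eq (Succ s) (Succ t)) ?G \<turnstile> F"
      by (rule entails_mp_assm[of "Eq s t"], simp, rule entails_Succ_inject) simp
    then have "?G \<turnstile> F"
      by (intro entails_mp_assm[of "Imp (Eq (Succ s) (Succ t)) F" F]) auto
    then show ?thesis unfolding 2 by (simp add: HA_Imp_iff)
  next
    case 3
    then show ?thesis using *[of s t "{}"] HA.HA_arith[OF HA_arith] unfolding entails_empty_iff by simp
  qed
next
  case (HA_ind A)
  then show ?case using HA.HA_ind[of "friedman (flift F) A"]
    by (simp add: friedman_finst friedman_fsucc)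
next
  case (HA_mp A B) then show ?case using HA.HA_mp by simp blast
next
  case (HA_allI A B)
  from HA_allI.IH[of "flift F"] have "HA (Imp (flift (friedman F A)) (friedman (flift F) B))"
    by (simp add: friedman_flift)
  then show ?case using HA.HA_allI by simp
next
  case (HA_exE A B)
  let ?A = "friedman (flift F) A" and ?B = "friedman F B"
  from HA_exE.IH[of "flift F"] have 1: "HA (Imp ?A (flift ?B))" by (simp add: friedman_flift)
  let ?P = "Forall (Imp ?A (flift F))"
  let ?G = "{Imp ?B F, Imp ?P F}"
  have "insert ?A (flift ` ?G) \<turnstile> flift F"
    by (rule entails_mp_assm[of "flift ?B"], simp, rule entails_HA_mp[OF 1], simp)
  then have "?G \<turnstile> ?P" by (intro entails_allI) simp
  then have "?G \<turnstile> F" by (rule entails_mp_assm[rotated]) simp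
  then have "{Imp ?P F} \<turnstile> ?B" by (rule entails_friedman_stable)
  then show ?case by (simp add: HA_Imp_iff)
qed (simp_all add: HA.intros)

text \<open>Universal closures make the set invariant under substitution and lifting, so that it may
  stay in the context under quantifier rules. Entailment from it is provability in Peano
  arithmetic.\<close>

definition DNE :: "fm set" where
  "DNE = {(Forall ^^ n) (Imp (Neg (Neg A)) A) |n A. ffree A \<subseteq> {..<n}}"

lemma friedman_DNE: "D \<in> DNE \<Longrightarrow> HA (friedman F D)"
proof -
  assume "D \<in> DNE"
  then obtain n A where D: "D = (Forall ^^ n) (Imp (Neg (Neg A)) A)" unfolding DNE_def by auto
  have "HA (friedman F ((Forall ^^ n) (Imp (Neg (Neg A)) A)))"
  proof (induction n arbitrary: F)
    case 0
    have "{Imp (Imp (friedman F A) F) F} \<turnstile> friedman F A"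
      by (rule entails_friedman_stable, rule entails_mp_assm[of "Imp (friedman F A) F" F])
        (auto intro: entails_assm simp del: entails_Imp)
    then show ?case by (simp add: HA_Imp_iff)
  next
    case (Suc n) then show ?case using HA_Forall by simp
  qed
  then show ?thesis using D by simp
qed

text \<open>The translation is compared with the formula itself, which is possible for decidable
  formulas only.\<close>

lemma delta0_friedman:
  "delta0 A \<Longrightarrow> (\<forall>F G. G \<turnstile> A \<longrightarrow> G \<turnstile> friedman F A) \<and>
    (\<forall>F G. G \<turnstile> friedman F A \<longrightarrow> insert (Imp A F) G \<turnstile> F)"
proof (induction rule: delta0.induct)
  case (delta0_Eq s t)
  have "G \<turnstile> friedman F (Eq s t)" if "G \<turnstile> Eq s t" for F G
    by (simp, rule entails_mp_assm[of "Eq s t"]) (auto intro: entails_mono[OF that])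
  moreover have "insert (Imp (Eq s t) F) G \<turnstile> F" if "G \<turnstile> friedman F (Eq s t)" for F G
    using that by simp
  ultimately show ?case by blast
next
  case delta0_Bot
  then show ?case by (auto intro: entails_botE entails_mono)
next
  case (delta0_And A B)
  have "insert (Imp (And A B) F) G \<turnstile> F" if "G \<turnstile> friedman F (And A B)" for F G
  proof -
    have *: "G \<turnstile> friedman F A" "G \<turnstile> friedman F B" using that by auto
    let ?G = "insert (Imp (And A B) F) G"
    have "insert A ?G \<turnstile> friedman F B" using *(2) by (rule entails_mono) auto
    then have 1: "insert (Imp B F) (insert A ?G) \<turnstile> F" using delta0_And.IH(2) by blast
    have "insert B (insert A ?G) \<turnstile> F" by (rule entails_mp_assm[of "And A B"]) (auto intro: entails_assm)
    then have "insert A ?G \<turnstile> Imp B F" by simp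
    then have 2: "insert A ?G \<turnstile> F" using 1 entails_cut by blast
    have "?G \<turnstile> friedman F A" using *(1) by (rule entails_mono) auto
    then have "insert (Imp A F) ?G \<turnstile> F" using delta0_And.IH(1) by blast
    moreover have "?G \<turnstile> Imp A F" using 2 by simp
    ultimately show ?thesis using entails_cut by blast
  qed
  then show ?case using delta0_And.IH by simp
next
  case (delta0_Or A B)
  have "G \<turnstile> friedman F (Or A B)" if "G \<turnstile> Or A B" for F G
  proof (rule entails_OrE[OF that])
    show "insert A G \<turnstile> friedman F (Or A B)"
      unfolding friedman.simps entails_Imp entails_insert_And
      by (rule entails_mp_assm[of "friedman F A"])
        (use delta0_Or.IH(1) in \<open>auto intro: entails_assm\<close>)
    show "insert B G \<turnstile> friedman F (Or A B)"
      unfolding friedman.simps entails_Imp entails_insert_And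
      by (rule entails_mp_assm[of "friedman F B"])
        (use delta0_Or.IH(2) in \<open>auto intro: entails_assm\<close>)
  qed
  moreover have "insert (Imp (Or A B) F) G \<turnstile> F" if "G \<turnstile> friedman F (Or A B)" for F G
  proof -
    let ?G = "insert (Imp (Or A B) F) G"
    have cA: "insert (friedman F A) ?G \<turnstile> Imp A F" "insert (friedman F B) ?G \<turnstile> Imp B F"
      unfolding entails_Imp
      by (rule entails_mp_assm[of "Or A B"], simp, simp add: entails_OrI1 entails_OrI2)+
    have "insert (friedman F A) ?G \<turnstile> F"
      by (rule entails_cut[OF cA(1)]) (use delta0_Or.IH(1) in simp)
    moreover have "insert (friedman F B) ?G \<turnstile> F"
      by (rule entails_cut[OF cA(2)]) (use delta0_Or.IH(2) in simp)
    moreover have "?G \<turnstile> friedman F (Or A B)" using that by (rule entails_mono) auto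
    ultimately show ?thesis
      using entails_mp[of ?G "And (Imp (friedman F A) F) (Imp (friedman F B) F)" F] by simp
  qed
  ultimately show ?case by blast
next
  case (delta0_Imp A B)
  note dA = delta0_decidable[OF delta0_Imp.hyps(1)]
  note dB = delta0_decidable[OF delta0_Imp.hyps(2)]
  have "G \<turnstile> friedman F (Imp A B)" if "G \<turnstile> Imp A B" for F G
  proof (rule entails_OrE[OF entails_HA[OF dA]])
    have "insert (friedman F A) (insert A G) \<turnstile> B"
      using that[unfolded entails_Imp] by (rule entails_mono) auto
    then show "insert A G \<turnstile> friedman F (Imp A B)" using delta0_Imp.IH(2) by simp
    let ?G = "insert (friedman F A) (insert (Neg A) G)"
    have 1: "?G \<turnstile> Imp A F"
      unfolding entails_Imp by (rule entails_botE, rule entails_mp_assm[of A]) auto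
    have "?G \<turnstile> F" by (rule entails_cut[OF 1]) (use delta0_Imp.IH(1) in simp)
    then show "insert (Neg A) G \<turnstile> friedman F (Imp A B)" using entails_friedman_F by simp
  qed
  moreover have "insert (Imp (Imp A B) F) G \<turnstile> F" if "G \<turnstile> friedman F (Imp A B)" for F G
  proof (rule entails_OrE[OF entails_HA[OF dB]])
    show "insert B (insert (Imp (Imp A B) F) G) \<turnstile> F"
      by (rule entails_mp_assm[of "Imp A B"]) auto
    show "insert (Neg B) (insert (Imp (Imp A B) F) G) \<turnstile> F"
    proof (rule entails_OrE[OF entails_HA[OF dA]])
      show "insert (Neg A) (insert (Neg B) (insert (Imp (Imp A B) F) G)) \<turnstile> F"
        by (rule entails_mp_assm[of "Imp A B"], simp, unfold entails_Imp, rule entails_botE,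
            rule entails_mp_assm[of A]) auto
      let ?G = "insert A (insert (Neg B) (insert (Imp (Imp A B) F) G))"
      have "?G \<turnstile> friedman F A" using delta0_Imp.IH(1) by simp
      moreover have "?G \<turnstile> Imp (friedman F A) (friedman F B)"
        using that unfolding friedman.simps by (rule entails_mono) auto
      ultimately have fB: "?G \<turnstile> friedman F B" using entails_mp by blast
      have 1: "?G \<turnstile> Imp B F"
        unfolding entails_Imp by (rule entails_botE, rule entails_mp_assm[of B]) auto
      show "?G \<turnstile> F" by (rule entails_cut[OF 1]) (use delta0_Imp.IH(2) fB in blast)
    qed
  qed
  ultimately show ?case by blast
next
  case (delta0_Ball A t)
  note dA = delta0_decidable[OF delta0_Ball.hyps(1)]
  have dImp: "delta0 (Le (Var 0) (tlift t))" by (rule delta0_Le)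
  \<comment> \<open>The bound is an existential formula and comes with no induction hypothesis, so
    both directions of the comparison are proved for it directly.\<close>
  have leI: "G \<turnstile> friedman F (Le s u)" if "G \<turnstile> Le s u" for F G s u
  proof -
    have "insert (Eq (Plus (tlift s) (Var 0)) (tlift u)) (insert (flift (Forall (Imp (friedman (flift F) (Eq (Plus (tlift s) (Var 0)) (tlift u))) (flift F)))) (flift ` G)) \<turnstile> flift F"
      (is "insert ?e (insert (flift (Forall (Imp ?fe _))) _) \<turnstile> _")
    proof -
      let ?H = "insert ?e (insert (flift (Forall (Imp ?fe (flift F)))) (flift ` G))"
      have "?H \<turnstile> Imp ?fe (flift F)" by (rule entails_allE_lifted) simp
      moreover have "?H \<turnstile> ?fe" by (simp, rule entails_mp_assm[of ?e]) auto
      ultimately show ?thesis by (rule entails_mp)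
    qed
    then have "insert (Le s u) (insert (Forall (Imp (friedman (flift F) (Eq (Plus (tlift s) (Var 0)) (tlift u))) (flift F))) G) \<turnstile> F"
      unfolding Le_def by (intro entails_insert_Exists) simp
    then have "insert (Le s u) G \<turnstile> friedman F (Le s u)" by (simp add: Le_def insert_commute)
    with that show ?thesis using entails_cut by blast
  qed
  have leE: "insert (Imp (Le s u) F) G \<turnstile> F" if "G \<turnstile> friedman F (Le s u)" for F G s u
  proof -
    let ?e = "Eq (Plus (tlift s) (Var 0)) (tlift u)"
    let ?H = "insert (Imp (Imp ?e (flift F)) (flift F)) (flift ` (insert (Imp (Le s u) F) G))"
    have "insert ?e ?H \<turnstile> flift (Le s u)" unfolding Le_def by (rule entails_exI_lifted) simp
    then have "insert ?e ?H \<turnstile> flift F" by (rule entails_mp_assm[rotated]) simp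
    then have "?H \<turnstile> Imp ?e (flift F)" unfolding entails_Imp .
    then have "?H \<turnstile> flift F" by (rule entails_mp_assm[rotated]) simp
    then have 1: "insert (Imp (Le s u) F) G \<turnstile> Forall (Imp (friedman (flift F) ?e) (flift F))"
      by (intro entails_allI) simp
    have "insert (Imp (Le s u) F) G \<turnstile> Imp (Forall (Imp (friedman (flift F) ?e) (flift F))) F"
      using that unfolding Le_def friedman.simps by (rule entails_mono) auto
    then show ?thesis using 1 by (rule entails_mp)
  qed
  let ?L = "Le (Var 0) (tlift t)"
  have "G \<turnstile> friedman F (BAll t A)" if "G \<turnstile> BAll t A" for F G
  proof -
    let ?G = "insert (friedman (flift F) ?L) (flift ` G)"
    have "?G \<turnstile> flift (BAll t A)" using entails_lift[OF that] by (rule entails_mono) auto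
    then have "?G \<turnstile> Imp ?L A" by (rule entails_allE_lifted)
    then have "insert ?L ?G \<turnstile> friedman (flift F) A" using delta0_Ball.IH by simp
    moreover have "insert (Neg ?L) ?G \<turnstile> friedman (flift F) A"
    proof (rule entails_friedman_F)
      have 1: "insert (Neg ?L) ?G \<turnstile> Imp ?L (flift F)"
        unfolding entails_Imp by (rule entails_botE, rule entails_mp_assm[of ?L]) auto
      show "insert (Neg ?L) ?G \<turnstile> flift F" by (rule entails_cut[OF 1], rule leE) simp
    qed
    ultimately have "?G \<turnstile> friedman (flift F) A"
      using entails_OrE[OF entails_HA[OF delta0_decidable[OF dImp]]] by blast
    then show ?thesis by (simp add: entails_allI)
  qed
  moreover have "insert (Imp (BAll t A) F) G \<turnstile> F" if "G \<turnstile> friedman F (BAll t A)" for F G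
  proof (rule entails_OrE[OF entails_HA[OF HA_bounded_cases[OF dA]]])
    show "insert (BAll t A) (insert (Imp (BAll t A) F) G) \<turnstile> F"
      by (rule entails_mp_assm[of "BAll t A"]) auto
    let ?G = "insert ?L (insert (Neg A) (flift ` (insert (Imp (BAll t A) F) G)))"
    have "?G \<turnstile> flift (friedman F (BAll t A))"
      using entails_lift[OF that] by (rule entails_mono) auto
    then have "?G \<turnstile> friedman (flift F) (Imp ?L A)" unfolding friedman.simps by (rule entails_allE_lifted)
    then have "?G \<turnstile> friedman (flift F) A"
      unfolding friedman.simps by (rule entails_mp) (rule leI, simp)
    then have "insert (Imp A (flift F)) ?G \<turnstile> flift F" using delta0_Ball.IH by blast
    moreover have "?G \<turnstile> Imp A (flift F)"
      unfolding entails_Imp by (rule entails_botE, rule entails_mp_assm[of A]) auto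
    ultimately have "?G \<turnstile> flift F" using entails_cut by blast
    then show "insert (BEx t (Neg A)) (insert (Imp (BAll t A) F) G) \<turnstile> F"
      by (intro entails_insert_Exists) simp
  qed
  ultimately show ?case by blast
next
  case (delta0_equiv A B)
  have f: "HA (Imp (friedman F A) (friedman F B))" "HA (Imp (friedman F B) (friedman F A))" for F
    using HA_friedman[OF delta0_equiv.hyps(2), of F] by (simp_all add: entails_empty_iff[symmetric])
  have "G \<turnstile> friedman F B" if "G \<turnstile> B" for F G
    using that delta0_equiv entails_Iff entails_HA_mp[OF f(1)] by blast
  moreover have "insert (Imp B F) G \<turnstile> F" if "G \<turnstile> friedman F B" for F G
  proof -
    have "G \<turnstile> friedman F A" using that by (rule entails_HA_mp[OF f(2)])
    then have "insert (Imp B F) G \<turnstile> friedman F A" by (rule entails_mono) auto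
    then have 1: "insert (Imp A F) (insert (Imp B F) G) \<turnstile> F" using delta0_equiv.IH by blast
    have "insert A (insert (Imp B F) G) \<turnstile> B"
      using entails_Iff[OF delta0_equiv.hyps(2), of "insert A (insert (Imp B F) G)"] by simp
    then have "insert (Imp B F) G \<turnstile> Imp A F"
      unfolding entails_Imp by (rule entails_mp_assm[rotated]) simp
    then show ?thesis using 1 entails_cut by blast
  qed
  ultimately show ?case by blast
qed

text \<open>The way back from the translation yields \<open>A\<close> only up to \<open>F\<close>,
  in the form that \<open>F\<close> follows from \<open>Imp A F\<close>. This is enough because
  \<open>F\<close> will be \<open>A\<close> itself.\<close>

lemma sigma_friedman:
  "sigma A \<Longrightarrow> (\<forall>F G. G \<turnstile> A \<longrightarrow> G \<turnstile> friedman F A) \<and>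
    (\<forall>F G. G \<turnstile> friedman F A \<longrightarrow> insert (Imp A F) G \<turnstile> F)"
proof (induction rule: sigma.induct)
  case (sigma_delta0 A) then show ?case by (rule delta0_friedman)
next
  case (sigma_And A B)
  have "insert (Imp (And A B) F) G \<turnstile> F" if "G \<turnstile> friedman F (And A B)" for F G
  proof -
    have *: "G \<turnstile> friedman F A" "G \<turnstile> friedman F B" using that by auto
    let ?G = "insert (Imp (And A B) F) G"
    have "insert A ?G \<turnstile> friedman F B" using *(2) by (rule entails_mono) auto
    then have 1: "insert (Imp B F) (insert A ?G) \<turnstile> F" using sigma_And.IH(2) by blast
    have "insert B (insert A ?G) \<turnstile> F" by (rule entails_mp_assm[of "And A B"]) (auto intro: entails_assm)
    then have "insert A ?G \<turnstile> Imp B F" by simp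
    then have 2: "insert A ?G \<turnstile> F" using 1 entails_cut by blast
    have "?G \<turnstile> friedman F A" using *(1) by (rule entails_mono) auto
    then have "insert (Imp A F) ?G \<turnstile> F" using sigma_And.IH(1) by blast
    moreover have "?G \<turnstile> Imp A F" using 2 by simp
    ultimately show ?thesis using entails_cut by blast
  qed
  then show ?case using sigma_And.IH by simp
next
  case (sigma_Or A B)
  have "G \<turnstile> friedman F (Or A B)" if "G \<turnstile> Or A B" for F G
  proof (rule entails_OrE[OF that])
    show "insert A G \<turnstile> friedman F (Or A B)"
      unfolding friedman.simps entails_Imp entails_insert_And
      by (rule entails_mp_assm[of "friedman F A"])
        (use sigma_Or.IH(1) in \<open>auto intro: entails_assm\<close>)
    show "insert B G \<turnstile> friedman F (Or A B)"
      unfolding friedman.simps entails_Imp entails_insert_And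
      by (rule entails_mp_assm[of "friedman F B"])
        (use sigma_Or.IH(2) in \<open>auto intro: entails_assm\<close>)
  qed
  moreover have "insert (Imp (Or A B) F) G \<turnstile> F" if "G \<turnstile> friedman F (Or A B)" for F G
  proof -
    let ?G = "insert (Imp (Or A B) F) G"
    have cA: "insert (friedman F A) ?G \<turnstile> Imp A F" "insert (friedman F B) ?G \<turnstile> Imp B F"
      unfolding entails_Imp
      by (rule entails_mp_assm[of "Or A B"], simp, simp add: entails_OrI1 entails_OrI2)+
    have "insert (friedman F A) ?G \<turnstile> F"
      by (rule entails_cut[OF cA(1)]) (use sigma_Or.IH(1) in simp)
    moreover have "insert (friedman F B) ?G \<turnstile> F"
      by (rule entails_cut[OF cA(2)]) (use sigma_Or.IH(2) in simp)
    moreover have "?G \<turnstile> friedman F (Or A B)" using that by (rule entails_mono) auto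
    ultimately show ?thesis
      using entails_mp[of ?G "And (Imp (friedman F A) F) (Imp (friedman F B) F)" F] by simp
  qed
  ultimately show ?case by blast
next
  case (sigma_Exists A)
  have "G \<turnstile> friedman F (Exists A)" if "G \<turnstile> Exists A" for F G
  proof -
    let ?P = "Forall (Imp (friedman (flift F) A) (flift F))"
    let ?H = "insert A (flift ` (insert ?P G))"
    have "?H \<turnstile> Imp (friedman (flift F) A) (flift F)" by (rule entails_allE_lifted) simp
    then have "?H \<turnstile> flift F" by (rule entails_mp) (use sigma_Exists.IH in simp)
    then have "insert (Exists A) (insert ?P G) \<turnstile> F" by (rule entails_insert_Exists)
    moreover have "insert ?P G \<turnstile> Exists A" using that by (rule entails_mono) auto
    ultimately have "insert ?P G \<turnstile> F" using entails_cut by blast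
    then show ?thesis by simp
  qed
  moreover have "insert (Imp (Exists A) F) G \<turnstile> F" if "G \<turnstile> friedman F (Exists A)" for F G
  proof -
    let ?P = "Forall (Imp (friedman (flift F) A) (flift F))"
    let ?G = "insert (Imp (Exists A) F) G"
    let ?H = "insert (friedman (flift F) A) (flift ` ?G)"
    have "insert A ?H \<turnstile> flift (Exists A)" by (rule entails_exI_lifted) simp
    then have "insert A ?H \<turnstile> flift F" by (rule entails_mp_assm[rotated]) simp
    then have "?H \<turnstile> Imp A (flift F)" by simp
    moreover have "insert (Imp A (flift F)) ?H \<turnstile> flift F" using sigma_Exists.IH by simp
    ultimately have "?H \<turnstile> flift F" using entails_cut by blast
    then have "?G \<turnstile> ?P" by (intro entails_allI) simp
    moreover have "?G \<turnstile> Imp ?P F" using that unfolding friedman.simps by (rule entails_mono) auto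
    ultimately show ?thesis using entails_mp by blast
  qed
  ultimately show ?case by blast
next
  case (sigma_equiv A B)
  have f: "HA (Imp (friedman F A) (friedman F B))" "HA (Imp (friedman F B) (friedman F A))" for F
    using HA_friedman[OF sigma_equiv.hyps(2), of F] by (simp_all add: entails_empty_iff[symmetric])
  have "G \<turnstile> friedman F B" if "G \<turnstile> B" for F G
    using that sigma_equiv entails_Iff entails_HA_mp[OF f(1)] by blast
  moreover have "insert (Imp B F) G \<turnstile> F" if "G \<turnstile> friedman F B" for F G
  proof -
    have "G \<turnstile> friedman F A" using that by (rule entails_HA_mp[OF f(2)])
    then have "insert (Imp B F) G \<turnstile> friedman F A" by (rule entails_mono) auto
    then have 1: "insert (Imp A F) (insert (Imp B F) G) \<turnstile> F" using sigma_equiv.IH by blast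
    have "insert A (insert (Imp B F) G) \<turnstile> B"
      using entails_Iff[OF sigma_equiv.hyps(2), of "insert A (insert (Imp B F) G)"] by simp
    then have "insert (Imp B F) G \<turnstile> Imp A F"
      unfolding entails_Imp by (rule entails_mp_assm[rotated]) simp
    then show ?thesis using 1 entails_cut by blast
  qed
  ultimately show ?case by blast
qed

text \<open>The translation with parameter \<open>Q\<close> turns the classical hypotheses into
  theorems. Since \<open>Imp Q Q\<close> is provable, the translated \<open>Q\<close> entails
  \<open>Q\<close>.\<close>

theorem sigma_conservative:
  assumes "sigma P" "sigma Q" "DNE \<turnstile> Imp P Q"
  shows "HA (Imp P Q)"
proof -
  obtain xs where xs: "set xs \<subseteq> DNE" "HA (foldr Imp xs (Imp P Q))"
    using assms(3) unfolding entails_def by blast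
  have "HA (friedman Q (foldr Imp xs (Imp P Q))) \<Longrightarrow> set xs \<subseteq> DNE \<Longrightarrow> HA (friedman Q (Imp P Q))"
    by (induction xs) (auto dest: HA_mp friedman_DNE)
  then have "HA (Imp (friedman Q P) (friedman Q Q))" using HA_friedman[OF xs(2)] xs(1) by simp
  moreover have "{P} \<turnstile> friedman Q P" using sigma_friedman[OF assms(1)] by simp
  ultimately have "{P} \<turnstile> friedman Q Q" by (rule entails_HA_mp)
  then have "insert (Imp Q Q) {P} \<turnstile> Q" using sigma_friedman[OF assms(2)] by blast
  moreover have "{P} \<turnstile> Imp Q Q" by simp
  ultimately show ?thesis using entails_cut HA_Imp_iff by blast
qed

section \<open>Models of arithmetic and completeness\<close>

text \<open>Since the language is countable, models whose universe is the type \<open>nat\<close> suffice.\<close>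

record interp =
  ip_zero :: nat
  ip_succ :: "nat \<Rightarrow> nat"
  ip_plus :: "nat \<Rightarrow> nat \<Rightarrow> nat"
  ip_times :: "nat \<Rightarrow> nat \<Rightarrow> nat"

fun tval :: "interp \<Rightarrow> (nat \<Rightarrow> nat) \<Rightarrow> trm \<Rightarrow> nat" where
  "tval M \<nu> (Var i) = \<nu> i"
| "tval M \<nu> Zero = ip_zero M"
| "tval M \<nu> (Succ t) = ip_succ M (tval M \<nu> t)"
| "tval M \<nu> (Plus s t) = ip_plus M (tval M \<nu> s) (tval M \<nu> t)"
| "tval M \<nu> (Times s t) = ip_times M (tval M \<nu> s) (tval M \<nu> t)"

fun sat :: "interp \<Rightarrow> (nat \<Rightarrow> nat) \<Rightarrow> fm \<Rightarrow> bool" where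
  "sat M \<nu> (Eq s t) \<longleftrightarrow> tval M \<nu> s = tval M \<nu> t"
| "sat M \<nu> Bot \<longleftrightarrow> False"
| "sat M \<nu> (And A B) \<longleftrightarrow> sat M \<nu> A \<and> sat M \<nu> B"
| "sat M \<nu> (Or A B) \<longleftrightarrow> sat M \<nu> A \<or> sat M \<nu> B"
| "sat M \<nu> (Imp A B) \<longleftrightarrow> (sat M \<nu> A \<longrightarrow> sat M \<nu> B)"
| "sat M \<nu> (Forall A) \<longleftrightarrow> (\<forall>x. sat M (case_nat x \<nu>) A)"
| "sat M \<nu> (Exists A) \<longleftrightarrow> (\<exists>x. sat M (case_nat x \<nu>) A)"

lemma tval_tsubst: "tval M \<nu> (tsubst \<sigma> t) = tval M (\<lambda>i. tval M \<nu> (\<sigma> i)) t"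
  by (induction t) auto

lemma tval_tlift [simp]: "tval M (case_nat x \<nu>) (tlift t) = tval M \<nu> t"
  by (simp add: tlift_def tval_tsubst)

lemma tval_up: "(\<lambda>i. tval M (case_nat x \<nu>) (up \<sigma> i)) = case_nat x (\<lambda>i. tval M \<nu> (\<sigma> i))"
  by (rule ext) (auto simp: up_def split: nat.splits)

lemma sat_fsubst: "sat M \<nu> (fsubst \<sigma> A) = sat M (\<lambda>i. tval M \<nu> (\<sigma> i)) A"
  by (induction A arbitrary: \<nu> \<sigma>) (auto simp: tval_tsubst tval_up)

lemma sat_flift [simp]: "sat M (case_nat x \<nu>) (flift A) = sat M \<nu> A"
  by (simp add: flift_def sat_fsubst)

lemma case_nat_tval: "(\<lambda>i. tval M \<nu> (case_nat t \<sigma> i)) = case_nat (tval M \<nu> t) (\<lambda>i. tval M \<nu> (\<sigma> i))"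
  by (rule ext) (auto split: nat.splits)

lemma sat_finst: "sat M \<nu> (finst t A) = sat M (case_nat (tval M \<nu> t) \<nu>) A"
  by (simp add: finst_def sat_fsubst case_nat_tval)

lemma tval_cong: "(\<And>i. i \<in> tfree t \<Longrightarrow> \<nu> i = \<nu>' i) \<Longrightarrow> tval M \<nu> t = tval M \<nu>' t"
  by (induction t) auto

text \<open>As \<open>sat\<close> is classical, a structure in which the theorems of HA hold is a
  model of Peano arithmetic; it may well be nonstandard.\<close>

locale pa_model =
  fixes M :: interp
  assumes HA_sound: "HA A \<Longrightarrow> sat M \<nu> A"

instance trm :: countable by countable_datatype
instance fm :: countable by countable_datatype

lemma entails_Forall_instances:
  "G \<turnstile> (Forall ^^ n) A \<Longrightarrow> G \<turnstile> fsubst (\<lambda>i. if i < n then \<sigma> i else Var (i - n)) A"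
proof (induction n arbitrary: A \<sigma>)
  case (Suc n)
  let ?\<tau> = "\<lambda>i. if i < n then \<sigma> (Suc i) else Var (i - n)"
  have "G \<turnstile> (Forall ^^ n) (Forall A)" using Suc.prems by (simp add: funpow_swap1)
  then have "G \<turnstile> Forall (fsubst (up ?\<tau>) A)" using Suc.IH[of "Forall A" "\<lambda>i. \<sigma> (Suc i)"] by simp
  then have "G \<turnstile> finst (\<sigma> 0) (fsubst (up ?\<tau>) A)" by (rule entails_allE)
  then have "G \<turnstile> fsubst (case_nat (\<sigma> 0) ?\<tau>) A" by (simp add: finst_fsubst_up)
  moreover have "fsubst (case_nat (\<sigma> 0) ?\<tau>) A = fsubst (\<lambda>i. if i < Suc n then \<sigma> i else Var (i - Suc n)) A"
    by (rule fsubst_cong) (auto split: nat.splits)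
  ultimately show ?case by simp
qed simp

lemma ffree_funpow_Forall: "ffree ((Forall ^^ n) A) = {i. i + n \<in> ffree A}"
  by (induction n arbitrary: A) (auto simp: funpow_swap1)

lemma DNE_closed: "D \<in> DNE \<Longrightarrow> fsubst \<sigma> D = D"
proof -
  assume "D \<in> DNE"
  then have "ffree D = {}" unfolding DNE_def by (fastforce simp: ffree_funpow_Forall)
  then show ?thesis by (intro fsubst_idem) auto
qed

lemma DNE_image [simp]: "fsubst \<sigma> ` DNE = DNE" "flift ` DNE = DNE"
  by (auto simp: DNE_closed flift_def image_iff)

lemma entails_DNE: assumes "DNE \<subseteq> G" shows "G \<turnstile> Imp (Neg (Neg A)) A"
proof -
  let ?D = "Imp (Neg (Neg A)) A"
  obtain n where n: "ffree A \<subseteq> {..<n}" using ffree_bounded by blast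
  then have "(Forall ^^ n) ?D \<in> G" using assms unfolding DNE_def by blast
  then have "G \<turnstile> (Forall ^^ n) ?D" by (rule entails_assm)
  then have "G \<turnstile> fsubst (\<lambda>i. if i < n then Var i else Var (i - n)) ?D"
    by (rule entails_Forall_instances)
  moreover have "fsubst (\<lambda>i. if i < n then Var i else Var (i - n)) ?D = ?D"
    by (rule fsubst_idem) (use n in auto)
  ultimately show ?thesis by simp
qed

lemma entails_ccontr: "DNE \<subseteq> G \<Longrightarrow> insert (Neg A) G \<turnstile> Bot \<Longrightarrow> G \<turnstile> A"
  using entails_DNE entails_Imp entails_mp by metis

lemma numerals_distinct:
  "m \<noteq> n \<Longrightarrow> G \<turnstile> Eq (numeral_trm m) (numeral_trm n) \<Longrightarrow> G \<turnstile> A"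
proof (induction m arbitrary: n)
  case 0
  then obtain k where "n = Suc k" by (cases n) auto
  with 0 show ?case using entails_Succ_Zero[OF entails_eq_sym] by simp
next
  case (Suc m)
  show ?case
  proof (cases n)
    case 0 with Suc show ?thesis using entails_Succ_Zero by simp
  next
    case (Suc k)
    then have "G \<turnstile> Eq (numeral_trm m) (numeral_trm k)" "m \<noteq> k"
      using Suc.prems by (auto intro: entails_Succ_inject)
    then show ?thesis using Suc.IH by blast
  qed
qed

section \<open>Henkin's completeness theorem for Peano arithmetic\<close>

locale henkin =
  fixes A0 :: fm
  assumes A0: "\<not> DNE \<turnstile> A0"
begin

abbreviation consistent :: "fm \<Rightarrow> bool" where
  "consistent B \<equiv> \<not> insert B DNE \<turnstile> Bot"

definition fresh :: "fm \<Rightarrow> nat" where "fresh B = (SOME k. ffree B \<subseteq> {..<k})"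

lemma fresh: "ffree B \<subseteq> {..<fresh B}"
  unfolding fresh_def by (rule someI_ex) (rule ffree_bounded)

text \<open>Maximal extension and witnesses are achieved in the same pass. A stage is a single
  formula and \<open>DNE\<close> is closed, so some variable is always fresh and can serve as a
  Henkin constant.\<close>

definition step :: "fm \<Rightarrow> fm \<Rightarrow> fm" where
  "step G A = (if consistent (And G A) then
      (case A of Exists B \<Rightarrow> And (And G A) (finst (Var (fresh (And G A))) B) | _ \<Rightarrow> And G A)
    else G)"

primrec stage :: "nat \<Rightarrow> fm" where
  "stage 0 = Neg A0"
| "stage (Suc n) = step (stage n) (from_nat n)"

definition theory_of :: "fm set" where
  "theory_of = {B. \<exists>n. insert (stage n) DNE \<turnstile> B}"

lemma stage_consistent: "consistent (stage n)"
proof (induction n)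
  case 0 show ?case using A0 entails_ccontr by auto
next
  case (Suc n)
  let ?G = "stage n" and ?A = "from_nat n :: fm"
  show ?case
  proof (cases "consistent (And ?G ?A)")
    case True
    show ?thesis
    proof (cases ?A)
      case (Exists B)
      let ?k = "fresh (And ?G ?A)"
      \<comment> \<open>Sends the witness variable to index 0 and lifts all others: the instance
        becomes the body \<open>B\<close> again and the stage becomes its own lift, as existential
        elimination requires.\<close>
      let ?\<sigma> = "\<lambda>i. if i = ?k then Var 0 else Var (Suc i)"
      have free: "?k \<notin> ffree (And ?G ?A)" using fresh by blast
      have "False" if "insert (And (And ?G ?A) (finst (Var ?k) B)) DNE \<turnstile> Bot"
      proof -
        have 1: "fsubst ?\<sigma> (And ?G ?A) = flift (And ?G ?A)"
          unfolding flift_def by (rule fsubst_cong) (use free in auto)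
        have 2: "fsubst ?\<sigma> (finst (Var ?k) B) = B"
          unfolding fsubst_finst finst_fsubst_up
          by (rule fsubst_idem) (use free Exists in \<open>auto split: nat.splits\<close>)
        have "insert (finst (Var ?k) B) (insert (And ?G ?A) DNE) \<turnstile> Bot"
          using that by (simp add: insert_commute)
        then have "fsubst ?\<sigma> ` (insert (finst (Var ?k) B) (insert (And ?G ?A) DNE)) \<turnstile> fsubst ?\<sigma> Bot"
          by (rule entails_fsubst)
        then have "insert B (flift ` (insert (And ?G ?A) DNE)) \<turnstile> flift Bot"
          by (simp only: image_insert 1 2 DNE_image fsubst.simps(2) flift_simps(2))
        then have "insert (Exists B) (insert (And ?G ?A) DNE) \<turnstile> Bot" by (rule entails_insert_Exists)
        moreover have "insert (And ?G ?A) DNE \<turnstile> Exists B"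
          unfolding Exists entails_insert_And by simp
        ultimately show False using True entails_cut by blast
      qed
      then show ?thesis using True Exists by (auto simp: step_def)
    qed (use True in \<open>auto simp: step_def\<close>)
  qed (use Suc in \<open>simp add: step_def\<close>)
qed

lemma stage_Suc: "insert (stage (Suc n)) DNE \<turnstile> stage n"
  by (auto simp: step_def split: fm.splits)

lemma stage_mono: "m \<le> n \<Longrightarrow> insert (stage m) DNE \<turnstile> B \<Longrightarrow> insert (stage n) DNE \<turnstile> B"
proof (induction n rule: dec_induct)
  case (step n)
  then have "insert (stage n) (insert (stage (Suc n)) DNE) \<turnstile> B"
    by (auto intro: entails_mono)
  then show ?case using stage_Suc entails_cut by blast
qed

lemma theory_entails: "theory_of \<turnstile> B \<longleftrightarrow> B \<in> theory_of"
proof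
  assume "theory_of \<turnstile> B"
  then obtain xs where xs: "set xs \<subseteq> theory_of" "HA (foldr Imp xs B)" unfolding entails_def by blast
  have "\<exists>n. \<forall>x\<in>set xs. insert (stage n) DNE \<turnstile> x"
    using xs(1)
  proof (induction xs)
    case (Cons x xs)
    then obtain n m where "\<forall>x\<in>set xs. insert (stage n) DNE \<turnstile> x" "insert (stage m) DNE \<turnstile> x"
      by (auto simp: theory_of_def)
    then have "\<forall>y\<in>set (x # xs). insert (stage (max m n)) DNE \<turnstile> y"
      by (auto intro: stage_mono[rotated])
    then show ?case by blast
  qed simp
  then obtain n where n: "\<forall>x\<in>set xs. insert (stage n) DNE \<turnstile> x" by blast
  have "insert (stage n) DNE \<turnstile> foldr Imp xs B" by (rule entails_HA[OF xs(2)])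
  then have "insert (stage n) DNE \<turnstile> B" using n
    by (induction xs) (auto intro: entails_mp simp del: entails_Imp)
  then show "B \<in> theory_of" unfolding theory_of_def by blast
qed (rule entails_assm)

lemma theory_HA: "HA B \<Longrightarrow> B \<in> theory_of"
  using entails_HA theory_entails by blast

lemma DNE_theory: "DNE \<subseteq> theory_of"
  unfolding theory_of_def by (auto intro: entails_assm)

lemma theory_consistent: "Bot \<notin> theory_of"
  using stage_consistent unfolding theory_of_def by blast

lemma theory_maximal: "B \<in> theory_of \<or> Neg B \<in> theory_of"
proof -
  let ?n = "to_nat B"
  have f: "from_nat ?n = B" by simp
  show ?thesis
  proof (cases "consistent (And (stage ?n) B)")
    case True
    then have "stage (Suc ?n) = And (stage ?n) B \<or> (\<exists>D. stage (Suc ?n) = And (And (stage ?n) B) D)"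
      by (auto simp: step_def f split: fm.splits)
    moreover have "insert (And X Y) H \<turnstile> X" "insert (And X Y) H \<turnstile> Y" for X Y H
      using entails_assm[of "And X Y" "insert (And X Y) H"] unfolding entails_And by auto
    ultimately have "insert (stage (Suc ?n)) DNE \<turnstile> B"
      using entails_And by metis
    then show ?thesis unfolding theory_of_def by blast
  next
    case False
    then have "insert (stage ?n) DNE \<turnstile> Neg B" by (simp add: insert_commute)
    then show ?thesis unfolding theory_of_def by blast
  qed
qed

lemma theory_Neg: "Neg B \<in> theory_of \<longleftrightarrow> B \<notin> theory_of"
  using theory_maximal theory_consistent theory_entails entails_mp entails_assm by blast

lemma theory_witness: "Exists B \<in> theory_of \<Longrightarrow> \<exists>t. finst t B \<in> theory_of"
proof -
  assume E: "Exists B \<in> theory_of"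
  let ?n = "to_nat (Exists B)"
  have f: "from_nat ?n = Exists B" by simp
  have "consistent (And (stage ?n) (Exists B))"
  proof
    assume "insert (And (stage ?n) (Exists B)) DNE \<turnstile> Bot"
    then have "insert (stage ?n) DNE \<turnstile> Neg (Exists B)" by (simp add: insert_commute)
    then have "Neg (Exists B) \<in> theory_of" unfolding theory_of_def by blast
    then show False using E theory_Neg by blast
  qed
  then have "insert (stage (Suc ?n)) DNE \<turnstile> finst (Var (fresh (And (stage ?n) (Exists B)))) B"
    by (simp add: step_def f)
  then show ?thesis unfolding theory_of_def by blast
qed

lemma theory_Imp: "Imp B D \<in> theory_of \<longleftrightarrow> (B \<in> theory_of \<longrightarrow> D \<in> theory_of)"
proof
  assume "Imp B D \<in> theory_of"
  then show "B \<in> theory_of \<longrightarrow> D \<in> theory_of" using theory_entails entails_mp by blast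
next
  assume *: "B \<in> theory_of \<longrightarrow> D \<in> theory_of"
  show "Imp B D \<in> theory_of"
  proof (cases "D \<in> theory_of")
    case True
    then have "theory_of \<turnstile> Imp B D" by (simp add: entails_assm)
    then show ?thesis by (simp only: theory_entails)
  next
    case False
    then have n: "Neg B \<in> theory_of" using * theory_Neg by blast
    have "theory_of \<turnstile> Imp B D" unfolding entails_Imp
      by (rule entails_botE[OF entails_mp_assm[of B Bot]]) (use n in auto)
    then show ?thesis by (simp only: theory_entails)
  qed
qed

lemma theory_Or: "Or B D \<in> theory_of \<longleftrightarrow> B \<in> theory_of \<or> D \<in> theory_of"
proof
  assume "Or B D \<in> theory_of"
  then have 1: "theory_of \<turnstile> Or B D" by (rule entails_assm)
  show "B \<in> theory_of \<or> D \<in> theory_of"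
  proof (rule ccontr)
    assume "\<not> (B \<in> theory_of \<or> D \<in> theory_of)"
    then have *: "Neg B \<in> theory_of" "Neg D \<in> theory_of" using theory_Neg by auto
    have "theory_of \<turnstile> Bot"
      by (rule entails_OrE[OF 1], rule entails_mp_assm[OF insertI2[OF *(1)]], simp,
          rule entails_mp_assm[OF insertI2[OF *(2)]], simp)
    then show False using theory_entails theory_consistent by blast
  qed
next
  assume "B \<in> theory_of \<or> D \<in> theory_of"
  then show "Or B D \<in> theory_of"
    using theory_entails entails_OrI1 entails_OrI2 by blast
qed

lemma theory_Exists: "Exists B \<in> theory_of \<longleftrightarrow> (\<exists>t. finst t B \<in> theory_of)"
  using theory_witness theory_entails entails_exI by blast

lemma theory_Forall: "Forall B \<in> theory_of \<longleftrightarrow> (\<forall>t. finst t B \<in> theory_of)"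
proof
  show "Forall B \<in> theory_of \<Longrightarrow> \<forall>t. finst t B \<in> theory_of"
    using theory_entails entails_allE by blast
  assume *: "\<forall>t. finst t B \<in> theory_of"
  show "Forall B \<in> theory_of"
  proof (rule ccontr)
    assume "Forall B \<notin> theory_of"
    then have n: "Neg (Forall B) \<in> theory_of" using theory_Neg by blast
    have "Exists (Neg B) \<notin> theory_of" using * theory_Neg unfolding theory_Exists by auto
    then have "Neg (Exists (Neg B)) \<in> theory_of" using theory_Neg by blast
    moreover have "insert (Neg (Exists (Neg B))) DNE \<turnstile> Forall B"
    proof (rule entails_allI, rule entails_ccontr)
      let ?G = "insert (Neg B) (flift ` insert (Neg (Exists (Neg B))) DNE)"
      have "?G \<turnstile> flift (Exists (Neg B))" by (rule entails_exI_lifted, rule entails_assm) simp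
      then show "?G \<turnstile> Bot" by (rule entails_mp_assm[rotated]) simp
    qed auto
    ultimately have "theory_of \<turnstile> Forall B" using DNE_theory by (auto intro: entails_mono)
    then show False using \<open>Forall B \<notin> theory_of\<close> theory_entails by blast
  qed
qed

definition eqv :: "trm \<Rightarrow> trm set" where "eqv s = {t. Eq s t \<in> theory_of}"

lemma eqv_eq: "eqv s = eqv t \<longleftrightarrow> Eq s t \<in> theory_of"
  unfolding eqv_def theory_entails[symmetric]
  using entails_eq_refl entails_eq_sym entails_eq_trans by blast

definition elem :: "trm \<Rightarrow> nat" where "elem t = to_nat_on (range eqv) (eqv t)"

text \<open>The classes of terms can be numbered by all of \<open>nat\<close> only if there are
  infinitely many; the numerals already represent infinitely many.\<close>

lemma infinite_classes: "infinite (range eqv)"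
proof -
  have "inj (\<lambda>n. eqv (numeral_trm n))"
  proof (rule injI, rule ccontr)
    fix m n assume "eqv (numeral_trm m) = eqv (numeral_trm n)" "m \<noteq> n"
    then have "theory_of \<turnstile> Bot" using numerals_distinct eqv_eq theory_entails by metis
    then show False using theory_entails theory_consistent by blast
  qed
  then have "infinite (range (\<lambda>n. eqv (numeral_trm n)))" using finite_imageD by blast
  then show ?thesis by (rule infinite_super[rotated]) auto
qed

lemma elem_bij: "bij_betw (to_nat_on (range eqv)) (range eqv) UNIV"
  by (rule to_nat_on_infinite[OF _ infinite_classes]) simp

lemma elem_eq: "elem s = elem t \<longleftrightarrow> Eq s t \<in> theory_of"
  unfolding elem_def eqv_eq[symmetric]
  using bij_betw_imp_inj_on[OF elem_bij] by (auto dest: inj_onD)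

lemma surj_elem: "surj elem"
proof -
  have "range elem = to_nat_on (range eqv) ` range eqv" unfolding elem_def by auto
  then show ?thesis using elem_bij by (simp add: bij_betw_def)
qed

definition rep :: "nat \<Rightarrow> trm" where "rep = inv elem"

lemma elem_rep [simp]: "elem (rep n) = n"
  unfolding rep_def by (rule surj_f_inv_f[OF surj_elem])

definition model :: interp where
  "model = \<lparr>ip_zero = elem Zero, ip_succ = (\<lambda>x. elem (Succ (rep x))),
    ip_plus = (\<lambda>x y. elem (Plus (rep x) (rep y))), ip_times = (\<lambda>x y. elem (Times (rep x) (rep y)))\<rparr>"

lemma rep_elem: "theory_of \<turnstile> Eq (rep (elem t)) t"
  unfolding theory_entails by (simp add: elem_eq[symmetric])

lemma tval_model: "tval model (\<lambda>i. elem (\<sigma> i)) t = elem (tsubst \<sigma> t)"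
  by (induction t)
    (auto simp: model_def elem_eq theory_entails[symmetric]
      intro!: entails_eq_Succ entails_eq_Plus entails_eq_Times rep_elem)

lemma sat_model: "sat model (\<lambda>i. elem (\<sigma> i)) B \<longleftrightarrow> fsubst \<sigma> B \<in> theory_of"
proof (induction B arbitrary: \<sigma>)
  case (Eq s t) then show ?case by (simp add: tval_model elem_eq)
next
  case Bot then show ?case using theory_consistent by simp
next
  case (And A B)
  have "And (fsubst \<sigma> A) (fsubst \<sigma> B) \<in> theory_of \<longleftrightarrow>
    fsubst \<sigma> A \<in> theory_of \<and> fsubst \<sigma> B \<in> theory_of"
    unfolding theory_entails[symmetric] by simp
  then show ?case using And by simp
next
  case (Or A B) then show ?case by (simp add: theory_Or)
next
  case (Imp A B) then show ?case by (simp add: theory_Imp)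
next
  case (Forall B)
  have env: "case_nat (elem t) (\<lambda>i. elem (\<sigma> i)) = (\<lambda>i. elem (case_nat t \<sigma> i))" for t
    by (rule ext) (auto split: nat.splits)
  have "(\<forall>x. sat model (case_nat x (\<lambda>i. elem (\<sigma> i))) B) \<longleftrightarrow>
    (\<forall>t. sat model (case_nat (elem t) (\<lambda>i. elem (\<sigma> i))) B)"
    using elem_rep by metis
  then show ?case unfolding sat.simps fsubst.simps theory_Forall
    by (simp add: env Forall.IH finst_fsubst_up)
next
  case (Exists B)
  have env: "case_nat (elem t) (\<lambda>i. elem (\<sigma> i)) = (\<lambda>i. elem (case_nat t \<sigma> i))" for t
    by (rule ext) (auto split: nat.splits)
  have "(\<exists>x. sat model (case_nat x (\<lambda>i. elem (\<sigma> i))) B) \<longleftrightarrow>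
    (\<exists>t. sat model (case_nat (elem t) (\<lambda>i. elem (\<sigma> i))) B)"
    using elem_rep by metis
  then show ?case unfolding sat.simps fsubst.simps theory_Exists
    by (simp add: env Exists.IH finst_fsubst_up)
qed

lemma pa_model_model: "pa_model model"
proof
  fix B \<nu> assume "HA B"
  then have "fsubst (\<lambda>i. rep (\<nu> i)) B \<in> theory_of" by (intro theory_HA HA_fsubst)
  then show "sat model \<nu> B" using sat_model[of "\<lambda>i. rep (\<nu> i)" B] by simp
qed

lemma model_refutes: "\<not> sat model (\<lambda>i. elem (Var i)) A0"
proof -
  have "Neg A0 \<in> theory_of" unfolding theory_of_def by (auto intro: exI[of _ 0] entails_assm simp del: entails_Imp)
  then show ?thesis using sat_model[of Var A0] theory_Neg by simp
qed

end

theorem completeness: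
  assumes "\<And>M \<nu>. pa_model M \<Longrightarrow> sat M \<nu> A"
  shows "DNE \<turnstile> A"
proof (rule ccontr)
  assume "\<not> DNE \<turnstile> A"
  then interpret henkin A by unfold_locales
  show False using assms pa_model_model model_refutes by blast
qed

theorem sigma_transfer:
  assumes "sigma P" "sigma Q" "\<And>M \<nu>. pa_model M \<Longrightarrow> sat M \<nu> P \<Longrightarrow> sat M \<nu> Q"
  shows "HA (Imp P Q)"
  by (rule sigma_conservative[OF assms(1,2)], rule completeness) (use assms(3) in simp)

lemma sigma_transfer_Iff:
  assumes "sigma P" "sigma Q" "\<And>M \<nu>. pa_model M \<Longrightarrow> sat M \<nu> P \<longleftrightarrow> sat M \<nu> Q"
  shows "HA (Iff P Q)"
  using sigma_transfer[of P Q] sigma_transfer[of Q P] assms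
  unfolding HA_Iff_entails HA_Imp_iff by blast

lemma clause_bound: "t \<in> insert (fst c) (set (snd c)) \<Longrightarrow> i \<in> tfree t \<Longrightarrow> i < clause_bound c"
proof -
  have "finite (\<Union>t\<in>insert (fst c) (set (snd c)). tfree t)" by auto
  then obtain n where "(\<Union>t\<in>insert (fst c) (set (snd c)). tfree t) \<subseteq> {..<n}"
    using finite_nat_iff_bounded by blast
  then have "\<forall>t \<in> insert (fst c) (set (snd c)). tfree t \<subseteq> {..<n}" by blast
  then have "\<forall>t \<in> insert (fst c) (set (snd c)). tfree t \<subseteq> {..<clause_bound c}"
    unfolding clause_bound_def by (rule LeastI)
  then show "t \<in> insert (fst c) (set (snd c)) \<Longrightarrow> i \<in> tfree t \<Longrightarrow> i < clause_bound c" by blast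
qed

section \<open>Arithmetic in a model\<close>

context pa_model
begin

abbreviation zer ("\<zero>") where "\<zero> \<equiv> ip_zero M"
abbreviation suc where "suc \<equiv> ip_succ M"
abbreviation plus (infixl "\<oplus>" 65) where "x \<oplus> y \<equiv> ip_plus M x y"
abbreviation times (infixl "\<otimes>" 70) where "x \<otimes> y \<equiv> ip_times M x y"

text \<open>In \<open>mix \<nu>\<close> the odd variables denote all elements of the model, so that a definable relation
  may have arbitrary parameters.\<close>

definition mix :: "(nat \<Rightarrow> nat) \<Rightarrow> nat \<Rightarrow> nat" where
  "mix \<nu> i = (if even i then \<nu> (i div 2) else i div 2)"

definition Tm :: "((nat \<Rightarrow> nat) \<Rightarrow> nat) \<Rightarrow> bool" where
  "Tm f \<longleftrightarrow> (\<exists>t. \<forall>\<nu>. f \<nu> = tval M (mix \<nu>) t)"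

text \<open>Induction in a model applies only to predicates defined by a formula, possibly with
  parameters. The closure rules for \<open>Tm\<close> and \<open>Df\<close> reduce this requirement
  to the shape of the predicate.\<close>

definition Df :: "((nat \<Rightarrow> nat) \<Rightarrow> bool) \<Rightarrow> bool" where
  "Df R \<longleftrightarrow> (\<exists>A. \<forall>\<nu>. R \<nu> = sat M (mix \<nu>) A)"

lemma Tm_var: "Tm (\<lambda>\<nu>. \<nu> i)"
  unfolding Tm_def by (rule exI[of _ "Var (2 * i)"]) (simp add: mix_def)

lemma Tm_const: "Tm (\<lambda>\<nu>. c)"
  unfolding Tm_def by (rule exI[of _ "Var (2 * c + 1)"]) (simp add: mix_def)

lemma Tm_suc: "Tm f \<Longrightarrow> Tm (\<lambda>\<nu>. suc (f \<nu>))"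
  unfolding Tm_def by (metis tval.simps(3))

lemma Tm_plus: "Tm f \<Longrightarrow> Tm g \<Longrightarrow> Tm (\<lambda>\<nu>. f \<nu> \<oplus> g \<nu>)"
  unfolding Tm_def by (metis tval.simps(4))

lemma Tm_times: "Tm f \<Longrightarrow> Tm g \<Longrightarrow> Tm (\<lambda>\<nu>. f \<nu> \<otimes> g \<nu>)"
  unfolding Tm_def by (metis tval.simps(5))

lemma Tm_shift: "Tm f \<Longrightarrow> Tm (\<lambda>\<nu>. f (\<lambda>i. \<nu> (Suc i)))"
proof -
  assume "Tm f"
  then obtain t where t: "\<And>\<nu>. f \<nu> = tval M (mix \<nu>) t" unfolding Tm_def by auto
  have "mix (\<lambda>i. \<nu> (Suc i)) = (\<lambda>i. tval M (mix \<nu>) (if even i then Var (i + 2) else Var i))" for \<nu>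
    by (rule ext) (auto simp: mix_def)
  then have "f (\<lambda>i. \<nu> (Suc i)) = tval M (mix \<nu>) (tsubst (\<lambda>i. if even i then Var (i + 2) else Var i) t)" for \<nu>
    by (simp add: t tval_tsubst)
  then show ?thesis unfolding Tm_def by blast
qed

lemma Tm_case_nat: "Tm f \<Longrightarrow> (\<And>i. Tm (g i)) \<Longrightarrow> Tm (\<lambda>\<nu>. case_nat (f \<nu>) (\<lambda>i. g i \<nu>) i)"
  by (cases i) auto

lemma Df_eq: "Tm f \<Longrightarrow> Tm g \<Longrightarrow> Df (\<lambda>\<nu>. f \<nu> = g \<nu>)"
  unfolding Tm_def Df_def by (metis sat.simps(1))

lemma Df_const: "Df (\<lambda>\<nu>. P)"
  unfolding Df_def by (cases P) (rule exI[of _ Verum], simp, rule exI[of _ Bot], simp)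

lemma Df_and: "Df R \<Longrightarrow> Df S \<Longrightarrow> Df (\<lambda>\<nu>. R \<nu> \<and> S \<nu>)"
  unfolding Df_def by (metis sat.simps(3))

lemma Df_or: "Df R \<Longrightarrow> Df S \<Longrightarrow> Df (\<lambda>\<nu>. R \<nu> \<or> S \<nu>)"
  unfolding Df_def by (metis sat.simps(4))

lemma Df_imp: "Df R \<Longrightarrow> Df S \<Longrightarrow> Df (\<lambda>\<nu>. R \<nu> \<longrightarrow> S \<nu>)"
  unfolding Df_def by (metis sat.simps(5))

lemma Df_not: "Df R \<Longrightarrow> Df (\<lambda>\<nu>. \<not> R \<nu>)"
  using Df_imp[OF _ Df_const[of False]] by simp

lemma Df_iff: "Df R \<Longrightarrow> Df S \<Longrightarrow> Df (\<lambda>\<nu>. R \<nu> \<longleftrightarrow> S \<nu>)"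
  using Df_and[OF Df_imp[of R S] Df_imp[of S R]] by (simp add: iff_conv_conj_imp)

text \<open>The quantified entry is the even variable 0 and becomes the bound index 0. Another even
  variable loses 2, because the environment drops its head, and gains 1 from the binder; odd
  variables, the parameters, gain 1.\<close>

lemma mix_quantifier:
  assumes "\<And>\<nu>. R (\<nu> 0) (\<lambda>i. \<nu> (Suc i)) = sat M (mix \<nu>) A"
  shows "R x \<nu> = sat M (case_nat x (mix \<nu>))
    (fsubst (\<lambda>i. if i = 0 then Var 0 else if even i then Var (i - 1) else Var (Suc i)) A)"
proof -
  have "R x \<nu> = sat M (mix (case_nat x \<nu>)) A"
    using assms[of "case_nat x \<nu>"] by simp
  also have "mix (case_nat x \<nu>) = (\<lambda>i. tval M (case_nat x (mix \<nu>))
    (if i = 0 then Var 0 else if even i then Var (i - 1) else Var (Suc i)))"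
    by (rule ext) (auto simp: mix_def split: nat.splits elim!: evenE)
  finally show ?thesis by (simp add: sat_fsubst)
qed

lemma Df_ex: "Df (\<lambda>\<nu>. R (\<nu> 0) (\<lambda>i. \<nu> (Suc i))) \<Longrightarrow> Df (\<lambda>\<nu>. \<exists>x. R x \<nu>)"
proof -
  assume "Df (\<lambda>\<nu>. R (\<nu> 0) (\<lambda>i. \<nu> (Suc i)))"
  then obtain A where "\<And>\<nu>. R (\<nu> 0) (\<lambda>i. \<nu> (Suc i)) = sat M (mix \<nu>) A" unfolding Df_def by auto
  from mix_quantifier[of R, OF this] show ?thesis unfolding Df_def
    by (intro exI[of _ "Exists (fsubst (\<lambda>i. if i = 0 then Var 0 else if even i then Var (i - 1) else Var (Suc i)) A)"])
      simp
qed

lemma Df_all: "Df (\<lambda>\<nu>. R (\<nu> 0) (\<lambda>i. \<nu> (Suc i))) \<Longrightarrow> Df (\<lambda>\<nu>. \<forall>x. R x \<nu>)"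
  using Df_not[OF Df_ex[of "\<lambda>x \<nu>. \<not> R x \<nu>"]] Df_not[of "\<lambda>\<nu>. R (\<nu> 0) (\<lambda>i. \<nu> (Suc i))"] by simp

lemma Df_sat: assumes "\<And>i. Tm (f i)" shows "Df (\<lambda>\<nu>. sat M (\<lambda>i. f i \<nu>) A)"
proof -
  have "\<forall>i. \<exists>t. \<forall>\<nu>. f i \<nu> = tval M (mix \<nu>) t" using assms unfolding Tm_def by blast
  then obtain t where "\<And>i \<nu>. f i \<nu> = tval M (mix \<nu>) (t i)" by metis
  then show ?thesis unfolding Df_def by (intro exI[of _ "fsubst t A"]) (simp add: sat_fsubst)
qed

lemma Df_subst: assumes "Df (\<lambda>\<nu>. P (\<nu> 0))" "Tm f" shows "Df (\<lambda>\<nu>. P (f \<nu>))"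
proof -
  obtain A where A: "\<And>\<nu>. P (\<nu> 0) = sat M (mix \<nu>) A" using assms(1) unfolding Df_def by auto
  obtain t where t: "\<And>\<nu>. f \<nu> = tval M (mix \<nu>) t" using assms(2) unfolding Tm_def by auto
  have "P (f \<nu>) = sat M (mix \<nu>) (fsubst (\<lambda>i. if i = 0 then t else Var i) A)" for \<nu>
  proof -
    have "P (f \<nu>) = sat M (mix (\<nu>(0 := f \<nu>))) A" using A[of "\<nu>(0 := f \<nu>)"] by simp
    also have "mix (\<nu>(0 := f \<nu>)) = (\<lambda>i. tval M (mix \<nu>) (if i = 0 then t else Var i))"
      by (rule ext) (auto simp: mix_def t[symmetric] elim!: evenE)
    finally show ?thesis by (simp add: sat_fsubst)
  qed
  then show ?thesis unfolding Df_def by blast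
qed

lemma Df_bex_list: "(\<And>c. c \<in> set cs \<Longrightarrow> Df (R c)) \<Longrightarrow> Df (\<lambda>\<nu>. \<exists>c\<in>set cs. R c \<nu>)"
  by (induction cs) (auto intro: Df_const Df_or)

lemmas Df_intros = Df_const Df_and Df_or Df_not Df_iff Df_imp Df_ex Df_all Df_eq
  Tm_const Tm_var Tm_suc Tm_plus Tm_times Tm_case_nat

lemma pa_induct:
  assumes "Df (\<lambda>\<nu>. Q (\<nu> 0))" "Q \<zero>" "\<And>x. Q x \<Longrightarrow> Q (suc x)"
  shows "Q x"
proof -
  obtain A where A: "\<And>\<nu>. Q (\<nu> 0) = sat M (mix \<nu>) A" using assms(1) unfolding Df_def by auto
  define \<mu> where "\<mu> = (\<lambda>i. mix (\<lambda>_. 0) (Suc i))"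
  have Q: "sat M (case_nat y \<mu>) A = Q y" for y
  proof -
    have "mix (case_nat y (\<lambda>_. 0)) = case_nat y \<mu>"
      by (rule ext) (auto simp: mix_def \<mu>_def split: nat.splits elim!: evenE)
    then show ?thesis using A[of "case_nat y (\<lambda>_. 0)"] by simp
  qed
  have succ: "sat M (case_nat y \<mu>) (fsucc A) = Q (suc y)" for y
    using Q by (simp add: fsucc_def sat_fsubst case_nat_tval)
  have "sat M \<mu> (Imp (finst Zero A) (Imp (Forall (Imp A (fsucc A))) (Forall A)))"
    by (rule HA_sound[OF HA_ind])
  then show ?thesis using assms(2,3) by (simp add: sat_finst Q succ)
qed

section \<open>The ordered semiring of a model\<close>

lemma arith_simps [simp]:
  "suc x \<noteq> \<zero>" "\<zero> \<noteq> suc x" "suc x = suc y \<longleftrightarrow> x = y" "x \<oplus> \<zero> = x" "x \<oplus> suc y = suc (x \<oplus> y)"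
  "x \<otimes> \<zero> = \<zero>" "x \<otimes> suc y = x \<otimes> y \<oplus> x"
proof -
  have "\<forall>A\<in>set arith_axioms. sat M (case_nat x (\<lambda>_. y)) A"
    using HA_sound HA_arith by blast
  then have ax: "suc x \<noteq> \<zero>" "suc x = suc y \<longrightarrow> x = y" "x \<oplus> \<zero> = x" "x \<oplus> suc y = suc (x \<oplus> y)"
    "x \<otimes> \<zero> = \<zero>" "x \<otimes> suc y = x \<otimes> y \<oplus> x"
    unfolding arith_axioms_def by simp_all
  from ax show "suc x \<noteq> \<zero>" "suc x = suc y \<longleftrightarrow> x = y" "x \<oplus> \<zero> = x" "x \<oplus> suc y = suc (x \<oplus> y)"
    "x \<otimes> \<zero> = \<zero>" "x \<otimes> suc y = x \<otimes> y \<oplus> x" by auto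
  then show "\<zero> \<noteq> suc x" by metis
qed

lemma plus_assoc: "x \<oplus> y \<oplus> w = x \<oplus> (y \<oplus> w)"
  by (rule pa_induct[of "\<lambda>w. x \<oplus> y \<oplus> w = x \<oplus> (y \<oplus> w)"], (intro Df_intros)) auto

lemma zero_plus [simp]: "\<zero> \<oplus> x = x"
  by (rule pa_induct[of "\<lambda>x. \<zero> \<oplus> x = x"], (intro Df_intros)) auto

lemma suc_plus [simp]: "suc x \<oplus> y = suc (x \<oplus> y)"
  by (rule pa_induct[of "\<lambda>y. suc x \<oplus> y = suc (x \<oplus> y)"], (intro Df_intros)) auto

lemma plus_comm: "x \<oplus> y = y \<oplus> x"
  by (rule pa_induct[of "\<lambda>y. x \<oplus> y = y \<oplus> x"], (intro Df_intros)) auto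

lemma plus_left_comm: "x \<oplus> (y \<oplus> w) = y \<oplus> (x \<oplus> w)"
  by (metis plus_assoc plus_comm)

lemma zero_times [simp]: "\<zero> \<otimes> x = \<zero>"
  by (rule pa_induct[of "\<lambda>x. \<zero> \<otimes> x = \<zero>"], (intro Df_intros)) auto

lemma suc_times [simp]: "suc x \<otimes> y = x \<otimes> y \<oplus> y"
  by (rule pa_induct[of "\<lambda>y. suc x \<otimes> y = x \<otimes> y \<oplus> y"], (intro Df_intros))
    (auto simp: plus_assoc plus_comm plus_left_comm)

lemma times_comm: "x \<otimes> y = y \<otimes> x"
  by (rule pa_induct[of "\<lambda>y. x \<otimes> y = y \<otimes> x"], (intro Df_intros)) auto

lemma distrib_left: "x \<otimes> (y \<oplus> w) = x \<otimes> y \<oplus> x \<otimes> w"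
  by (rule pa_induct[of "\<lambda>w. x \<otimes> (y \<oplus> w) = x \<otimes> y \<oplus> x \<otimes> w"], (intro Df_intros))
    (auto simp: plus_assoc)

lemma times_assoc: "x \<otimes> y \<otimes> w = x \<otimes> (y \<otimes> w)"
  by (rule pa_induct[of "\<lambda>w. x \<otimes> y \<otimes> w = x \<otimes> (y \<otimes> w)"], (intro Df_intros))
    (auto simp: distrib_left)

lemma times_left_comm: "x \<otimes> (y \<otimes> w) = y \<otimes> (x \<otimes> w)"
  by (metis times_assoc times_comm)

lemmas ring_norm = plus_assoc plus_comm plus_left_comm times_assoc times_comm times_left_comm
  distrib_left

lemma plus_cancel [simp]: "x \<oplus> y = x \<oplus> w \<longleftrightarrow> y = w"
proof -
  have "x \<oplus> y = x \<oplus> w \<longrightarrow> y = w"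
    by (rule pa_induct[of "\<lambda>x. x \<oplus> y = x \<oplus> w \<longrightarrow> y = w"], (intro Df_intros)) auto
  then show ?thesis by auto
qed

lemma plus_eq_self [simp]: "x \<oplus> y = x \<longleftrightarrow> y = \<zero>" "x = x \<oplus> y \<longleftrightarrow> y = \<zero>"
  using plus_cancel[of x y \<zero>] plus_cancel[of x \<zero> y] by auto

lemma zero_or_suc: "x = \<zero> \<or> (\<exists>y. x = suc y)"
  by (rule pa_induct[of "\<lambda>x. x = \<zero> \<or> (\<exists>y. x = suc y)"], (intro Df_intros)) auto

lemma plus_eq_zero [simp]: "x \<oplus> y = \<zero> \<longleftrightarrow> x = \<zero> \<and> y = \<zero>"
  using zero_or_suc[of y] by auto

lemma times_eq_zero [simp]: "x \<otimes> y = \<zero> \<longleftrightarrow> x = \<zero> \<or> y = \<zero>"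
  using zero_or_suc[of y] by auto

definition le (infix "\<preceq>" 50) where "x \<preceq> y \<longleftrightarrow> (\<exists>w. x \<oplus> w = y)"

lemma Df_le: "Tm f \<Longrightarrow> Tm g \<Longrightarrow> Df (\<lambda>\<nu>. f \<nu> \<preceq> g \<nu>)"
proof -
  assume "Tm f" "Tm g"
  then obtain s t where "\<And>\<nu>. f \<nu> = tval M (mix \<nu>) s" "\<And>\<nu>. g \<nu> = tval M (mix \<nu>) t"
    unfolding Tm_def by auto
  then show ?thesis unfolding Df_def le_def
    by (intro exI[of _ "Le s t"]) (simp add: Le_def)
qed

lemma sat_Le [simp]: "sat M \<nu> (Le s t) \<longleftrightarrow> tval M \<nu> s \<preceq> tval M \<nu> t"
  by (simp add: Le_def le_def)

lemma le_total: "(\<exists>w. x \<oplus> w = y) \<or> (\<exists>w. y \<oplus> suc w = x)"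
proof (rule pa_induct[of "\<lambda>y. (\<exists>w. x \<oplus> w = y) \<or> (\<exists>w. y \<oplus> suc w = x)"])
  show "(\<exists>w. x \<oplus> w = \<zero>) \<or> (\<exists>w. \<zero> \<oplus> suc w = x)" using zero_or_suc[of x] by auto
  fix y assume "(\<exists>w. x \<oplus> w = y) \<or> (\<exists>w. y \<oplus> suc w = x)"
  then show "(\<exists>w. x \<oplus> w = suc y) \<or> (\<exists>w. suc y \<oplus> suc w = x)"
  proof
    assume "\<exists>w. x \<oplus> w = y" then show ?thesis by (metis arith_simps(5))
  next
    assume "\<exists>w. y \<oplus> suc w = x"
    then obtain w where w: "y \<oplus> suc w = x" by blast
    show ?thesis using zero_or_suc[of w] w by auto
  qed
qed (intro Df_intros)

lemma le_refl [simp]: "x \<preceq> x" unfolding le_def by (metis arith_simps(4))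
lemma zero_le [simp]: "\<zero> \<preceq> x" unfolding le_def by simp
lemma le_trans: "x \<preceq> y \<Longrightarrow> y \<preceq> w \<Longrightarrow> x \<preceq> w" unfolding le_def by (metis plus_assoc)
lemma le_antisym: "x \<preceq> y \<Longrightarrow> y \<preceq> x \<Longrightarrow> x = y" unfolding le_def by (auto simp: plus_assoc)
lemma le_plus1 [simp]: "x \<preceq> x \<oplus> y" and le_plus2 [simp]: "x \<preceq> y \<oplus> x"
  unfolding le_def by (auto simp: plus_comm)
lemma le_suc [simp]: "x \<preceq> suc x" using le_plus1[of x "suc \<zero>"] by simp
lemma le_zero [simp]: "x \<preceq> \<zero> \<longleftrightarrow> x = \<zero>" unfolding le_def by auto
lemma suc_le_suc [simp]: "suc x \<preceq> suc y \<longleftrightarrow> x \<preceq> y" unfolding le_def by simp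
lemma not_suc_le [simp]: "\<not> suc x \<preceq> x" unfolding le_def by (auto simp: arith_simps(5)[symmetric] simp del: arith_simps(5))
lemma le_or_suc_le: "x \<preceq> y \<or> suc y \<preceq> x"
  using le_total[of x y] unfolding le_def by auto
lemma le_suc_iff: "x \<preceq> suc y \<longleftrightarrow> x \<preceq> y \<or> x = suc y"
proof
  assume "x \<preceq> suc y"
  then obtain w where w: "x \<oplus> w = suc y" unfolding le_def by blast
  show "x \<preceq> y \<or> x = suc y"
    using zero_or_suc[of w] w unfolding le_def by auto
qed (auto intro: le_trans[OF _ le_suc])
lemma le_eq_or: "x \<preceq> y \<longleftrightarrow> x = y \<or> suc x \<preceq> y"
  using le_or_suc_le[of y x] le_antisym[of x y] le_trans[OF le_suc, of x y] by auto

lemmas Df_intros' = Df_le Df_intros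

lemma le_induct_Ball:
  assumes "Df (\<lambda>\<nu>. Q (\<nu> 0))" "\<And>x. (\<And>y. suc y \<preceq> x \<Longrightarrow> Q y) \<Longrightarrow> Q x"
  shows "Q x"
proof -
  have "\<forall>y. y \<preceq> x \<longrightarrow> Q y"
  proof (rule pa_induct[of "\<lambda>x. \<forall>y. y \<preceq> x \<longrightarrow> Q y"])
    show "Df (\<lambda>\<nu>. \<forall>y. y \<preceq> \<nu> 0 \<longrightarrow> Q y)"
      by (intro Df_intros' Df_subst[OF assms(1)])
    have "Q \<zero>" by (rule assms(2)) simp
    then show "\<forall>y. y \<preceq> \<zero> \<longrightarrow> Q y" by simp
    fix x assume *: "\<forall>y. y \<preceq> x \<longrightarrow> Q y"
    have "Q (suc x)" by (rule assms(2)) (simp add: *)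
    then show "\<forall>y. y \<preceq> suc x \<longrightarrow> Q y" using * le_suc_iff by auto
  qed
  then show ?thesis by simp
qed

section \<open>The pairing function in a model\<close>

definition pr :: "nat \<Rightarrow> nat \<Rightarrow> nat" where "pr x y = (x \<oplus> y) \<otimes> (x \<oplus> y) \<oplus> x"

lemma tval_pair_trm [simp]: "tval M \<nu> (pair_trm s t) = pr (tval M \<nu> s) (tval M \<nu> t)"
  by (simp add: pair_trm_def pr_def)

lemma Tm_pr: "Tm f \<Longrightarrow> Tm g \<Longrightarrow> Tm (\<lambda>\<nu>. pr (f \<nu>) (g \<nu>))"
  unfolding pr_def by (intro Df_intros)

text \<open>Write n for the sum of \<open>x\<close> and \<open>y\<close>. A larger sum has a square
  of at least (n + 1)^2, which exceeds n^2 + x since x is at most n.\<close>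

lemma pr_less: assumes "x \<oplus> y \<oplus> suc w = x' \<oplus> y'" shows "pr x y \<noteq> pr x' y'"
proof
  assume eq: "pr x y = pr x' y'"
  let ?n = "x \<oplus> y"
  have "pr x' y' = (?n \<oplus> suc w) \<otimes> (?n \<oplus> suc w) \<oplus> x'" unfolding pr_def assms ..
  also have "\<dots> = (?n \<otimes> ?n \<oplus> x) \<oplus> suc (y \<oplus> (w \<otimes> ?n \<oplus> (?n \<oplus> w) \<otimes> w \<oplus> ?n \<oplus> w \<oplus> w \<oplus> x'))"
    by (simp add: ring_norm)
  finally show False using eq unfolding pr_def by (metis plus_eq_self(1) arith_simps(1))
qed

lemma pr_inject [simp]: "pr x y = pr x' y' \<longleftrightarrow> x = x' \<and> y = y'"
proof
  assume eq: "pr x y = pr x' y'"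
  have "x \<oplus> y = x' \<oplus> y'"
    using le_total[of "x \<oplus> y" "x' \<oplus> y'"] pr_less[of x y _ x' y'] pr_less[of x' y' _ x y] eq
      zero_or_suc by (metis arith_simps(4))
  then show "x = x' \<and> y = y'" using eq unfolding pr_def by (metis plus_cancel)
qed simp

lemma le_times_suc: "x \<preceq> x \<otimes> suc y" by simp

lemma le_square: "x \<preceq> x \<otimes> x"
  using zero_or_suc[of x] le_times_suc by auto

lemma le_pr1 [simp]: "x \<preceq> pr x y" and le_pr2 [simp]: "y \<preceq> pr x y"
  unfolding pr_def
  by simp (meson le_plus2 le_square le_plus1 le_trans)

section \<open>Coding of finite sets by divisibility\<close>

abbreviation dvds (infix "\<bar>\<bar>" 50) where "d \<bar>\<bar> x \<equiv> \<exists>y. y \<otimes> d = x"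

text \<open>Divisibility of a difference without subtraction. If \<open>y\<close> is larger than
  \<open>x\<close>, the equation forces \<open>a\<close> to be zero, which everything
  divides.\<close>

lemma dvds_diff: "d \<otimes> x = d \<otimes> y \<oplus> a \<Longrightarrow> d \<bar>\<bar> a"
proof -
  assume eq: "d \<otimes> x = d \<otimes> y \<oplus> a"
  from le_total[of y x] show ?thesis
  proof
    assume "\<exists>w. y \<oplus> w = x"
    then obtain w where "x = y \<oplus> w" by auto
    with eq have "d \<otimes> w = a" by (simp add: distrib_left)
    then show ?thesis by (metis times_comm)
  next
    assume "\<exists>w. x \<oplus> suc w = y"
    then obtain w where "y = x \<oplus> suc w" by auto
    with eq have "d \<otimes> x = d \<otimes> x \<oplus> (d \<otimes> suc w \<oplus> a)" by (simp add: distrib_left plus_assoc)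
    then have "a = \<zero>" unfolding plus_eq_self by simp
    then show ?thesis by (metis zero_times)
  qed
qed

abbreviation modulus :: "nat \<Rightarrow> nat \<Rightarrow> nat" where "modulus q n \<equiv> suc (suc n \<otimes> q)"

text \<open>The coprimality argument behind Goedel's beta function. Let d be the modulus of
  \<open>j\<close>. Eliminating \<open>q\<close> from the two moduli shows that d divides
  \<open>p\<close> times the difference of \<open>j\<close> and \<open>b\<close>. That difference
  divides \<open>q\<close>, so d divides p q; and d times \<open>p\<close> is \<open>p\<close> plus
  a multiple of p q.\<close>

lemma modulus_dvds_cancel:
  assumes "modulus q j \<bar>\<bar> p \<otimes> modulus q b" "suc j \<oplus> suc i = suc b \<or> suc b \<oplus> suc i = suc j"
    and "suc i \<otimes> k = q"
  shows "modulus q j \<bar>\<bar> p"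
proof -
  let ?d = "modulus q j"
  obtain c where c: "p \<otimes> modulus q b = c \<otimes> ?d" using assms(1) by metis
  have "?d \<bar>\<bar> p \<otimes> suc i"
    using assms(2)
  proof
    assume b: "suc j \<oplus> suc i = suc b"
    show ?thesis
    proof (rule dvds_diff)
      have "?d \<otimes> (p \<otimes> suc b) = suc j \<otimes> (p \<otimes> modulus q b) \<oplus> p \<otimes> suc i"
        unfolding b[symmetric] by (simp only: ring_norm arith_simps suc_plus suc_times)
      then show "?d \<otimes> (p \<otimes> suc b) = ?d \<otimes> (suc j \<otimes> c) \<oplus> p \<otimes> suc i"
        unfolding c by (simp only: times_assoc times_comm times_left_comm)
    qed
  next
    assume j: "suc b \<oplus> suc i = suc j"
    show ?thesis
    proof (rule dvds_diff)
      have "suc j \<otimes> (p \<otimes> modulus q b) = ?d \<otimes> (p \<otimes> suc b) \<oplus> p \<otimes> suc i"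
        unfolding j[symmetric] by (simp only: ring_norm arith_simps suc_plus suc_times)
      then show "?d \<otimes> (suc j \<otimes> c) = ?d \<otimes> (p \<otimes> suc b) \<oplus> p \<otimes> suc i"
        unfolding c by (simp only: times_assoc times_comm times_left_comm)
    qed
  qed
  then obtain e where e: "e \<otimes> ?d = p \<otimes> suc i" by blast
  show ?thesis
  proof (rule dvds_diff)
    have "?d \<otimes> p = suc j \<otimes> (p \<otimes> suc i \<otimes> k) \<oplus> p"
      unfolding assms(3)[symmetric] by (simp add: ring_norm)
    also have "suc j \<otimes> (p \<otimes> suc i \<otimes> k) = ?d \<otimes> (suc j \<otimes> e \<otimes> k)"
      unfolding e[symmetric] by (simp only: times_assoc times_comm times_left_comm)
    finally show "?d \<otimes> p = ?d \<otimes> (suc j \<otimes> e \<otimes> k) \<oplus> p" .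
  qed
qed

text \<open>Takes the place of a factorial: defining the factorial in a model would itself require
  coded sequences, whereas the existence of a common multiple has a direct induction.\<close>

lemma common_multiple: "\<exists>q. q \<noteq> \<zero> \<and> (\<forall>i. i \<preceq> m \<longrightarrow> (\<exists>k. suc i \<otimes> k = q))"
proof (rule pa_induct[of "\<lambda>m. \<exists>q. q \<noteq> \<zero> \<and> (\<forall>i. i \<preceq> m \<longrightarrow> (\<exists>k. suc i \<otimes> k = q))"])
  show "\<exists>q. q \<noteq> \<zero> \<and> (\<forall>i. i \<preceq> \<zero> \<longrightarrow> (\<exists>k. suc i \<otimes> k = q))"
    by (rule exI[of _ "suc \<zero>"]) auto
  fix m assume "\<exists>q. q \<noteq> \<zero> \<and> (\<forall>i. i \<preceq> m \<longrightarrow> (\<exists>k. suc i \<otimes> k = q))"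
  then obtain q where q: "q \<noteq> \<zero>" "\<And>i. i \<preceq> m \<Longrightarrow> \<exists>k. suc i \<otimes> k = q" by blast
  have "\<exists>k. suc i \<otimes> k = suc (suc m) \<otimes> q" if "i \<preceq> suc m" for i
    using that unfolding le_suc_iff
  proof
    assume "i \<preceq> m"
    then obtain k where "suc i \<otimes> k = q" using q(2) by blast
    then have "suc i \<otimes> (suc (suc m) \<otimes> k) = suc (suc m) \<otimes> q" by (metis times_left_comm)
    then show ?thesis by blast
  qed blast
  moreover have "suc (suc m) \<otimes> q \<noteq> \<zero>" using q(1) unfolding times_eq_zero by simp
  ultimately show "\<exists>q. q \<noteq> \<zero> \<and> (\<forall>i. i \<preceq> suc m \<longrightarrow> (\<exists>k. suc i \<otimes> k = q))" by blast
qed (intro Df_intros')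

definition mem :: "nat \<Rightarrow> nat \<Rightarrow> nat \<Rightarrow> nat \<Rightarrow> bool" where
  "mem p q m n \<longleftrightarrow> n \<preceq> m \<and> (\<exists>y. y \<preceq> p \<and> y \<otimes> modulus q n = p)"

lemma mem_iff: "mem p q m n \<longleftrightarrow> n \<preceq> m \<and> modulus q n \<bar>\<bar> p"
  unfolding mem_def using le_times_suc by metis

lemma sat_Mem: "sat M \<nu> (Mem t) \<longleftrightarrow> mem (\<nu> 1) (\<nu> 2) (\<nu> 3) (tval M \<nu> t)"
  by (simp add: Mem_def mem_def eval_nat_numeral)

definition coded :: "nat set \<Rightarrow> bool" where
  "coded X \<longleftrightarrow> (\<exists>p q m. X = {n. mem p q m n})"

lemma Df_mem: "Tm f \<Longrightarrow> Tm g \<Longrightarrow> Tm h \<Longrightarrow> Tm k \<Longrightarrow> Df (\<lambda>\<nu>. mem (f \<nu>) (g \<nu>) (h \<nu>) (k \<nu>))"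
  unfolding mem_iff
  by (intro Df_and Df_le Df_ex Df_eq Tm_times Tm_suc Tm_var) (assumption | rule Tm_shift, assumption)+

text \<open>The code \<open>p\<close> is the product of the moduli of the members, built by
  induction on the number \<open>b\<close> of candidates inspected. The cancellation lemma ensures
  that no modulus of a nonmember divides it.\<close>

lemma comprehension:
  assumes P: "Df (\<lambda>\<nu>. P (\<nu> 0))"
  shows "coded {n. n \<preceq> m \<and> P n}"
proof -
  obtain q where q0: "q \<noteq> \<zero>" and q: "\<And>i. i \<preceq> m \<Longrightarrow> \<exists>k. suc i \<otimes> k = q"
    using common_multiple by blast
  let ?Q = "\<lambda>b p. \<forall>j. j \<preceq> m \<longrightarrow> ((modulus q j \<bar>\<bar> p) \<longleftrightarrow> suc j \<preceq> b \<and> P j)"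
  have "\<exists>p. ?Q b p" for b
  proof (rule pa_induct[of "\<lambda>b. \<exists>p. ?Q b p"])
    show "Df (\<lambda>\<nu>. \<exists>p. ?Q (\<nu> 0) p)"
      by (intro Df_intros' Df_subst[OF P])
    \<comment> \<open>The empty product is one. As \<open>q\<close> is not zero, every modulus
      exceeds one, so the empty set is coded.\<close>
    have "\<not> modulus q j \<bar>\<bar> suc \<zero>" for j
    proof
      assume "modulus q j \<bar>\<bar> suc \<zero>"
      then obtain y where y: "y \<otimes> modulus q j = suc \<zero>" by blast
      show False using zero_or_suc[of y] y q0 by auto
    qed
    then show "\<exists>p. ?Q \<zero> p" by (intro exI[of _ "suc \<zero>"]) auto
    fix b assume "\<exists>p. ?Q b p"
    then obtain p where p: "?Q b p" by blast
    show "\<exists>p. ?Q (suc b) p"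
    proof (cases "b \<preceq> m \<and> P b")
      case True
      have "(modulus q j \<bar>\<bar> p \<otimes> modulus q b) \<longleftrightarrow> suc j \<preceq> suc b \<and> P j" if j: "j \<preceq> m" for j
      proof (cases "j = b")
        case True
        then show ?thesis using \<open>b \<preceq> m \<and> P b\<close> by auto
      next
        case False
        have "(modulus q j \<bar>\<bar> p \<otimes> modulus q b) \<longleftrightarrow> modulus q j \<bar>\<bar> p"
        proof
          assume d: "modulus q j \<bar>\<bar> p \<otimes> modulus q b"
          obtain i where i: "suc j \<oplus> suc i = suc b \<or> suc b \<oplus> suc i = suc j"
            using le_total[of j b] False zero_or_suc
            by (metis arith_simps(4) suc_plus)
          then have "i \<preceq> m"
          proof
            assume "suc j \<oplus> suc i = suc b"
            then have "suc i \<preceq> b" by (metis le_plus2 suc_plus arith_simps(3))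
            then show ?thesis using True le_trans le_suc by blast
          next
            assume "suc b \<oplus> suc i = suc j"
            then have "suc i \<preceq> j" by (metis le_plus2 suc_plus arith_simps(3))
            then show ?thesis using j le_trans le_suc by blast
          qed
          then obtain k where "suc i \<otimes> k = q" using q by blast
          then show "modulus q j \<bar>\<bar> p" using modulus_dvds_cancel[OF d i] by blast
        next
          assume "modulus q j \<bar>\<bar> p"
          then obtain y where "y \<otimes> modulus q j = p" by blast
          then have "(y \<otimes> modulus q b) \<otimes> modulus q j = p \<otimes> modulus q b"
            by (metis times_assoc times_comm)
          then show "modulus q j \<bar>\<bar> p \<otimes> modulus q b" by blast
        qed
        moreover have "suc j \<preceq> suc b \<longleftrightarrow> suc j \<preceq> b" using False le_eq_or[of j b] by auto
        ultimately show ?thesis using p j by simp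
      qed
      then show ?thesis by blast
    next
      case False
      have "?Q (suc b) p"
        using p False le_eq_or by (metis suc_le_suc)
      then show ?thesis by blast
    qed
  qed
  then obtain p where p: "?Q (suc m) p" by blast
  then have "{n. n \<preceq> m \<and> P n} = {n. mem p q m n}" unfolding mem_iff by auto
  then show ?thesis unfolding coded_def by blast
qed

lemma Df_coded: "coded X \<Longrightarrow> Df (\<lambda>\<nu>. \<nu> 0 \<in> X)"
  unfolding coded_def by (auto intro!: Df_mem Df_intros)

lemma coded_bounded: "coded X \<Longrightarrow> \<exists>m. \<forall>n\<in>X. n \<preceq> m"
  unfolding coded_def mem_def by auto

lemma coded_Un: assumes "coded X" "coded Y" shows "coded (X \<union> Y)"
proof -
  obtain m m' where "\<forall>n\<in>X. n \<preceq> m" "\<forall>n\<in>Y. n \<preceq> m'" using assms coded_bounded by meson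
  then have "X \<union> Y = {n. n \<preceq> m \<oplus> m' \<and> (n \<in> X \<or> n \<in> Y)}"
    using le_trans le_plus1 le_plus2 by blast
  then show ?thesis using comprehension[of "\<lambda>n. n \<in> X \<or> n \<in> Y"] assms
    by (simp add: Df_or Df_coded)
qed

lemma coded_empty: "coded {}"
  using comprehension[OF Df_const[of False]] by simp

lemma coded_singleton: "coded {x}"
proof -
  have "{x} = {n. n \<preceq> x \<and> n = x}" by auto
  then show ?thesis using comprehension[of "\<lambda>n. n = x" x] by (simp add: Df_intros)
qed

lemma coded_insert: "coded X \<Longrightarrow> coded (insert x X)"
  using coded_Un[OF coded_singleton] by simp

section \<open>Derivability in a model\<close>

abbreviation clauses :: "clause list" where "clauses \<equiv> syntax_clauses @ HA_clauses"

definition closed :: "nat set \<Rightarrow> bool" where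
  "closed X \<longleftrightarrow> (\<forall>n\<in>X. \<exists>c\<in>set clauses. \<exists>r \<nu>. n = pr (suc r) (tval M \<nu> (fst c)) \<and>
    (\<forall>b\<in>set (snd c). pr r (tval M \<nu> b) \<in> X))"

lemma sat_Ex_var: "sat M \<nu> (Ex_var k A) \<longleftrightarrow> (\<exists>x. sat M (\<nu>(k := x)) A)"
proof -
  have "(\<lambda>i. tval M (case_nat x \<nu>) (if i = k then Var 0 else Var (Suc i))) = \<nu>(k := x)" for x
    by (rule ext) auto
  then show ?thesis by (simp add: Ex_var_def bind_var_def sat_fsubst)
qed

lemma sat_All_var: "sat M \<nu> (All_var k A) \<longleftrightarrow> (\<forall>x. sat M (\<nu>(k := x)) A)"
proof -
  have "(\<lambda>i. tval M (case_nat x \<nu>) (if i = k then Var 0 else Var (Suc i))) = \<nu>(k := x)" for x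
    by (rule ext) auto
  then show ?thesis by (simp add: All_var_def bind_var_def sat_fsubst)
qed

lemma sat_Conj: "sat M \<nu> (Conj As) \<longleftrightarrow> (\<forall>A\<in>set As. sat M \<nu> A)"
  unfolding Conj_def by (induction As) auto

lemma sat_Disj: "sat M \<nu> (Disj As) \<longleftrightarrow> (\<exists>A\<in>set As. sat M \<nu> A)"
  unfolding Disj_def by (induction As) auto

text \<open>Variable 3 holds the common bound; quantifying it would change the bound for the
  quantifiers further inside.\<close>

lemma sat_Ex_bounded:
  "3 \<notin> set ks \<Longrightarrow> sat M \<nu> (foldr Ex_bounded ks A) \<longleftrightarrow>
    (\<exists>\<nu>'. (\<forall>i. i \<notin> set ks \<longrightarrow> \<nu>' i = \<nu> i) \<and> (\<forall>k\<in>set ks. \<nu>' k \<preceq> \<nu> 3) \<and> sat M \<nu>' A)"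
proof (induction ks arbitrary: \<nu>)
  case Nil
  have "\<nu>' = \<nu>" if "\<forall>i. \<nu>' i = \<nu> i" for \<nu>' using that by auto
  then show ?case by auto
next
  case (Cons k ks)
  have k: "k \<noteq> 3" using Cons.prems by auto
  show ?case (is "_ \<longleftrightarrow> ?R")
  proof
    assume "sat M \<nu> (foldr Ex_bounded (k # ks) A)"
    then obtain x where x: "x \<preceq> \<nu> 3" "sat M (\<nu>(k := x)) (foldr Ex_bounded ks A)"
      using k by (auto simp: Ex_bounded_def[of k] sat_Ex_var)
    have ks: "3 \<notin> set ks" using Cons.prems by auto
    from Cons.IH[OF ks, THEN iffD1, OF x(2)] obtain \<nu>' where
      "\<And>i. i \<notin> set ks \<Longrightarrow> \<nu>' i = (\<nu>(k := x)) i"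
      "\<And>j. j \<in> set ks \<Longrightarrow> \<nu>' j \<preceq> (\<nu>(k := x)) 3" "sat M \<nu>' A" by blast
    moreover from this have "\<nu>' k \<preceq> \<nu> 3" using x(1) k by (cases "k \<in> set ks") auto
    ultimately show ?R using k by (intro exI[of _ \<nu>']) (auto split: if_splits)
  next
    assume ?R
    then obtain \<nu>' where *: "\<And>i. i \<notin> set (k # ks) \<Longrightarrow> \<nu>' i = \<nu> i"
      "\<And>j. j \<in> set (k # ks) \<Longrightarrow> \<nu>' j \<preceq> \<nu> 3" "sat M \<nu>' A" by auto
    have "sat M (\<nu>(k := \<nu>' k)) (foldr Ex_bounded ks A)"
      unfolding Cons.IH[OF Cons.prems[unfolded set_simps insert_iff de_Morgan_disj, THEN conjunct2]]
      by (rule exI[of _ \<nu>']) (use * k in auto)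
    then show "sat M \<nu> (foldr Ex_bounded (k # ks) A)"
      using * k by (auto simp: Ex_bounded_def[of k] sat_Ex_var)
  qed
qed

text \<open>Terms without products, apart from those in the pairing function, dominate their
  variables.\<close>

inductive pterm :: "trm \<Rightarrow> bool" where
  pterm_Var: "pterm (Var i)"
| pterm_Zero: "pterm Zero"
| pterm_Succ: "pterm t \<Longrightarrow> pterm (Succ t)"
| pterm_Plus: "pterm s \<Longrightarrow> pterm t \<Longrightarrow> pterm (Plus s t)"
| pterm_pair: "pterm s \<Longrightarrow> pterm t \<Longrightarrow> pterm (pair_trm s t)"

lemma pterm_numeral: "pterm (numeral_trm n)"
  by (induction n) (auto intro: pterm.intros)

lemma pterm_le: "pterm t \<Longrightarrow> i \<in> tfree t \<Longrightarrow> \<nu> i \<preceq> tval M \<nu> t"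
proof (induction rule: pterm.induct)
  case (pterm_Succ t) then show ?case by (auto intro: le_trans)
next
  case (pterm_Plus s t) then show ?case by (auto intro: le_trans)
next
  case (pterm_pair s t)
  then have "\<nu> i \<preceq> tval M \<nu> s \<or> \<nu> i \<preceq> tval M \<nu> t" by (auto simp: pair_trm_def)
  then show ?case by (auto intro: le_trans)
qed auto

lemma pterm_clauses: "c \<in> set clauses \<Longrightarrow> t \<in> insert (fst c) (set (snd c)) \<Longrightarrow> pterm t"
proof -
  have "\<forall>c\<in>set syntax_clauses. pterm (fst c) \<and> (\<forall>b\<in>set (snd c). pterm b)"
    unfolding syntax_clauses_def Let_def tag1_def tag2_def
    by (simp del: numeral_trm.simps) (intro conjI pterm.intros pterm_numeral)
  moreover have "\<forall>c\<in>set HA_clauses. pterm (fst c) \<and> (\<forall>b\<in>set (snd c). pterm b)"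
    unfolding HA_clauses_def arith_axioms_def Let_def tag1_def tag2_def
    by (simp del: numeral_trm.simps fcode.simps) (intro conjI pterm.intros pterm_numeral)
  ultimately show "c \<in> set clauses \<Longrightarrow> t \<in> insert (fst c) (set (snd c)) \<Longrightarrow> pterm t" by auto
qed

abbreviation memset :: "nat \<Rightarrow> nat \<Rightarrow> nat \<Rightarrow> nat set" where "memset p q m \<equiv> {n. mem p q m n}"

text \<open>Bounding the variables of a clause loses no instance: each one that occurs is dominated
  by the value of a head or premise, and these are components of pairs below the bound of the coded
  set.\<close>

lemma sat_Clause_fm:
  assumes "\<nu> 4 \<preceq> \<nu> 3" "c \<in> set clauses"
  shows "sat M \<nu> (Clause_fm c) \<longleftrightarrow> (\<exists>r \<mu>. \<nu> 4 = pr (suc r) (tval M \<mu> (fst c)) \<and>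
    (\<forall>b\<in>set (snd c). pr r (tval M \<mu> b) \<in> memset (\<nu> 1) (\<nu> 2) (\<nu> 3)))" (is "_ \<longleftrightarrow> ?R")
proof -
  let ?n = "clause_bound c"
  have shift: "tval M \<nu>' (tsubst (\<lambda>i. Var (6 + i)) t) = tval M (\<lambda>i. \<nu>' (6 + i)) t" for \<nu>' t
    by (simp add: tval_tsubst)
  have "sat M \<nu> (Clause_fm c) \<longleftrightarrow> (\<exists>\<nu>'. (\<forall>i. i \<notin> {5..<6 + ?n} \<longrightarrow> \<nu>' i = \<nu> i) \<and>
    (\<forall>k\<in>{5..<6 + ?n}. \<nu>' k \<preceq> \<nu> 3) \<and> \<nu>' 4 = pr (suc (\<nu>' 5)) (tval M (\<lambda>i. \<nu>' (6 + i)) (fst c)) \<and>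
    (\<forall>b\<in>set (snd c). mem (\<nu>' 1) (\<nu>' 2) (\<nu>' 3) (pr (\<nu>' 5) (tval M (\<lambda>i. \<nu>' (6 + i)) b))))"
    (is "_ \<longleftrightarrow> ?L")
    unfolding Clause_fm_def
    by (subst sat_Ex_bounded) (auto simp: sat_Conj sat_Mem shift)
  also have "?L \<longleftrightarrow> ?R"
  proof
    assume ?L
    then obtain \<nu>' where *: "\<And>i. i \<notin> {5..<6 + ?n} \<Longrightarrow> \<nu>' i = \<nu> i"
      "\<nu>' 4 = pr (suc (\<nu>' 5)) (tval M (\<lambda>i. \<nu>' (6 + i)) (fst c))"
      "\<And>b. b \<in> set (snd c) \<Longrightarrow> mem (\<nu>' 1) (\<nu>' 2) (\<nu>' 3) (pr (\<nu>' 5) (tval M (\<lambda>i. \<nu>' (6 + i)) b))"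
      by blast
    show ?R
      by (rule exI[of _ "\<nu>' 5"], rule exI[of _ "\<lambda>i. \<nu>' (6 + i)"])
        (use * *(1)[of 1] *(1)[of 2] *(1)[of 3] *(1)[of 4] in auto)
  next
    assume ?R
    then obtain r \<mu> where *: "\<nu> 4 = pr (suc r) (tval M \<mu> (fst c))"
      "\<And>b. b \<in> set (snd c) \<Longrightarrow> mem (\<nu> 1) (\<nu> 2) (\<nu> 3) (pr r (tval M \<mu> b))" by auto
    define occ where "occ = (\<Union>t\<in>insert (fst c) (set (snd c)). tfree t)"
    \<comment> \<open>Indices below \<open>clause_bound\<close> that occur nowhere in the clause are
      quantified as well and receive zero, so as to respect the bound.\<close>
    define \<nu>' where "\<nu>' k = (if k = 5 then r else if k \<in> {6..<6 + ?n} then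
      (if k - 6 \<in> occ then \<mu> (k - 6) else \<zero>) else \<nu> k)" for k
    have tv: "tval M (\<lambda>i. \<nu>' (6 + i)) t = tval M \<mu> t" if "t \<in> insert (fst c) (set (snd c))" for t
    proof (rule tval_cong)
      fix i assume i: "i \<in> tfree t"
      have "i \<in> occ" unfolding occ_def using that i by blast
      then show "\<nu>' (6 + i) = \<mu> i" using clause_bound[OF that i] by (simp add: \<nu>'_def)
    qed
    have val_le: "tval M \<mu> t \<preceq> \<nu> 3" if "t \<in> insert (fst c) (set (snd c))" for t
    proof (cases "t = fst c")
      case True
      then show ?thesis using *(1) assms(1) le_pr2 le_trans by metis
    next
      case False
      then show ?thesis using *(2)[of t] that le_pr2 le_trans unfolding mem_def by blast
    qed
    have occ_le: "\<mu> i \<preceq> \<nu> 3" if occ: "i \<in> occ" for i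
    proof -
      obtain t where t: "t \<in> insert (fst c) (set (snd c))" "i \<in> tfree t"
        using occ unfolding occ_def by blast
      then show ?thesis using pterm_le[OF pterm_clauses[OF assms(2)]] val_le le_trans by blast
    qed
    have "suc r \<preceq> \<nu> 3" using *(1) assms(1) le_pr1 le_trans by metis
    then have "r \<preceq> \<nu> 3" using le_suc le_trans by blast
    then have "\<nu>' k \<preceq> \<nu> 3" if "k \<in> {5..<6 + ?n}" for k
      using that occ_le by (auto simp: \<nu>'_def)
    moreover have "\<nu>' i = \<nu> i" if "i \<notin> {5..<6 + ?n}" for i using that by (auto simp: \<nu>'_def)
    moreover have "\<nu>' 1 = \<nu> 1" "\<nu>' 2 = \<nu> 2" "\<nu>' 3 = \<nu> 3" "\<nu>' 4 = \<nu> 4" "\<nu>' 5 = r"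
      by (auto simp: \<nu>'_def)
    ultimately show ?L using * tv by (intro exI[of _ \<nu>']) auto
  qed
  finally show ?thesis .
qed

definition Closed_fm :: fm where
  "Closed_fm = All_var 4 (Imp (Mem (Var 4)) (Disj (map Clause_fm clauses)))"

lemma sat_Closed_fm: "sat M \<nu> Closed_fm \<longleftrightarrow> closed (memset (\<nu> 1) (\<nu> 2) (\<nu> 3))"
proof -
  have "sat M (\<nu>(4 := n)) (Disj (map Clause_fm clauses)) \<longleftrightarrow>
    (\<exists>c\<in>set clauses. \<exists>r \<mu>. n = pr (suc r) (tval M \<mu> (fst c)) \<and>
    (\<forall>b\<in>set (snd c). pr r (tval M \<mu> b) \<in> memset (\<nu> 1) (\<nu> 2) (\<nu> 3)))"
    if "mem (\<nu> 1) (\<nu> 2) (\<nu> 3) n" for n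
  proof -
    have "n \<preceq> \<nu> 3" using that unfolding mem_def by blast
    then show ?thesis unfolding sat_Disj set_map bex_simps
      by (intro bex_cong refl) (simp add: sat_Clause_fm)
  qed
  then show ?thesis unfolding Closed_fm_def sat_All_var closed_def by (auto simp: sat_Mem)
qed

section \<open>Derivability by coded closed sets\<close>

definition DerH :: "nat \<Rightarrow> nat \<Rightarrow> bool" where
  "DerH r x \<longleftrightarrow> (\<exists>X. coded X \<and> closed X \<and> pr r x \<in> X)"

definition DER :: "nat \<Rightarrow> bool" where "DER x \<longleftrightarrow> (\<exists>r. DerH r x)"

text \<open>This is what allows induction on heights inside a model: quantifying over coded sets
  amounts to quantifying over the three numbers of a code.\<close>

lemma Df_DerH: "Tm f \<Longrightarrow> Tm g \<Longrightarrow> Df (\<lambda>\<nu>. DerH (f \<nu>) (g \<nu>))"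
proof -
  assume *: "Tm f" "Tm g"
  have "DerH r x \<longleftrightarrow> (\<exists>p q m. mem p q m (pr r x) \<and>
    sat M (\<lambda>i. case_nat \<zero> (\<lambda>i. case_nat p (\<lambda>i. case_nat q (\<lambda>i. m) i) i) i) Closed_fm)" for r x
    unfolding DerH_def coded_def sat_Closed_fm by (auto simp: eval_nat_numeral)
  then show ?thesis
    by simp (intro Df_and Df_ex Df_mem Df_sat Tm_case_nat Tm_pr Tm_shift[OF Tm_shift[OF Tm_shift[OF *(1)]]]
        Tm_shift[OF Tm_shift[OF Tm_shift[OF *(2)]]] Tm_var Tm_const)
qed

lemma Df_DER: "Tm g \<Longrightarrow> Df (\<lambda>\<nu>. DER (g \<nu>))"
  unfolding DER_def by (intro Df_ex Df_DerH Tm_var Tm_shift)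

lemma sat_Der: "sat M \<nu> (Der t) \<longleftrightarrow> DER (tval M \<nu> t)"
proof -
  let ?x = "tval M \<nu> t"
  have "sat M \<nu> (Der t) \<longleftrightarrow> sat M (case_nat ?x \<nu>) Der_fm"
    by (simp add: Der_def sat_fsubst case_nat_tval)
  also have "\<dots> \<longleftrightarrow> (\<exists>p q m. (\<exists>r. mem p q m (pr r ?x)) \<and> closed (memset p q m))"
    unfolding Der_fm_def Closed_fm_def[symmetric] sat_Ex_var
    by (simp add: sat_Ex_var sat_Mem sat_Closed_fm)
  also have "\<dots> \<longleftrightarrow> (\<exists>r p q m. closed (memset p q m) \<and> pr r ?x \<in> memset p q m)" by auto
  also have "\<dots> \<longleftrightarrow> DER ?x" unfolding DER_def DerH_def coded_def by blast
  finally show ?thesis .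
qed

lemma closed_Un: "closed X \<Longrightarrow> closed Y \<Longrightarrow> closed (X \<union> Y)"
  unfolding closed_def by blast

lemma closed_insert:
  assumes "closed X" "c \<in> set clauses" "\<And>b. b \<in> set (snd c) \<Longrightarrow> pr r (tval M \<nu> b) \<in> X"
  shows "closed (insert (pr (suc r) (tval M \<nu> (fst c))) X)"
  unfolding closed_def
proof
  fix n assume "n \<in> insert (pr (suc r) (tval M \<nu> (fst c))) X"
  then show "\<exists>c'\<in>set clauses. \<exists>r' \<nu>'. n = pr (suc r') (tval M \<nu>' (fst c')) \<and>
    (\<forall>b\<in>set (snd c'). pr r' (tval M \<nu>' b) \<in> insert (pr (suc r) (tval M \<nu> (fst c))) X)"
  proof
    assume "n = pr (suc r) (tval M \<nu> (fst c))"
    then show ?thesis using assms(2,3) by blast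
  next
    assume "n \<in> X"
    then show ?thesis using assms(1) unfolding closed_def by blast
  qed
qed

lemma DerH_clause:
  assumes "c \<in> set clauses" "\<And>b. b \<in> set (snd c) \<Longrightarrow> DerH r (tval M \<nu> b)"
  shows "DerH (suc r) (tval M \<nu> (fst c))"
proof -
  have "(\<forall>b\<in>set bs. DerH r (tval M \<nu> b)) \<Longrightarrow>
    \<exists>X. coded X \<and> closed X \<and> (\<forall>b\<in>set bs. pr r (tval M \<nu> b) \<in> X)" for bs
  proof (induction bs)
    case Nil show ?case by (intro exI[of _ "{}"]) (simp add: coded_empty closed_def)
  next
    case (Cons b bs)
    then obtain X Y where "coded X" "closed X" "\<forall>b\<in>set bs. pr r (tval M \<nu> b) \<in> X"
      "coded Y" "closed Y" "pr r (tval M \<nu> b) \<in> Y" unfolding DerH_def by auto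
    then show ?case by (intro exI[of _ "X \<union> Y"]) (auto intro: coded_Un closed_Un)
  qed
  from this[of "snd c"] obtain X where "coded X" "closed X"
    "\<forall>b\<in>set (snd c). pr r (tval M \<nu> b) \<in> X" using assms(2) by blast
  then show ?thesis unfolding DerH_def
    by (intro exI[of _ "insert (pr (suc r) (tval M \<nu> (fst c))) X"])
      (auto intro: coded_insert closed_insert assms(1))
qed

lemma DerH_cases:
  assumes "DerH r x"
  obtains r' c \<nu> where "r = suc r'" "c \<in> set clauses" "x = tval M \<nu> (fst c)"
    "\<And>b. b \<in> set (snd c) \<Longrightarrow> DerH r' (tval M \<nu> b)"
proof -
  obtain X where X: "coded X" "closed X" "pr r x \<in> X" using assms unfolding DerH_def by blast
  then obtain c r' \<nu> where "c \<in> set clauses" "pr r x = pr (suc r') (tval M \<nu> (fst c))"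
    "\<And>b. b \<in> set (snd c) \<Longrightarrow> pr r' (tval M \<nu> b) \<in> X" unfolding closed_def by blast
  then show ?thesis using that X unfolding DerH_def by (metis pr_inject)
qed

text \<open>All premises of a clause must be present at one common height. Derivations of different
  heights can be combined only because heights may be raised.\<close>

lemma DerH_suc: "DerH r x \<Longrightarrow> DerH (suc r) x"
proof -
  have "\<forall>x. DerH r x \<longrightarrow> DerH (suc r) x"
  proof (rule pa_induct[of "\<lambda>r. \<forall>x. DerH r x \<longrightarrow> DerH (suc r) x"])
    show "Df (\<lambda>\<nu>. \<forall>x. DerH (\<nu> 0) x \<longrightarrow> DerH (suc (\<nu> 0)) x)"
      by (intro Df_all Df_imp Df_DerH Tm_var Tm_suc)
    show "\<forall>x. DerH \<zero> x \<longrightarrow> DerH (suc \<zero>) x"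
      using DerH_cases[of \<zero>] by (metis arith_simps(2))
    fix r assume IH: "\<forall>x. DerH r x \<longrightarrow> DerH (suc r) x"
    show "\<forall>x. DerH (suc r) x \<longrightarrow> DerH (suc (suc r)) x"
    proof (intro allI impI)
      fix x assume "DerH (suc r) x"
      then obtain c \<nu> where "c \<in> set clauses" "x = tval M \<nu> (fst c)"
        "\<And>b. b \<in> set (snd c) \<Longrightarrow> DerH r (tval M \<nu> b)"
        using DerH_cases by (metis arith_simps(3))
      then show "DerH (suc (suc r)) x" using DerH_clause IH by blast
    qed
  qed
  then show "DerH r x \<Longrightarrow> DerH (suc r) x" by blast
qed

lemma DerH_mono: "DerH r x \<Longrightarrow> DerH (r \<oplus> k) x"
proof -
  have "DerH r x \<longrightarrow> DerH (r \<oplus> k) x"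
    by (rule pa_induct[of "\<lambda>k. DerH r x \<longrightarrow> DerH (r \<oplus> k) x"], intro Df_imp Df_DerH Df_intros)
      (auto intro: DerH_suc)
  then show "DerH r x \<Longrightarrow> DerH (r \<oplus> k) x" by blast
qed

theorem DER_clause:
  assumes "c \<in> set clauses" "\<And>b. b \<in> set (snd c) \<Longrightarrow> DER (tval M \<nu> b)"
  shows "DER (tval M \<nu> (fst c))"
proof -
  have "(\<forall>b\<in>set bs. DER (tval M \<nu> b)) \<Longrightarrow> \<exists>r. \<forall>b\<in>set bs. DerH r (tval M \<nu> b)" for bs
  proof (induction bs)
    case (Cons b bs)
    then obtain r r' where "\<forall>b\<in>set bs. DerH r (tval M \<nu> b)" "DerH r' (tval M \<nu> b)"
      unfolding DER_def by auto
    then have "\<forall>b\<in>set (b # bs). DerH (r \<oplus> r') (tval M \<nu> b)"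
      using DerH_mono[of r _ r'] DerH_mono[of r' _ r] by (auto simp: plus_comm)
    then show ?case by blast
  qed simp
  from this[of "snd c"] obtain r where "\<forall>b\<in>set (snd c). DerH r (tval M \<nu> b)" using assms(2) by blast
  then show ?thesis using DerH_clause[OF assms(1)] unfolding DER_def by blast
qed

theorem DER_cases:
  assumes "DER x"
  obtains c \<nu> where "c \<in> set clauses" "x = tval M \<nu> (fst c)" "\<And>b. b \<in> set (snd c) \<Longrightarrow> DER (tval M \<nu> b)"
  using assms DerH_cases unfolding DER_def by metis

end

section \<open>Codes of formulas in a model\<close>

declare tcode.simps [simp del] fcode.simps [simp del]

text \<open>The state of a free variable during successive instantiations: replaced by the term with
  the given code, or still a variable, under its current index.\<close>

datatype slot = Code nat | Free nat

definition sub_at :: "nat \<Rightarrow> trm \<Rightarrow> nat \<Rightarrow> nat \<Rightarrow> trm" where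
  "sub_at d t e i = (if i < d then Var i else if i = d then t else Var (i - 1 + e))"

lemma up_sub_at: "up (sub_at d t e) = sub_at (Suc d) (tlift t) e"
  by (rule ext) (auto simp: sub_at_def up_def split: nat.splits)

lemma sub_at_cases:
  "tsubst (sub_at 0 (Var 1) 2) = tlift" "fsubst (sub_at 0 (Var 1) 2) = flift"
  "fsubst (sub_at 0 (Succ (Var 0)) 1) = fsucc" "fsubst (sub_at 0 t 0) = finst t"
proof -
  have "sub_at 0 (Var 1) 2 = (\<lambda>i. Var (Suc i))" by (rule ext) (auto simp: sub_at_def)
  then show "tsubst (sub_at 0 (Var 1) 2) = tlift" "fsubst (sub_at 0 (Var 1) 2) = flift"
    by (auto simp: tlift_def flift_def)
  have "sub_at 0 (Succ (Var 0)) 1 = case_nat (Succ (Var 0)) (\<lambda>i. Var (Suc i))"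
    by (rule ext) (auto simp: sub_at_def split: nat.splits)
  then show "fsubst (sub_at 0 (Succ (Var 0)) 1) = fsucc" by (auto simp: fsucc_def)
  have "sub_at 0 t 0 = case_nat t Var"
    by (rule ext) (auto simp: sub_at_def split: nat.splits)
  then show "fsubst (sub_at 0 t 0) = finst t" by (auto simp: finst_def)
qed

lemma free_bound: "ffree A \<subseteq> {..<free_bound A}"
  unfolding free_bound_def by (rule LeastI_ex) (rule ffree_bounded)

lemma free_boundD: "i \<in> ffree A \<Longrightarrow> i < free_bound A"
  using free_bound by blast

context pa_model
begin

primrec num :: "nat \<Rightarrow> nat" where
  "num 0 = \<zero>"
| "num (Suc n) = suc (num n)"

lemma tval_numeral [simp]: "tval M \<nu> (numeral_trm n) = num n"
  by (induction n) auto

lemma num_plus: "num (m + n) = num m \<oplus> num n"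
  by (induction n) auto

lemma num_times: "num (m * n) = num m \<otimes> num n"
  by (induction n) (auto simp: num_plus plus_comm)

lemma num_pair: "num (pair m n) = pr (num m) (num n)"
  by (simp add: pair_def pr_def num_plus num_times)

lemma num_inject [simp]: "num m = num n \<longleftrightarrow> m = n"
proof (induction m arbitrary: n)
  case 0 then show ?case by (cases n) auto
next
  case (Suc m) then show ?case by (cases n) auto
qed

definition mk1 :: "nat \<Rightarrow> nat \<Rightarrow> nat" where "mk1 k a = pr (num k) a"
definition mk2 :: "nat \<Rightarrow> nat \<Rightarrow> nat \<Rightarrow> nat" where "mk2 k a b = pr (num k) (pr a b)"

lemma tval_tags [simp]:
  "tval M \<nu> (tag1 k t) = mk1 k (tval M \<nu> t)" "tval M \<nu> (tag2 k s t) = mk2 k (tval M \<nu> s) (tval M \<nu> t)"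
  by (auto simp: tag1_def tag2_def mk1_def mk2_def)

lemma mk_inject [simp]:
  "mk1 k a = mk1 k' b \<longleftrightarrow> k = k' \<and> a = b"
  "mk2 k a a' = mk2 k' b b' \<longleftrightarrow> k = k' \<and> a = b \<and> a' = b'"
  "mk1 k a = mk2 k' b b' \<longleftrightarrow> k = k' \<and> a = pr b b'"
  "mk2 k' b b' = mk1 k a \<longleftrightarrow> k = k' \<and> a = pr b b'"
  by (auto simp: mk1_def mk2_def)

lemma Tm_mk: "Tm f \<Longrightarrow> Tm (\<lambda>\<nu>. mk1 k (f \<nu>))" "Tm f \<Longrightarrow> Tm g \<Longrightarrow> Tm (\<lambda>\<nu>. mk2 k (f \<nu>) (g \<nu>))"
  unfolding mk1_def mk2_def by (intro Tm_pr Tm_const; assumption)+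

lemmas Df_rules = Df_DER Tm_mk Tm_pr Df_intros'

abbreviation NUMj where "NUMj n a \<equiv> DER (mk2 0 n a)"
abbreviation TRMj where "TRMj a \<equiv> DER (mk1 (Suc 0) a)"
abbreviation FMLj where "FMLj a \<equiv> DER (mk1 2 a)"
abbreviation SUBj where "SUBj d t e a b \<equiv> DER (mk2 3 (pr d (pr t e)) (pr a b))"
abbreviation PRVj where "PRVj a \<equiv> DER (mk1 4 a)"

abbreviation LIFTj where "LIFTj a b \<equiv> SUBj \<zero> (mk1 0 (suc \<zero>)) (num 2) a b"
abbreviation INSTj where "INSTj t a b \<equiv> SUBj \<zero> t \<zero> a b"
abbreviation SUCCj where "SUCCj a b \<equiv> SUBj \<zero> (mk1 2 (mk1 0 \<zero>)) (suc \<zero>) a b"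

lemma clause_rule:
  "c \<in> set clauses \<Longrightarrow> case c of (h, bs) \<Rightarrow> list_all (\<lambda>b. DER (tval M \<nu> b)) bs \<longrightarrow> DER (tval M \<nu> h)"
  using DER_clause[of c \<nu>] by (auto simp: list_all_iff split: prod.splits)

lemma syntax_rules_env:
  "\<forall>c\<in>set syntax_clauses. case c of (h, bs) \<Rightarrow>
    list_all (\<lambda>b. DER (tval M \<nu> b)) bs \<longrightarrow> DER (tval M \<nu> h)"
  by (intro ballI clause_rule) simp

lemma HA_rules_env:
  "\<forall>c\<in>set HA_clauses. case c of (h, bs) \<Rightarrow>
    list_all (\<lambda>b. DER (tval M \<nu> b)) bs \<longrightarrow> DER (tval M \<nu> h)"
  by (intro ballI clause_rule) simp

lemma syntax_rules:
  "NUMj \<zero> (mk1 (Suc 0) \<zero>)" "NUMj i a \<Longrightarrow> NUMj (suc i) (mk1 2 a)"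
  "TRMj (mk1 0 i)" "TRMj (mk1 (Suc 0) \<zero>)" "TRMj a \<Longrightarrow> TRMj (mk1 2 a)"
  "TRMj a \<Longrightarrow> TRMj b \<Longrightarrow> TRMj (mk2 3 a b)" "TRMj a \<Longrightarrow> TRMj b \<Longrightarrow> TRMj (mk2 4 a b)"
  "TRMj a \<Longrightarrow> TRMj b \<Longrightarrow> FMLj (mk2 5 a b)" "FMLj (mk1 6 \<zero>)"
  "FMLj a \<Longrightarrow> FMLj b \<Longrightarrow> FMLj (mk2 7 a b)" "FMLj a \<Longrightarrow> FMLj b \<Longrightarrow> FMLj (mk2 8 a b)"
  "FMLj a \<Longrightarrow> FMLj b \<Longrightarrow> FMLj (mk2 9 a b)" "FMLj a \<Longrightarrow> FMLj (mk1 10 a)" "FMLj a \<Longrightarrow> FMLj (mk1 11 a)"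
  using syntax_rules_env[of "(\<lambda>_. \<zero>)(0 := a, 1 := b, 7 := i)"]
  unfolding syntax_clauses_def Let_def by auto

lemma SUB_rules:
  "SUBj (suc (i \<oplus> d)) t e (mk1 0 i) (mk1 0 i)" "SUBj d t e (mk1 0 d) t"
  "SUBj d t e (mk1 0 (suc (d \<oplus> i))) (mk1 0 (d \<oplus> i \<oplus> e))"
  "SUBj d t e (mk1 (Suc 0) \<zero>) (mk1 (Suc 0) \<zero>)" "SUBj d t e (mk1 6 \<zero>) (mk1 6 \<zero>)"
  "SUBj d t e a b \<Longrightarrow> SUBj d t e (mk1 2 a) (mk1 2 b)"
  "k \<in> {3, 4, 5, 7, 8, 9} \<Longrightarrow> SUBj d t e a a' \<Longrightarrow> SUBj d t e b b' \<Longrightarrow>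
    SUBj d t e (mk2 k a b) (mk2 k a' b')"
  "k \<in> {10, 11} \<Longrightarrow> LIFTj t u \<Longrightarrow> SUBj (suc d) u e a b \<Longrightarrow> SUBj d t e (mk1 k a) (mk1 k b)"
  using syntax_rules_env[of
    "(\<lambda>_. \<zero>)(0 := a, 1 := b, 2 := a', 3 := b', 4 := d, 5 := t, 6 := e, 7 := i, 8 := u)"]
  unfolding syntax_clauses_def Let_def by auto

lemma HA_rules:
  "FMLj a \<Longrightarrow> FMLj b \<Longrightarrow> PRVj (mk2 9 a (mk2 9 b a))"
  "FMLj a \<Longrightarrow> FMLj b \<Longrightarrow> FMLj d \<Longrightarrow>
    PRVj (mk2 9 (mk2 9 a (mk2 9 b d)) (mk2 9 (mk2 9 a b) (mk2 9 a d)))"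
  "FMLj a \<Longrightarrow> FMLj b \<Longrightarrow> PRVj (mk2 9 (mk2 7 a b) a)"
  "FMLj a \<Longrightarrow> FMLj b \<Longrightarrow> PRVj (mk2 9 (mk2 7 a b) b)"
  "FMLj a \<Longrightarrow> FMLj b \<Longrightarrow> PRVj (mk2 9 a (mk2 9 b (mk2 7 a b)))"
  "FMLj a \<Longrightarrow> FMLj b \<Longrightarrow> PRVj (mk2 9 a (mk2 8 a b))"
  "FMLj a \<Longrightarrow> FMLj b \<Longrightarrow> PRVj (mk2 9 b (mk2 8 a b))"
  "FMLj a \<Longrightarrow> FMLj b \<Longrightarrow> FMLj d \<Longrightarrow>
    PRVj (mk2 9 (mk2 9 a d) (mk2 9 (mk2 9 b d) (mk2 9 (mk2 8 a b) d)))"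
  "FMLj a \<Longrightarrow> PRVj (mk2 9 (mk1 6 \<zero>) a)"
  "FMLj a \<Longrightarrow> TRMj t \<Longrightarrow> INSTj t a b \<Longrightarrow> PRVj (mk2 9 (mk1 10 a) b)"
  "FMLj a \<Longrightarrow> TRMj t \<Longrightarrow> INSTj t a b \<Longrightarrow> PRVj (mk2 9 b (mk1 11 a))"
  "TRMj t \<Longrightarrow> PRVj (mk2 5 t t)"
  "FMLj a \<Longrightarrow> TRMj s \<Longrightarrow> TRMj t \<Longrightarrow> INSTj s a b \<Longrightarrow> INSTj t a d \<Longrightarrow>
    PRVj (mk2 9 (mk2 5 s t) (mk2 9 b d))"
  "A \<in> set arith_axioms \<Longrightarrow> PRVj (num (fcode A))"
  "FMLj a \<Longrightarrow> INSTj (mk1 (Suc 0) \<zero>) a b \<Longrightarrow> SUCCj a d \<Longrightarrow>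
    PRVj (mk2 9 b (mk2 9 (mk1 10 (mk2 9 a d)) (mk1 10 a)))"
  "PRVj (mk2 9 a b) \<Longrightarrow> PRVj a \<Longrightarrow> PRVj b"
  "FMLj a \<Longrightarrow> LIFTj a u \<Longrightarrow> PRVj (mk2 9 u b) \<Longrightarrow> PRVj (mk2 9 a (mk1 10 b))"
  "FMLj b \<Longrightarrow> LIFTj b u \<Longrightarrow> PRVj (mk2 9 a u) \<Longrightarrow> PRVj (mk2 9 (mk1 11 a) b)"
  using HA_rules_env[of "(\<lambda>_. \<zero>)(0 := a, 1 := b, 2 := d, 3 := s, 4 := t, 5 := u)"]
  unfolding HA_clauses_def Let_def by (simp_all add: ball_Un)

text \<open>Every clause of HA has a head with tag 4, so a judgement of another kind can only stem
  from the syntax clauses.\<close>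

lemma DER_syntax_cases:
  assumes "DER x" "\<And>a. x \<noteq> mk1 4 a"
  shows "\<exists>c\<in>set syntax_clauses. \<exists>\<nu>. x = tval M \<nu> (fst c) \<and> list_all (\<lambda>b. DER (tval M \<nu> b)) (snd c)"
proof -
  obtain c \<nu> where c: "c \<in> set clauses" "x = tval M \<nu> (fst c)" "\<And>b. b \<in> set (snd c) \<Longrightarrow> DER (tval M \<nu> b)"
    using DER_cases[OF assms(1)] by blast
  have "\<forall>c\<in>set HA_clauses. \<exists>t. fst c = tag1 4 t"
    unfolding HA_clauses_def Let_def by (auto simp: ball_Un)
  then have "c \<notin> set HA_clauses" using c(2) assms(2) by fastforce
  then show ?thesis using c by (auto simp: list_all_iff)
qed

lemma NUM_cases:
  "NUMj \<zero> a \<Longrightarrow> a = mk1 (Suc 0) \<zero>"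
  "NUMj (suc n) a \<Longrightarrow> \<exists>b. a = mk1 2 b \<and> NUMj n b"
proof -
  assume "NUMj \<zero> a" from DER_syntax_cases[OF this] show "a = mk1 (Suc 0) \<zero>"
    unfolding syntax_clauses_def Let_def by (auto simp: bex_Un)
next
  assume "NUMj (suc n) a" from DER_syntax_cases[OF this] show "\<exists>b. a = mk1 2 b \<and> NUMj n b"
    unfolding syntax_clauses_def Let_def by (auto simp: bex_Un)
qed

lemma SUB_cases:
  "SUBj d t e (mk1 0 i) c \<Longrightarrow> (\<exists>j. d = suc (i \<oplus> j)) \<and> c = mk1 0 i \<or> i = d \<and> c = t \<or>
    (\<exists>j. i = suc (d \<oplus> j) \<and> c = mk1 0 (d \<oplus> j \<oplus> e))"
  "SUBj d t e (mk1 (Suc 0) \<zero>) c \<Longrightarrow> c = mk1 (Suc 0) \<zero>"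
  "SUBj d t e (mk1 6 \<zero>) c \<Longrightarrow> c = mk1 6 \<zero>"
  "SUBj d t e (mk1 2 a) c \<Longrightarrow> \<exists>b. c = mk1 2 b \<and> SUBj d t e a b"
  "k \<in> {3, 4, 5, 7, 8, 9} \<Longrightarrow> SUBj d t e (mk2 k a b) c \<Longrightarrow>
    \<exists>a' b'. c = mk2 k a' b' \<and> SUBj d t e a a' \<and> SUBj d t e b b'"
  "k \<in> {10, 11} \<Longrightarrow> SUBj d t e (mk1 k a) c \<Longrightarrow>
    \<exists>u b. c = mk1 k b \<and> LIFTj t u \<and> SUBj (suc d) u e a b"
proof -
  assume "SUBj d t e (mk1 0 i) c"
  from DER_syntax_cases[OF this] show "(\<exists>j. d = suc (i \<oplus> j)) \<and> c = mk1 0 i \<or> i = d \<and> c = t \<or>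
    (\<exists>j. i = suc (d \<oplus> j) \<and> c = mk1 0 (d \<oplus> j \<oplus> e))"
    unfolding syntax_clauses_def Let_def by (auto simp: bex_Un)
next
  assume "SUBj d t e (mk1 (Suc 0) \<zero>) c"
  from DER_syntax_cases[OF this] show "c = mk1 (Suc 0) \<zero>"
    unfolding syntax_clauses_def Let_def by (auto simp: bex_Un)
next
  assume "SUBj d t e (mk1 6 \<zero>) c"
  from DER_syntax_cases[OF this] show "c = mk1 6 \<zero>"
    unfolding syntax_clauses_def Let_def by (auto simp: bex_Un)
next
  assume "SUBj d t e (mk1 2 a) c"
  from DER_syntax_cases[OF this] show "\<exists>b. c = mk1 2 b \<and> SUBj d t e a b"
    unfolding syntax_clauses_def Let_def by (auto simp: bex_Un)
next
  assume "k \<in> {3, 4, 5, 7, 8, 9}" "SUBj d t e (mk2 k a b) c"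
  from DER_syntax_cases[OF this(2)] this(1)
  show "\<exists>a' b'. c = mk2 k a' b' \<and> SUBj d t e a a' \<and> SUBj d t e b b'"
    unfolding syntax_clauses_def Let_def by (auto simp: bex_Un)
next
  assume "k \<in> {10, 11}" "SUBj d t e (mk1 k a) c"
  from DER_syntax_cases[OF this(2)] this(1)
  show "\<exists>u b. c = mk1 k b \<and> LIFTj t u \<and> SUBj (suc d) u e a b"
    unfolding syntax_clauses_def Let_def by (auto simp: bex_Un)
qed

lemma SUB_iffs:
  "SUBj d t e (mk1 (Suc 0) \<zero>) c \<longleftrightarrow> c = mk1 (Suc 0) \<zero>"
  "SUBj d t e (mk1 6 \<zero>) c \<longleftrightarrow> c = mk1 6 \<zero>"
  "SUBj d t e (mk1 2 a) c \<longleftrightarrow> (\<exists>b. c = mk1 2 b \<and> SUBj d t e a b)"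
  "k \<in> {3, 4, 5, 7, 8, 9} \<Longrightarrow> SUBj d t e (mk2 k a b) c \<longleftrightarrow>
    (\<exists>a' b'. c = mk2 k a' b' \<and> SUBj d t e a a' \<and> SUBj d t e b b')"
  "k \<in> {10, 11} \<Longrightarrow> SUBj d t e (mk1 k a) c \<longleftrightarrow>
    (\<exists>u b. c = mk1 k b \<and> LIFTj t u \<and> SUBj (suc d) u e a b)"
proof -
  show "SUBj d t e (mk1 (Suc 0) \<zero>) c \<longleftrightarrow> c = mk1 (Suc 0) \<zero>" using SUB_cases(2) SUB_rules(4) by blast
  show "SUBj d t e (mk1 6 \<zero>) c \<longleftrightarrow> c = mk1 6 \<zero>" using SUB_cases(3) SUB_rules(5) by blast
  show "SUBj d t e (mk1 2 a) c \<longleftrightarrow> (\<exists>b. c = mk1 2 b \<and> SUBj d t e a b)"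
    using SUB_cases(4) SUB_rules(6) by blast
  show "k \<in> {3, 4, 5, 7, 8, 9} \<Longrightarrow> SUBj d t e (mk2 k a b) c \<longleftrightarrow>
    (\<exists>a' b'. c = mk2 k a' b' \<and> SUBj d t e a a' \<and> SUBj d t e b b')"
    using SUB_cases(5)[of k] SUB_rules(7)[of k] by blast
  show "k \<in> {10, 11} \<Longrightarrow> SUBj d t e (mk1 k a) c \<longleftrightarrow>
    (\<exists>u b. c = mk1 k b \<and> LIFTj t u \<and> SUBj (suc d) u e a b)"
    using SUB_cases(6)[of k] SUB_rules(8)[of k] by blast
qed

lemma NUM_exists: "\<exists>a. NUMj n a"
  by (rule pa_induct[of "\<lambda>n. \<exists>a. NUMj n a"], intro Df_rules) (auto intro: syntax_rules)

lemma NUM_unique: "NUMj n a \<Longrightarrow> NUMj n b \<Longrightarrow> a = b"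
proof -
  have "\<forall>a b. NUMj n a \<longrightarrow> NUMj n b \<longrightarrow> a = b"
    by (rule pa_induct[of "\<lambda>n. \<forall>a b. NUMj n a \<longrightarrow> NUMj n b \<longrightarrow> a = b"], intro Df_rules)
      (use NUM_cases in blast)+
  then show "NUMj n a \<Longrightarrow> NUMj n b \<Longrightarrow> a = b" by blast
qed

text \<open>For a nonstandard element this is the code of a numeral of nonstandard length, which no
  recursion from outside the model could produce.\<close>

definition numc :: "nat \<Rightarrow> nat" where "numc n = (THE a. NUMj n a)"

lemma NUM_iff: "NUMj n a \<longleftrightarrow> a = numc n"
  unfolding numc_def using NUM_exists[of n] NUM_unique[of n] by (metis the_equality)

lemma numc_zero [simp]: "numc \<zero> = mk1 (Suc 0) \<zero>"
  and numc_suc [simp]: "numc (suc n) = mk1 2 (numc n)"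
  using syntax_rules(1,2) NUM_iff by metis+

lemma TRM_numc: "TRMj (numc n)"
proof -
  have "\<forall>a. NUMj n a \<longrightarrow> TRMj a"
  proof (rule pa_induct[of "\<lambda>n. \<forall>a. NUMj n a \<longrightarrow> TRMj a"])
    show "\<forall>a. NUMj \<zero> a \<longrightarrow> TRMj a" using NUM_cases(1) syntax_rules(4) by metis
    fix n assume "\<forall>a. NUMj n a \<longrightarrow> TRMj a"
    then show "\<forall>a. NUMj (suc n) a \<longrightarrow> TRMj a" using NUM_cases(2) syntax_rules(5) by metis
  qed (intro Df_rules)
  then show ?thesis using NUM_iff by blast
qed

text \<open>Numerals contain no variables, so substitution leaves them alone. The induction runs
  inside the model because the numeral may be nonstandard.\<close>

lemma SUB_numc: "SUBj d t e (numc n) c \<longleftrightarrow> c = numc n"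
proof -
  have "\<forall>a. NUMj n a \<longrightarrow> (\<forall>c. SUBj d t e a c \<longleftrightarrow> c = a)"
  proof (rule pa_induct[of "\<lambda>n. \<forall>a. NUMj n a \<longrightarrow> (\<forall>c. SUBj d t e a c \<longleftrightarrow> c = a)"])
    show "\<forall>a. NUMj \<zero> a \<longrightarrow> (\<forall>c. SUBj d t e a c \<longleftrightarrow> c = a)"
      using NUM_cases(1) SUB_cases(2) SUB_rules(4) by blast
    fix n assume IH: "\<forall>a. NUMj n a \<longrightarrow> (\<forall>c. SUBj d t e a c \<longleftrightarrow> c = a)"
    show "\<forall>a. NUMj (suc n) a \<longrightarrow> (\<forall>c. SUBj d t e a c \<longleftrightarrow> c = a)"
      using NUM_cases(2)[of n] SUB_cases(4) SUB_rules(6) IH by metis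
  qed (intro Df_rules)
  then show ?thesis using NUM_iff by blast
qed

text \<open>The code in a model of a standard term below \<open>d\<close> binders, with slots in the
  place of its free variables. An inserted code is not lifted; this is right because only codes of
  numerals are ever inserted.\<close>

fun ctm :: "nat \<Rightarrow> (nat \<Rightarrow> slot) \<Rightarrow> trm \<Rightarrow> nat" where
  "ctm d \<sigma> (Var i) = (if i < d then mk1 0 (num i) else
    (case \<sigma> (i - d) of Code u \<Rightarrow> u | Free j \<Rightarrow> mk1 0 (num (d + j))))"
| "ctm d \<sigma> Zero = mk1 (Suc 0) \<zero>"
| "ctm d \<sigma> (Succ t) = mk1 2 (ctm d \<sigma> t)"
| "ctm d \<sigma> (Plus s t) = mk2 3 (ctm d \<sigma> s) (ctm d \<sigma> t)"
| "ctm d \<sigma> (Times s t) = mk2 4 (ctm d \<sigma> s) (ctm d \<sigma> t)"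

fun cfm :: "nat \<Rightarrow> (nat \<Rightarrow> slot) \<Rightarrow> fm \<Rightarrow> nat" where
  "cfm d \<sigma> (Eq s t) = mk2 5 (ctm d \<sigma> s) (ctm d \<sigma> t)"
| "cfm d \<sigma> Bot = mk1 6 \<zero>"
| "cfm d \<sigma> (And A B) = mk2 7 (cfm d \<sigma> A) (cfm d \<sigma> B)"
| "cfm d \<sigma> (Or A B) = mk2 8 (cfm d \<sigma> A) (cfm d \<sigma> B)"
| "cfm d \<sigma> (Imp A B) = mk2 9 (cfm d \<sigma> A) (cfm d \<sigma> B)"
| "cfm d \<sigma> (Forall A) = mk1 10 (cfm (Suc d) \<sigma> A)"
| "cfm d \<sigma> (Exists A) = mk1 11 (cfm (Suc d) \<sigma> A)"

lemma num_codes [simp]: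
  "num (tcode (Var i)) = mk1 0 (num i)" "num (tcode Zero) = mk1 (Suc 0) \<zero>"
  "num (tcode (Succ t)) = mk1 2 (num (tcode t))"
  "num (tcode (Plus s t)) = mk2 3 (num (tcode s)) (num (tcode t))"
  "num (tcode (Times s t)) = mk2 4 (num (tcode s)) (num (tcode t))"
  "num (fcode (Eq s t)) = mk2 5 (num (tcode s)) (num (tcode t))"
  "num (fcode Bot) = mk1 6 \<zero>"
  "num (fcode (And A B)) = mk2 7 (num (fcode A)) (num (fcode B))"
  "num (fcode (Or A B)) = mk2 8 (num (fcode A)) (num (fcode B))"
  "num (fcode (Imp A B)) = mk2 9 (num (fcode A)) (num (fcode B))"
  "num (fcode (Forall A)) = mk1 10 (num (fcode A))"
  "num (fcode (Exists A)) = mk1 11 (num (fcode A))"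
  by (simp_all add: tcode.simps fcode.simps num_pair mk1_def mk2_def)

lemma num_code: "num (tcode t) = ctm d Free t" "num (fcode A) = cfm d Free A"
proof -
  show "num (tcode t) = ctm d Free t" for d t by (induction t) auto
  then show "num (fcode A) = cfm d Free A" by (induction A arbitrary: d) auto
qed

definition numeral_slots :: "(nat \<Rightarrow> slot) \<Rightarrow> bool" where
  "numeral_slots \<sigma> \<longleftrightarrow> (\<forall>i u. \<sigma> i = Code u \<longrightarrow> (\<exists>n. u = numc n))"

text \<open>The effect of one instantiation of variable 0: slots already filled stay, and the
  remaining variables move down by one.\<close>

definition inst_slots :: "nat \<Rightarrow> (nat \<Rightarrow> slot) \<Rightarrow> nat \<Rightarrow> slot" where
  "inst_slots n \<sigma> i = (case \<sigma> i of Code u \<Rightarrow> Code u | Free j \<Rightarrow> (case j of 0 \<Rightarrow> Code (numc n) | Suc j \<Rightarrow> Free j))"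

lemma numeral_slots_inst: "numeral_slots \<sigma> \<Longrightarrow> numeral_slots (inst_slots n \<sigma>)"
  unfolding numeral_slots_def inst_slots_def by (auto split: slot.splits nat.splits)

lemma num_less: "i < d \<longleftrightarrow> (\<exists>j. num d = suc (num i \<oplus> j))"
proof
  assume "i < d"
  then obtain k where "d = Suc (i + k)" using less_imp_Suc_add by blast
  then have "num d = suc (num i \<oplus> num k)" by (simp add: num_plus)
  then show "\<exists>j. num d = suc (num i \<oplus> j)" by blast
next
  assume "\<exists>j. num d = suc (num i \<oplus> j)"
  then obtain j where j: "num d = suc (num i \<oplus> j)" by blast
  show "i < d"
  proof (rule ccontr)
    assume "\<not> i < d"
    then obtain k where "i = d + k" using le_Suc_ex not_less by blast
    then have "num d = num d \<oplus> suc (num k \<oplus> j)" using j by (simp add: num_plus plus_assoc)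
    then show False unfolding plus_eq_self by simp
  qed
qed

lemma SUB_var: "SUBj (num d) t (num e) (mk1 0 (num i)) c \<longleftrightarrow>
  c = (if i < d then mk1 0 (num i) else if i = d then t else mk1 0 (num (i - 1 + e)))"
proof -
  consider "i < d" | "i = d" | k where "i = Suc (d + k)" "d < i"
    using less_imp_Suc_add by (metis nat_neq_iff)
  then show ?thesis
  proof cases
    case 1
    then obtain j where j: "num d = suc (num i \<oplus> j)" using num_less by blast
    have no: "\<not> (\<exists>j. num i = suc (num d \<oplus> j))" using num_less[of d i] 1 by auto
    show ?thesis using SUB_cases(1)[of "num d" t "num e" "num i" c] SUB_rules(1)[of "num i" j] 1 no
      by (auto simp: j[symmetric])
  next
    case 2
    have no: "num d \<noteq> suc (num d \<oplus> j)" for j using num_less[of d d] by blast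
    show ?thesis using SUB_cases(1)[of "num d" t "num e" "num i" c] SUB_rules(2)[of "num d" t] 2 no
      by auto
  next
    case 3
    have i: "num i = suc (num d \<oplus> num k)" using 3 by (simp add: num_plus)
    have no: "\<not> (\<exists>j. num d = suc (num i \<oplus> j))" using num_less[of i d] 3 by auto
    have no': "suc (num d \<oplus> num k) \<noteq> num d" using num_less[of d d] by (metis less_irrefl)
    have "num (i - 1 + e) = num d \<oplus> num k \<oplus> num e" using 3 by (simp add: num_plus)
    then show ?thesis
      using SUB_cases(1)[of "num d" t "num e" "num i" c] SUB_rules(3)[of "num d" t "num e" "num k"] 3 no no' i
      by (auto simp del: arith_simps(5))
  qed
qed

lemma SUB_ctm:
  assumes "numeral_slots \<sigma>"
  shows "SUBj (num d) (numc n) \<zero> (ctm d \<sigma> t) c \<longleftrightarrow> c = ctm d (inst_slots n \<sigma>) t"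
proof (induction t arbitrary: c)
  case (Var i)
  show ?case
  proof (cases "i < d")
    case True
    then show ?thesis using SUB_var[of d "numc n" 0 i c] by simp
  next
    case False
    show ?thesis
    proof (cases "\<sigma> (i - d)")
      case (Code u)
      then obtain m where "u = numc m" using assms unfolding numeral_slots_def by blast
      then show ?thesis using Code False by (simp add: SUB_numc inst_slots_def)
    next
      case (Free j)
      then show ?thesis using SUB_var[of d "numc n" 0 "d + j" c] False
        by (auto simp: inst_slots_def split: nat.splits)
    qed
  qed
next
  case Zero then show ?case by (simp add: SUB_iffs)
next
  case (Succ t) then show ?case by (auto simp: SUB_iffs)
next
  case (Plus s t) then show ?case by (auto simp: SUB_iffs)
next
  case (Times s t) then show ?case by (auto simp: SUB_iffs)
qed

text \<open>The formula is standard although the numerals in it may not be, so induction from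
  outside suffices. Under a binder the inserted numeral is lifted to itself.\<close>

lemma SUB_cfm:
  assumes "numeral_slots \<sigma>"
  shows "SUBj (num d) (numc n) \<zero> (cfm d \<sigma> A) c \<longleftrightarrow> c = cfm d (inst_slots n \<sigma>) A"
proof (induction A arbitrary: d c)
  case (Eq s t) then show ?case by (auto simp: SUB_iffs SUB_ctm[OF assms])
next
  case Bot then show ?case by (simp add: SUB_iffs)
next
  case (And A B) then show ?case by (auto simp: SUB_iffs)
next
  case (Or A B) then show ?case by (auto simp: SUB_iffs)
next
  case (Imp A B) then show ?case by (auto simp: SUB_iffs)
next
  case (Forall A)
  then show ?case using Forall[of "Suc d"] by (auto simp: SUB_iffs SUB_numc)
next
  case (Exists A)
  then show ?case using Exists[of "Suc d"] by (auto simp: SUB_iffs SUB_numc)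
qed

lemma FML_cfm:
  assumes "numeral_slots \<sigma>" shows "TRMj (ctm d \<sigma> t)" "FMLj (cfm d \<sigma> A)"
proof -
  show "TRMj (ctm d \<sigma> t)" for d t
  proof (induction t)
    case (Var i)
    show ?case
    proof (cases "\<sigma> (i - d)")
      case (Code u)
      then obtain m where "u = numc m" using assms unfolding numeral_slots_def by blast
      then show ?thesis using Code by (auto simp: TRM_numc syntax_rules)
    qed (auto simp: syntax_rules)
  qed (auto intro: syntax_rules)
  then show "FMLj (cfm d \<sigma> A)" by (induction A arbitrary: d) (auto intro: syntax_rules)
qed

section \<open>Standard expressions and standard proofs\<close>

lemma SUB_standard_trm:
  "SUBj (num d) (num (tcode u)) (num e) (num (tcode t)) (num (tcode (tsubst (sub_at d u e) t)))"
proof (induction t)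
  case (Var i)
  then show ?case
    using SUB_var[of d "num (tcode u)" e i] by (auto simp: sub_at_def)
next
  case Zero
  then show ?case using SUB_iffs(1) by simp
next
  case (Succ t)
  then show ?case using SUB_rules(6) by simp
next
  case (Plus s t)
  then show ?case using SUB_rules(7)[of 3] by simp
next
  case (Times s t)
  then show ?case using SUB_rules(7)[of 4] by simp
qed

lemma LIFT_standard_trm: "LIFTj (num (tcode t)) (num (tcode (tlift t)))"
  using SUB_standard_trm[of 0 "Var 1" 2 t]
  by (simp add: sub_at_cases[simplified] )

lemma SUB_standard:
  "SUBj (num d) (num (tcode u)) (num e) (num (fcode A)) (num (fcode (fsubst (sub_at d u e) A)))"
proof (induction A arbitrary: d u)
  case (Eq s t)
  then show ?case using SUB_rules(7)[of 5] SUB_standard_trm by simp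
next
  case Bot
  then show ?case using SUB_iffs(2) by simp
next
  case (And A B)
  then show ?case using SUB_rules(7)[of 7] by simp
next
  case (Or A B)
  then show ?case using SUB_rules(7)[of 8] by simp
next
  case (Imp A B)
  then show ?case using SUB_rules(7)[of 9] by simp
next
  case (Forall A)
  from Forall[of "Suc d" "tlift u"] LIFT_standard_trm[of u] show ?case
    using SUB_rules(8)[of 10] by (simp add: up_sub_at)
next
  case (Exists A)
  from Exists[of "Suc d" "tlift u"] LIFT_standard_trm[of u] show ?case
    using SUB_rules(8)[of 11] by (simp add: up_sub_at)
qed

lemma standard_subs:
  "LIFTj (num (fcode A)) (num (fcode (flift A)))" "SUCCj (num (fcode A)) (num (fcode (fsucc A)))"
  "INSTj (num (tcode t)) (num (fcode A)) (num (fcode (finst t A)))"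
  using SUB_standard[of 0 "Var 1" 2 A] SUB_standard[of 0 "Succ (Var 0)" 1 A] SUB_standard[of 0 t 0 A]
  by (simp_all add: sub_at_cases[simplified] )

lemma standard_syntax: "TRMj (num (tcode t))" "FMLj (num (fcode A))"
  using FML_cfm[of Free] by (simp_all add: num_code[where d = 0] numeral_slots_def)

lemma PRV_HA: "HA A \<Longrightarrow> PRVj (num (fcode A))"
proof (induction rule: HA.induct)
  case (HA_arith A) then show ?case by (rule HA_rules(14))
next
  case (HA_ind A)
  show ?case using HA_rules(15)[OF standard_syntax(2)] standard_subs(2) standard_subs(3)[of Zero]
    by simp
next
  case (HA_allE A t)
  show ?case using HA_rules(10)[OF standard_syntax(2,1) standard_subs(3)]
    by simp
next
  case (HA_exI t A)
  show ?case using HA_rules(11)[OF standard_syntax(2,1) standard_subs(3)]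
    by simp
next
  case (HA_eq_subst s t A)
  show ?case using HA_rules(13)[OF standard_syntax(2,1,1) standard_subs(3,3)]
    by simp
next
  case (HA_mp A B)
  then show ?case using HA_rules(16) by simp
next
  case (HA_allI A B)
  then show ?case using HA_rules(17)[OF standard_syntax(2) standard_subs(1)]
    by simp
next
  case (HA_exE A B)
  then show ?case using HA_rules(18)[OF standard_syntax(2) standard_subs(1)]
    by simp
qed (simp_all add: HA_rules standard_syntax)

lemma PRV_inst:
  assumes "numeral_slots \<sigma>" "PRVj (cfm 0 \<sigma> A)"
  shows "PRVj (cfm 0 (inst_slots n \<sigma>) A)"
proof -
  \<comment> \<open>The generalization rule acts on the consequent of an implication. The theorem
    therefore receives the antecedent \<open>Verum\<close>, whose code is \<open>?V\<close> and
    which lifting does not change.\<close>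
  let ?a = "cfm 0 \<sigma> A" and ?V = "mk2 9 (mk1 6 \<zero>) (mk1 6 \<zero>)"
  have V: "FMLj ?V" "LIFTj ?V ?V" by (auto simp: syntax_rules SUB_iffs)
  have PV: "PRVj ?V" by (rule HA_rules(9)) (rule syntax_rules)
  have fa: "FMLj ?a" by (rule FML_cfm[OF assms(1)])
  have "PRVj (mk2 9 ?V ?a)" using HA_rules(16)[OF HA_rules(1)[OF fa V(1)] assms(2)] .
  then have "PRVj (mk2 9 ?V (mk1 10 ?a))" by (rule HA_rules(17)[OF V])
  then have all: "PRVj (mk1 10 ?a)" by (rule HA_rules(16)) (rule PV)
  have "INSTj (numc n) ?a (cfm 0 (inst_slots n \<sigma>) A)"
    using SUB_cfm[OF assms(1), of 0 n A] by simp
  then show ?thesis using HA_rules(16)[OF HA_rules(10)[OF fa TRM_numc] all] by blast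
qed

lemma cfm_cong:
  "(\<And>i. i \<in> tfree t \<Longrightarrow> d \<le> i \<Longrightarrow> \<sigma> (i - d) = \<tau> (i - d)) \<Longrightarrow> ctm d \<sigma> t = ctm d \<tau> t"
  "(\<And>i. i \<in> ffree A \<Longrightarrow> d \<le> i \<Longrightarrow> \<sigma> (i - d) = \<tau> (i - d)) \<Longrightarrow> cfm d \<sigma> A = cfm d \<tau> A"
proof -
  show tm: "ctm d \<sigma> t = ctm d \<tau> t" if "\<And>i. i \<in> tfree t \<Longrightarrow> d \<le> i \<Longrightarrow> \<sigma> (i - d) = \<tau> (i - d)" for d t
    using that by (induction t) auto
  show "(\<And>i. i \<in> ffree A \<Longrightarrow> d \<le> i \<Longrightarrow> \<sigma> (i - d) = \<tau> (i - d)) \<Longrightarrow> cfm d \<sigma> A = cfm d \<tau> A"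
  proof (induction A arbitrary: d)
    case (Eq s t) then show ?case using tm[of s d] tm[of t d] by auto
  next
    case (Forall A)
    have "cfm (Suc d) \<sigma> A = cfm (Suc d) \<tau> A"
    proof (rule Forall.IH)
      fix i assume "i \<in> ffree A" "Suc d \<le> i"
      then show "\<sigma> (i - Suc d) = \<tau> (i - Suc d)" using Forall.prems[of "i - 1"] by auto
    qed
    then show ?case by simp
  next
    case (Exists A)
    have "cfm (Suc d) \<sigma> A = cfm (Suc d) \<tau> A"
    proof (rule Exists.IH)
      fix i assume "i \<in> ffree A" "Suc d \<le> i"
      then show "\<sigma> (i - Suc d) = \<tau> (i - Suc d)" using Exists.prems[of "i - 1"] by auto
    qed
    then show ?case by simp
  qed auto
qed

text \<open>The code of the sentence that arises from \<open>A\<close> when each variable \<open>i\<close> is replaced by the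
  numeral of \<open>\<nu> i\<close>.\<close>

definition cinst :: "(nat \<Rightarrow> nat) \<Rightarrow> fm \<Rightarrow> nat" where
  "cinst \<nu> A = cfm 0 (\<lambda>i. Code (numc (\<nu> i))) A"

definition PR :: "(nat \<Rightarrow> nat) \<Rightarrow> fm \<Rightarrow> bool" where "PR \<nu> A \<longleftrightarrow> PRVj (cinst \<nu> A)"

lemma fold_inst_slots:
  "fold inst_slots ws Free = (\<lambda>i. if i < length ws then Code (numc (ws ! i)) else Free (i - length ws))"
proof (induction ws rule: rev_induct)
  case (snoc w ws)
  show ?case
    by (rule ext) (simp add: snoc, auto simp: inst_slots_def nth_append split: nat.splits)
qed simp

lemma numeral_slots_fold: "numeral_slots (fold inst_slots ws Free)"
  unfolding fold_inst_slots numeral_slots_def by auto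

lemma cfm_fold:
  assumes "\<And>i. i \<in> ffree A \<Longrightarrow> i < length ws \<and> ws ! i = \<nu> i"
  shows "cfm 0 (fold inst_slots ws Free) A = cinst \<nu> A"
  unfolding cinst_def by (rule cfm_cong(2)) (use assms in \<open>auto simp: fold_inst_slots\<close>)

lemma sat_Prov_inst:
  assumes "tval M \<nu> a = cfm 0 \<sigma> A" "numeral_slots \<sigma>"
  shows "sat M \<nu> (Prov_inst ts a) \<longleftrightarrow> PRVj (cfm 0 (fold inst_slots (map (tval M \<nu>) ts) \<sigma>) A)"
  using assms
proof (induction "length ts" arbitrary: ts \<nu> a \<sigma>)
  case 0 then show ?case by (simp add: Prov_def sat_Der)
next
  case (Suc k)
  then obtain t ts' where ts: "ts = t # ts'" by (cases ts) auto
  let ?n = "tval M \<nu> t"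
  let ?\<nu> = "case_nat (cfm 0 (inst_slots ?n \<sigma>) A) (case_nat (numc ?n) \<nu>)"
  let ?ts = "map (\<lambda>s. tlift (tlift s)) ts'"
  \<comment> \<open>Numeral coding and instantiation are functional on these codes, so both
    existential quantifiers have a single possible witness, recorded in the extended
    environment.\<close>
  have "sat M \<nu> (Prov_inst ts a) \<longleftrightarrow> sat M ?\<nu> (Prov_inst ?ts (Var 0))"
    using SUB_cfm[OF Suc.prems(2), of 0 ?n A]
    by (simp add: ts sat_Der NUM_iff Suc.prems(1))
  also have "\<dots> \<longleftrightarrow> PRVj (cfm 0 (fold inst_slots (map (tval M ?\<nu>) ?ts) (inst_slots ?n \<sigma>)) A)"
    by (rule Suc.hyps(1)) (use Suc.hyps(2) Suc.prems numeral_slots_inst ts in auto)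
  also have "map (tval M ?\<nu>) ?ts = map (tval M \<nu>) ts'" by simp
  finally show ?case by (simp add: ts)
qed

theorem sat_Box: "sat M \<nu> (Box A) \<longleftrightarrow> PR \<nu> A"
proof -
  let ?ts = "map (\<lambda>i. if i \<in> ffree A then Var i else Zero) [0..<free_bound A]"
  have "sat M \<nu> (Box A) \<longleftrightarrow> PRVj (cfm 0 (fold inst_slots (map (tval M \<nu>) ?ts) Free) A)"
    unfolding Box_def
    by (rule sat_Prov_inst) (auto simp: num_code(2)[where d = 0] numeral_slots_def)
  moreover have "cfm 0 (fold inst_slots (map (tval M \<nu>) ?ts) Free) A = cinst \<nu> A"
    by (rule cfm_fold) (simp add: free_boundD)
  ultimately show ?thesis by (simp add: PR_def)
qed

text \<open>The standard proof is available in every model; possibly nonstandard numerals are then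
  inserted for the variables one at a time.\<close>

theorem PR_HA: assumes "HA A" shows "PR \<nu> A"
proof -
  have "PRVj (cfm 0 (fold inst_slots ws Free) A)" for ws
  proof (induction ws rule: rev_induct)
    case Nil then show ?case using PRV_HA[OF assms] by (simp add: num_code[where d = 0])
  next
    case (snoc w ws)
    then show ?case using PRV_inst[OF numeral_slots_fold] by simp
  qed
  from this[of "map \<nu> [0..<free_bound A]"] show ?thesis
    unfolding PR_def by (subst (asm) cfm_fold[of A _ \<nu>]) (auto dest: free_boundD)
qed

theorem PR_mp: "PR \<nu> (Imp A B) \<Longrightarrow> PR \<nu> A \<Longrightarrow> PR \<nu> B"
  unfolding PR_def cinst_def using HA_rules(16) by simp

lemma PR_mono: "HA (Imp A B) \<Longrightarrow> PR \<nu> A \<Longrightarrow> PR \<nu> B"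
  using PR_HA PR_mp by blast

lemma PR_And: "PR \<nu> (And A B) \<longleftrightarrow> PR \<nu> A \<and> PR \<nu> B"
  using PR_mono[OF HA_andE1] PR_mono[OF HA_andE2] PR_mono[OF HA_andI] PR_mp by blast

lemma PR_Iff: "HA (Iff A B) \<Longrightarrow> PR \<nu> A \<longleftrightarrow> PR \<nu> B"
  using PR_mono HA_andE1 HA_andE2 HA_mp by blast

text \<open>The hypothesis asks for equality of codes, not for provable equality. It covers
  variables, zero, numerals and successors of variables, but not sums or products.\<close>

lemma cinst_fsubst:
  assumes "\<And>i. i \<in> ffree A \<Longrightarrow> ctm 0 (\<lambda>i. Code (numc (\<nu> i))) (\<sigma> i) = numc (\<nu>' i)"
  shows "cinst \<nu> (fsubst \<sigma> A) = cinst \<nu>' A"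
proof -
  let ?c = "\<lambda>\<nu> i. Code (numc (\<nu> i))"
  have pow: "(tlift ^^ d) (Var i) = Var (i + d)" "(tlift ^^ d) Zero = Zero"
    "(tlift ^^ d) (Succ t) = Succ ((tlift ^^ d) t)"
    "(tlift ^^ d) (Plus s t) = Plus ((tlift ^^ d) s) ((tlift ^^ d) t)"
    "(tlift ^^ d) (Times s t) = Times ((tlift ^^ d) s) ((tlift ^^ d) t)" for d i s t
    by (induction d) auto
  have lift: "ctm d (?c \<nu>) ((tlift ^^ d) t) = ctm 0 (?c \<nu>) t" for d t
    by (induction t) (auto simp: pow)
  \<comment> \<open>The invariant below \<open>d\<close> binders: \<open>\<tau>\<close> fixes the
    bound indices and maps the others to terms lifted \<open>d\<close> times whose uninstantiated
    originals code the required numerals.\<close>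
  let ?ok = "\<lambda>d \<tau> i. (i < d \<longrightarrow> \<tau> i = Var i) \<and>
    (d \<le> i \<longrightarrow> (\<exists>t. \<tau> i = (tlift ^^ d) t \<and> ctm 0 (?c \<nu>) t = numc (\<nu>' (i - d))))"
  have tm: "ctm d (?c \<nu>) (tsubst \<tau> t) = ctm d (?c \<nu>') t" if "\<And>i. i \<in> tfree t \<Longrightarrow> ?ok d \<tau> i" for d \<tau> t
    using that
  proof (induction t)
    case (Var i) then show ?case using lift by (cases "i < d") auto
  qed auto
  have up_ok: "?ok (Suc d) (up \<tau>) i" if "\<And>j. i = Suc j \<Longrightarrow> ?ok d \<tau> j" for d \<tau> i
    using that by (cases i) auto
  have fm: "cfm d (?c \<nu>) (fsubst \<tau> A) = cfm d (?c \<nu>') A" if "\<And>i. i \<in> ffree A \<Longrightarrow> ?ok d \<tau> i" for d \<tau>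
    using that
  proof (induction A arbitrary: d \<tau>)
    case (Eq s t) then show ?case using tm[of s d \<tau>] tm[of t d \<tau>] by auto
  next
    case (Forall A)
    have "cfm (Suc d) (?c \<nu>) (fsubst (up \<tau>) A) = cfm (Suc d) (?c \<nu>') A"
      by (rule Forall.IH, rule up_ok) (use Forall.prems in auto)
    then show ?case by simp
  next
    case (Exists A)
    have "cfm (Suc d) (?c \<nu>) (fsubst (up \<tau>) A) = cfm (Suc d) (?c \<nu>') A"
      by (rule Exists.IH, rule up_ok) (use Exists.prems in auto)
    then show ?case by simp
  next
    case (And A B)
    show ?case using And.IH(1)[of d \<tau>] And.IH(2)[of d \<tau>] And.prems by simp
  next
    case (Or A B)
    show ?case using Or.IH(1)[of d \<tau>] Or.IH(2)[of d \<tau>] Or.prems by simp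
  next
    case (Imp A B)
    show ?case using Imp.IH(1)[of d \<tau>] Imp.IH(2)[of d \<tau>] Imp.prems by simp
  qed simp
  show ?thesis unfolding cinst_def by (rule fm) (use assms in auto)
qed

end

section \<open>Provable completeness for existential formulas\<close>

lemma HA_neq_Plus: "HA (Imp (And (Eq (Plus (Var 0) (Succ (Var 1))) (Var 2)) (Eq (Var 0) (Var 2))) Bot)"
proof (rule sigma_transfer)
  fix M \<nu> assume "pa_model M" 
  then interpret pa_model M .
  assume "sat M \<nu> (And (Eq (Plus (Var 0) (Succ (Var 1))) (Var 2)) (Eq (Var 0) (Var 2)))"
  from this[unfolded sat.simps tval.simps]
  have "ip_plus M (\<nu> 0) (ip_succ M (\<nu> 1)) = \<nu> 0" by metis
  then show "sat M \<nu> Bot" unfolding plus_eq_self by simp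
qed (intro sigma_delta0 delta0.intros)+

lemma entails_And_assm: "And A B \<in> G \<Longrightarrow> G \<turnstile> A" "And A B \<in> G \<Longrightarrow> G \<turnstile> B"
  using entails_assm[of "And A B" G] unfolding entails_And by auto

lemma entails_insert_And' [simp]:
  "insert X (insert (And A B) G) \<turnstile> D \<longleftrightarrow> insert X (insert A (insert B G)) \<turnstile> D"
  using entails_insert_And[of A B "insert X G" D] by (simp only: insert_commute)

context pa_model
begin

section \<open>Provable evaluation of terms\<close>

lemma Df_PR: "(\<And>i. Tm (f i)) \<Longrightarrow> Df (\<lambda>\<nu>. PR (\<lambda>i. f i \<nu>) A)"
  unfolding sat_Box[symmetric] by (rule Df_sat)

lemma cinst_rename: "cinst \<nu> (fsubst (\<lambda>i. Var (f i)) A) = cinst (\<lambda>i. \<nu> (f i)) A"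
  by (rule cinst_fsubst) simp

lemma PR_rename: "PR \<nu> (fsubst (\<lambda>i. Var (f i)) A) \<longleftrightarrow> PR (\<lambda>i. \<nu> (f i)) A"
  by (simp add: PR_def cinst_rename)

lemma PR_flift [simp]: "PR (case_nat x \<nu>) (flift A) \<longleftrightarrow> PR \<nu> A"
  using PR_rename[of "case_nat x \<nu>" Suc A] by (simp add: flift_def)

lemma PR_finst_zero: "PR \<nu> (finst Zero A) \<longleftrightarrow> PR (case_nat \<zero> \<nu>) A"
  unfolding PR_def finst_def
  by (subst cinst_fsubst[where \<nu>' = "case_nat \<zero> \<nu>"]) (auto split: nat.splits)

lemma PR_fsucc: "PR (case_nat x \<nu>) (fsucc A) \<longleftrightarrow> PR (case_nat (suc x) \<nu>) A"
  unfolding PR_def fsucc_def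
  by (subst cinst_fsubst[where \<nu>' = "case_nat (suc x) \<nu>"]) (auto split: nat.splits)

lemma PR_entails:
  assumes "{A} \<turnstile> B" "PR \<nu> A" shows "PR \<nu> B"
  using PR_mono assms HA_Imp_iff by blast

text \<open>The recursion equations for addition are applied once per step of an induction on the
  second summand, carried out inside the model since both summands may be nonstandard.\<close>

lemma PR_Plus:
  assumes "\<nu> k = \<nu> i \<oplus> \<nu> j" shows "PR \<nu> (Eq (Plus (Var i) (Var j)) (Var k))"
proof -
  let ?A = "Eq (Plus (Var 0) (Var 1)) (Var 2)"
  let ?e = "\<lambda>x y w. case_nat x (\<lambda>i. case_nat y (\<lambda>i. w) i)"
  have "PR (\<lambda>i. ?e x y (x \<oplus> y) i) ?A" for x y
  proof (rule pa_induct[of "\<lambda>y. PR (\<lambda>i. ?e x y (x \<oplus> y) i) ?A"])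
    show "Df (\<lambda>\<nu>. PR (\<lambda>i. ?e x (\<nu> 0) (x \<oplus> \<nu> 0) i) ?A)"
      by (intro Df_PR Df_rules)
    have "PR (\<lambda>_. x) (Eq (Plus (Var 0) Zero) (Var 0))" by (rule PR_HA) (rule HA_axiom_instances)
    then show "PR (\<lambda>i. ?e x \<zero> (x \<oplus> \<zero>) i) ?A" by (simp add: PR_def cinst_def eval_nat_numeral)
    fix y assume IH: "PR (\<lambda>i. ?e x y (x \<oplus> y) i) ?A"
    have "{?A} \<turnstile> Eq (Plus (Var 0) (Succ (Var 1))) (Succ (Var 2))"
      by (rule entails_eq_trans[OF entails_Plus_Succ entails_eq_Succ]) simp
    from PR_entails[OF this IH] show "PR (\<lambda>i. ?e x (suc y) (x \<oplus> suc y) i) ?A"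
      by (simp add: PR_def cinst_def eval_nat_numeral)
  qed
  from this[of "\<nu> i" "\<nu> j"] show ?thesis using assms
    by (simp add: PR_def cinst_def eval_nat_numeral)
qed

lemma PR_Times:
  assumes "\<nu> k = \<nu> i \<otimes> \<nu> j" shows "PR \<nu> (Eq (Times (Var i) (Var j)) (Var k))"
proof -
  let ?A = "Eq (Times (Var 0) (Var 1)) (Var 2)"
  let ?e = "\<lambda>x y w. case_nat x (\<lambda>i. case_nat y (\<lambda>i. w) i)"
  have "PR (\<lambda>i. ?e x y (x \<otimes> y) i) ?A" for x y
  proof (rule pa_induct[of "\<lambda>y. PR (\<lambda>i. ?e x y (x \<otimes> y) i) ?A"])
    show "Df (\<lambda>\<nu>. PR (\<lambda>i. ?e x (\<nu> 0) (x \<otimes> \<nu> 0) i) ?A)"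
      by (intro Df_PR Df_rules)
    have "PR (\<lambda>_. x) (Eq (Times (Var 0) Zero) Zero)" by (rule PR_HA) (rule HA_axiom_instances)
    then show "PR (\<lambda>i. ?e x \<zero> (x \<otimes> \<zero>) i) ?A" by (simp add: PR_def cinst_def eval_nat_numeral)
    fix y assume IH: "PR (\<lambda>i. ?e x y (x \<otimes> y) i) ?A"
    let ?\<nu> = "case_nat x (case_nat y (case_nat (x \<otimes> y) (\<lambda>_. x \<otimes> y \<oplus> x)))"
    have 1: "PR ?\<nu> ?A" using IH by (simp add: PR_def cinst_def eval_nat_numeral)
    have 2: "PR ?\<nu> (Eq (Plus (Var 2) (Var 0)) (Var 3))" by (rule PR_Plus) (simp add: eval_nat_numeral)
    let ?G = "{And ?A (Eq (Plus (Var 2) (Var 0)) (Var 3))}"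
    have "?G \<turnstile> Eq (Times (Var 0) (Succ (Var 1))) (Plus (Times (Var 0) (Var 1)) (Var 0))"
      by (rule entails_HA) (rule HA_axiom_instances)
    moreover have "?G \<turnstile> Eq (Plus (Times (Var 0) (Var 1)) (Var 0)) (Plus (Var 2) (Var 0))"
      by (rule entails_eq_Plus) simp_all
    moreover have "?G \<turnstile> Eq (Plus (Var 2) (Var 0)) (Var 3)" by simp
    ultimately have "?G \<turnstile> Eq (Times (Var 0) (Succ (Var 1))) (Var 3)"
      using entails_eq_trans by blast
    then have "PR ?\<nu> (Eq (Times (Var 0) (Succ (Var 1))) (Var 3))"
      using PR_entails 1 2 PR_And by blast
    then show "PR (\<lambda>i. ?e x (suc y) (x \<otimes> suc y) i) ?A"
      by (simp add: PR_def cinst_def eval_nat_numeral)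
  qed
  from this[of "\<nu> i" "\<nu> j"] show ?thesis using assms
    by (simp add: PR_def cinst_def eval_nat_numeral)
qed

text \<open>The values of subterms are named by new variables at the front of the environment. This
  shifts the variables of the term, and \<open>f\<close> is there to absorb the shift in the
  induction.\<close>

lemma PR_eval_rename:
  "tval M (\<lambda>j. \<nu> (f j)) t = \<nu> i \<Longrightarrow> PR \<nu> (Eq (tsubst (\<lambda>j. Var (f j)) t) (Var i))"
proof (induction t arbitrary: f \<nu> i)
  case (Var j)
  have "PR (\<lambda>_. \<nu> i) (Eq (Var 0) (Var 0))" by (rule PR_HA) (rule HA_eq_refl)
  with Var show ?case by (simp add: PR_def cinst_def)
next
  case Zero
  have "PR \<nu> (Eq Zero Zero)" by (rule PR_HA) (rule HA_eq_refl)
  with Zero[symmetric] show ?case by (simp add: PR_def cinst_def)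
next
  case (Succ t)
  let ?a = "tval M (\<lambda>j. \<nu> (f j)) t"
  let ?\<nu> = "case_nat ?a \<nu>" and ?t = "tsubst (\<lambda>j. Var (Suc (f j))) t"
  have 1: "PR ?\<nu> (Eq ?t (Var 0))" using Succ.IH[of ?\<nu> "\<lambda>j. Suc (f j)" 0] by simp
  have "PR ?\<nu> (Eq (Succ (Var 0)) (Succ (Var 0)))" by (rule PR_HA) (rule HA_eq_refl)
  then have 2: "PR ?\<nu> (Eq (Succ (Var 0)) (Var (Suc i)))"
    using Succ.prems[symmetric] by (simp add: PR_def cinst_def)
  have "{And (Eq ?t (Var 0)) (Eq (Succ (Var 0)) (Var (Suc i)))} \<turnstile> Eq (Succ ?t) (Var (Suc i))"
    by (rule entails_eq_trans[OF entails_eq_Succ[of _ _ "Var 0"]]) simp_all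
  then have "PR ?\<nu> (Eq (Succ ?t) (Var (Suc i)))" using 1 2 PR_entails PR_And by blast
  moreover have "Eq (Succ ?t) (Var (Suc i)) = flift (Eq (Succ (tsubst (\<lambda>j. Var (f j)) t)) (Var i))"
    by (simp add: tlift_def tsubst_tsubst)
  ultimately have "PR ?\<nu> (flift (Eq (Succ (tsubst (\<lambda>j. Var (f j)) t)) (Var i)))" by metis
  then show ?case by (simp only: PR_flift tsubst.simps)
next
  case (Plus s t)
  let ?a = "tval M (\<lambda>j. \<nu> (f j)) s" and ?b = "tval M (\<lambda>j. \<nu> (f j)) t"
  let ?\<nu> = "case_nat ?a (case_nat ?b \<nu>)"
  let ?r = "tsubst (\<lambda>j. Var (Suc (Suc (f j))))"
  have 1: "PR ?\<nu> (Eq (?r s) (Var 0))" using Plus.IH(1)[of ?\<nu> "\<lambda>j. Suc (Suc (f j))" 0] by simp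
  have 2: "PR ?\<nu> (Eq (?r t) (Var 1))" using Plus.IH(2)[of ?\<nu> "\<lambda>j. Suc (Suc (f j))" 1] by simp
  have 3: "PR ?\<nu> (Eq (Plus (Var 0) (Var 1)) (Var (Suc (Suc i))))"
    by (rule PR_Plus) (use Plus.prems in simp)
  have "{And (Eq (?r s) (Var 0)) (And (Eq (?r t) (Var 1)) (Eq (Plus (Var 0) (Var 1)) (Var (Suc (Suc i)))))} \<turnstile>
    Eq (Plus (?r s) (?r t)) (Var (Suc (Suc i)))"
    by (rule entails_eq_trans[OF entails_eq_Plus[of _ _ "Var 0" _ "Var 1"]]) simp_all
  then have "PR ?\<nu> (Eq (Plus (?r s) (?r t)) (Var (Suc (Suc i))))" using 1 2 3 PR_entails PR_And by blast
  moreover have "Eq (Plus (?r s) (?r t)) (Var (Suc (Suc i))) =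
    flift (flift (Eq (Plus (tsubst (\<lambda>j. Var (f j)) s) (tsubst (\<lambda>j. Var (f j)) t)) (Var i)))"
    by (simp add: tlift_def tsubst_tsubst)
  ultimately have "PR ?\<nu> (flift (flift (Eq (Plus (tsubst (\<lambda>j. Var (f j)) s) (tsubst (\<lambda>j. Var (f j)) t)) (Var i))))"
    by metis
  then show ?case by (simp only: PR_flift tsubst.simps)
next
  case (Times s t)
  let ?a = "tval M (\<lambda>j. \<nu> (f j)) s" and ?b = "tval M (\<lambda>j. \<nu> (f j)) t"
  let ?\<nu> = "case_nat ?a (case_nat ?b \<nu>)"
  let ?r = "tsubst (\<lambda>j. Var (Suc (Suc (f j))))"
  have 1: "PR ?\<nu> (Eq (?r s) (Var 0))" using Times.IH(1)[of ?\<nu> "\<lambda>j. Suc (Suc (f j))" 0] by simp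
  have 2: "PR ?\<nu> (Eq (?r t) (Var 1))" using Times.IH(2)[of ?\<nu> "\<lambda>j. Suc (Suc (f j))" 1] by simp
  have 3: "PR ?\<nu> (Eq (Times (Var 0) (Var 1)) (Var (Suc (Suc i))))"
    by (rule PR_Times) (use Times.prems in simp)
  have "{And (Eq (?r s) (Var 0)) (And (Eq (?r t) (Var 1)) (Eq (Times (Var 0) (Var 1)) (Var (Suc (Suc i)))))} \<turnstile>
    Eq (Times (?r s) (?r t)) (Var (Suc (Suc i)))"
    by (rule entails_eq_trans[OF entails_eq_Times[of _ _ "Var 0" _ "Var 1"]]) simp_all
  then have "PR ?\<nu> (Eq (Times (?r s) (?r t)) (Var (Suc (Suc i))))" using 1 2 3 PR_entails PR_And by blast
  moreover have "Eq (Times (?r s) (?r t)) (Var (Suc (Suc i))) =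
    flift (flift (Eq (Times (tsubst (\<lambda>j. Var (f j)) s) (tsubst (\<lambda>j. Var (f j)) t)) (Var i)))"
    by (simp add: tlift_def tsubst_tsubst)
  ultimately have "PR ?\<nu> (flift (flift (Eq (Times (tsubst (\<lambda>j. Var (f j)) s) (tsubst (\<lambda>j. Var (f j)) t)) (Var i))))"
    by metis
  then show ?case by (simp only: PR_flift tsubst.simps)
qed

lemma PR_eval: "tval M \<nu> t = \<nu> i \<Longrightarrow> PR \<nu> (Eq t (Var i))"
  using PR_eval_rename[of \<nu> "\<lambda>j. j" t i] by simp

text \<open>The two sides concern different codes: one contains a compound term, the other the
  numeral of its value. They are linked by the provable equation between the term and that
  numeral.\<close>

lemma PR_finst: "PR \<nu> (finst t A) \<longleftrightarrow> PR (case_nat (tval M \<nu> t) \<nu>) A"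
proof -
  let ?\<nu> = "case_nat (tval M \<nu> t) \<nu>"
  have e: "PR ?\<nu> (Eq (tlift t) (Var 0))" by (rule PR_eval) simp
  then have e': "PR ?\<nu> (Eq (Var 0) (tlift t))"
    by (rule PR_entails[rotated]) (rule entails_eq_sym, simp)
  let ?B = "fsubst (up (\<lambda>i. Var (Suc i))) A"
  have B: "finst (tlift t) ?B = flift (finst t A)" "finst (Var 0) ?B = A"
    using finst_skip unfolding flift_def fsubst_finst by (simp_all add: tlift_def)
  have "PR ?\<nu> (Imp (flift (finst t A)) A)" "PR ?\<nu> (Imp A (flift (finst t A)))"
    using PR_mono[OF HA_eq_subst e, of ?B] PR_mono[OF HA_eq_subst e', of ?B] unfolding B by auto
  then show ?thesis using PR_mp PR_flift by blast
qed

lemma PR_Exists: "PR (case_nat x \<nu>) A \<Longrightarrow> PR \<nu> (Exists A)"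
proof -
  assume "PR (case_nat x \<nu>) A"
  moreover have "{A} \<turnstile> flift (Exists A)" by (rule entails_exI_lifted) simp
  ultimately show ?thesis using PR_entails PR_flift by blast
qed

text \<open>Of two distinct elements one is the other plus a successor. That equation is provable by
  evaluation, and HA refutes equality from it.\<close>

lemma PR_neq: assumes "\<nu> i \<noteq> \<nu> j" shows "PR \<nu> (Neg (Eq (Var i) (Var j)))"
proof -
  have *: "PR \<nu> (Neg (Eq (Var i) (Var j)))" if "\<nu> i \<oplus> suc w = \<nu> j" for w i j
  proof -
    let ?\<nu> = "case_nat (\<nu> i) (case_nat w (\<lambda>_. \<nu> j))"
    let ?E = "Eq (Plus (Var 0) (Succ (Var 1))) (Var 2)"
    have "PR ?\<nu> ?E" by (rule PR_eval) (use that in \<open>simp add: eval_nat_numeral\<close>)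
    moreover have "{?E} \<turnstile> Neg (Eq (Var 0) (Var 2))"
      using HA_neq_Plus by (simp add: HA_Imp_iff insert_commute)
    ultimately have "PR ?\<nu> (Neg (Eq (Var 0) (Var 2)))" using PR_entails by blast
    then show ?thesis by (simp add: PR_def cinst_def eval_nat_numeral)
  qed
  have "(\<exists>w. \<nu> i \<oplus> suc w = \<nu> j) \<or> (\<exists>w. \<nu> j \<oplus> suc w = \<nu> i)"
    using le_total[of "\<nu> i" "\<nu> j"] zero_or_suc assms by (metis arith_simps(4))
  then show ?thesis
  proof
    assume "\<exists>w. \<nu> i \<oplus> suc w = \<nu> j" then show ?thesis using * by blast
  next
    assume "\<exists>w. \<nu> j \<oplus> suc w = \<nu> i"
    then have "PR \<nu> (Neg (Eq (Var j) (Var i)))" using * by blast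
    moreover have "{Neg (Eq (Var j) (Var i))} \<turnstile> Neg (Eq (Var i) (Var j))"
      unfolding entails_Imp by (rule entails_mp_assm[of "Eq (Var j) (Var i)"], simp) (rule entails_eq_sym, simp)
    ultimately show ?thesis using PR_entails by blast
  qed
qed

text \<open>False formulas must be refuted along with proving true ones, because formulas also occur
  as antecedents. For a bounded quantifier, the proofs of the instances are assembled by induction
  inside the model on the bound, which may be nonstandard.\<close>

lemma PR_delta0: "delta0 A \<Longrightarrow> (\<forall>\<nu>. sat M \<nu> A \<longrightarrow> PR \<nu> A) \<and> (\<forall>\<nu>. \<not> sat M \<nu> A \<longrightarrow> PR \<nu> (Neg A))"
proof (induction rule: delta0.induct)
  case (delta0_Eq s t)
  have "PR \<nu> (Eq s t)" if "sat M \<nu> (Eq s t)" for \<nu>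
  proof -
    let ?\<nu> = "case_nat (tval M \<nu> s) \<nu>"
    have "PR ?\<nu> (Eq (tlift s) (Var 0))" "PR ?\<nu> (Eq (tlift t) (Var 0))"
      by (rule PR_eval, use that in simp)+
    moreover have "{And (Eq (tlift s) (Var 0)) (Eq (tlift t) (Var 0))} \<turnstile> flift (Eq s t)"
      unfolding flift_simps by (rule entails_eq_trans[of _ _ "Var 0"], simp, rule entails_eq_sym, simp)
    ultimately show ?thesis using PR_entails PR_And PR_flift by blast
  qed
  moreover have "PR \<nu> (Neg (Eq s t))" if "\<not> sat M \<nu> (Eq s t)" for \<nu>
  proof -
    let ?\<nu> = "case_nat (tval M \<nu> s) (case_nat (tval M \<nu> t) \<nu>)"
    let ?s = "tlift (tlift s)" and ?t = "tlift (tlift t)"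
    have "PR ?\<nu> (Eq ?s (Var 0))" "PR ?\<nu> (Eq ?t (Var 1))" by (rule PR_eval, simp)+
    moreover have "PR ?\<nu> (Neg (Eq (Var 0) (Var 1)))" by (rule PR_neq) (use that in simp)
    moreover have "{And (Eq ?s (Var 0)) (And (Eq ?t (Var 1)) (Neg (Eq (Var 0) (Var 1))))} \<turnstile> flift (flift (Neg (Eq s t)))"
    proof -
      let ?P = "And (Eq ?s (Var 0)) (And (Eq ?t (Var 1)) (Neg (Eq (Var 0) (Var 1))))"
      let ?G = "{Eq ?s ?t, ?P}"
      have "?G \<turnstile> ?P" "?G \<turnstile> Eq ?s ?t" by (rule entails_assm, simp)+
      then have "?G \<turnstile> Eq (Var 0) ?s" "?G \<turnstile> Eq ?t (Var 1)" "?G \<turnstile> Neg (Eq (Var 0) (Var 1))"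
        unfolding entails_And by (blast intro: entails_eq_sym)+
      then have "?G \<turnstile> Bot" using \<open>?G \<turnstile> Eq ?s ?t\<close> entails_eq_trans entails_mp by blast
      then show ?thesis unfolding flift_simps entails_Imp .
    qed
    ultimately have "PR ?\<nu> (flift (flift (Neg (Eq s t))))" using PR_entails PR_And by blast
    then show ?thesis by (simp only: PR_flift)
  qed
  ultimately show ?case by blast
next
  case delta0_Bot
  have "PR \<nu> Verum" for \<nu> by (rule PR_HA) (rule HA_botE)
  then show ?case by simp
next
  case (delta0_And A B)
  have "{Neg A} \<turnstile> Neg (And A B)" "{Neg B} \<turnstile> Neg (And A B)"
    by (simp, rule entails_mp_assm[of A] entails_mp_assm[of B]; simp)+
  then show ?case using delta0_And.IH PR_And PR_entails by auto
next
  case (delta0_Or A B)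
  have "{A} \<turnstile> Or A B" "{B} \<turnstile> Or A B" by (auto intro: entails_OrI1 entails_OrI2)
  moreover have "{And (Neg A) (Neg B)} \<turnstile> Neg (Or A B)"
    unfolding entails_Imp[of _ "Or A B"] entails_insert_Or
    by (rule conjI, rule entails_mp[of _ A], rule entails_And_assm(1)[of "Neg A" "Neg B"], simp, simp,
        rule entails_mp[of _ B], rule entails_And_assm(2)[of "Neg A" "Neg B"]) simp_all
  ultimately show ?case using delta0_Or.IH PR_And PR_entails by (metis sat.simps(4))
next
  case (delta0_Imp A B)
  have "{Neg A} \<turnstile> Imp A B"
    unfolding entails_Imp by (rule entails_botE, rule entails_mp_assm[of A]) simp_all
  moreover have "{B} \<turnstile> Imp A B" by simp
  moreover have "{And A (Neg B)} \<turnstile> Neg (Imp A B)"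
    unfolding entails_Imp[of _ "Imp A B"] entails_insert_And'
    by (rule entails_mp_assm[of B], simp, rule entails_mp_assm[of A]) simp_all
  ultimately show ?case using delta0_Imp.IH PR_And PR_entails by (metis sat.simps(5))
next
  case (delta0_Ball A t)
  let ?A = "fsubst (up (\<lambda>i. Var (Suc i))) A"
  let ?X = "BAll (Var 0) ?A"
  have inst: "finst u ?X = BAll u A" for u
    by (simp add: finst_def fsubst_fsubst up_comp)
  have succ: "fsucc ?X = BAll (Succ (Var 0)) ?A"
    by (simp add: fsucc_def fsubst_fsubst up_comp)
  have fs: "finst (Succ (Var 0)) ?A = fsucc A"
    by (simp add: finst_fsubst_up fsucc_def)
  have "PR \<nu> (BAll t A)" if "sat M \<nu> (BAll t A)" for \<nu>
  proof -
    let ?v = "tval M \<nu> t"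
    have IH: "PR (case_nat x \<nu>) A" if "x \<preceq> ?v" for x
      using that \<open>sat M \<nu> (BAll t A)\<close> delta0_Ball.IH by simp
    have "b \<preceq> ?v \<longrightarrow> PR (\<lambda>i. case_nat b (\<lambda>i. \<nu> i) i) ?X" for b
    proof (rule pa_induct[of "\<lambda>b. b \<preceq> ?v \<longrightarrow> PR (\<lambda>i. case_nat b (\<lambda>i. \<nu> i) i) ?X"])
      show "Df (\<lambda>\<mu>. \<mu> 0 \<preceq> ?v \<longrightarrow> PR (\<lambda>i. case_nat (\<mu> 0) (\<lambda>i. \<nu> i) i) ?X)"
        by (intro Df_PR Df_rules)
      have "PR \<nu> (finst Zero A)" using IH[of \<zero>] by (simp add: PR_finst_zero)
      then have "PR \<nu> (BAll Zero A)" by (rule PR_mono[OF HA_Ball_Zero])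
      then have "PR (case_nat \<zero> \<nu>) ?X" unfolding PR_finst_zero[symmetric] inst .
      then show "\<zero> \<preceq> ?v \<longrightarrow> PR (\<lambda>i. case_nat \<zero> (\<lambda>i. \<nu> i) i) ?X" by simp
      fix b assume *: "b \<preceq> ?v \<longrightarrow> PR (\<lambda>i. case_nat b (\<lambda>i. \<nu> i) i) ?X"
      show "suc b \<preceq> ?v \<longrightarrow> PR (\<lambda>i. case_nat (suc b) (\<lambda>i. \<nu> i) i) ?X"
      proof
        assume b: "suc b \<preceq> ?v"
        then have "b \<preceq> ?v" using le_suc le_trans by blast
        with * have 1: "PR (case_nat b \<nu>) ?X" by simp
        have "PR (case_nat b \<nu>) (fsucc A)" using IH[OF b] by (simp add: PR_fsucc)
        then have "PR (case_nat b \<nu>) (BAll (Succ (Var 0)) ?A)"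
          using PR_mp[OF PR_mono[OF HA_Ball_Succ 1]] unfolding fs by blast
        then show "PR (\<lambda>i. case_nat (suc b) (\<lambda>i. \<nu> i) i) ?X"
          unfolding succ[symmetric] by (simp only: PR_fsucc)
      qed
    qed
    then have "PR (case_nat ?v \<nu>) ?X" using le_refl by blast
    then show ?thesis unfolding PR_finst[symmetric] inst .
  qed
  moreover have "PR \<nu> (Neg (BAll t A))" if not: "\<not> sat M \<nu> (BAll t A)" for \<nu>
  proof -
    obtain x where x: "x \<preceq> tval M \<nu> t" "\<not> sat M (case_nat x \<nu>) A" using not by auto
    then obtain w where w: "x \<oplus> w = tval M \<nu> t" unfolding le_def by blast
    let ?\<nu> = "case_nat w (case_nat x \<nu>)"
    let ?v = "tval M \<nu> t"
    let ?\<nu>' = "case_nat ?v ?\<nu>"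
    have "PR ?\<nu>' (Eq (Plus (Var 2) (Var 1)) (Var 0))"
      by (rule PR_eval) (use w in \<open>simp add: eval_nat_numeral\<close>)
    moreover have "PR ?\<nu>' (Eq (tlift (tlift (tlift t))) (Var 0))" by (rule PR_eval) simp
    moreover have "{And (Eq (Plus (Var 2) (Var 1)) (Var 0)) (Eq (tlift (tlift (tlift t))) (Var 0))} \<turnstile>
      flift (Eq (Plus (Var 1) (Var 0)) (tlift (tlift t)))"
      by (simp add: eval_nat_numeral, rule entails_eq_trans[of _ _ "Var 0"], simp, rule entails_eq_sym, simp)
    ultimately have "PR ?\<nu> (Eq (Plus (Var 1) (Var 0)) (tlift (tlift t)))"
      using PR_entails PR_And PR_flift by blast
    then have "PR (case_nat x \<nu>) (Le (Var 0) (tlift t))"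
      unfolding Le_def by (intro PR_Exists) simp
    moreover have "PR (case_nat x \<nu>) (Neg A)" using x(2) delta0_Ball.IH by blast
    moreover have "{And (Le (Var 0) (tlift t)) (Neg A)} \<turnstile> flift (Neg (BAll t A))"
    proof -
      let ?G = "{flift (BAll t A), Le (Var 0) (tlift t), Neg A}"
      have "?G \<turnstile> Imp (Le (Var 0) (tlift t)) A" by (rule entails_allE_lifted) (simp add: entails_assm)
      then have "?G \<turnstile> A" by (rule entails_mp) (simp add: entails_assm)
      then have "?G \<turnstile> Bot" by (rule entails_mp_assm[rotated]) simp
      then show ?thesis by (simp add: insert_commute)
    qed
    ultimately have "PR (case_nat x \<nu>) (flift (Neg (BAll t A)))" using PR_entails PR_And by blast
    then show ?thesis by (simp only: PR_flift)
  qed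
  ultimately show ?case by blast
next
  case (delta0_equiv A B)
  have "{A} \<turnstile> B" "{B} \<turnstile> A" using delta0_equiv.hyps(2) HA_Iff_entails by blast+
  then have "{Neg A} \<turnstile> Neg B"
    unfolding entails_Imp by (intro entails_mp_assm[of A Bot], simp) (rule entails_mono, auto)
  moreover have "sat M \<nu> A \<longleftrightarrow> sat M \<nu> B" for \<nu> using HA_sound[OF delta0_equiv.hyps(2)] by auto
  ultimately show ?case using delta0_equiv.IH \<open>{A} \<turnstile> B\<close> PR_entails by blast
qed

theorem PR_sigma: "sigma A \<Longrightarrow> sat M \<nu> A \<Longrightarrow> PR \<nu> A"
proof (induction arbitrary: \<nu> rule: sigma.induct)
  case (sigma_delta0 A) then show ?case using PR_delta0 by blast
next
  case (sigma_And A B) then show ?case by (simp add: PR_And)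
next
  case (sigma_Or A B) then show ?case using PR_mono[OF HA_orI1] PR_mono[OF HA_orI2] by auto
next
  case (sigma_Exists A) then show ?case using PR_Exists by auto
next
  case (sigma_equiv A B)
  have "sat M \<nu> A" using HA_sound[OF sigma_equiv.hyps(2), of \<nu>] sigma_equiv.prems by simp
  then show ?case using sigma_equiv PR_Iff by blast
qed

end

section \<open>Derivability conditions\<close>

lemma delta0_Mem: "delta0 (Mem t)"
proof -
  have "delta0 (BEx (Var 1) (Eq (Times (Var 0) (Succ (Times (Succ (tlift t)) (tlift (Var 2))))) (tlift (Var 1))))"
    by (intro delta0_Bex delta0.intros)
  then show ?thesis unfolding Mem_def by (intro delta0_And delta0_Le)
qed

lemma delta0_Conj: "(\<And>A. A \<in> set As \<Longrightarrow> delta0 A) \<Longrightarrow> delta0 (Conj As)"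
  unfolding Conj_def by (induction As) (auto intro: delta0.intros)

lemma delta0_Disj: "(\<And>A. A \<in> set As \<Longrightarrow> delta0 A) \<Longrightarrow> delta0 (Disj As)"
  unfolding Disj_def by (induction As) (auto intro: delta0.intros)

lemma delta0_Ex_bounded: "delta0 A \<Longrightarrow> k \<noteq> 3 \<Longrightarrow> delta0 (Ex_bounded k A)"
  using delta0_Bex[of "bind_var k A" "Var 3"] delta0_fsubst
  by (simp add: Ex_bounded_def Ex_var_def bind_var_def eval_nat_numeral)

lemma delta0_Clause_fm: "delta0 (Clause_fm c)"
proof -
  have "3 \<notin> set ks \<Longrightarrow> delta0 A \<Longrightarrow> delta0 (foldr Ex_bounded ks A)" for ks A
    by (induction ks) (auto intro: delta0_Ex_bounded)
  note * = this
  show ?thesis unfolding Clause_fm_def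
    by (rule *) (auto intro!: delta0_And delta0_Eq delta0_Conj delta0_Mem)
qed

text \<open>Membership contains the bound of the coded set as its first conjunct. Currying the
  implication exposes it as the bound of the universal quantifier.\<close>

lemma delta0_Closed_fm: "delta0 (All_var 4 (Imp (Mem (Var 4)) (Disj (map Clause_fm cs))))"
proof -
  define D where "D = bind_var 4 (Disj (map Clause_fm cs))"
  define R where "R = bind_var 4 (Exists (And (Le (Var 0) (tlift (Var 1)))
      (Eq (Times (Var 0) (Succ (Times (Succ (tlift (Var 4))) (tlift (Var 2))))) (tlift (Var 1)))))"
  have D: "delta0 D" unfolding D_def bind_var_def
    by (intro delta0_fsubst delta0_Disj) (auto simp: delta0_Clause_fm)
  have R: "delta0 R" unfolding R_def bind_var_def by (intro delta0_fsubst delta0_Bex delta0.intros)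
  let ?L = "Le (Var 0) (tlift (Var 3))"
  have "All_var 4 (Imp (Mem (Var 4)) (Disj (map Clause_fm cs))) = Forall (Imp (And ?L R) D)"
    by (simp add: All_var_def D_def R_def Mem_def) (simp add: bind_var_def)
  moreover have "HA (Iff (Imp ?L (Imp R D)) (Imp (And ?L R) D))"
  proof -
    have "{Imp ?L (Imp R D)} \<turnstile> Imp (And ?L R) D"
      unfolding entails_Imp entails_insert_And
      by (rule entails_mp[of _ R], rule entails_mp_assm[of ?L]) simp_all
    moreover have "{Imp (And ?L R) D} \<turnstile> Imp ?L (Imp R D)"
      unfolding entails_Imp by (rule entails_mp_assm[of "And ?L R"]) simp_all
    ultimately show ?thesis unfolding HA_Iff_entails by blast
  qed
  ultimately show ?thesis
    using delta0_equiv[OF delta0_Ball[OF delta0_Imp[OF R D]] HA_Iff_Forall] by metis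
qed

lemma sigma_Ex_var: "sigma A \<Longrightarrow> sigma (Ex_var k A)"
  unfolding Ex_var_def bind_var_def by (intro sigma_Exists sigma_fsubst)

lemma sigma_Der: "sigma (Der t)"
  unfolding Der_def Der_fm_def
  by (intro sigma_fsubst sigma_Ex_var sigma_And)
    (auto intro: sigma_delta0 delta0_Mem delta0_Closed_fm simp del: map_append)

lemma sigma_Box: "sigma (Box A)"
proof -
  have "sigma (Prov_inst ts a)" for ts a
    by (induction ts a rule: Prov_inst.induct) (auto intro!: sigma_Der sigma_Exists sigma_And simp: Prov_def)
  then show ?thesis unfolding Box_def .
qed

lemma sat_Box: "pa_model M \<Longrightarrow> sat M \<nu> (Box A) \<longleftrightarrow> pa_model.PR M \<nu> A"
  by (rule pa_model.sat_Box)

lemma sigma_Verum: "sigma Verum"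
  by (intro sigma_delta0 delta0.intros)

theorem HA_Box_nec: assumes "HA A" shows "HA (Box A)"
proof -
  have "HA (Imp Verum (Box A))"
    by (rule sigma_transfer[OF sigma_Verum sigma_Box]) (simp add: sat_Box pa_model.PR_HA[OF _ assms])
  then show ?thesis using HA_imp_refl HA_mp by blast
qed

theorem HA_Box_K: "HA (Imp (And (Box (Imp A B)) (Box A)) (Box B))"
  by (rule sigma_transfer) (auto intro: sigma_And sigma_Box pa_model.PR_mp simp: sat_Box)

theorem HA_sigma_Box: "sigma A \<Longrightarrow> HA (Imp A (Box A))"
  by (rule sigma_transfer) (auto intro: sigma_Box pa_model.PR_sigma simp: sat_Box)

text \<open>The numeral inside \<open>Box\<close> is the code of the formula and changes with the
  names, so this is an equivalence and not an identity. The renaming may identify variables, as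
  modal substitution does.\<close>

theorem HA_Box_rename:
  "HA (Iff (fsubst (\<lambda>i. Var (f i)) (Box A)) (Box (fsubst (\<lambda>i. Var (f i)) A)))"
  by (rule sigma_transfer_Iff)
    (auto intro: sigma_fsubst sigma_Box simp: sat_fsubst sat_Box pa_model.PR_rename)

lemma entails_Box_mp: "G \<turnstile> Box (Imp A B) \<Longrightarrow> G \<turnstile> Box A \<Longrightarrow> G \<turnstile> Box B"
  by (rule entails_HA_mp[OF HA_Box_K]) (simp only: entails_And)

lemma entails_Box_mono: "HA (Imp A B) \<Longrightarrow> G \<turnstile> Box A \<Longrightarrow> G \<turnstile> Box B"
  using entails_Box_mp entails_HA HA_Box_nec by blast

lemma entails_sigma_Box: "sigma A \<Longrightarrow> G \<turnstile> A \<Longrightarrow> G \<turnstile> Box A"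
  using entails_HA_mp HA_sigma_Box by blast

lemma HA_Box_Iff: "HA (Iff A B) \<Longrightarrow> HA (Iff (Box A) (Box B))"
  unfolding HA_Iff_entails using entails_Box_mono HA_Imp_iff entails_assm by blast

section \<open>Free variables of the provability predicate\<close>

lemma ffree_Le: "ffree (Le s t) = tfree s \<union> tfree t"
proof -
  have "{i. Suc i \<in> tfree (tlift t)} = tfree t" for t by (induction t) auto
  then show ?thesis unfolding Le_def by auto
qed

lemma tfree_tlift: "Suc i \<in> tfree (tlift t) \<longleftrightarrow> i \<in> tfree t"
  by (induction t) auto

lemma ffree_Mem: "ffree (Mem t) \<subseteq> tfree t \<union> {1, 2, 3}"
  by (auto simp: Mem_def ffree_Le tfree_tlift)

lemma ffree_Conj: "ffree (Conj As) = (\<Union>A\<in>set As. ffree A)"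
  unfolding Conj_def by (induction As) auto

lemma ffree_Disj: "ffree (Disj As) = (\<Union>A\<in>set As. ffree A)"
  unfolding Disj_def by (induction As) auto

lemma tfree_pair_trm [simp]: "tfree (pair_trm s t) = tfree s \<union> tfree t"
  by (auto simp: pair_trm_def)

lemma ffree_Clause_fm: "ffree (Clause_fm c) \<subseteq> {1, 2, 3, 4}"
proof -
  have *: "ffree (foldr Ex_bounded ks A) \<subseteq> insert 3 (ffree A - set ks)" for ks A
    by (induction ks) (auto simp: Ex_bounded_def ffree_Le)
  have tf: "tfree (tsubst (\<lambda>i. Var (6 + i)) t) \<subseteq> {5..<6 + clause_bound c}"
    if "t \<in> insert (fst c) (set (snd c))" for t
    using clause_bound[OF that] by (auto simp: tfree_tsubst)
  show ?thesis unfolding Clause_fm_def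
    by (rule subset_trans[OF *]) (use tf ffree_Mem in \<open>fastforce simp: ffree_Conj\<close>)
qed

lemma ffree_Der: "ffree (Der t) \<subseteq> tfree t"
proof -
  have m: "ffree (Mem (Var 4)) \<subseteq> {1, 2, 3, 4}" "ffree (Mem (pair_trm (Var 5) (Var 0))) \<subseteq> {0, 1, 2, 3, 5}"
    using ffree_Mem[of "Var 4"] ffree_Mem[of "pair_trm (Var 5) (Var 0)"] by auto
  have "ffree (Disj (map Clause_fm (syntax_clauses @ HA_clauses))) \<subseteq> {1, 2, 3, 4}"
    using ffree_Clause_fm by (auto simp: ffree_Disj)
  with m have "ffree Der_fm \<subseteq> {0}" unfolding Der_fm_def by auto
  then show ?thesis unfolding Der_def ffree_fsubst by (auto split: nat.splits)
qed

lemma tfree_tags [simp]: "tfree (tag1 k t) = tfree t" "tfree (tag2 k s t) = tfree s \<union> tfree t"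
  by (auto simp: tag1_def tag2_def)

lemma ffree_Box: "ffree (Box A) \<subseteq> ffree A"
proof -
  have "ffree (Prov_inst ts a) \<subseteq> (\<Union>t\<in>set ts. tfree t) \<union> tfree a" for ts a
  proof (induction ts a rule: Prov_inst.induct)
    case (1 a) then show ?case using ffree_Der[of "tag1 4 a"] by (simp add: Prov_def)
  next
    case (2 t ts a)
    have "ffree (Prov_inst (map (\<lambda>s. tlift (tlift s)) ts) (Var 0)) \<subseteq>
      (\<Union>s\<in>set ts. tfree (tlift (tlift s))) \<union> {0}" using 2 by simp
    then show ?case
      using ffree_Der[of "tag2 0 (tlift (tlift t)) (Var 1)"]
        ffree_Der[of "tag2 3 (pair_trm Zero (pair_trm (Var 1) Zero)) (pair_trm (tlift (tlift a)) (Var 0))"]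
      by (fastforce simp: tfree_tlift)
  qed
  then have "ffree (Box A) \<subseteq> (\<Union>t\<in>set (map (\<lambda>i. if i \<in> ffree A then Var i else Zero) [0..<free_bound A]). tfree t)
    \<union> tfree (numeral_trm (fcode A))" unfolding Box_def .
  then show ?thesis by (auto split: if_splits)
qed

section \<open>Arithmetical soundness\<close>

fun var_index :: "mtrm \<Rightarrow> nat" where
  "var_index (MVar k) = 2 * k"
| "var_index (MConst k) = 2 * k + 1"

lemma var_of_index: "var_of t = Var (var_index t)"
  by (cases t) auto

lemma var_index_inject [simp]: "var_index s = var_index t \<longleftrightarrow> s = t"
  by (cases s; cases t) (auto, presburger+)

definition rename_var :: "nat \<Rightarrow> nat \<Rightarrow> nat \<Rightarrow> trm" where
  "rename_var k l i = Var (if i = k then l else i)"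

lemma rename_var_eq: "rename_var k l = (\<lambda>i. Var (if i = k then l else i))"
  by (rule ext) (simp add: rename_var_def)

lemma QRC1_wf: "QRC1 ar C \<phi> \<psi> \<Longrightarrow> wf_spf ar C \<phi> \<and> wf_spf ar C \<psi>"
proof (induction rule: QRC1.induct)
  have *: "wf_mtrm C t \<Longrightarrow> wf_spf ar C (ssubst x t \<phi>) \<longleftrightarrow> wf_spf ar C \<phi>" for x t and \<phi> :: "'a spf"
    by (induction \<phi>) auto
  {
    case (qrc_allL x t \<phi> \<psi>) then show ?case using * by auto
  next
    case (qrc_inst \<phi> \<psi> t x) then show ?case using * by auto
  next
    case (qrc_const x c \<phi> \<psi>) then show ?case using *[of "MConst c"] by auto
  }
qed auto

lemma ssubst_idem: "x \<notin> sfree \<phi> \<Longrightarrow> ssubst x t \<phi> = \<phi>"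
  by (induction \<phi>) (auto intro!: map_idI)

lemma HA_Iff_refl: "HA (Iff A A)"
  by (simp add: HA_Iff_entails)

lemma HA_Iff_And: "HA (Iff A A') \<Longrightarrow> HA (Iff B B') \<Longrightarrow> HA (Iff (And A B) (And A' B'))"
  by (rule HA_IffI) (auto simp: entails_Iff[of A A'] entails_Iff[of B B'])

lemma HA_Iff_trans: "HA (Iff A B) \<Longrightarrow> HA (Iff B D) \<Longrightarrow> HA (Iff A D)"
  by (rule HA_IffI) (auto simp: entails_Iff[of A B] entails_Iff[of B D])

lemma HA_Iff_sym: "HA (Iff A B) \<Longrightarrow> HA (Iff B A)"
  by (rule HA_IffI) (auto simp: entails_Iff[of A B])

lemma HA_Iff_Neg: "HA (Iff A B) \<Longrightarrow> HA (Iff (Neg A) (Neg B))"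
proof -
  assume *: "HA (Iff A B)"
  have "{Neg A} \<turnstile> Neg B"
    unfolding entails_Imp by (rule entails_mp_assm[of A], simp) (simp add: entails_Iff[OF *])
  moreover have "{Neg B} \<turnstile> Neg A"
    unfolding entails_Imp by (rule entails_mp_assm[of B], simp) (simp add: entails_Iff[OF *, symmetric])
  ultimately show ?thesis unfolding HA_Iff_entails by blast
qed

lemma HA_Dia_mono:
  assumes "HA (Imp A B)" shows "HA (Imp (Neg (Box (Neg A))) (Neg (Box (Neg B))))"
proof -
  have 1: "HA (Imp (Neg B) (Neg A))"
    unfolding HA_Imp_iff entails_Imp
    by (rule entails_mp_assm[of B], simp, rule entails_HA_mp[OF assms], simp)
  have "{Box (Neg B), Neg (Box (Neg A))} \<turnstile> Box (Neg A)" by (rule entails_Box_mono[OF 1]) simp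
  then have "{Box (Neg B), Neg (Box (Neg A))} \<turnstile> Bot" by (rule entails_mp_assm[rotated]) simp
  then show ?thesis by (simp add: HA_Imp_iff)
qed

text \<open>Transitivity comes from provable completeness: \<open>?B\<close> is existential and
  therefore implies its own provability.\<close>

lemma HA_Dia_Dia: "HA (Imp (Neg (Box (Neg (Neg (Box (Neg A)))))) (Neg (Box (Neg A))))"
proof -
  let ?B = "Box (Neg A)"
  have 1: "HA (Imp ?B (Neg (Neg ?B)))"
    unfolding HA_Imp_iff entails_Imp[of _ "Neg ?B"] by (rule entails_mp_assm[of ?B]) simp_all
  let ?G = "{?B, Neg (Box (Neg (Neg ?B)))}"
  have "?G \<turnstile> Box ?B" by (rule entails_sigma_Box[OF sigma_Box]) simp
  then have "?G \<turnstile> Box (Neg (Neg ?B))" by (rule entails_Box_mono[OF 1])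
  then have "?G \<turnstile> Bot" by (rule entails_mp_assm[rotated]) simp
  then show ?thesis unfolding HA_Imp_iff entails_Imp[of _ ?B] .
qed

lemma HA_All_var_elim: "HA (Imp (All_var k A) (fsubst (rename_var k l) A))"
proof -
  have "finst (Var l) (bind_var k A) = fsubst (rename_var k l) A"
    unfolding bind_var_def finst_def fsubst_fsubst by (rule fsubst_cong) (auto simp: rename_var_def)
  then show ?thesis using HA_allE[of "bind_var k A" "Var l"] by (simp add: All_var_def)
qed

lemma HA_All_var_intro: "HA (Imp A B) \<Longrightarrow> k \<notin> ffree A \<Longrightarrow> HA (Imp A (All_var k B))"
proof -
  assume *: "HA (Imp A B)" "k \<notin> ffree A"
  have "bind_var k A = flift A"
    unfolding bind_var_def flift_def by (rule fsubst_cong) (use *(2) in auto)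
  then have "HA (Imp (flift A) (bind_var k B))"
    using HA_fsubst[OF *(1), of "\<lambda>i. if i = k then Var 0 else Var (Suc i)"] by (simp add: bind_var_def)
  then show ?thesis unfolding All_var_def by (rule HA_allI)
qed

locale realized =
  fixes ar :: "'r \<Rightarrow> nat option" and C :: "nat set" and \<rho> :: "'r \<Rightarrow> fm"
  assumes realization: "realization ar \<rho>"
begin

lemma ffree_realization: "wf_spf ar C (SRel S ts) \<Longrightarrow> i \<in> ffree (\<rho> S) \<Longrightarrow> i < length ts"
  using realization unfolding realization_def by fastforce

lemma ffree_translate:
  "wf_spf ar C \<phi> \<Longrightarrow> ffree (translate \<rho> \<phi>) \<subseteq> var_index ` (MVar ` sfree \<phi> \<union> MConst ` sconsts \<phi>)"
proof (induction \<phi>)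
  case (SRel S ts)
  show ?case
  proof
    fix j assume "j \<in> ffree (translate \<rho> (SRel S ts))"
    then obtain i where i: "i \<in> ffree (\<rho> S)" "j \<in> tfree (if i < length ts then var_of (ts ! i) else Var i)"
      by (auto simp: ffree_fsubst)
    then have "i < length ts" using ffree_realization[OF SRel.prems] by blast
    with i(2) have "j = var_index (ts ! i)" "ts ! i \<in> set ts" by (auto simp: var_of_index)
    then show "j \<in> var_index ` (MVar ` sfree (SRel S ts) \<union> MConst ` sconsts (SRel S ts))"
      by (cases "ts ! i") force+
  qed
next
  case (SAll x \<phi>)
  then have "ffree (translate \<rho> \<phi>) \<subseteq> var_index ` (MVar ` sfree \<phi> \<union> MConst ` sconsts \<phi>)" by simp
  moreover have "var_index (MVar x) = 2 * x" by simp
  ultimately show ?case by fastforce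
next
  case (SDia \<phi>)
  then show ?case using ffree_Box[of "Neg (translate \<rho> \<phi>)"] by auto
next
  case (SAnd \<phi> \<psi>)
  then have "ffree (translate \<rho> \<phi>) \<subseteq> var_index ` (MVar ` sfree \<phi> \<union> MConst ` sconsts \<phi>)"
    "ffree (translate \<rho> \<psi>) \<subseteq> var_index ` (MVar ` sfree \<psi> \<union> MConst ` sconsts \<psi>)" by auto
  then show ?case unfolding translate.simps ffree.simps sfree.simps sconsts.simps
    by (intro Un_least; elim order_trans; intro image_mono; blast)
qed simp

lemma translate_not_free: "wf_spf ar C \<phi> \<Longrightarrow> x \<notin> sfree \<phi> \<Longrightarrow> 2 * x \<notin> ffree (translate \<rho> \<phi>)"
  and translate_no_const: "wf_spf ar C \<phi> \<Longrightarrow> c \<notin> sconsts \<phi> \<Longrightarrow> 2 * c + 1 \<notin> ffree (translate \<rho> \<phi>)"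
proof -
  have *: "var_index t \<notin> ffree (translate \<rho> \<phi>)"
    if "wf_spf ar C \<phi>" "t \<notin> MVar ` sfree \<phi> \<union> MConst ` sconsts \<phi>" for t
  proof
    assume "var_index t \<in> ffree (translate \<rho> \<phi>)"
    then have "var_index t \<in> var_index ` (MVar ` sfree \<phi> \<union> MConst ` sconsts \<phi>)"
      using ffree_translate[OF that(1)] by blast
    moreover have "inj var_index" by (rule injI) simp
    ultimately show False using that(2) inj_image_mem_iff by metis
  qed
  show "wf_spf ar C \<phi> \<Longrightarrow> x \<notin> sfree \<phi> \<Longrightarrow> 2 * x \<notin> ffree (translate \<rho> \<phi>)"
    using *[of "MVar x"] by auto
  show "wf_spf ar C \<phi> \<Longrightarrow> c \<notin> sconsts \<phi> \<Longrightarrow> 2 * c + 1 \<notin> ffree (translate \<rho> \<phi>)"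
    using *[of "MConst c"] by auto
qed

text \<open>Modal substitution becomes a renaming of arithmetical variables. The diamond case makes
  this an equivalence only; at a universal quantifier \<open>free_for\<close> keeps the new index
  different from the bound one.\<close>

lemma translate_ssubst:
  "wf_spf ar C \<phi> \<Longrightarrow> free_for t x \<phi> \<Longrightarrow>
    HA (Iff (translate \<rho> (ssubst x t \<phi>)) (fsubst (rename_var (2 * x) (var_index t)) (translate \<rho> \<phi>)))"
proof (induction \<phi>)
  case STop then show ?case by (simp add: HA_Iff_refl del: entails_Imp)
next
  case (SRel S ts)
  have "fsubst (rename_var (2 * x) (var_index t)) (translate \<rho> (SRel S ts)) = translate \<rho> (ssubst x t (SRel S ts))"
    unfolding ssubst.simps translate.simps fsubst_fsubst
  proof (rule fsubst_cong)
    fix i assume "i \<in> ffree (\<rho> S)"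
    then have "i < length ts" using ffree_realization[OF SRel.prems(1)] by blast
    moreover have "var_index s = 2 * x \<longleftrightarrow> s = MVar x" for s using var_index_inject[of s "MVar x"] by simp
    ultimately show "tsubst (rename_var (2 * x) (var_index t)) (if i < length ts then var_of (ts ! i) else Var i) =
      (if i < length (map (\<lambda>s. if s = MVar x then t else s) ts)
       then var_of (map (\<lambda>s. if s = MVar x then t else s) ts ! i) else Var i)"
      by (simp add: var_of_index rename_var_def)
  qed
  then show ?case by (metis HA_Iff_refl)
next
  case (SAnd \<phi> \<psi>) then show ?case using HA_Iff_And by simp
next
  case (SAll y \<phi>)
  let ?\<sigma> = "rename_var (2 * x) (var_index t)"
  show ?case
  proof (cases "x \<in> sfree (SAll y \<phi>)")
    case False
    have "fsubst ?\<sigma> (translate \<rho> (SAll y \<phi>)) = translate \<rho> (SAll y \<phi>)"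
      by (rule fsubst_idem) (use translate_not_free[OF SAll.prems(1) False] in \<open>auto simp: rename_var_def\<close>)
    moreover have "ssubst x t (SAll y \<phi>) = SAll y \<phi>" using False by (rule ssubst_idem)
    ultimately show ?thesis by (metis HA_Iff_refl)
  next
    case True
    then have y: "y \<noteq> x" and t: "t \<noteq> MVar y" "free_for t x \<phi>" using SAll.prems(2) by auto
    have "var_index t \<noteq> 2 * y" using t(1) var_index_inject[of t "MVar y"] by auto
    then have e: "fsubst ?\<sigma> (All_var (2 * y) A) = All_var (2 * y) (fsubst ?\<sigma> A)" for A
      unfolding fsubst_All_var unfolding All_var_def bind_var_def fsubst_fsubst
      using y by (intro arg_cong[of _ _ Forall] fsubst_cong) (auto simp: rename_var_def)
    have "HA (Iff (translate \<rho> (ssubst x t \<phi>)) (fsubst ?\<sigma> (translate \<rho> \<phi>)))"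
      using SAll t(2) by simp
    from HA_fsubst[OF this]
    have "HA (Iff (bind_var (2 * y) (translate \<rho> (ssubst x t \<phi>))) (bind_var (2 * y) (fsubst ?\<sigma> (translate \<rho> \<phi>))))"
      unfolding bind_var_def fsubst.simps .
    from HA_Iff_Forall[OF this] show ?thesis using y by (simp add: e) (simp add: All_var_def)
  qed
next
  case (SDia \<phi>)
  let ?\<sigma> = "rename_var (2 * x) (var_index t)"
  have "HA (Iff (translate \<rho> (ssubst x t \<phi>)) (fsubst ?\<sigma> (translate \<rho> \<phi>)))" using SDia by simp
  from HA_Box_Iff[OF HA_Iff_Neg[OF this]]
  have "HA (Iff (Box (Neg (translate \<rho> (ssubst x t \<phi>)))) (Box (fsubst ?\<sigma> (Neg (translate \<rho> \<phi>)))))" by simp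
  from HA_Iff_trans[OF this HA_Iff_sym[OF HA_Box_rename[of "\<lambda>i. if i = 2 * x then var_index t else i", folded rename_var_eq]]]
  show ?case using HA_Iff_Neg by simp
qed

theorem soundness: "QRC1 ar C \<phi> \<psi> \<Longrightarrow> HA (Imp (translate \<rho> \<phi>) (translate \<rho> \<psi>))"
proof (induction rule: QRC1.induct)
  case (qrc_top \<phi>) then show ?case by (simp add: HA_Imp_iff)
next
  case (qrc_refl \<phi>) then show ?case by (simp add: HA_imp_refl)
next
  case (qrc_conjE1 \<phi> \<psi>) then show ?case by (simp add: HA_andE1)
next
  case (qrc_conjE2 \<phi> \<psi>) then show ?case by (simp add: HA_andE2)
next
  case (qrc_conjI \<phi> \<psi> \<chi>) then show ?case by (simp add: HA_Imp_iff)
next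
  case (qrc_cut \<phi> \<psi> \<chi>) then show ?case using HA_imp_trans by blast
next
  case (qrc_nec \<phi> \<psi>) then show ?case using HA_Dia_mono by simp
next
  case (qrc_trans \<phi>) then show ?case using HA_Dia_Dia by simp
next
  case (qrc_allR \<phi> \<psi> x)
  have "2 * x \<notin> ffree (translate \<rho> \<phi>)"
    using translate_not_free QRC1_wf[OF qrc_allR.hyps(1)] qrc_allR.hyps(2) by blast
  then show ?case using HA_All_var_intro[OF qrc_allR.IH] by simp
next
  case (qrc_allL x t \<phi> \<psi>)
  have wf: "wf_spf ar C \<phi>"
    using QRC1_wf[OF QRC1.qrc_allL[OF qrc_allL.hyps]] by simp
  have "HA (Imp (fsubst (rename_var (2 * x) (var_index t)) (translate \<rho> \<phi>)) (translate \<rho> (ssubst x t \<phi>)))"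
    using translate_ssubst[OF wf qrc_allL.hyps(3)] HA_andE2 HA_mp by blast
  then show ?case using HA_All_var_elim HA_imp_trans qrc_allL.IH by simp blast
next
  case (qrc_inst \<phi> \<psi> t x)
  have wf: "wf_spf ar C \<phi>" "wf_spf ar C \<psi>" using QRC1_wf[OF qrc_inst.hyps(1)] by auto
  let ?\<sigma> = "rename_var (2 * x) (var_index t)"
  have "HA (Imp (translate \<rho> (ssubst x t \<phi>)) (fsubst ?\<sigma> (translate \<rho> \<phi>)))"
    using translate_ssubst[OF wf(1) qrc_inst.hyps(3)] HA_andE1 HA_mp by blast
  moreover have "HA (Imp (fsubst ?\<sigma> (translate \<rho> \<phi>)) (fsubst ?\<sigma> (translate \<rho> \<psi>)))"
    using HA_fsubst[OF qrc_inst.IH, of ?\<sigma>] by simp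
  moreover have "HA (Imp (fsubst ?\<sigma> (translate \<rho> \<psi>)) (translate \<rho> (ssubst x t \<psi>)))"
    using translate_ssubst[OF wf(2) qrc_inst.hyps(4)] HA_andE2 HA_mp by blast
  ultimately show ?case using HA_imp_trans by blast
next
  case (qrc_const x c \<phi> \<psi>)
  have free: "free_for (MConst c) x \<chi>" for \<chi> :: "'r spf" by (induction \<chi>) auto
  have wf: "wf_spf ar C \<phi>" "wf_spf ar C \<psi>"
    using QRC1_wf[OF QRC1.qrc_const[OF qrc_const.hyps]] by auto
  \<comment> \<open>Constants are translated to free variables, so replacing \<open>c\<close> by
    \<open>x\<close> again is a renaming too. As \<open>c\<close> occurs in neither formula,
    \<open>?\<tau>\<close> undoes \<open>?\<sigma>\<close>.\<close>
  let ?\<sigma> = "rename_var (2 * x) (2 * c + 1)" and ?\<tau> = "rename_var (2 * c + 1) (2 * x)"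
  have 1: "HA (Imp (fsubst ?\<sigma> (translate \<rho> \<phi>)) (translate \<rho> (ssubst x (MConst c) \<phi>)))"
    using translate_ssubst[OF wf(1) free] HA_andE2 HA_mp by fastforce
  have 2: "HA (Imp (translate \<rho> (ssubst x (MConst c) \<psi>)) (fsubst ?\<sigma> (translate \<rho> \<psi>)))"
    using translate_ssubst[OF wf(2) free] HA_andE1 HA_mp by fastforce
  have "HA (Imp (fsubst ?\<sigma> (translate \<rho> \<phi>)) (fsubst ?\<sigma> (translate \<rho> \<psi>)))"
    using 1 2 qrc_const.IH HA_imp_trans by blast
  from HA_fsubst[OF this, of ?\<tau>]
  have "HA (Imp (fsubst ?\<tau> (fsubst ?\<sigma> (translate \<rho> \<phi>))) (fsubst ?\<tau> (fsubst ?\<sigma> (translate \<rho> \<psi>))))" by simp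
  moreover have "fsubst ?\<tau> (fsubst ?\<sigma> A) = A" if "2 * c + 1 \<notin> ffree A" for A
    unfolding fsubst_fsubst by (rule fsubst_idem) (use that in \<open>auto simp: rename_var_def\<close>)
  ultimately show ?case
    using translate_no_const wf qrc_const.hyps(3,4) by metis
qed

end

section \<open>Soundness of the provability predicate in the standard model\<close>

definition std :: interp where
  "std = \<lparr>ip_zero = 0, ip_succ = Suc, ip_plus = (+), ip_times = times\<rparr>"

lemma std_simps [simp]: "ip_zero std = 0" "ip_succ std = Suc" "ip_plus std = (+)" "ip_times std = times"
  by (simp_all add: std_def)

lemma pa_model_std: "pa_model std"
proof
  fix A \<nu> assume "HA A"
  then show "sat std \<nu> A"
  proof (induction arbitrary: \<nu> rule: HA.induct)
    case (HA_ind A)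
    have "sat std (case_nat y \<nu>) (fsucc A) = sat std (case_nat (Suc y) \<nu>) A" for y
      by (simp add: fsucc_def sat_fsubst case_nat_tval)
    moreover have "Q 0 \<Longrightarrow> (\<forall>y. Q y \<longrightarrow> Q (Suc y)) \<Longrightarrow> Q x" for Q :: "nat \<Rightarrow> bool" and x
      by (induction x) auto
    ultimately show ?case by (auto simp: sat_finst)
  next
    case (HA_arith A) then show ?case by (auto simp: arith_axioms_def)
  next
    case (HA_allI A B)
    then show ?case using sat_flift by simp
  next
    case (HA_exE A B)
    have "sat std (case_nat x \<nu>) A \<longrightarrow> sat std \<nu> B" for x using HA_exE.IH[of "case_nat x \<nu>"] by simp
    then show ?case by auto
  qed (auto simp: sat_finst)
qed

interpretation std: pa_model std by (rule pa_model_std)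

lemma std_num [simp]: "std.num n = n"
  by (induction n) auto

lemmas std_codes = std.num_codes[unfolded std_num]

section \<open>Codes and judgements in the standard model\<close>

lemma code_cases:
  "tcode u = std.mk1 k a \<longleftrightarrow> (case u of Var i \<Rightarrow> k = 0 \<and> a = i | Zero \<Rightarrow> k = Suc 0 \<and> a = 0 |
    Succ v \<Rightarrow> k = 2 \<and> a = tcode v | Plus v w \<Rightarrow> k = 3 \<and> a = std.pr (tcode v) (tcode w) |
    Times v w \<Rightarrow> k = 4 \<and> a = std.pr (tcode v) (tcode w))"
  "tcode u = std.mk2 k a b \<longleftrightarrow> (case u of Var i \<Rightarrow> k = 0 \<and> i = std.pr a b | Zero \<Rightarrow> k = Suc 0 \<and> std.pr a b = 0 |
    Succ v \<Rightarrow> k = 2 \<and> std.pr a b = tcode v | Plus v w \<Rightarrow> k = 3 \<and> a = tcode v \<and> b = tcode w |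
    Times v w \<Rightarrow> k = 4 \<and> a = tcode v \<and> b = tcode w)"
  "fcode A = std.mk1 k a \<longleftrightarrow> (case A of Eq u v \<Rightarrow> k = 5 \<and> a = std.pr (tcode u) (tcode v) |
    Bot \<Rightarrow> k = 6 \<and> a = 0 | And B B' \<Rightarrow> k = 7 \<and> a = std.pr (fcode B) (fcode B') |
    Or B B' \<Rightarrow> k = 8 \<and> a = std.pr (fcode B) (fcode B') | Imp B B' \<Rightarrow> k = 9 \<and> a = std.pr (fcode B) (fcode B') |
    Forall B \<Rightarrow> k = 10 \<and> a = fcode B | Exists B \<Rightarrow> k = 11 \<and> a = fcode B)"
  "fcode A = std.mk2 k a b \<longleftrightarrow> (case A of Eq u v \<Rightarrow> k = 5 \<and> a = tcode u \<and> b = tcode v |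
    Bot \<Rightarrow> k = 6 \<and> std.pr a b = 0 | And B B' \<Rightarrow> k = 7 \<and> a = fcode B \<and> b = fcode B' |
    Or B B' \<Rightarrow> k = 8 \<and> a = fcode B \<and> b = fcode B' | Imp B B' \<Rightarrow> k = 9 \<and> a = fcode B \<and> b = fcode B' |
    Forall B \<Rightarrow> k = 10 \<and> std.pr a b = fcode B | Exists B \<Rightarrow> k = 11 \<and> std.pr a b = fcode B)"
proof -
  show "tcode u = std.mk1 k a \<longleftrightarrow> (case u of Var i \<Rightarrow> k = 0 \<and> a = i | Zero \<Rightarrow> k = Suc 0 \<and> a = 0 |
    Succ v \<Rightarrow> k = 2 \<and> a = tcode v | Plus v w \<Rightarrow> k = 3 \<and> a = std.pr (tcode v) (tcode w) |
    Times v w \<Rightarrow> k = 4 \<and> a = std.pr (tcode v) (tcode w))"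
    by (cases u) (auto simp: std_codes)
  show "tcode u = std.mk2 k a b \<longleftrightarrow> (case u of Var i \<Rightarrow> k = 0 \<and> i = std.pr a b | Zero \<Rightarrow> k = Suc 0 \<and> std.pr a b = 0 |
    Succ v \<Rightarrow> k = 2 \<and> std.pr a b = tcode v | Plus v w \<Rightarrow> k = 3 \<and> a = tcode v \<and> b = tcode w |
    Times v w \<Rightarrow> k = 4 \<and> a = tcode v \<and> b = tcode w)"
    by (cases u) (auto simp: std_codes)
  show "fcode A = std.mk1 k a \<longleftrightarrow> (case A of Eq u v \<Rightarrow> k = 5 \<and> a = std.pr (tcode u) (tcode v) |
    Bot \<Rightarrow> k = 6 \<and> a = 0 | And B B' \<Rightarrow> k = 7 \<and> a = std.pr (fcode B) (fcode B') |
    Or B B' \<Rightarrow> k = 8 \<and> a = std.pr (fcode B) (fcode B') | Imp B B' \<Rightarrow> k = 9 \<and> a = std.pr (fcode B) (fcode B') |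
    Forall B \<Rightarrow> k = 10 \<and> a = fcode B | Exists B \<Rightarrow> k = 11 \<and> a = fcode B)"
    by (cases A) (auto simp: std_codes)
  show "fcode A = std.mk2 k a b \<longleftrightarrow> (case A of Eq u v \<Rightarrow> k = 5 \<and> a = tcode u \<and> b = tcode v |
    Bot \<Rightarrow> k = 6 \<and> std.pr a b = 0 | And B B' \<Rightarrow> k = 7 \<and> a = fcode B \<and> b = fcode B' |
    Or B B' \<Rightarrow> k = 8 \<and> a = fcode B \<and> b = fcode B' | Imp B B' \<Rightarrow> k = 9 \<and> a = fcode B \<and> b = fcode B' |
    Forall B \<Rightarrow> k = 10 \<and> std.pr a b = fcode B | Exists B \<Rightarrow> k = 11 \<and> std.pr a b = fcode B)"
    by (cases A) (auto simp: std_codes)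
qed

lemma tcode_inject [simp]: "tcode s = tcode t \<longleftrightarrow> s = t"
  by (induction s arbitrary: t) (case_tac t; auto simp: std_codes)+

lemma fcode_inject [simp]: "fcode A = fcode B \<longleftrightarrow> A = B"
  by (induction A arbitrary: B) (case_tac B; auto simp: std_codes)+

text \<open>The clauses for \<open>SUB\<close> do not require that \<open>t\<close> or the third
  component codes an expression, so correctness is claimed only on condition that they do.\<close>

definition sub_ok :: "nat \<Rightarrow> nat \<Rightarrow> nat \<Rightarrow> nat \<Rightarrow> nat \<Rightarrow> bool" where
  "sub_ok d t e a b \<longleftrightarrow> (\<forall>t0. t = tcode t0 \<longrightarrow>
    (\<forall>u. a = tcode u \<longrightarrow> b = tcode (tsubst (sub_at d t0 e) u)) \<and>
    (\<forall>A. a = fcode A \<longrightarrow> b = fcode (fsubst (sub_at d t0 e) A)))"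

text \<open>The intended truth of each kind of judgement. Heights in the standard model are actual
  numbers, so it is preserved along derivations by induction from outside.\<close>

definition meaning :: "nat \<Rightarrow> bool" where
  "meaning x \<longleftrightarrow> (\<forall>n a. x = std.mk2 0 n a \<longrightarrow> a = tcode (numeral_trm n)) \<and>
    (\<forall>a. x = std.mk1 (Suc 0) a \<longrightarrow> (\<exists>t. a = tcode t)) \<and>
    (\<forall>a. x = std.mk1 2 a \<longrightarrow> (\<exists>A. a = fcode A)) \<and>
    (\<forall>d t e a b. x = std.mk2 3 (std.pr d (std.pr t e)) (std.pr a b) \<longrightarrow> sub_ok d t e a b) \<and>
    (\<forall>a. x = std.mk1 4 a \<longrightarrow> (\<exists>A. a = fcode A \<and> HA A))"

lemma meaning_simps [simp]:
  "meaning (std.mk2 0 n a) \<longleftrightarrow> a = tcode (numeral_trm n)"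
  "meaning (std.mk1 (Suc 0) a) \<longleftrightarrow> (\<exists>t. a = tcode t)"
  "meaning (std.mk1 2 a) \<longleftrightarrow> (\<exists>A. a = fcode A)"
  "meaning (std.mk2 3 (std.pr d (std.pr t e)) (std.pr a b)) \<longleftrightarrow> sub_ok d t e a b"
  "meaning (std.mk1 4 a) \<longleftrightarrow> (\<exists>A. a = fcode A \<and> HA A)"
  unfolding meaning_def by auto

lemma sub_ok_trm: "sub_ok d (tcode t) e (tcode u) b \<longleftrightarrow> b = tcode (tsubst (sub_at d t e) u)"
proof -
  have "tcode u \<noteq> fcode A" for A by (cases u; cases A) (auto simp: std_codes)
  then show ?thesis by (auto simp: sub_ok_def)
qed

lemma sub_ok_fm: "sub_ok d (tcode t) e (fcode A) b \<longleftrightarrow> b = fcode (fsubst (sub_at d t e) A)"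
proof -
  have "fcode A \<noteq> tcode u" for u by (cases u; cases A) (auto simp: std_codes)
  then show ?thesis by (auto simp: sub_ok_def)
qed

lemma sub_ok_rules:
  "sub_ok (Suc (i + d)) t e (std.mk1 0 i) (std.mk1 0 i)" "sub_ok d t e (std.mk1 0 d) t"
  "sub_ok d t e (std.mk1 0 (Suc (d + i))) (std.mk1 0 (d + i + e))"
  "sub_ok d t e (std.mk1 (Suc 0) 0) (std.mk1 (Suc 0) 0)" "sub_ok d t e (std.mk1 6 0) (std.mk1 6 0)"
  "sub_ok d t e a b \<Longrightarrow> sub_ok d t e (std.mk1 2 a) (std.mk1 2 b)"
  "sub_ok d t e a a' \<Longrightarrow> sub_ok d t e b b' \<Longrightarrow> k \<in> {3, 4, 5, 7, 8, 9} \<Longrightarrow>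
    sub_ok d t e (std.mk2 k a b) (std.mk2 k a' b')"
  by (fastforce simp: sub_ok_def code_cases sub_at_def std_codes eq_commute[of "std.mk1 _ _"]
      eq_commute[of "std.mk2 _ _ _"] split: trm.splits fm.splits)+

lemma sub_ok_quantifier:
  assumes "sub_ok 0 (tcode (Var (Suc 0))) 2 t u" "sub_ok (Suc d) u e a b" "k \<in> {10, 11}"
  shows "sub_ok d t e (std.mk1 k a) (std.mk1 k b)"
  unfolding sub_ok_def
proof (intro allI impI conjI)
  fix t0 v assume "std.mk1 k a = tcode v"
  then show "std.mk1 k b = tcode (tsubst (sub_at d t0 e) v)"
    using assms(3) by (cases v) (auto simp: std_codes)
next
  fix t0 A assume t: "t = tcode t0" and A: "std.mk1 k a = fcode A"
  have u: "u = tcode (tlift t0)"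
    using assms(1) sub_at_cases(1) unfolding t by (simp add: sub_ok_trm)
  from A assms(3) obtain B where B: "a = fcode B" "k = 10 \<and> A = Forall B \<or> k = 11 \<and> A = Exists B"
    by (cases A) (auto simp: std_codes)
  then have "b = fcode (fsubst (up (sub_at d t0 e)) B)"
    using assms(2) unfolding u B(1) by (simp only: sub_ok_fm up_sub_at)
  then show "std.mk1 k b = fcode (fsubst (sub_at d t0 e) A)" using B(2) by (auto simp: std_codes)
qed

lemma sub_ok_inst:
  "sub_ok 0 (tcode t) 0 (fcode A) b \<longleftrightarrow> b = fcode (finst t A)"
  "sub_ok 0 (tcode (Var (Suc 0))) 2 (fcode A) b \<longleftrightarrow> b = fcode (flift A)"
  "sub_ok 0 (tcode (Succ (Var 0))) (Suc 0) (fcode A) b \<longleftrightarrow> b = fcode (fsucc A)"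
  using sub_at_cases by (simp_all add: sub_ok_fm)

lemma meaning_clause:
  assumes "c \<in> set (syntax_clauses @ HA_clauses)" "\<And>b. b \<in> set (snd c) \<Longrightarrow> meaning (tval std \<nu> b)"
  shows "meaning (tval std \<nu> (fst c))"
proof -
  have fold: "std.mk1 0 n = tcode (Var n)" "std.mk1 (Suc 0) 0 = tcode Zero"
    "std.mk1 2 (tcode t) = tcode (Succ t)" "std.mk2 3 (tcode s) (tcode t) = tcode (Plus s t)"
    "std.mk2 4 (tcode s) (tcode t) = tcode (Times s t)"
    "std.mk2 5 (tcode s) (tcode t) = fcode (Eq s t)" "std.mk1 6 0 = fcode Bot"
    "std.mk2 7 (fcode A) (fcode B) = fcode (And A B)" "std.mk2 8 (fcode A) (fcode B) = fcode (Or A B)"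
    "std.mk2 9 (fcode A) (fcode B) = fcode (Imp A B)" "std.mk1 10 (fcode A) = fcode (Forall A)"
    "std.mk1 11 (fcode A) = fcode (Exists A)" for n s t A B
    by (simp_all add: std_codes)
  have 1: "\<forall>c\<in>set syntax_clauses. case c of (h, bs) \<Rightarrow>
    list_all (\<lambda>b. meaning (tval std \<nu> b)) bs \<longrightarrow> meaning (tval std \<nu> h)"
    unfolding syntax_clauses_def Let_def
    by (simp add: sub_ok_rules) (intro conjI impI; (elim conjE exE)?;
        (rule sub_ok_quantifier[of _ "\<nu> 8"])?; simp add: fold)
  have mp: "\<exists>B. b = fcode B \<and> HA B" if "std.mk2 9 (fcode A) b = fcode D" "HA D" "HA A" for A b D
    using that by (cases D) (auto simp: std_codes intro: HA_mp)
  have allI: "\<exists>B. std.mk2 9 (fcode A) (std.mk1 10 b) = fcode B \<and> HA B"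
    if c: "std.mk2 9 (fcode (flift A)) b = fcode D" "HA D" for A b D
  proof -
    obtain B where "D = Imp (flift A) B" "b = fcode B" using c(1) by (cases D) (auto simp: std_codes)
    then show ?thesis using c(2) HA_allI by (intro exI[of _ "Imp A (Forall B)"]) (simp add: std_codes)
  qed
  have exE: "\<exists>B. std.mk2 9 (std.mk1 11 a) (fcode A) = fcode B \<and> HA B"
    if c: "std.mk2 9 a (fcode (flift A)) = fcode D" "HA D" for A a D
  proof -
    obtain B where "D = Imp B (flift A)" "a = fcode B" using c(1) by (cases D) (auto simp: std_codes)
    then show ?thesis using c(2) HA_exE by (intro exI[of _ "Imp (Exists B) A"]) (simp add: std_codes)
  qed
  have 2: "\<forall>c\<in>set HA_clauses. case c of (h, bs) \<Rightarrow>
    list_all (\<lambda>b. meaning (tval std \<nu> b)) bs \<longrightarrow> meaning (tval std \<nu> h)"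
    unfolding HA_clauses_def Let_def
    apply (simp add: ball_Un)
    apply (intro conjI impI ballI)
    apply (clarsimp simp: fold sub_ok_inst HA_K HA_S HA_andE1 HA_andE2 HA_andI HA_orI1 HA_orI2 HA_orE HA_botE
          HA_allE HA_exI HA_eq_refl HA_eq_subst HA_ind)+
      apply (rule mp; assumption)
     apply (clarsimp simp: fold sub_ok_inst, rule allI; assumption)
    apply (clarsimp simp: fold sub_ok_inst, rule exE; assumption)
    by (rule HA_arith)
  show ?thesis using 1 2 assms by (fastforce simp: list_all_iff)
qed

lemma std_DER_meaning: "std.DER x \<Longrightarrow> meaning x"
proof -
  have "std.DerH r x \<Longrightarrow> meaning x" for r x
  proof (induction r arbitrary: x)
    case 0 then show ?case by (rule std.DerH_cases) simp
  next
    case (Suc r)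
    from Suc.prems obtain c \<nu> where "c \<in> set (syntax_clauses @ HA_clauses)" "x = tval std \<nu> (fst c)"
      "\<And>b. b \<in> set (snd c) \<Longrightarrow> std.DerH r (tval std \<nu> b)" by (rule std.DerH_cases) auto
    then show ?case using meaning_clause Suc.IH by blast
  qed
  then show "std.DER x \<Longrightarrow> meaning x" unfolding std.DER_def by blast
qed

text \<open>For a closed formula the instantiated code is its ordinary code, and derivable
  judgements in the standard model mean what they say. This is needed for the consistency of the
  root sentence.\<close>

theorem std_Box_sound: assumes "sat std \<nu> (Box A)" "ffree A = {}" shows "HA A"
proof -
  have "std.cinst \<nu> A = std.num (fcode A)"
    unfolding std.cinst_def std.num_code(2)[where d = 0] by (rule std.cfm_cong(2)) (use assms(2) in auto)
  then have "meaning (std.mk1 4 (fcode A))"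
    using assms(1) std_DER_meaning by (simp add: std.sat_Box std.PR_def del: meaning_simps)
  then show ?thesis by simp
qed

section \<open>Stages of existential formulas\<close>

abbreviation skip :: "fm \<Rightarrow> fm" where "skip \<equiv> fsubst (up (\<lambda>i. Var (Suc i)))"

lemma sat_skip [simp]: "sat M (case_nat x (case_nat y \<nu>)) (skip A) = sat M (case_nat x \<nu>) A"
  by (simp add: sat_fsubst tval_up)

text \<open>A single number bounding all existential witnesses replaces them; it serves as the stage
  at which the truth of \<open>P\<close> is noticed. Sums provide such a bound.\<close>

lemma sigma_stage_exists: "sigma P \<Longrightarrow> \<exists>D. delta0 D \<and> HA (Iff P (Exists D))"
proof (induction rule: sigma.induct)
  case (sigma_delta0 A)
  have "HA (Iff A (Exists (flift A)))"
    by (rule sigma_transfer_Iff) (auto intro: sigma.intros sigma_delta0 delta0_fsubst simp: flift_def sat_fsubst)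
  then show ?case using delta0_fsubst[OF sigma_delta0] unfolding flift_def by blast
next
  case (sigma_And A B)
  then obtain D E where D: "delta0 D" "HA (Iff A (Exists D))" and E: "delta0 E" "HA (Iff B (Exists E))" by blast
  let ?F = "And (BEx (Var 0) (skip D)) (BEx (Var 0) (skip E))"
  have d: "delta0 ?F" by (intro delta0_And delta0_Bex delta0_fsubst D E)
  have "HA (Iff (And A B) (Exists ?F))"
  proof (rule sigma_transfer_Iff)
    fix M \<nu> assume M: "pa_model M"
    then interpret pa_model M .
    have 1: "sat M \<nu> A \<longleftrightarrow> (\<exists>x. sat M (case_nat x \<nu>) D)" "sat M \<nu> B \<longleftrightarrow> (\<exists>x. sat M (case_nat x \<nu>) E)"
      using HA_sound[OF D(2), of \<nu>] HA_sound[OF E(2), of \<nu>] by auto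
    show "sat M \<nu> (And A B) \<longleftrightarrow> sat M \<nu> (Exists ?F)"
      by (simp add: 1) (metis le_plus1 le_plus2)
  qed (rule sigma.sigma_Exists[OF sigma.sigma_delta0[OF d]] sigma.sigma_And sigma_And.hyps)+
  then show ?case using d by blast
next
  case (sigma_Or A B)
  then obtain D E where D: "delta0 D" "HA (Iff A (Exists D))" and E: "delta0 E" "HA (Iff B (Exists E))" by blast
  have d: "delta0 (Or D E)" by (intro delta0_Or D E)
  have "HA (Iff (Or A B) (Exists (Or D E)))"
  proof (rule sigma_transfer_Iff)
    fix M \<nu> assume "pa_model M"
    then interpret pa_model M .
    show "sat M \<nu> (Or A B) \<longleftrightarrow> sat M \<nu> (Exists (Or D E))"
      using HA_sound[OF D(2), of \<nu>] HA_sound[OF E(2), of \<nu>] by auto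
  qed (auto intro: sigma.intros sigma_Or.hyps d)
  then show ?case using d by blast
next
  case (sigma_Exists A)
  then obtain D where D: "delta0 D" "HA (Iff A (Exists D))" by blast
  let ?F = "BEx (Var 0) (BEx (Var 1) (fsubst (up (up (\<lambda>i. Var (Suc i)))) D))"
  have d: "delta0 ?F" by (intro delta0_Bex delta0_fsubst D)
  have "HA (Iff (Exists A) (Exists ?F))"
  proof (rule sigma_transfer_Iff)
    fix M \<nu> assume "pa_model M"
    then interpret pa_model M .
    have 1: "sat M \<nu>' A \<longleftrightarrow> (\<exists>x. sat M (case_nat x \<nu>') D)" for \<nu>'
      using HA_sound[OF D(2), of \<nu>'] by auto
    show "sat M \<nu> (Exists A) \<longleftrightarrow> sat M \<nu> (Exists ?F)"
      by (simp add: 1 sat_fsubst tval_up) (metis le_plus1 le_plus2)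
  qed (rule sigma.sigma_Exists[OF sigma.sigma_delta0[OF d]] sigma.sigma_Exists[OF sigma_Exists.hyps])+
  then show ?case using d by blast
next
  case (sigma_equiv A B)
  then obtain D where D: "delta0 D" "HA (Iff A (Exists D))" by blast
  have "HA (Iff B (Exists D))"
    by (rule HA_IffI) (simp_all only: entails_Iff[OF sigma_equiv.hyps(2), symmetric] entails_Iff[OF D(2)])
  then show ?case using D(1) by blast
qed

lemma sigma_stage: assumes "sigma P"
  obtains D where "delta0 D" "HA (Iff P (Exists D))" "\<And>i. Suc i \<in> ffree D \<Longrightarrow> i \<in> ffree P"
proof -
  obtain D where D: "delta0 D" "HA (Iff P (Exists D))" using sigma_stage_exists[OF assms] by blast
  \<comment> \<open>Closure under equivalence may bring stray parameters into \<open>D\<close>.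
    Replacing by zero everything that is not free in \<open>P\<close> removes them and leaves
    \<open>P\<close> unchanged.\<close>
  let ?\<tau> = "\<lambda>i. if i \<in> ffree P then Var i else Zero"
  have "fsubst ?\<tau> P = P" by (rule fsubst_idem) simp
  then have "HA (Iff P (Exists (fsubst (up ?\<tau>) D)))" using HA_fsubst[OF D(2), of ?\<tau>] by simp
  moreover have "i \<in> ffree P" if i: "Suc i \<in> ffree (fsubst (up ?\<tau>) D)" for i
  proof -
    obtain j where "j \<in> ffree D" "Suc i \<in> tfree (up ?\<tau> j)" using i unfolding ffree_fsubst by blast
    then show ?thesis by (cases j) (auto simp: tfree_tlift split: if_splits)
  qed
  ultimately show ?thesis using that D(1) delta0_fsubst by blast
qed

section \<open>A Solovay construction on trees\<close>

text \<open>The refutation of the limit at the child \<open>u\<close> is the earliest among the children; ties are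
  resolved in favour of the smaller child. Unlike in Solovay's function, the stage at which the
  parent is reached plays no role.\<close>

definition First :: "(nat \<Rightarrow> fm) \<Rightarrow> nat list \<Rightarrow> nat \<Rightarrow> fm" where
  "First D us u = Exists (And (D u) (Conj (map (\<lambda>w.
    if w < u then BAll (Var 0) (Neg (skip (D w)))
    else if u < w then BAll (Var 0) (Imp (Le (Succ (Var 0)) (Var 1)) (Neg (skip (D w))))
    else Verum) us)))"

text \<open>A node lists the moves leading to it, the latest move first; \<open>u # x\<close> is the
  child \<open>u\<close> of \<open>x\<close>. Reaching a node is thus a conjunction along its
  path.\<close>

fun reach :: "(nat list \<Rightarrow> fm) \<Rightarrow> (nat list \<Rightarrow> nat list) \<Rightarrow> nat list \<Rightarrow> fm" where
  "reach D ch [] = Verum"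
| "reach D ch (u # x) = And (reach D ch x) (First (\<lambda>w. D (w # x)) (ch x) u)"

definition limit :: "(nat list \<Rightarrow> fm) \<Rightarrow> (nat list \<Rightarrow> nat list) \<Rightarrow> nat list \<Rightarrow> fm" where
  "limit D ch x = And (reach D ch x) (Conj (map (\<lambda>u. Neg (Exists (D (u # x)))) (ch x)))"

lemma fsubst_Conj: "fsubst \<sigma> (Conj As) = Conj (map (fsubst \<sigma>) As)"
  unfolding Conj_def by (induction As) auto

lemma fsubst_Disj: "fsubst \<sigma> (Disj As) = Disj (map (fsubst \<sigma>) As)"
  unfolding Disj_def by (induction As) auto

lemma fsubst_up_skip: "fsubst (up (up \<sigma>)) (skip A) = skip (fsubst (up \<sigma>) A)"
  by (simp add: fsubst_fsubst up_comp tlift_def)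

lemma fsubst_First: "fsubst \<sigma> (First D us u) = First (\<lambda>w. fsubst (up \<sigma>) (D w)) us u"
  by (simp add: First_def fsubst_Conj) (rule arg_cong[of _ _ Conj], auto simp: fsubst_up_skip)

lemma fsubst_limit: "fsubst \<sigma> (limit D ch x) = limit (\<lambda>y. fsubst (up \<sigma>) (D y)) ch x"
proof -
  have "fsubst \<sigma> (reach D ch x) = reach (\<lambda>y. fsubst (up \<sigma>) (D y)) ch x"
    by (induction x) (auto simp: fsubst_First)
  then show ?thesis by (simp add: limit_def fsubst_Conj comp_def)
qed

lemma sigma_First: "(\<And>w. delta0 (D w)) \<Longrightarrow> sigma (First D us u)"
  unfolding First_def
  by (intro sigma_Exists sigma_delta0 delta0_And delta0_Conj)
    (auto intro!: delta0_Ball[of _ "Var 0", simplified] delta0_Imp delta0_Le delta0_fsubst delta0_Bot)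

lemma sigma_reach: "(\<And>y. delta0 (D y)) \<Longrightarrow> sigma (reach D ch x)"
  by (induction x) (auto intro: sigma_First sigma_And sigma_Verum)

lemma sigma_Disj: "(\<And>A. A \<in> set As \<Longrightarrow> sigma A) \<Longrightarrow> sigma (Disj As)"
  unfolding Disj_def by (induction As) (auto intro: sigma_Or sigma_delta0 delta0_Bot)

lemma entails_Conj: "G \<turnstile> Conj As \<longleftrightarrow> (\<forall>A\<in>set As. G \<turnstile> A)"
  unfolding Conj_def by (induction As) auto

lemma entails_DisjI: "A \<in> set As \<Longrightarrow> G \<turnstile> A \<Longrightarrow> G \<turnstile> Disj As"
  unfolding Disj_def by (induction As) (auto intro: entails_OrI1 entails_OrI2)

lemma entails_DisjE: "G \<turnstile> Disj As \<Longrightarrow> (\<And>A. A \<in> set As \<Longrightarrow> insert A G \<turnstile> B) \<Longrightarrow> G \<turnstile> B"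
proof (induction As arbitrary: G)
  case Nil then show ?case by (auto simp: Disj_def intro: entails_botE)
next
  case (Cons A As)
  have "insert (Disj As) G \<turnstile> B"
  proof (rule Cons.IH)
    show "insert (Disj As) G \<turnstile> Disj As" by simp
    fix A' assume "A' \<in> set As"
    then have "insert A' G \<turnstile> B" using Cons.prems(2) by simp
    then show "insert A' (insert (Disj As) G) \<turnstile> B" by (rule entails_mono) auto
  qed
  moreover have "insert A G \<turnstile> B" using Cons.prems(2) by simp
  moreover have "G \<turnstile> Or A (Disj As)" using Cons.prems(1) by (simp add: Disj_def)
  ultimately show ?case using entails_OrE by blast
qed

text \<open>\<open>refutes i\<close> says of the code in variable 0 that the formula obtained by replacing its
  variables 0 and 1 by its own numeral and the numeral of \<open>i\<close> is refutable.\<close>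

definition refutes :: "nat \<Rightarrow> fm" where
  "refutes i = Exists (Exists (Exists
    (And (Der (tag2 0 (Var 3) (Var 2)))
    (And (Der (tag2 3 (pair_trm Zero (pair_trm (Var 2) Zero)) (pair_trm (Var 3) (Var 1))))
    (And (Der (tag2 3 (pair_trm Zero (pair_trm (numeral_trm (tcode (numeral_trm i))) Zero)) (pair_trm (Var 1) (Var 0))))
      (Der (tag1 4 (tag2 9 (Var 0) (tag1 6 Zero)))))))))"

lemma sigma_refutes: "sigma (refutes i)"
  unfolding refutes_def by (intro sigma_Exists sigma_And sigma_Der)

lemma ffree_refutes: "ffree (refutes i) \<subseteq> {0}"
proof -
  have "ffree (Der (tag2 0 (Var 3) (Var 2))) \<subseteq> {3, 2}"
    "ffree (Der (tag2 3 (pair_trm Zero (pair_trm (Var 2) Zero)) (pair_trm (Var 3) (Var 1)))) \<subseteq> {1, 2, 3}"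
    "ffree (Der (tag2 3 (pair_trm Zero (pair_trm (numeral_trm (tcode (numeral_trm i))) Zero)) (pair_trm (Var 1) (Var 0)))) \<subseteq> {0, 1}"
    "ffree (Der (tag1 4 (tag2 9 (Var 0) (tag1 6 Zero)))) \<subseteq> {0}"
    by (rule subset_trans[OF ffree_Der]; auto)+
  then show ?thesis unfolding refutes_def by (auto simp: eval_nat_numeral)
qed

lemma (in pa_model) ctm_numeral: "ctm d \<sigma> (numeral_trm n) = numc (num n)"
  by (induction n) auto

lemma (in pa_model) numc_num: "numc (num n) = num (tcode (numeral_trm n))"
  by (induction n) auto

abbreviation self_inst :: "fm \<Rightarrow> nat \<Rightarrow> nat \<Rightarrow> trm" where
  "self_inst A i \<equiv> case_nat (numeral_trm (fcode A)) (\<lambda>_. numeral_trm i)"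

text \<open>The diagonal lemma in the required form: once the code of \<open>A\<close> is inserted,
  \<open>refutes i\<close> speaks of the instance of \<open>A\<close> at its own code and at
  \<open>i\<close>.\<close>

lemma HA_refutes:
  assumes "ffree A \<subseteq> {0, 1}"
  shows "HA (Iff (fsubst (\<lambda>_. numeral_trm (fcode A)) (refutes i)) (Box (Neg (fsubst (self_inst A i) A))))"
proof (rule sigma_transfer_Iff)
  fix M \<nu> assume "pa_model M"
  then interpret pa_model M .
  let ?f = "num (fcode A)"
  let ?ws = "[?f, num i]"
  have slots: "numeral_slots Free" "numeral_slots (inst_slots ?f Free)"
    by (auto simp: numeral_slots_def inst_slots_def split: nat.splits)
  have "cinst \<nu> (fsubst (self_inst A i) A) = cinst (case_nat ?f (\<lambda>_. num i)) A"
    by (rule cinst_fsubst) (auto simp: ctm_numeral split: nat.splits)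
  also have "\<dots> = cfm 0 (fold inst_slots ?ws Free) A"
    by (rule cfm_fold[symmetric]) (use assms in \<open>auto simp: less_Suc_eq\<close>)
  finally have c: "cinst \<nu> (fsubst (self_inst A i) A) = cfm 0 (inst_slots (num i) (inst_slots ?f Free)) A"
    by simp
  have s1: "INSTj (numc ?f) ?f a \<longleftrightarrow> a = cfm 0 (inst_slots ?f Free) A" for a
    using SUB_cfm[OF slots(1), of 0 ?f A a] by (simp add: num_code[where d = 0])
  have s2: "INSTj (num (tcode (numeral_trm i))) (cfm 0 (inst_slots ?f Free) A) b \<longleftrightarrow>
    b = cfm 0 (inst_slots (num i) (inst_slots ?f Free)) A" for b
    using SUB_cfm[OF slots(2), of 0 "num i" A b] by (simp add: numc_num)
  have "sat M \<nu> (fsubst (\<lambda>_. numeral_trm (fcode A)) (refutes i)) \<longleftrightarrow>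
    PRVj (mk2 9 (cfm 0 (inst_slots (num i) (inst_slots ?f Free)) A) (mk1 6 (ip_zero M)))"
    unfolding sat_fsubst refutes_def
    by (simp add: sat_Der NUM_iff s1 s2 del: numeral_trm.simps)
  also have "\<dots> \<longleftrightarrow> sat M \<nu> (Box (Neg (fsubst (self_inst A i) A)))"
    unfolding sat_Box PR_def c[symmetric] by (simp add: cinst_def)
  finally show "sat M \<nu> (fsubst (\<lambda>_. numeral_trm (fcode A)) (refutes i)) \<longleftrightarrow>
    sat M \<nu> (Box (Neg (fsubst (self_inst A i) A)))" .
qed (auto intro: sigma_fsubst sigma_refutes sigma_Box)

text \<open>The empty list is an additional node whose only child is the root of the Kripke model.
  It is the starting position of the walk, like the world 0 of Solovay, and does not count as a
  world.\<close>

locale tree =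
  fixes nodes :: "nat list list" and ch :: "nat list \<Rightarrow> nat list" and root :: nat
  assumes Nil_node: "[] \<in> set nodes"
    and node_Cons: "u # x \<in> set nodes \<longleftrightarrow> x \<in> set nodes \<and> u \<in> set (ch x)"
    and ch_Nil: "ch [] = [root]"
begin

text \<open>The sentences of all nodes refer to one another. A single diagonal formula with an
  argument for the node provides the simultaneous fixed point.\<close>

theorem solovay_sentences:
  obtains D lam where "\<And>x. delta0 (D x)" "\<And>x. ffree (lam x) = {}"
    "\<And>x. x \<in> set nodes \<Longrightarrow> HA (Iff (lam x) (limit D ch x))"
    "\<And>x. HA (Iff (Exists (D x)) (Box (Neg (lam x))))"
proof -
  have "\<exists>E. delta0 E \<and> HA (Iff (refutes i) (Exists E)) \<and> ffree E \<subseteq> {0, 1}" for i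
  proof -
    obtain E where E: "delta0 E" "HA (Iff (refutes i) (Exists E))"
      "\<And>j. Suc j \<in> ffree E \<Longrightarrow> j \<in> ffree (refutes i)"
      using sigma_stage[OF sigma_refutes] by metis
    have "j \<in> {0, 1}" if "j \<in> ffree E" for j
      using that E(3)[of "j - 1"] ffree_refutes[of i] by (cases j) auto
    with E(1,2) show ?thesis by blast
  qed
  then obtain E where E: "\<And>i. delta0 (E i)" "\<And>i. HA (Iff (refutes i) (Exists (E i)))"
    "\<And>i. ffree (E i) \<subseteq> {0, 1}" by metis
  let ?n = "to_nat :: nat list \<Rightarrow> nat"
  \<comment> \<open>Variable 0 is reserved for the code of the formula itself; variable 1 holds the
    number of a node and selects the disjunct of that node.\<close>
  define A0 where "A0 = Disj (map (\<lambda>x. And (Eq (Var 1) (numeral_trm (?n x))) (limit (\<lambda>y. E (?n y)) ch x)) nodes)"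
  \<comment> \<open>Zero for all further variables gives the bound on the free variables without
    inspecting the formula.\<close>
  define A where "A = fsubst (\<lambda>i. if i \<in> {0, 1} then Var i else Zero) A0"
  have fA: "ffree A \<subseteq> {0, 1}" by (auto simp: A_def ffree_fsubst split: if_splits)
  let ?F = "numeral_trm (fcode A)"
  define D where "D y = fsubst (up (\<lambda>_. ?F)) (E (?n y))" for y
  define lam where "lam x = fsubst (self_inst A (?n x)) A" for x
  have lam: "lam x = Disj (map (\<lambda>y. And (Eq (numeral_trm (?n x)) (numeral_trm (?n y))) (limit D ch y)) nodes)" for x
  proof -
    let ?\<tau> = "\<lambda>i. if i = 0 then ?F else if i = 1 then numeral_trm (?n x) else Zero"
    have "lam x = fsubst ?\<tau> A0"
      unfolding lam_def A_def fsubst_fsubst by (rule fsubst_cong) (auto split: nat.splits)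
    also have "\<dots> = Disj (map (\<lambda>y. And (Eq (numeral_trm (?n x)) (numeral_trm (?n y)))
      (limit (\<lambda>y. fsubst (up ?\<tau>) (E (?n y))) ch y)) nodes)"
      by (simp add: A0_def fsubst_Disj fsubst_limit comp_def)
    also have "(\<lambda>y. fsubst (up ?\<tau>) (E (?n y))) = D"
      unfolding D_def using E(3)
      by (intro ext fsubst_cong) (fastforce simp: up_def split: nat.splits)
    finally show ?thesis .
  qed
  show ?thesis
  proof (rule that[of D lam])
    show "delta0 (D x)" for x unfolding D_def by (intro delta0_fsubst E)
    show "ffree (lam x) = {}" for x
      unfolding lam_def ffree_fsubst by (auto split: nat.splits)
    show "HA (Iff (lam x) (limit D ch x))" if x: "x \<in> set nodes" for x
    proof (rule HA_IffI)
      fix G assume "G \<turnstile> limit D ch x"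
      then have "G \<turnstile> And (Eq (numeral_trm (?n x)) (numeral_trm (?n x))) (limit D ch x)" by simp
      then show "G \<turnstile> lam x" unfolding lam by (rule entails_DisjI[rotated]) (use x in auto)
    next
      fix G assume "G \<turnstile> lam x"
      then show "G \<turnstile> limit D ch x" unfolding lam
      proof (rule entails_DisjE)
        fix B assume "B \<in> set (map (\<lambda>y. And (Eq (numeral_trm (?n x)) (numeral_trm (?n y))) (limit D ch y)) nodes)"
        then obtain y where B: "B = And (Eq (numeral_trm (?n x)) (numeral_trm (?n y))) (limit D ch y)" by auto
        show "insert B G \<turnstile> limit D ch x"
        proof (cases "y = x")
          case True then show ?thesis unfolding B by simp
        next
          case False
          then have "?n x \<noteq> ?n y" by simp
          show ?thesis unfolding B entails_insert_And
            by (rule numerals_distinct[OF \<open>?n x \<noteq> ?n y\<close>]) simp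
        qed
      qed
    qed
    show "HA (Iff (Exists (D x)) (Box (Neg (lam x))))" for x
    proof -
      have "HA (Iff (fsubst (\<lambda>_. ?F) (refutes (?n x))) (Exists (D x)))"
        using HA_fsubst[OF E(2), of "\<lambda>_. ?F" "?n x"] by (simp add: D_def)
      note * = this HA_refutes[OF fA, of "?n x"]
      show ?thesis unfolding lam_def
        by (rule HA_IffI) (simp_all only: entails_Iff[OF *(1), symmetric] entails_Iff[OF *(2)])
    qed
  qed
qed

end

locale solovay = tree +
  fixes D :: "nat list \<Rightarrow> fm" and lam :: "nat list \<Rightarrow> fm"
  assumes delta0_D: "delta0 (D x)"
    and ffree_lam: "ffree (lam x) = {}"
    and HA_lam: "x \<in> set nodes \<Longrightarrow> HA (Iff (lam x) (limit D ch x))"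
    and HA_D: "HA (Iff (Exists (D x)) (Box (Neg (lam x))))"
begin

abbreviation "sol x \<equiv> reach D ch x"

lemma node_append: "ys @ x \<in> set nodes \<Longrightarrow> x \<in> set nodes"
  by (induction ys) (auto simp: node_Cons)

lemma entails_lam:
  assumes "x \<in> set nodes"
  shows "G \<turnstile> lam x \<longleftrightarrow> G \<turnstile> sol x \<and> (\<forall>u\<in>set (ch x). G \<turnstile> Neg (Exists (D (u # x))))"
  unfolding entails_Iff[OF HA_lam[OF assms]] limit_def entails_And entails_Conj by auto

lemma HA_reach_append: "HA (Imp (sol (ys @ x)) (sol x))"
  by (induction ys) (auto simp: HA_Imp_iff intro: entails_mono)

lemma sat_First: "pa_model M \<Longrightarrow> sat M \<nu> (First D' us u) \<longleftrightarrow>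
  (\<exists>s. sat M (case_nat s \<nu>) (D' u) \<and> (\<forall>w\<in>set us. 
    (w < u \<longrightarrow> (\<forall>t. pa_model.le M t s \<longrightarrow> \<not> sat M (case_nat t \<nu>) (D' w))) \<and>
    (u < w \<longrightarrow> (\<forall>t. pa_model.le M (ip_succ M t) s \<longrightarrow> \<not> sat M (case_nat t \<nu>) (D' w)))))"
proof -
  assume M: "pa_model M"
  then interpret pa_model M .
  have "suc t \<preceq> s \<Longrightarrow> t \<preceq> s" for s t using le_suc le_trans by blast
  then show ?thesis unfolding First_def
    by (simp add: sat_Conj ball_Un) (intro iff_exI conj_cong ball_cong refl; auto)
qed

text \<open>Let u < v be first at the stages s and t. The claim of u excludes t < s, and the claim
  of v excludes s \<le> t because ties favour the smaller child.\<close>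

lemma HA_First_exclusive:
  assumes "u \<in> set us" "v \<in> set us" "u \<noteq> v" "\<And>w. delta0 (D' w)"
  shows "HA (Imp (And (First D' us u) (First D' us v)) Bot)"
proof (rule sigma_transfer)
  fix M \<nu> assume M: "pa_model M"
  then interpret pa_model M .
  have no: "\<not> (sat M \<nu> (First D' us u) \<and> sat M \<nu> (First D' us v))"
    if uv: "u \<in> set us" "v \<in> set us" "u < v" for u v
  proof
    assume "sat M \<nu> (First D' us u) \<and> sat M \<nu> (First D' us v)"
    then have f: "sat M \<nu> (First D' us u)" "sat M \<nu> (First D' us v)" by simp_all
    from f(1)[unfolded sat_First[OF M]] obtain s where s: "sat M (case_nat s \<nu>) (D' u)"
      "\<forall>w\<in>set us. u < w \<longrightarrow> (\<forall>t. le (ip_succ M t) s \<longrightarrow> \<not> sat M (case_nat t \<nu>) (D' w))" by metis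
    from f(2)[unfolded sat_First[OF M]] obtain t where t: "sat M (case_nat t \<nu>) (D' v)"
      "\<forall>w\<in>set us. w < v \<longrightarrow> (\<forall>s. le s t \<longrightarrow> \<not> sat M (case_nat s \<nu>) (D' w))" by metis
    have st: "sat M (case_nat s \<nu>) (D' u)" "sat M (case_nat t \<nu>) (D' v)"
      "\<And>t'. le (ip_succ M t') s \<Longrightarrow> \<not> sat M (case_nat t' \<nu>) (D' v)"
      "\<And>s'. le s' t \<Longrightarrow> \<not> sat M (case_nat s' \<nu>) (D' u)"
      using s t uv by simp_all
    show False using le_or_suc_le[of s t] st by blast
  qed
  assume "sat M \<nu> (And (First D' us u) (First D' us v))"
  then have "sat M \<nu> (First D' us u)" "sat M \<nu> (First D' us v)" by simp_all
  then show "sat M \<nu> Bot"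
    using no[OF assms(1,2)] no[OF assms(2,1)] assms(3) by (metis neqE sat.simps(3))
qed (auto intro: sigma_And sigma_First assms(4) sigma_delta0 delta0_Bot)

text \<open>The least number principle in a model gives the earliest stage at which some child is
  refuted; the smallest child refuted at this stage is first. Both sides are existential, so the
  fact passes to HA.\<close>

lemma HA_First_exists:
  assumes "u \<in> set us" "\<And>w. delta0 (D' w)"
  shows "HA (Imp (Exists (D' u)) (Disj (map (First D' us) us)))"
proof (rule sigma_transfer)
  fix M \<nu> assume M: "pa_model M" and "sat M \<nu> (Exists (D' u))"
  interpret pa_model M by (rule M)
  obtain s0 where s0: "sat M (case_nat s0 \<nu>) (D' u)" using \<open>sat M \<nu> (Exists (D' u))\<close> by auto
  let ?Q = "\<lambda>s. \<exists>w\<in>set us. sat M (\<lambda>i. case_nat s (\<lambda>i. \<nu> i) i) (D' w)"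
  have "\<exists>s. ?Q s \<and> (\<forall>t. le (ip_succ M t) s \<longrightarrow> \<not> ?Q t)"
  proof (rule ccontr)
    assume no: "\<not> ?thesis"
    have "\<not> ?Q s0"
    proof (rule le_induct_Ball[of "\<lambda>s. \<not> ?Q s"])
      show "Df (\<lambda>\<mu>. \<not> (\<exists>w\<in>set us. sat M (\<lambda>i. case_nat (\<mu> 0) (\<lambda>i. \<nu> i) i) (D' w)))"
        by (intro Df_not Df_bex_list Df_sat Df_intros)
      fix x assume "\<And>y. le (ip_succ M y) x \<Longrightarrow> \<not> ?Q y"
      then show "\<not> ?Q x" using no by blast
    qed
    then show False using s0 assms(1) by blast
  qed
  then obtain s where s: "?Q s" "\<And>t. le (ip_succ M t) s \<Longrightarrow> \<not> ?Q t" by blast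
  define w where "w = (LEAST w. w \<in> set us \<and> sat M (case_nat s \<nu>) (D' w))"
  obtain w0 where "w0 \<in> set us \<and> sat M (case_nat s \<nu>) (D' w0)" using s(1) by auto
  then have w: "w \<in> set us \<and> sat M (case_nat s \<nu>) (D' w)" unfolding w_def by (rule LeastI)
  have least: "\<not> sat M (case_nat s \<nu>) (D' v)" if "v < w" "v \<in> set us" for v
    using that not_less_Least unfolding w_def by blast
  have "sat M \<nu> (First D' us w)" unfolding sat_First[OF M]
  proof (intro exI[of _ s] conjI ballI impI allI)
    show "sat M (case_nat s \<nu>) (D' w)" using w by blast
    fix v t assume v: "v \<in> set us"
    show "\<not> sat M (case_nat t \<nu>) (D' v)" if "le (ip_succ M t) s" using s(2)[OF that] v by auto
    show "\<not> sat M (case_nat t \<nu>) (D' v)" if "v < w" "le t s"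
    proof (cases "t = s")
      case True then show ?thesis using least that v by blast
    next
      case False
      then have "le (ip_succ M t) s" using that(2) le_eq_or by blast
      then show ?thesis using s(2) v by auto
    qed
  qed
  then show "sat M \<nu> (Disj (map (First D' us) us))" using w by (auto simp: sat_Disj)
next
  show "sigma (Exists (D' u))" using assms(2) by (intro sigma_Exists sigma_delta0)
  show "sigma (Disj (map (First D' us) us))"
    using assms(2) by (intro sigma_Disj) (auto intro: sigma_First)
qed

lemma entails_sol_D: "G \<turnstile> sol (u # x) \<Longrightarrow> G \<turnstile> Exists (D (u # x))"
proof -
  assume "G \<turnstile> sol (u # x)"
  then have "G \<turnstile> First (\<lambda>w. D (w # x)) (ch x) u" by simp
  moreover have "{First (\<lambda>w. D (w # x)) (ch x) u} \<turnstile> Exists (D (u # x))"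
    unfolding First_def by (rule entails_insert_Exists, rule entails_exI_lifted) simp
  ultimately show ?thesis using HA_Imp_iff entails_HA_mp by blast
qed

text \<open>If one node lies below the other, reaching the lower one contradicts that the walk ends
  at the upper one. Otherwise the paths branch at some node, and two distinct children of it cannot
  both be first.\<close>

lemma HA_lam_exclusive:
  assumes "x \<in> set nodes" "y \<in> set nodes" "x \<noteq> y"
  shows "HA (Imp (And (lam x) (lam y)) Bot)"
proof -
  let ?G = "{lam x, lam y}"
  have l: "?G \<turnstile> lam x" "?G \<turnstile> lam y" by simp_all
  note lx = l(1)[unfolded entails_lam[OF assms(1)]] and ly = l(2)[unfolded entails_lam[OF assms(2)]]
  have desc: "?G \<turnstile> Bot"
    if "b = ys @ u # a" "b \<in> set nodes" "?G \<turnstile> sol b" "\<And>v. v \<in> set (ch a) \<Longrightarrow> ?G \<turnstile> Neg (Exists (D (v # a)))"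
    for a b ys u
  proof -
    have "?G \<turnstile> sol (u # a)" using that(1,3) HA_reach_append entails_HA_mp by blast
    then have "?G \<turnstile> Exists (D (u # a))" by (rule entails_sol_D)
    moreover have "u \<in> set (ch a)" using node_append[of ys "u # a"] that(1,2) node_Cons by blast
    ultimately show ?thesis using that(4) entails_mp by blast
  qed
  consider ys u where "y = ys @ u # x" | ys u where "x = ys @ u # y"
    | z u v xs ys where "x = xs @ u # z" "y = ys @ v # z" "u \<noteq> v"
  proof -
    \<comment> \<open>Nodes list the latest move first, so reversal turns the tree order into the
      prefix order.\<close>
    consider "prefix (rev x) (rev y)" | "prefix (rev y) (rev x)" | "parallel (rev x) (rev y)"
      by (metis prefix_cases strict_prefix_def)
    then show thesis
    proof cases
      case 1
      then obtain zs where "y = rev zs @ x" by (metis prefix_def rev_append rev_rev_ident)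
      with assms(3) show thesis using that(1)[of "rev (tl zs)" "hd zs"] by (cases zs) auto
    next
      case 2
      then obtain zs where "x = rev zs @ y" by (metis prefix_def rev_append rev_rev_ident)
      with assms(3) show thesis using that(2)[of "rev (tl zs)" "hd zs"] by (cases zs) auto
    next
      case 3
      then obtain as b bs c cs where "b \<noteq> c" "rev x = as @ b # bs" "rev y = as @ c # cs"
        using parallel_decomp by blast
      then have "x = rev bs @ b # rev as" "y = rev cs @ c # rev as"
        by (metis append.assoc append_Cons append_Nil rev.simps(2) rev_append rev_rev_ident)+
      then show thesis using that(3) \<open>b \<noteq> c\<close> by blast
    qed
  qed
  then have "?G \<turnstile> Bot"
  proof cases
    case 1 then show ?thesis using desc[OF _ assms(2)] lx ly by blast
  next
    case 2 then show ?thesis using desc[OF _ assms(1)] lx ly by blast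
  next
    case 3
    have nd: "u # z \<in> set nodes" "v # z \<in> set nodes" using 3 assms node_append by blast+
    then have uv: "u \<in> set (ch z)" "v \<in> set (ch z)" using node_Cons by auto
    have "?G \<turnstile> sol (u # z)" "?G \<turnstile> sol (v # z)"
      using lx ly 3 HA_reach_append entails_HA_mp by blast+
    then have "?G \<turnstile> And (First (\<lambda>w. D (w # z)) (ch z) u) (First (\<lambda>w. D (w # z)) (ch z) v)" by simp
    then show ?thesis using entails_HA_mp[OF HA_First_exclusive[of u "ch z" v "\<lambda>w. D (w # z)", OF uv 3(3) delta0_D]] by blast
  qed
  then show ?thesis by (simp add: HA_Imp_iff)
qed

lemma HA_lam_Dia:
  assumes "u # x \<in> set nodes" "G \<turnstile> lam x"
  shows "G \<turnstile> Neg (Box (Neg (lam (u # x))))"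
proof -
  have x: "x \<in> set nodes" "u \<in> set (ch x)" using assms(1) node_Cons by auto
  then have n: "G \<turnstile> Neg (Exists (D (u # x)))" using assms(2) entails_lam[OF x(1)] by blast
  have "insert (Box (Neg (lam (u # x)))) G \<turnstile> Exists (D (u # x))"
    unfolding entails_Iff[OF HA_D] by simp
  moreover have "insert (Box (Neg (lam (u # x)))) G \<turnstile> Neg (Exists (D (u # x)))"
    using n by (rule entails_mono) auto
  ultimately have "insert (Box (Neg (lam (u # x)))) G \<turnstile> Bot" using entails_mp by blast
  then show ?thesis by simp
qed

text \<open>HA does not prove that a reached node is the limit or has a reached child, but to refute
  \<open>B\<close> one may argue as if it did. Under the assumption \<open>B\<close>, a refutation
  at any child would yield a first child, whose being reached refutes \<open>B\<close>; hence there
  is no such refutation, and that is exactly what makes \<open>x\<close> the limit.\<close>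

lemma children_exhausted:
  assumes x: "x \<in> set nodes"
    and ch: "\<And>u. u \<in> set (ch x) \<Longrightarrow> insert (sol (u # x)) G \<turnstile> Neg B"
    and l: "insert (lam x) G \<turnstile> Neg B"
  shows "insert (sol x) G \<turnstile> Neg B"
proof -
  let ?G = "insert B (insert (sol x) G)"
  have "?G \<turnstile> Neg (Exists (D (u # x)))" if u: "u \<in> set (ch x)" for u
  proof -
    let ?H = "insert (Exists (D (u # x))) ?G"
    have "?H \<turnstile> Disj (map (First (\<lambda>w. D (w # x)) (ch x)) (ch x))"
      by (rule entails_HA_mp[OF HA_First_exists[of u _ "\<lambda>w. D (w # x)"]]) (auto simp: u delta0_D)
    then have "?H \<turnstile> Bot"
    proof (rule entails_DisjE)
      fix A assume "A \<in> set (map (First (\<lambda>w. D (w # x)) (ch x)) (ch x))"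
      then obtain v where v: "v \<in> set (ch x)" "A = First (\<lambda>w. D (w # x)) (ch x) v" by auto
      have "insert A ?H \<turnstile> sol (v # x)" using v(2) by (simp add: entails_assm)
      moreover have "insert (sol (v # x)) (insert A ?H) \<turnstile> Neg B"
        using ch[OF v(1)] by (rule entails_mono) auto
      ultimately have "insert A ?H \<turnstile> Neg B" by (rule entails_cut)
      then show "insert A ?H \<turnstile> Bot" by (rule entails_mp) (rule entails_assm, simp)
    qed
    then show ?thesis by simp
  qed
  then have "?G \<turnstile> lam x" unfolding entails_lam[OF x] by (simp del: entails_Imp)
  moreover have "insert (lam x) ?G \<turnstile> Neg B" using l by (rule entails_mono) auto
  ultimately have "?G \<turnstile> Neg B" by (rule entails_cut)
  then have "?G \<turnstile> Bot" by (rule entails_mp) simp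
  then show ?thesis by simp
qed

lemma node_depth: "\<exists>h. \<forall>x\<in>set nodes. length x \<le> h"
  by (meson finite_set finite_imageI finite_nat_set_iff_bounded_le image_eqI)

text \<open>The weak case distinction is iterated from the leaves of the finite tree towards
  \<open>x\<close>.\<close>

lemma sol_refutes:
  assumes "x \<in> set nodes" "\<And>ys. ys @ x \<in> set nodes \<Longrightarrow> insert (lam (ys @ x)) G \<turnstile> Neg B"
  shows "insert (sol x) G \<turnstile> Neg B"
proof -
  obtain h where h: "\<And>x. x \<in> set nodes \<Longrightarrow> length x \<le> h" using node_depth by blast
  show ?thesis using assms
  proof (induction "h - length x" arbitrary: x rule: less_induct)
    case less
    show ?case
    proof (rule children_exhausted[OF less.prems(1)])
      fix u assume "u \<in> set (ch x)"
      then have u: "u # x \<in> set nodes" using less.prems(1) node_Cons by blast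
      have "h - length (u # x) < h - length x" using h[OF u] by simp
      then show "insert (sol (u # x)) G \<turnstile> Neg B"
      proof (rule less.hyps[OF _ u])
        fix ys assume "ys @ u # x \<in> set nodes"
        then show "insert (lam (ys @ u # x)) G \<turnstile> Neg B" using less.prems(2)[of "ys @ [u]"] by simp
      qed
    next
      show "insert (lam x) G \<turnstile> Neg B" using less.prems(2)[of "[]"] less.prems(1) by simp
    qed
  qed
qed

lemma entails_Box_context:
  assumes "G \<turnstile> B" "\<And>A. A \<in> G \<Longrightarrow> H \<turnstile> Box A"
  shows "H \<turnstile> Box B"
proof -
  obtain xs where xs: "set xs \<subseteq> G" "HA (foldr Imp xs B)" using assms(1) unfolding entails_def by blast
  have "H \<turnstile> Box (foldr Imp xs B) \<Longrightarrow> set xs \<subseteq> G \<Longrightarrow> H \<turnstile> Box B"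
  proof (induction xs)
    case (Cons A xs)
    then have "H \<turnstile> Box (foldr Imp xs B)" using entails_Box_mp[of H A] assms(2)[of A] by simp
    then show ?case using Cons by simp
  qed simp
  then show ?thesis using HA_Box_nec[OF xs(2)] entails_HA xs(1) by blast
qed

text \<open>If the walk ends at \<open>x\<close>, then provably \<open>x\<close> has been reached,
  an existential fact. It was reached because \<open>lam x\<close> is refutable, so
  \<open>Neg (lam x)\<close> is provable too. Inside \<open>Box\<close> the walk thus goes beyond
  \<open>x\<close>, and only proper descendants have to be considered. The formulas of
  \<open>G\<close> enter the box because they are existential.\<close>

theorem lam_Box:
  assumes x: "x \<in> set nodes" "x \<noteq> []" and G: "\<And>A. A \<in> G \<Longrightarrow> sigma A"
    and desc: "\<And>ys. ys \<noteq> [] \<Longrightarrow> ys @ x \<in> set nodes \<Longrightarrow> insert (lam (ys @ x)) G \<turnstile> Neg B"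
  shows "insert (lam x) G \<turnstile> Box (Neg B)"
proof -
  let ?H = "insert (lam x) G"
  have "insert (sol x) (insert (Neg (lam x)) G) \<turnstile> Neg B"
  proof (rule children_exhausted[OF x(1)])
    fix u assume "u \<in> set (ch x)"
    then have u: "u # x \<in> set nodes" using x(1) node_Cons by blast
    have "insert (sol (u # x)) G \<turnstile> Neg B"
    proof (rule sol_refutes[OF u])
      fix ys assume "ys @ u # x \<in> set nodes"
      then show "insert (lam (ys @ u # x)) G \<turnstile> Neg B" using desc[of "ys @ [u]"] by simp
    qed
    then show "insert (sol (u # x)) (insert (Neg (lam x)) G) \<turnstile> Neg B" by (rule entails_mono) auto
  next
    show "insert (lam x) (insert (Neg (lam x)) G) \<turnstile> Neg B"
      by (rule entails_botE, rule entails_mp[of _ "lam x"]) (rule entails_assm, simp)+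
  qed
  then show ?thesis
  proof (rule entails_Box_context)
    have "?H \<turnstile> lam x" by simp
    then have s: "?H \<turnstile> sol x" unfolding entails_lam[OF x(1)] by blast
    fix A assume "A \<in> insert (sol x) (insert (Neg (lam x)) G)"
    then consider "A = sol x" | "A = Neg (lam x)" | "A \<in> G" by blast
    then show "?H \<turnstile> Box A"
    proof cases
      case 1
      then show ?thesis using s entails_sigma_Box[OF sigma_reach[of D ch x, OF delta0_D]] by blast
    next
      case 2
      obtain u x' where "x = u # x'" using x(2) by (cases x) auto
      then have "?H \<turnstile> Exists (D x)" using s entails_sol_D by blast
      then show ?thesis unfolding 2 by (simp only: entails_Iff[OF HA_D])
    next
      case 3
      then show ?thesis using entails_sigma_Box[OF G] entails_assm by blast
    qed
  qed
qed

text \<open>Work in the standard model. If \<open>lam\<close> of a reached node is refutable, it is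
  false, so the walk moves on to a child. A child is entered only if its sentence has a refutation,
  and that is a real one by soundness. So the situation repeats one level higher, which is
  impossible in a finite tree.\<close>

theorem lam_root_consistent: "\<not> HA (Neg (lam [root]))"
proof
  assume root: "HA (Neg (lam [root]))"
  obtain h where h: "\<And>x. x \<in> set nodes \<Longrightarrow> length x \<le> h" using node_depth by blast
  define \<nu> :: "nat \<Rightarrow> nat" where "\<nu> = (\<lambda>_. 0)"
  have sat_D: "sat std \<nu> (Exists (D x)) \<longleftrightarrow> HA (Neg (lam x))" for x
  proof -
    have "sat std \<nu> (Exists (D x)) \<longleftrightarrow> sat std \<nu> (Box (Neg (lam x)))"
      using std.HA_sound[OF HA_D[of x], of \<nu>] by auto
    also have "\<dots> \<longleftrightarrow> HA (Neg (lam x))"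
      using std_Box_sound[of \<nu> "Neg (lam x)"] std.HA_sound[OF HA_Box_nec] ffree_lam by auto
    finally show ?thesis .
  qed
  have step: "\<exists>v\<in>set (ch x). sat std \<nu> (sol (v # x))"
    if "sat std \<nu> (sol x)" "u \<in> set (ch x)" "sat std \<nu> (Exists (D (u # x)))" for x u
    using std.HA_sound[OF HA_First_exists[of u "ch x" "\<lambda>w. D (w # x)"], of \<nu>] that delta0_D
    by (auto simp: std.sat_Disj)
  have no: "\<not> HA (Neg (lam x))" if "x \<in> set nodes" "sat std \<nu> (sol x)" for x
    using that
  proof (induction "h - length x" arbitrary: x rule: less_induct)
    case less
    show ?case
    proof
      assume "HA (Neg (lam x))"
      then have "\<not> sat std \<nu> (lam x)" using std.HA_sound[of "Neg (lam x)" \<nu>] by simp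
      then have "\<not> sat std \<nu> (limit D ch x)"
        using std.HA_sound[OF HA_lam[OF less.prems(1)], of \<nu>] by simp
      then obtain u where "u \<in> set (ch x)" "sat std \<nu> (Exists (D (u # x)))"
        using less.prems(2) by (auto simp: limit_def std.sat_Conj)
      then obtain v where v: "v \<in> set (ch x)" "sat std \<nu> (sol (v # x))"
        using step less.prems(2) by blast
      have vn: "v # x \<in> set nodes" using v(1) less.prems(1) node_Cons by blast
      have "sat std \<nu> (First (\<lambda>w. D (w # x)) (ch x) v)" using v(2) by simp
      then have "sat std \<nu> (Exists (D (v # x)))" unfolding First_def by auto
      then have "HA (Neg (lam (v # x)))" unfolding sat_D .
      moreover have "h - length (v # x) < h - length x" using h[OF vn] by simp
      ultimately show False using less.hyps vn v(2) by blast
    qed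
  qed
  have "sat std \<nu> (Exists (D [root]))" using root sat_D by blast
  then have "sat std \<nu> (sol [root])" using step[of "[]" root] by (auto simp: ch_Nil)
  moreover have "[root] \<in> set nodes" using Nil_node node_Cons ch_Nil by simp
  ultimately show False using no root by blast
qed

end

section \<open>Modal completeness\<close>

fun mval :: "(nat \<Rightarrow> nat) \<Rightarrow> (nat \<Rightarrow> nat) \<Rightarrow> mtrm \<Rightarrow> nat" where
  "mval h g (MVar y) = g y"
| "mval h g (MConst c) = h c"

fun force :: "nat list set \<Rightarrow> nat \<Rightarrow> (nat \<Rightarrow> nat) \<Rightarrow> (nat list \<Rightarrow> 'r \<Rightarrow> nat list \<Rightarrow> bool) \<Rightarrow>
    nat list \<Rightarrow> (nat \<Rightarrow> nat) \<Rightarrow> 'r spf \<Rightarrow> bool" where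
  "force N m h I x g STop = True"
| "force N m h I x g (SRel S ts) = I x S (map (mval h g) ts)"
| "force N m h I x g (SAnd \<phi> \<psi>) = (force N m h I x g \<phi> \<and> force N m h I x g \<psi>)"
| "force N m h I x g (SAll y \<phi>) = (\<forall>d<m. force N m h I x (g(y := d)) \<phi>)"
| "force N m h I x g (SDia \<phi>) = (\<exists>ys. ys \<noteq> [] \<and> ys @ x \<in> N \<and> force N m h I (ys @ x) g \<phi>)"

fun svars :: "'r spf \<Rightarrow> nat set" where
  "svars STop = {}"
| "svars (SRel S ts) = {x. MVar x \<in> set ts}"
| "svars (SAnd \<phi> \<psi>) = svars \<phi> \<union> svars \<psi>"
| "svars (SAll x \<phi>) = insert x (svars \<phi>)"
| "svars (SDia \<phi>) = svars \<phi>"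

fun mdepth :: "'r spf \<Rightarrow> nat" where
  "mdepth STop = 0"
| "mdepth (SRel S ts) = 0"
| "mdepth (SAnd \<phi> \<psi>) = max (mdepth \<phi>) (mdepth \<psi>)"
| "mdepth (SAll x \<phi>) = mdepth \<phi>"
| "mdepth (SDia \<phi>) = Suc (mdepth \<phi>)"

fun dias :: "'r spf \<Rightarrow> 'r spf set" where
  "dias STop = {}"
| "dias (SRel S ts) = {}"
| "dias (SAnd \<phi> \<psi>) = dias \<phi> \<union> dias \<psi>"
| "dias (SAll x \<phi>) = dias \<phi>"
| "dias (SDia \<phi>) = insert \<phi> (dias \<phi>)"

fun tinst :: "(nat \<Rightarrow> mtrm) \<Rightarrow> mtrm \<Rightarrow> mtrm" where
  "tinst \<sigma> (MVar y) = \<sigma> y"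
| "tinst \<sigma> (MConst c) = MConst c"

text \<open>Bound variables are not renamed. In the instances that form the Kripke model there is no
  capture: values are constants or variables from \<open>B\<close> on, while the variables of the
  formula lie below \<open>B\<close>.\<close>

fun minst :: "(nat \<Rightarrow> mtrm) \<Rightarrow> 'r spf \<Rightarrow> 'r spf" where
  "minst \<sigma> STop = STop"
| "minst \<sigma> (SRel S ts) = SRel S (map (tinst \<sigma>) ts)"
| "minst \<sigma> (SAnd \<phi> \<psi>) = SAnd (minst \<sigma> \<phi>) (minst \<sigma> \<psi>)"
| "minst \<sigma> (SAll x \<phi>) = SAll x (minst (\<sigma>(x := MVar x)) \<phi>)"
| "minst \<sigma> (SDia \<phi>) = SDia (minst \<sigma> \<phi>)"

section \<open>Substitution and depth of modal formulas\<close>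

lemma finite_MVar_set [simp]: "finite {x. MVar x \<in> set ts}"
  by (rule finite_vimageI[of "set ts" MVar, unfolded vimage_def]) (auto simp: inj_def)

lemma finite_MConst_set [simp]: "finite {x. MConst x \<in> set ts}"
  by (rule finite_vimageI[of "set ts" MConst, unfolded vimage_def]) (auto simp: inj_def)

lemma finite_svars [simp]: "finite (svars \<phi>)" by (induction \<phi>) auto
lemma finite_sconsts [simp]: "finite (sconsts \<phi>)" by (induction \<phi>) auto
lemma finite_dias [simp]: "finite (dias \<phi>)" by (induction \<phi>) auto

lemma sfree_svars: "sfree \<phi> \<subseteq> svars \<phi>" by (induction \<phi>) auto

lemma dias_svars: "\<chi> \<in> dias \<phi> \<Longrightarrow> svars \<chi> \<subseteq> svars \<phi>" by (induction \<phi>) auto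
lemma dias_dias: "\<chi> \<in> dias \<phi> \<Longrightarrow> dias \<chi> \<subseteq> dias \<phi>" by (induction \<phi>) auto
lemma dias_sconsts: "\<chi> \<in> dias \<phi> \<Longrightarrow> sconsts \<chi> \<subseteq> sconsts \<phi>" by (induction \<phi>) auto
lemma dias_wf: "\<chi> \<in> dias \<phi> \<Longrightarrow> wf_spf ar C \<phi> \<Longrightarrow> wf_spf ar C \<chi>" by (induction \<phi>) auto

lemma sconsts_wf: "wf_spf ar C \<phi> \<Longrightarrow> sconsts \<phi> \<subseteq> C" by (induction \<phi>) auto

lemma mdepth_ssubst [simp]: "mdepth (ssubst x t \<phi>) = mdepth \<phi>" by (induction \<phi>) auto

text \<open>The source of irreflexivity: no formula derives the diamond of itself.\<close>

lemma QRC1_mdepth: "QRC1 ar C \<phi> \<psi> \<Longrightarrow> mdepth \<psi> \<le> mdepth \<phi>"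
  by (induction rule: QRC1.induct) auto

lemma wf_minst: "wf_spf ar C \<phi> \<Longrightarrow> (\<And>y. wf_mtrm C (\<sigma> y)) \<Longrightarrow> wf_spf ar C (minst \<sigma> \<phi>)"
proof (induction \<phi> arbitrary: \<sigma>)
  case (SRel S ts)
  have "wf_mtrm C t \<Longrightarrow> wf_mtrm C (tinst \<sigma> t)" for t using SRel.prems(2) by (cases t) auto
  then show ?case using SRel.prems(1) by auto
qed auto

lemma minst_cong: "(\<And>y. y \<in> sfree \<phi> \<Longrightarrow> \<sigma> y = \<tau> y) \<Longrightarrow> minst \<sigma> \<phi> = minst \<tau> \<phi>"
proof (induction \<phi> arbitrary: \<sigma> \<tau>)
  case (SRel S ts)
  have "tinst \<sigma> t = tinst \<tau> t" if "t \<in> set ts" for t using SRel that by (cases t) auto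
  then show ?case by simp
next
  case (SAll x \<phi>)
  have "minst (\<sigma>(x := MVar x)) \<phi> = minst (\<tau>(x := MVar x)) \<phi>"
    using SAll.prems by (intro SAll.IH) simp
  then show ?case unfolding minst.simps by (rule arg_cong)
next
  case (SAnd \<phi> \<psi>)
  then show ?case unfolding minst.simps sfree.simps by (metis UnCI)
next
  case (SDia \<phi>)
  then show ?case unfolding minst.simps sfree.simps by metis
qed simp

lemma minst_MVar: "(\<And>y. y \<in> sfree \<phi> \<Longrightarrow> \<sigma> y = MVar y) \<Longrightarrow> minst \<sigma> \<phi> = \<phi>"
proof -
  have *: "minst MVar \<phi> = \<phi>" for \<phi> :: "'a spf"
  proof (induction \<phi>)
    case (SRel S ts)
    have "tinst MVar t = t" for t by (cases t) auto
    then show ?case by (simp add: map_idI)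
  next
    case (SAll x \<phi>)
    have "MVar(x := MVar x) = MVar" by auto
    then show ?case using SAll by simp
  qed auto
  assume "\<And>y. y \<in> sfree \<phi> \<Longrightarrow> \<sigma> y = MVar y"
  then show ?thesis using minst_cong[of \<phi> \<sigma> MVar] * by simp
qed

lemma sfree_minst: "z \<in> sfree (minst \<sigma> \<phi>) \<Longrightarrow> \<exists>y\<in>sfree \<phi>. \<sigma> y = MVar z"
proof (induction \<phi> arbitrary: \<sigma>)
  case (SRel S ts)
  then obtain t where t: "t \<in> set ts" "tinst \<sigma> t = MVar z" by auto
  obtain y where "t = MVar y" using t(2) by (cases t) simp_all
  then show ?case using t by auto
next
  case (SAll x \<phi>)
  then show ?case by (fastforce split: if_splits)
qed auto

lemma free_for_minst:
  assumes "\<And>y. y \<in> sfree \<phi> \<Longrightarrow> \<sigma> y = MVar v \<Longrightarrow> y = x" "v \<notin> svars \<phi>"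
  shows "free_for (MVar x) v (minst \<sigma> \<phi>)"
  using assms
proof (induction \<phi> arbitrary: \<sigma>)
  case (SAll y \<phi>)
  show ?case
  proof (cases "y = x")
    case True
    have "v \<notin> sfree (minst (\<sigma>(x := MVar x)) \<phi>)"
      using SAll.prems True sfree_minst[of v "\<sigma>(x := MVar x)" \<phi>] by (fastforce split: if_splits)
    then show ?thesis using True by simp
  next
    case False
    have "free_for (MVar x) v (minst (\<sigma>(y := MVar y)) \<phi>)"
      using SAll.prems by (intro SAll.IH) (auto split: if_splits)
    then show ?thesis using False by simp
  qed
qed auto

lemma free_for_fresh: "(\<And>v. t = MVar v \<Longrightarrow> v \<notin> svars \<phi>) \<Longrightarrow> free_for t x (minst \<sigma> \<phi>)"
  by (induction \<phi> arbitrary: \<sigma>) auto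

text \<open>A quantifier over \<open>w\<close> in \<open>\<phi>\<close> would block the
  substitution. This is harmless if \<open>w\<close> does not occur in \<open>\<phi>\<close>, or if
  \<open>w\<close> is introduced by nothing but the variable \<open>w\<close> itself, which that
  quantifier would hide on both sides.\<close>

lemma ssubst_minst:
  assumes "w \<notin> svars \<phi> \<or> (\<forall>y\<in>sfree \<phi>. \<sigma> y = MVar w \<longrightarrow> y = w)"
  shows "ssubst w t (minst \<sigma> \<phi>) = minst (\<lambda>y. if \<sigma> y = MVar w then t else \<sigma> y) \<phi>"
  using assms
proof (induction \<phi> arbitrary: \<sigma>)
  case (SRel S ts)
  have "(if tinst \<sigma> s = MVar w then t else tinst \<sigma> s) =
      tinst (\<lambda>y. if \<sigma> y = MVar w then t else \<sigma> y) s" for s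
    by (cases s) auto
  then show ?case by simp
next
  case (SAll y \<phi>)
  show ?case
  proof (cases "y = w")
    case True
    have "minst (\<sigma>(w := MVar w)) \<phi> = minst ((\<lambda>y. if \<sigma> y = MVar w then t else \<sigma> y)(w := MVar w)) \<phi>"
      using SAll.prems True by (intro minst_cong) auto
    then show ?thesis using True by simp
  next
    case False
    have "ssubst w t (minst (\<sigma>(y := MVar y)) \<phi>) =
        minst (\<lambda>z. if (\<sigma>(y := MVar y)) z = MVar w then t else (\<sigma>(y := MVar y)) z) \<phi>"
      using SAll.prems False by (intro SAll.IH) auto
    also have "(\<lambda>z. if (\<sigma>(y := MVar y)) z = MVar w then t else (\<sigma>(y := MVar y)) z) =
        (\<lambda>y. if \<sigma> y = MVar w then t else \<sigma> y)(y := MVar y)"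
      using False by auto
    finally show ?thesis unfolding minst.simps ssubst.simps using False by (simp only: if_False)
  qed
qed auto

text \<open>A counterexample is a Kripke model whose worlds are formulas and whose domain consists of
  terms. The bound \<open>3 * B + 1\<close> leaves a variable of the domain that is free neither in a given world
  nor in a given instance, since these have at most \<open>B\<close> free variables each.\<close>

locale underivable =
  fixes ar :: "'r \<Rightarrow> nat option" and C :: "nat set" and \<phi>0 \<psi>0 :: "'r spf" and B :: nat
  assumes wf: "wf_spf ar C \<phi>0" "wf_spf ar C \<psi>0"
    and bound: "svars \<phi>0 \<subseteq> {..<B}" "svars \<psi>0 \<subseteq> {..<B}"
    and underivable: "\<not> QRC1 ar C \<phi>0 \<psi>0"
begin

abbreviation derives :: "'r spf \<Rightarrow> 'r spf \<Rightarrow> bool" (infix \<open>\<tturnstile>\<close> 50) where "\<phi> \<tturnstile> \<psi> \<equiv> QRC1 ar C \<phi> \<psi>"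

definition dom :: "mtrm set" where
  "dom = MVar ` {B..<3 * B + 1} \<union> MConst ` (sconsts \<phi>0 \<union> sconsts \<psi>0)"

definition relevant :: "'r spf \<Rightarrow> bool" where
  "relevant \<chi> \<longleftrightarrow> wf_spf ar C \<chi> \<and> svars \<chi> \<subseteq> {..<B} \<and> dias \<chi> \<subseteq> dias \<phi>0 \<union> dias \<psi>0 \<and>
    sconsts \<chi> \<subseteq> sconsts \<phi>0 \<union> sconsts \<psi>0"

abbreviation dom_val :: "(nat \<Rightarrow> mtrm) \<Rightarrow> bool" where "dom_val \<sigma> \<equiv> \<forall>y. \<sigma> y \<in> dom"

definition instances :: "'r spf \<Rightarrow> 'r spf set" where
  "instances \<chi> = {minst \<sigma> \<chi> |\<sigma>. dom_val \<sigma>}"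

text \<open>Moves the free variables of the sequent injectively into the domain. The default value
  \<open>B\<close> lies in the domain even if \<open>B\<close> is zero.\<close>

definition \<sigma>0 :: "nat \<Rightarrow> mtrm" where "\<sigma>0 y = MVar (B + (if y < B then y else 0))"

text \<open>Worlds are single formulas rather than theories. Instances of the formulas below a
  diamond are all that successors require, which keeps the model finite.\<close>

definition worlds :: "'r spf set" where
  "worlds = insert (minst \<sigma>0 \<phi>0) (\<Union>\<chi>\<in>dias \<phi>0 \<union> dias \<psi>0. instances \<chi>)"

lemma relevant_simps [simp]:
  "relevant (SAnd \<phi> \<psi>) \<longleftrightarrow> relevant \<phi> \<and> relevant \<psi>"
  "relevant (SAll x \<phi>) \<longleftrightarrow> x < B \<and> relevant \<phi>"
  "relevant (SDia \<phi>) \<longleftrightarrow> \<phi> \<in> dias \<phi>0 \<union> dias \<psi>0 \<and> relevant \<phi>"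
  unfolding relevant_def by auto

lemma relevant0: "relevant \<phi>0" "relevant \<psi>0"
  using wf bound unfolding relevant_def by auto

lemma relevant_dias: "\<chi> \<in> dias \<phi>0 \<union> dias \<psi>0 \<Longrightarrow> relevant \<chi>"
  unfolding relevant_def
  using dias_wf wf bound dias_svars dias_dias dias_sconsts by blast

lemma finite_dom: "finite dom" unfolding dom_def by auto

lemma dom_wf: "d \<in> dom \<Longrightarrow> wf_mtrm C d"
  using sconsts_wf wf unfolding dom_def by fastforce

lemma dom_MVar: "MVar v \<in> dom \<Longrightarrow> B \<le> v" unfolding dom_def by auto

lemma dom_val_upd: "dom_val \<sigma> \<Longrightarrow> d \<in> dom \<Longrightarrow> dom_val (\<sigma>(x := d))" by simp

lemma dom_val_\<sigma>0: "dom_val \<sigma>0" unfolding \<sigma>0_def dom_def by auto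

lemma wf_instance: "relevant \<chi> \<Longrightarrow> dom_val \<sigma> \<Longrightarrow> wf_spf ar C (minst \<sigma> \<chi>)"
  using dom_wf by (intro wf_minst) (auto simp: relevant_def)

lemma sfree_relevant: "relevant \<chi> \<Longrightarrow> sfree \<chi> \<subseteq> {..<B}"
  using sfree_svars[of \<chi>] unfolding relevant_def by blast

lemma card_sfree_instance:
  assumes "relevant \<chi>" shows "finite (sfree (minst \<sigma> \<chi>))" "card (sfree (minst \<sigma> \<chi>)) \<le> B"
proof -
  let ?f = "\<lambda>y. case \<sigma> y of MVar z \<Rightarrow> z | MConst c \<Rightarrow> c"
  have sub: "sfree (minst \<sigma> \<chi>) \<subseteq> ?f ` {..<B}"
  proof
    fix z assume "z \<in> sfree (minst \<sigma> \<chi>)"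
    then obtain y where "y \<in> sfree \<chi>" "\<sigma> y = MVar z" using sfree_minst by blast
    then show "z \<in> ?f ` {..<B}" using sfree_relevant[OF assms] by (intro image_eqI[of _ _ y]) auto
  qed
  then show "finite (sfree (minst \<sigma> \<chi>))" using finite_subset by blast
  have "card (sfree (minst \<sigma> \<chi>)) \<le> card (?f ` {..<B})" using sub by (intro card_mono) auto
  also have "\<dots> \<le> B" using card_image_le[of "{..<B}" ?f] by simp
  finally show "card (sfree (minst \<sigma> \<chi>)) \<le> B" .
qed

lemma world_instance: "\<pi> \<in> worlds \<Longrightarrow> \<exists>\<chi> \<sigma>. relevant \<chi> \<and> dom_val \<sigma> \<and> \<pi> = minst \<sigma> \<chi>"
  unfolding worlds_def instances_def using relevant0(1) dom_val_\<sigma>0 relevant_dias by auto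

lemma world_wf: "\<pi> \<in> worlds \<Longrightarrow> wf_spf ar C \<pi>"
  using world_instance wf_instance by blast

lemma finite_worlds: "finite worlds"
proof -
  have "finite (instances \<chi>)" if "\<chi> \<in> dias \<phi>0 \<union> dias \<psi>0" for \<chi>
  proof (rule finite_subset)
    show "instances \<chi> \<subseteq> (\<lambda>\<sigma>. minst \<sigma> \<chi>) ` ({..<B} \<rightarrow>\<^sub>E dom)"
    proof
      fix \<pi> assume "\<pi> \<in> instances \<chi>"
      then obtain \<sigma> where s: "dom_val \<sigma>" "\<pi> = minst \<sigma> \<chi>" unfolding instances_def by blast
      then have "\<pi> = minst (restrict \<sigma> {..<B}) \<chi>"
        using sfree_relevant[OF relevant_dias[OF that]] by (auto intro!: minst_cong)
      then show "\<pi> \<in> (\<lambda>\<sigma>. minst \<sigma> \<chi>) ` ({..<B} \<rightarrow>\<^sub>E dom)" using s(1) by auto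
    qed
    show "finite ((\<lambda>\<sigma>. minst \<sigma> \<chi>) ` ({..<B} \<rightarrow>\<^sub>E dom))" using finite_dom by (auto intro!: finite_PiE)
  qed
  then show ?thesis unfolding worlds_def by auto
qed

lemma derives_And:
  assumes "wf_spf ar C \<phi>" "wf_spf ar C \<psi>"
  shows "\<pi> \<tturnstile> SAnd \<phi> \<psi> \<longleftrightarrow> \<pi> \<tturnstile> \<phi> \<and> \<pi> \<tturnstile> \<psi>"
  using assms qrc_conjI qrc_cut qrc_conjE1 qrc_conjE2 by metis

text \<open>For the converse a domain variable is chosen that is free neither in
  \<open>\<pi>\<close> nor in the instance of the body. Deriving the instance at this variable is as
  good as deriving it generically: \<open>qrc_allR\<close> generalizes, and the bound variable is
  renamed to \<open>x\<close>.\<close>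

lemma derives_All:
  assumes \<pi>: "\<pi> \<in> worlds" and \<chi>: "relevant (SAll x \<chi>)" and \<sigma>: "dom_val \<sigma>"
  shows "\<pi> \<tturnstile> minst \<sigma> (SAll x \<chi>) \<longleftrightarrow> (\<forall>d\<in>dom. \<pi> \<tturnstile> minst (\<sigma>(x := d)) \<chi>)"
proof
  have x: "x < B" and sv: "svars \<chi> \<subseteq> {..<B}" and rel: "relevant \<chi>" using \<chi> by (auto simp: relevant_def)
  have x_dom: "\<sigma> y \<noteq> MVar x" for y using \<sigma> dom_MVar[of x] x by (metis not_le)
  {
    assume der: "\<pi> \<tturnstile> minst \<sigma> (SAll x \<chi>)"
    show "\<forall>d\<in>dom. \<pi> \<tturnstile> minst (\<sigma>(x := d)) \<chi>"
    proof
      fix d assume d: "d \<in> dom"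
      have "ssubst x d (minst (\<sigma>(x := MVar x)) \<chi>) = minst (\<sigma>(x := d)) \<chi>"
        using x_dom by (subst ssubst_minst) (auto intro!: arg_cong2[of _ _ _ _ minst])
      then have "ssubst x d (minst (\<sigma>(x := MVar x)) \<chi>) \<tturnstile> minst (\<sigma>(x := d)) \<chi>"
        using qrc_refl[OF wf_instance[OF rel dom_val_upd[OF \<sigma> d]]] by (simp only:)
      moreover have "free_for d x (minst (\<sigma>(x := MVar x)) \<chi>)"
        using dom_MVar d sv by (intro free_for_fresh) fastforce
      ultimately have "minst \<sigma> (SAll x \<chi>) \<tturnstile> minst (\<sigma>(x := d)) \<chi>"
        using qrc_allL dom_wf[OF d] by simp
      then show "\<pi> \<tturnstile> minst (\<sigma>(x := d)) \<chi>" using der qrc_cut by blast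
    qed
  }
  assume all: "\<forall>d\<in>dom. \<pi> \<tturnstile> minst (\<sigma>(x := d)) \<chi>"
  obtain \<chi>' \<sigma>' where p: "relevant \<chi>'" "\<pi> = minst \<sigma>' \<chi>'" using world_instance[OF \<pi>] by blast
  let ?U = "sfree \<pi> \<union> sfree (minst \<sigma> \<chi>)"
  have fin: "finite ?U" using card_sfree_instance[OF p(1)] card_sfree_instance[OF rel] p(2) by blast
  have "card ?U \<le> 2 * B"
    using card_Un_le[of "sfree \<pi>" "sfree (minst \<sigma> \<chi>)"] card_sfree_instance(2)[OF p(1), of \<sigma>']
      card_sfree_instance(2)[OF rel, of \<sigma>] unfolding p(2) by linarith
  then have "\<not> {B..<3 * B + 1} \<subseteq> ?U" using card_mono[OF fin, of "{B..<3 * B + 1}"] by auto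
  then obtain v where "v \<in> {B..<3 * B + 1}" "v \<notin> ?U" by blast
  then have v: "B \<le> v" "MVar v \<in> dom" "v \<notin> sfree \<pi>" "v \<notin> sfree (minst \<sigma> \<chi>)"
    unfolding dom_def by auto
  have v_\<sigma>: "\<sigma> y \<noteq> MVar v" if "y \<in> sfree \<chi>" for y
  proof
    have sf: "y \<in> sfree \<phi> \<Longrightarrow> \<sigma> y = MVar v \<Longrightarrow> (\<And>z. z \<in> svars \<phi> \<Longrightarrow> z \<noteq> v) \<Longrightarrow>
        v \<in> sfree (minst \<sigma> \<phi>)" for \<phi> :: "'r spf" and \<sigma>
    proof (induction \<phi> arbitrary: \<sigma>)
      case (SRel S ts)
      then show ?case by force
    qed auto
    assume "\<sigma> y = MVar v"
    then show False using sf[OF that] v(1,4) sv by fastforce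
  qed
  have "\<pi> \<tturnstile> SAll v (minst (\<sigma>(x := MVar v)) \<chi>)" using all v qrc_allR by blast
  moreover have "SAll v (minst (\<sigma>(x := MVar v)) \<chi>) \<tturnstile> SAll x (minst (\<sigma>(x := MVar x)) \<chi>)"
  proof (intro qrc_allR qrc_allL)
    have wfx: "wf_spf ar C (minst (\<sigma>(x := MVar x)) \<chi>)"
      using \<sigma> dom_wf rel by (intro wf_minst) (auto simp: relevant_def)
    have "v \<notin> svars \<chi>" using v(1) sv by auto
    then have "ssubst v (MVar x) (minst (\<sigma>(x := MVar v)) \<chi>) = minst (\<sigma>(x := MVar x)) \<chi>"
      using v_\<sigma> by (subst ssubst_minst) (auto intro!: minst_cong)
    then show "ssubst v (MVar x) (minst (\<sigma>(x := MVar v)) \<chi>) \<tturnstile> minst (\<sigma>(x := MVar x)) \<chi>"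
      using qrc_refl[OF wfx] by simp
    show "free_for (MVar x) v (minst (\<sigma>(x := MVar v)) \<chi>)"
      using v_\<sigma> \<open>v \<notin> svars \<chi>\<close> by (intro free_for_minst) (auto split: if_splits)
    show "x \<notin> sfree (SAll v (minst (\<sigma>(x := MVar v)) \<chi>))"
      using sfree_minst[of x "\<sigma>(x := MVar v)" \<chi>] x_dom x v(1) by (auto split: if_splits)
  qed simp
  ultimately show "\<pi> \<tturnstile> minst \<sigma> (SAll x \<chi>)" using qrc_cut by simp
qed

abbreviation sees :: "'r spf \<Rightarrow> 'r spf \<Rightarrow> bool" where "sees \<pi> \<rho> \<equiv> \<pi> \<tturnstile> SDia \<rho>"

lemma sees_trans: "sees \<pi> \<rho> \<Longrightarrow> sees \<rho> \<tau> \<Longrightarrow> sees \<pi> \<tau>"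
proof -
  assume s: "sees \<pi> \<rho>" "sees \<rho> \<tau>"
  then have "wf_spf ar C \<tau>" using QRC1_wf[OF s(2)] by simp
  then show ?thesis by (rule qrc_cut[OF qrc_cut[OF s(1) qrc_nec[OF s(2)]] qrc_trans])
qed

lemma sees_irrefl: "\<not> sees \<pi> \<pi>"
  using QRC1_mdepth by fastforce

text \<open>The required successor is the instance of the body itself, which is a world by
  construction.\<close>

lemma derives_Dia:
  assumes "relevant (SDia \<chi>)" "dom_val \<sigma>"
  shows "\<pi> \<tturnstile> minst \<sigma> (SDia \<chi>) \<longleftrightarrow> (\<exists>\<rho>\<in>worlds. sees \<pi> \<rho> \<and> \<rho> \<tturnstile> minst \<sigma> \<chi>)"
proof
  assume "\<pi> \<tturnstile> minst \<sigma> (SDia \<chi>)"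
  moreover have "minst \<sigma> \<chi> \<in> worlds" using assms unfolding worlds_def instances_def by auto
  moreover have "minst \<sigma> \<chi> \<tturnstile> minst \<sigma> \<chi>" using assms by (intro qrc_refl wf_instance) auto
  ultimately show "\<exists>\<rho>\<in>worlds. sees \<pi> \<rho> \<and> \<rho> \<tturnstile> minst \<sigma> \<chi>" by auto
next
  assume "\<exists>\<rho>\<in>worlds. sees \<pi> \<rho> \<and> \<rho> \<tturnstile> minst \<sigma> \<chi>"
  then show "\<pi> \<tturnstile> minst \<sigma> (SDia \<chi>)" using qrc_nec qrc_cut unfolding minst.simps by blast
qed

text \<open>The rule \<open>qrc_inst\<close> undoes \<open>\<sigma>0\<close> one variable at a time,
  sending \<open>B + k\<close> back to \<open>k\<close>; the intermediate substitution
  \<open>\<tau> k\<close> has restored the variables below \<open>k\<close>.\<close>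

lemma root_underivable: "\<not> minst \<sigma>0 \<phi>0 \<tturnstile> minst \<sigma>0 \<psi>0"
proof
  assume der: "minst \<sigma>0 \<phi>0 \<tturnstile> minst \<sigma>0 \<psi>0"
  define \<tau> where "\<tau> k y = (if y < k then MVar y else \<sigma>0 y)" for k y
  have step: "ssubst (B + k) (MVar k) (minst (\<tau> k) \<chi>) = minst (\<tau> (Suc k)) \<chi> \<and>
      free_for (MVar k) (B + k) (minst (\<tau> k) \<chi>)"
    if "relevant \<chi>" "k < B" for k \<chi>
  proof
    have sv: "B + k \<notin> svars \<chi>" using that(1) unfolding relevant_def by auto
    then show "ssubst (B + k) (MVar k) (minst (\<tau> k) \<chi>) = minst (\<tau> (Suc k)) \<chi>"
      using sfree_relevant[OF that(1)] that(2)
      by (subst ssubst_minst) (auto intro!: minst_cong simp: \<tau>_def \<sigma>0_def split: if_splits)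
    show "free_for (MVar k) (B + k) (minst (\<tau> k) \<chi>)"
      using sv sfree_relevant[OF that(1)] that(2)
      by (intro free_for_minst) (auto simp: \<tau>_def \<sigma>0_def split: if_splits)
  qed
  have "k \<le> B \<Longrightarrow> minst (\<tau> k) \<phi>0 \<tturnstile> minst (\<tau> k) \<psi>0" for k
  proof (induction k)
    case 0
    have "\<tau> 0 = \<sigma>0" by (auto simp: \<tau>_def)
    then show ?case using der by simp
  next
    case (Suc k)
    then have k: "k < B" by simp
    have "ssubst (B + k) (MVar k) (minst (\<tau> k) \<phi>0) \<tturnstile> ssubst (B + k) (MVar k) (minst (\<tau> k) \<psi>0)"
      using Suc step[OF relevant0(1) k] step[OF relevant0(2) k] by (intro qrc_inst) auto
    then show ?case using step[OF relevant0(1) k] step[OF relevant0(2) k] by simp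
  qed
  moreover have "minst (\<tau> B) \<phi>0 = \<phi>0" "minst (\<tau> B) \<psi>0 = \<psi>0"
    using sfree_relevant[OF relevant0(1)] sfree_relevant[OF relevant0(2)]
    by (auto intro!: minst_MVar simp: \<tau>_def)
  ultimately show False using underivable by (metis order_refl)
qed

end

section \<open>Unravelling into a finite tree\<close>

fun chain :: "('a \<Rightarrow> 'a list) \<Rightarrow> 'a \<Rightarrow> 'a list \<Rightarrow> bool" where
  "chain r root [] = True"
| "chain r root [u] = (u = root)"
| "chain r root (u # v # x) = (u \<in> set (r v) \<and> chain r root (v # x))"

lemma chain_related:
  assumes "\<And>u v w. v \<in> set (r u) \<Longrightarrow> w \<in> set (r v) \<Longrightarrow> w \<in> set (r u)"
  shows "chain r root (u # x) \<Longrightarrow> w \<in> set x \<Longrightarrow> u \<in> set (r w)"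
proof (induction x arbitrary: u)
  case (Cons v x)
  then show ?case using assms by fastforce
qed simp

text \<open>Transitivity relates the last element of a path to all earlier ones, and irreflexivity
  then excludes repetitions. Hence the unravelled tree is finite.\<close>

lemma chain_distinct:
  assumes "\<And>u v w. v \<in> set (r u) \<Longrightarrow> w \<in> set (r v) \<Longrightarrow> w \<in> set (r u)" "\<And>u. u \<notin> set (r u)"
  shows "chain r root x \<Longrightarrow> distinct x"
proof (induction x)
  case (Cons u x)
  have "u \<notin> set x" using chain_related[of r root u x u] assms Cons.prems by blast
  moreover have "chain r root x" using Cons.prems by (cases x) auto
  ultimately show ?case using Cons.IH by simp
qed simp

theorem modal_completeness:
  fixes \<phi> \<psi> :: "'r spf"
  assumes "wf_spf ar C \<phi>" "wf_spf ar C \<psi>" "\<not> QRC1 ar C \<phi> \<psi>"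
  obtains nodes ch root m h g and I :: "nat list \<Rightarrow> 'r \<Rightarrow> nat list \<Rightarrow> bool" where
    "tree nodes ch root" "\<And>c. h c < m" "\<And>y. g y < m"
    "force (set nodes) m h I [root] g \<phi>" "\<not> force (set nodes) m h I [root] g \<psi>"
proof -
  have "finite (svars \<phi> \<union> svars \<psi>)" by simp
  then obtain B where "\<forall>x\<in>svars \<phi> \<union> svars \<psi>. x < B" using finite_nat_set_iff_bounded by blast
  then interpret underivable ar C \<phi> \<psi> B using assms by unfold_locales auto
  obtain Ds where Ds: "set Ds = dom" using finite_list[OF finite_dom] by blast
  obtain Ws where Ws: "set Ws = worlds" using finite_list[OF finite_worlds] by blast
  define m where "m = length Ds"
  have Ds_ex: "\<exists>i<m. Ds ! i = d" if "d \<in> dom" for d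
    using that Ds unfolding m_def by (metis in_set_conv_nth)
  \<comment> \<open>Constants that do not occur in the sequent need a value as well; they receive 0,
    which is legitimate because the domain is not empty.\<close>
  define ix where "ix d = (if d \<in> dom then SOME i. i < m \<and> Ds ! i = d else 0)" for d
  have ix: "ix d < m" "Ds ! ix d = d" if "d \<in> dom" for d
    using someI_ex[OF Ds_ex[OF that]] that by (auto simp: ix_def)
  have "0 < m" using ix dom_val_\<sigma>0 by (metis gr_zeroI not_less_zero)
  then have ix_m: "ix d < m" for d using ix(1) by (cases "d \<in> dom") (auto simp: ix_def)
  obtain root where root: "root < length Ws" "Ws ! root = minst \<sigma>0 \<phi>"
    using Ws in_set_conv_nth[of "minst \<sigma>0 \<phi>" Ws] by (auto simp: worlds_def)
  define r where "r v = filter (\<lambda>u. sees (Ws ! v) (Ws ! u)) [0..<length Ws]" for v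
  have r_trans: "w \<in> set (r u)" if "v \<in> set (r u)" "w \<in> set (r v)" for u v w
    using that sees_trans unfolding r_def by auto
  have r_irrefl: "u \<notin> set (r u)" for u using sees_irrefl unfolding r_def by auto
  define ch where "ch x = (case x of [] \<Rightarrow> [root] | v # _ \<Rightarrow> r v)" for x
  have chain_bound: "chain r root x \<Longrightarrow> set x \<subseteq> {..<length Ws}" for x
  proof (induction x)
    case (Cons u x)
    then show ?case using root(1) by (cases x) (auto simp: r_def)
  qed simp
  have "finite {x. chain r root x}"
    by (rule finite_subset[OF _ finite_subset_distinct[of "{..<length Ws}"]])
      (use chain_bound chain_distinct[of r root, OF r_trans r_irrefl] in auto)
  then obtain nodes where nodes: "set nodes = {x. chain r root x}" using finite_list by blast
  have tree: "tree nodes ch root"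
  proof
    show "u # x \<in> set nodes \<longleftrightarrow> x \<in> set nodes \<and> u \<in> set (ch x)" for u x
      unfolding nodes ch_def by (cases x) auto
  qed (auto simp: nodes ch_def)
  \<comment> \<open>A node is interpreted by the last world on its path, which is the head of the
    list.\<close>
  define I where "I x S is = (Ws ! hd x \<tturnstile> SRel S (map ((!) Ds) is))"
    for x :: "nat list" and S :: 'r and "is"
  define h where "h c = ix (MConst c)" for c
  define g0 where "g0 y = ix (\<sigma>0 y)" for y
  have F: "force (set nodes) m h I x g \<chi> \<longleftrightarrow> Ws ! hd x \<tturnstile> minst (\<lambda>y. Ds ! g y) \<chi>"
    if "relevant \<chi>" "x \<in> set nodes" "x \<noteq> []" "\<And>y. g y < m" for \<chi> x g
    using that
  proof (induction \<chi> arbitrary: x g)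
    case STop
    then have "Ws ! hd x \<in> worlds" using chain_bound[of x] nodes Ws by (cases x) auto
    then show ?case using world_wf qrc_top by auto
  next
    case (SRel S ts)
    have "Ds ! mval h g t = tinst (\<lambda>y. Ds ! g y) t" if "t \<in> set ts" for t
    proof (cases t)
      case (MConst c)
      then have "MConst c \<in> dom" using SRel.prems(1) that by (auto simp: relevant_def dom_def)
      then show ?thesis using ix(2) MConst by (simp add: h_def)
    qed simp
    then have "map ((!) Ds) (map (mval h g) ts) = map (tinst (\<lambda>y. Ds ! g y)) ts" by simp
    then show ?case unfolding force.simps minst.simps I_def by (simp only:)
  next
    case (SAnd \<chi> \<chi>')
    have val: "dom_val (\<lambda>y. Ds ! g y)" using SAnd.prems(4) Ds m_def by (metis nth_mem)
    show ?case using SAnd wf_instance val by (simp add: derives_And)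
  next
    case (SAll y \<chi>)
    have val: "dom_val (\<lambda>y. Ds ! g y)" using SAll.prems(4) Ds m_def by (metis nth_mem)
    have w: "Ws ! hd x \<in> worlds" using chain_bound[of x] nodes Ws SAll.prems by (cases x) auto
    have "force (set nodes) m h I x g (SAll y \<chi>) \<longleftrightarrow>
        (\<forall>d<m. Ws ! hd x \<tturnstile> minst (\<lambda>z. Ds ! (g(y := d)) z) \<chi>)"
      using SAll by auto
    also have "\<dots> \<longleftrightarrow> (\<forall>d\<in>dom. Ws ! hd x \<tturnstile> minst ((\<lambda>y. Ds ! g y)(y := d)) \<chi>)"
    proof -
      have "(\<lambda>z. Ds ! (g(y := d)) z) = (\<lambda>y. Ds ! g y)(y := Ds ! d)" for d by auto
      then show ?thesis using Ds_ex Ds m_def by (metis nth_mem)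
    qed
    also have "\<dots> \<longleftrightarrow> Ws ! hd x \<tturnstile> minst (\<lambda>y. Ds ! g y) (SAll y \<chi>)"
      using derives_All[OF w SAll.prems(1) val] by simp
    finally show ?case .
  next
    case (SDia \<chi>)
    have val: "dom_val (\<lambda>y. Ds ! g y)" using SDia.prems(4) Ds m_def by (metis nth_mem)
    obtain v x' where x: "x = v # x'" using SDia.prems(3) by (cases x) auto
    have rel: "relevant \<chi>" using SDia.prems(1) by simp
    show ?case unfolding derives_Dia[OF SDia.prems(1) val]
    proof
      assume "force (set nodes) m h I x g (SDia \<chi>)"
      then obtain ys where ys: "ys \<noteq> []" "ys @ x \<in> set nodes" "force (set nodes) m h I (ys @ x) g \<chi>"
        by auto
      then obtain u ys' where u: "ys = u # ys'" by (cases ys) auto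
      have "u \<in> set (r v)" using chain_related[of r root u "ys' @ x" v, OF r_trans] ys(2) u x nodes by auto
      moreover have "Ws ! u \<tturnstile> minst (\<lambda>y. Ds ! g y) \<chi>"
        using SDia.IH[OF rel ys(2)] ys(3) u SDia.prems(4) by simp
      ultimately show "\<exists>\<rho>\<in>worlds. sees (Ws ! hd x) \<rho> \<and> \<rho> \<tturnstile> minst (\<lambda>y. Ds ! g y) \<chi>"
        using Ws x by (auto simp: r_def)
    next
      assume "\<exists>\<rho>\<in>worlds. sees (Ws ! hd x) \<rho> \<and> \<rho> \<tturnstile> minst (\<lambda>y. Ds ! g y) \<chi>"
      then obtain u where u: "u < length Ws" "sees (Ws ! v) (Ws ! u)" "Ws ! u \<tturnstile> minst (\<lambda>y. Ds ! g y) \<chi>"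
        using Ws x by (metis in_set_conv_nth list.sel(1))
      then have "u # x \<in> set nodes" using SDia.prems(2) x nodes by (auto simp: r_def)
      moreover have "force (set nodes) m h I (u # x) g \<chi>"
        using SDia.IH[OF rel, of "u # x"] \<open>u # x \<in> set nodes\<close> u(3) SDia.prems(4) by simp
      ultimately show "force (set nodes) m h I x g (SDia \<chi>)"
        by (auto intro!: exI[of _ "[u]"])
    qed
  qed
  have g0: "g0 y < m" "(\<lambda>y. Ds ! g0 y) = \<sigma>0" for y
    using ix_m ix(2) dom_val_\<sigma>0 by (auto simp: g0_def)
  have rn: "[root] \<in> set nodes" using nodes by simp
  have "force (set nodes) m h I [root] g0 \<phi>" "\<not> force (set nodes) m h I [root] g0 \<psi>"
    using F[OF relevant0(1) rn, of g0] F[OF relevant0(2) rn, of g0] g0 root root_underivable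
      qrc_refl[OF wf_instance[OF relevant0(1) dom_val_\<sigma>0]] by auto
  then show thesis using that[OF tree, of h m g0 I] ix_m by (simp add: h_def g0_def)
qed

section \<open>Arithmetical completeness\<close>

lemma entails_trans: "H \<turnstile> B \<Longrightarrow> (\<And>A. A \<in> H \<Longrightarrow> G \<turnstile> A) \<Longrightarrow> G \<turnstile> B"
proof -
  assume B: "H \<turnstile> B" and A: "\<And>A. A \<in> H \<Longrightarrow> G \<turnstile> A"
  obtain xs where xs: "set xs \<subseteq> H" "HA (foldr Imp xs B)" using B unfolding entails_def by blast
  have "G \<turnstile> foldr Imp xs B \<Longrightarrow> set xs \<subseteq> H \<Longrightarrow> G \<turnstile> B"
  proof (induction xs)
    case (Cons A' xs)
    then have "G \<turnstile> foldr Imp xs B" using entails_mp[of G A'] A[of A'] by (simp del: entails_Imp)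
    then show ?case using Cons by simp
  qed simp
  then show ?thesis using xs entails_HA by blast
qed

text \<open>The domain \<open>{..<m}\<close> of a Kripke model is represented by a partition of the natural numbers:
  the classes are the singletons of \<open>0\<close>, ..., \<open>m - 2\<close> and the set of all \<open>n \<ge> m - 1\<close>.\<close>

definition cls :: "nat \<Rightarrow> nat \<Rightarrow> trm \<Rightarrow> fm" where
  "cls m i t = (if Suc i < m then Eq t (numeral_trm i) else Le (numeral_trm i) t)"

lemma delta0_cls: "delta0 (cls m i t)"
  by (simp add: cls_def delta0_Le delta0_Eq)

lemma fsubst_cls [simp]: "fsubst \<sigma> (cls m i t) = cls m i (tsubst \<sigma> t)"
  by (simp add: cls_def)

lemma ffree_cls [simp]: "ffree (cls m i t) = tfree t"
  by (simp add: cls_def ffree_Le)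

lemma entails_cls_numeral: "i < m \<Longrightarrow> G \<turnstile> cls m i (numeral_trm i)"
proof -
  have "HA (Imp Verum (Le (numeral_trm i) (numeral_trm i)))"
  proof (rule sigma_transfer)
    fix M \<nu> assume "pa_model M"
    then interpret pa_model M .
    show "sat M \<nu> (Le (numeral_trm i) (numeral_trm i))" by simp
  qed (auto intro!: sigma_delta0 delta0_Le delta0_Imp delta0_Bot)
  then have "G \<turnstile> Le (numeral_trm i) (numeral_trm i)" by (rule entails_HA_mp) simp
  then show ?thesis by (simp add: cls_def)
qed

lemma entails_cls_exhaust:
  assumes "0 < m" shows "G \<turnstile> Disj (map (\<lambda>i. cls m i t) [0..<m])"
proof -
  have "HA (Imp Verum (Disj (map (\<lambda>i. cls m i t) [0..<m])))"
  proof (rule sigma_transfer)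
    fix M \<nu> assume M: "pa_model M"
    then interpret pa_model M .
    let ?a = "tval M \<nu> t"
    have *: "le (num k) ?a \<or> (\<exists>i<k. ?a = num i)" for k
    proof (induction k)
      case (Suc k)
      then show ?case using le_eq_or[of "num k" ?a] less_Suc_eq by auto
    qed simp
    have "sat M \<nu> (cls m (m - 1) t) \<or> (\<exists>i<m. sat M \<nu> (cls m i t))"
      using *[of "m - 1"] assms by (auto simp: cls_def)
    then show "sat M \<nu> (Disj (map (\<lambda>i. cls m i t) [0..<m]))"
      using assms by (auto simp: sat_Disj intro: bexI[of _ "m - 1"])
  next
    show "sigma (Disj (map (\<lambda>i. cls m i t) [0..<m]))"
      by (auto intro!: sigma_delta0 delta0_Disj delta0_cls)
  qed (auto intro!: sigma_delta0 delta0_Imp delta0_Bot)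
  then show ?thesis by (rule entails_HA_mp) simp
qed

lemma entails_cls_exclusive:
  assumes "i < m" "j < m" "i \<noteq> j" "G \<turnstile> cls m i t" "G \<turnstile> cls m j t"
  shows "G \<turnstile> Bot"
proof -
  have *: "HA (Imp (And (cls m i t) (cls m j t)) Bot)" if ij: "i < j" "j < m" for i j
  proof (rule sigma_transfer)
    fix M \<nu> assume M: "pa_model M" and s: "sat M \<nu> (And (cls m i t) (cls m j t))"
    interpret pa_model M by (rule M)
    have i: "tval M \<nu> t = num i" using s that by (simp add: cls_def)
    have "\<not> le (num j) (num i)"
    proof
      assume "le (num j) (num i)"
      moreover obtain k where k: "num j = ip_succ M (ip_plus M (num i) k)" using num_less[THEN iffD1, OF ij(1)] by blast
      moreover have "le (ip_succ M (num i)) (num j)" unfolding k le_def by auto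
      then have "le (num i) (num j)" using le_trans[OF le_suc] by blast
      ultimately have "num j = num i" using le_antisym by blast
      then show False using ij(1) by simp
    qed
    then show "sat M \<nu> Bot" using s i that by (auto simp: cls_def split: if_splits)
  qed (auto intro!: sigma_delta0 delta0_And delta0_cls delta0_Bot)
  show ?thesis
  proof (cases "i < j")
    case True
    then show ?thesis using entails_HA_mp[OF *[OF True assms(2)]] assms(4,5) by simp
  next
    case False
    then have "j < i" using assms(3) by simp
    then show ?thesis using entails_HA_mp[OF *[OF _ assms(1), of j]] assms(4,5) by simp
  qed
qed

lemma HA_All_var_finst: "HA (Imp (All_var k A) (fsubst (Var(k := t)) A))"
proof -
  have "finst t (bind_var k A) = fsubst (Var(k := t)) A"
    unfolding bind_var_def finst_def fsubst_fsubst by (rule fsubst_cong) auto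
  then show ?thesis using HA_allE[of "bind_var k A" t] by (simp add: All_var_def)
qed

lemma entails_All_var_intro:
  assumes "G \<turnstile> A" "\<And>B. B \<in> G \<Longrightarrow> k \<notin> ffree B" shows "G \<turnstile> All_var k A"
proof -
  have "bind_var k B = flift B" if "B \<in> G" for B
    unfolding bind_var_def flift_def by (rule fsubst_cong) (use assms(2)[OF that] in auto)
  then have "bind_var k ` G = flift ` G" by (rule image_cong[OF refl])
  then have "flift ` G \<turnstile> bind_var k A"
    using entails_fsubst[OF assms(1)] unfolding bind_var_def by metis
  then show ?thesis unfolding All_var_def by (rule entails_allI)
qed

section \<open>The realization and its truth lemma\<close>

locale solovay_model = solovay nodes ch root D lam
  for nodes :: "nat list list" and ch root D lam +
  fixes ar :: "'r \<Rightarrow> nat option" and C :: "nat set" and m :: nat and h :: "nat \<Rightarrow> nat"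
    and I :: "nat list \<Rightarrow> 'r \<Rightarrow> nat list \<Rightarrow> bool"
  assumes h_less: "h c < m"
begin

definition witnesses :: "'r \<Rightarrow> nat \<Rightarrow> (nat list \<times> nat list) list" where
  "witnesses S n = filter (\<lambda>(x, is). I x S is)
    (List.product (filter ((\<noteq>) []) nodes) (List.n_lists n [0..<m]))"

definition witnessed :: "trm list \<Rightarrow> nat list \<times> nat list \<Rightarrow> fm" where
  "witnessed ts w = And (lam (fst w)) (Conj (map (\<lambda>k. cls m (snd w ! k) (ts ! k)) [0..<length ts]))"

text \<open>A relation holds of numbers if the walk ends at a node where the Kripke model makes it
  true of their classes. Since nodes and classes are finite in number, this is a finite
  disjunction.\<close>

definition rho :: "'r \<Rightarrow> fm" where
  "rho S = (let n = the (ar S) in Disj (map (witnessed (map Var [0..<n])) (witnesses S n)))"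

text \<open>Hypotheses that put each variable, whether it translates a modal variable or a constant,
  into the class prescribed by \<open>g\<close> and \<open>h\<close>.\<close>

definition ctx :: "(nat \<Rightarrow> nat) \<Rightarrow> fm set" where
  "ctx g = range (\<lambda>t. cls m (mval h g t) (var_of t))"

abbreviation here :: "nat list \<Rightarrow> (nat \<Rightarrow> nat) \<Rightarrow> fm set" where
  "here x g \<equiv> insert (lam x) (ctx g)"

abbreviation forces :: "nat list \<Rightarrow> (nat \<Rightarrow> nat) \<Rightarrow> 'r spf \<Rightarrow> bool" where
  "forces \<equiv> force (set nodes) m h I"

lemma fsubst_lam [simp]: "fsubst \<sigma> (lam x) = lam x"
  using ffree_lam by (intro fsubst_idem) simp

lemma witnesses_iff: "w \<in> set (witnesses S n) \<longleftrightarrow>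
    I (fst w) S (snd w) \<and> fst w \<in> set nodes \<and> fst w \<noteq> [] \<and> length (snd w) = n \<and> set (snd w) \<subseteq> {..<m}"
  by (cases w) (auto simp: witnesses_def set_n_lists)

lemma realization_rho: "realization ar rho"
  unfolding realization_def rho_def Let_def witnessed_def
  by (auto simp: ffree_Disj ffree_Conj ffree_lam)

lemma translate_rel:
  assumes "ar S = Some (length ts)"
  shows "translate rho (SRel S ts) = Disj (map (witnessed (map var_of ts)) (witnesses S (length ts)))"
  using assms
  by (auto simp: rho_def Let_def witnessed_def fsubst_Disj fsubst_Conj
      intro!: arg_cong[of _ _ Disj] arg_cong[of _ _ Conj])

lemma entails_lam_Dia:
  "ys \<noteq> [] \<Longrightarrow> ys @ x \<in> set nodes \<Longrightarrow> HA (Imp (lam x) (Neg (Box (Neg (lam (ys @ x))))))"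
proof (induction ys)
  case (Cons u ys)
  then have n: "u # ys @ x \<in> set nodes" by simp
  have step: "HA (Imp (lam (ys @ x)) (Neg (Box (Neg (lam (u # ys @ x))))))"
    unfolding HA_Imp_iff by (rule HA_lam_Dia[OF n]) simp
  show ?case
  proof (cases "ys = []")
    case False
    then have "HA (Imp (lam x) (Neg (Box (Neg (lam (ys @ x))))))"
      using Cons.IH n node_Cons by blast
    then show ?thesis
      using HA_imp_trans[OF _ HA_imp_trans[OF HA_Dia_mono[OF step] HA_Dia_Dia]] by simp
  qed (use step in simp)
qed simp

lemma ctx_Box: "A \<in> ctx g \<Longrightarrow> sigma A"
  unfolding ctx_def by (auto intro: sigma_delta0 delta0_cls)

lemma mval_less: "(\<And>y. g y < m) \<Longrightarrow> mval h g t < m"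
  using h_less by (cases t) auto

text \<open>Both halves are needed at once: the refutation of a formula at all descendants is what
  gives its refutability at \<open>x\<close>. Together they show that \<open>lam x\<close> decides
  the translation.\<close>

lemma truth:
  assumes "wf_spf ar C \<chi>" "x \<in> set nodes" "x \<noteq> []" "\<And>y. g y < m"
  shows "(forces x g \<chi> \<longrightarrow> here x g \<turnstile> translate rho \<chi>) \<and>
    (\<not> forces x g \<chi> \<longrightarrow> here x g \<turnstile> Neg (translate rho \<chi>))"
  using assms
proof (induction \<chi> arbitrary: x g)
  case STop
  then show ?case by simp
next
  case (SRel S ts)
  have ar: "ar S = Some (length ts)" using SRel.prems(1) by simp
  have cls: "here x g \<turnstile> cls m (mval h g t) (var_of t)" for t
    by (rule entails_assm) (simp add: ctx_def)
  let ?is = "map (mval h g) ts"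
  show ?case
  proof (intro conjI impI)
    assume "forces x g (SRel S ts)"
    then have "(x, ?is) \<in> set (witnesses S (length ts))"
      using SRel.prems mval_less by (auto simp: witnesses_iff)
    moreover have "here x g \<turnstile> witnessed (map var_of ts) (x, ?is)"
      using cls by (simp add: witnessed_def entails_Conj)
    ultimately show "here x g \<turnstile> translate rho (SRel S ts)"
      unfolding translate_rel[OF ar] by (rule_tac entails_DisjI) auto
  next
    assume no: "\<not> forces x g (SRel S ts)"
    have "insert (translate rho (SRel S ts)) (here x g) \<turnstile> Bot"
    proof (rule entails_DisjE)
      show "insert (translate rho (SRel S ts)) (here x g) \<turnstile>
          Disj (map (witnessed (map var_of ts)) (witnesses S (length ts)))"
        unfolding translate_rel[OF ar] by simp
      fix A assume "A \<in> set (map (witnessed (map var_of ts)) (witnesses S (length ts)))"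
      then obtain w where "w \<in> set (witnesses S (length ts))" "A = witnessed (map var_of ts) w"
        unfolding set_map by blast
      then obtain y "is" where y: "I y S is" "y \<in> set nodes" "length is = length ts" "set is \<subseteq> {..<m}"
          "A = And (lam y) (Conj (map (\<lambda>k. cls m (is ! k) (map var_of ts ! k)) [0..<length ts]))"
        by (auto simp: witnesses_iff witnessed_def)
      let ?G = "insert A (insert (translate rho (SRel S ts)) (here x g))"
      have A: "?G \<turnstile> A" by simp
      have x: "?G \<turnstile> lam x" by (rule entails_assm) simp
      show "?G \<turnstile> Bot"
      proof (cases "y = x")
        case False
        have "?G \<turnstile> And (lam y) (lam x)" using A x unfolding y(5) entails_And by blast
        then show ?thesis by (rule entails_HA_mp[OF HA_lam_exclusive[OF y(2) SRel.prems(2) False]])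
      next
        case True
        then have "is \<noteq> ?is" using no y(1) by auto
        then obtain k where k: "k < length ts" "is ! k \<noteq> mval h g (ts ! k)"
          using y(3) by (metis length_map nth_equalityI nth_map)
        have "?G \<turnstile> cls m (is ! k) (var_of (ts ! k))"
          using A k(1) unfolding y(5) entails_And entails_Conj by simp
        moreover have "?G \<turnstile> cls m (mval h g (ts ! k)) (var_of (ts ! k))"
          using cls by (rule entails_mono) auto
        moreover have "is ! k < m" using y(3,4) k(1) nth_mem[of k "is"] by fastforce
        ultimately show ?thesis
          using entails_cls_exclusive[OF _ mval_less[of g, OF SRel.prems(4)] k(2)] by blast
      qed
    qed
    then show "here x g \<turnstile> Neg (translate rho (SRel S ts))" unfolding entails_Imp .
  qed
next
  case (SAnd \<chi> \<chi>')
  have IH: "forces x g \<chi> \<longrightarrow> here x g \<turnstile> translate rho \<chi>"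
      "\<not> forces x g \<chi> \<longrightarrow> here x g \<turnstile> Neg (translate rho \<chi>)"
      "forces x g \<chi>' \<longrightarrow> here x g \<turnstile> translate rho \<chi>'"
      "\<not> forces x g \<chi>' \<longrightarrow> here x g \<turnstile> Neg (translate rho \<chi>')"
    using SAnd.IH(1)[of x g] SAnd.IH(2)[of x g] SAnd.prems by auto
  have "here x g \<turnstile> Imp (Neg (translate rho \<chi>)) (Neg (translate rho (SAnd \<chi> \<chi>')))"
      "here x g \<turnstile> Imp (Neg (translate rho \<chi>')) (Neg (translate rho (SAnd \<chi> \<chi>')))"
    unfolding entails_Imp translate.simps
    by (rule entails_mp_assm[of "translate rho \<chi>"], simp, simp,
        rule entails_mp_assm[of "translate rho \<chi>'"], simp, simp)
  then show ?case using IH entails_mp by (simp del: entails_Imp) blast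
next
  case (SAll y \<chi>)
  have IH: "forces x (g(y := d)) \<chi> \<longrightarrow> here x (g(y := d)) \<turnstile> translate rho \<chi>"
      "\<not> forces x (g(y := d)) \<chi> \<longrightarrow> here x (g(y := d)) \<turnstile> Neg (translate rho \<chi>)" if d: "d < m" for d
  proof -
    have "wf_spf ar C \<chi>" "\<And>z. (g(y := d)) z < m" using SAll.prems d by simp_all
    from SAll.IH[of x "g(y := d)", OF this(1) SAll.prems(2,3) this(2)]
    show "forces x (g(y := d)) \<chi> \<longrightarrow> here x (g(y := d)) \<turnstile> translate rho \<chi>"
      "\<not> forces x (g(y := d)) \<chi> \<longrightarrow> here x (g(y := d)) \<turnstile> Neg (translate rho \<chi>)" by blast+
  qed
  have mval_upd: "t \<noteq> MVar y \<Longrightarrow> mval h (g(y := d)) t = mval h g t" for t d by (cases t) auto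
  show ?case
  proof (intro conjI impI)
    assume "forces x g (SAll y \<chi>)"
    then have all: "here x (g(y := d)) \<turnstile> translate rho \<chi>" if "d < m" for d using IH(1) that by simp
    \<comment> \<open>The hypothesis about the quantified variable is dropped, since it would block
      generalization; the distinction of all classes makes up for it.\<close>
    let ?G = "insert (lam x) ((\<lambda>t. cls m (mval h g t) (var_of t)) ` (- {MVar y}))"
    have "here x (g(y := d)) \<subseteq> insert (cls m d (Var (2 * y))) ?G" for d
    proof -
      have "cls m (mval h (g(y := d)) t) (var_of t) \<in> insert (cls m d (Var (2 * y))) ?G" for t
        by (cases "t = MVar y") (auto simp: mval_upd)
      then show ?thesis unfolding ctx_def by blast
    qed
    then have "insert (cls m d (Var (2 * y))) ?G \<turnstile> translate rho \<chi>" if "d < m" for d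
      using entails_mono[OF all[OF that]] by blast
    moreover have "?G \<turnstile> Disj (map (\<lambda>i. cls m i (Var (2 * y))) [0..<m])"
      using h_less by (intro entails_cls_exhaust) (metis gr_zeroI not_less_zero)
    ultimately have "?G \<turnstile> translate rho \<chi>" by (rule_tac entails_DisjE) auto
    then have "?G \<turnstile> All_var (2 * y) (translate rho \<chi>)"
    proof (rule entails_All_var_intro)
      fix B assume "B \<in> ?G"
      then consider "B = lam x" | t where "t \<noteq> MVar y" "B = cls m (mval h g t) (var_of t)" by blast
      then show "2 * y \<notin> ffree B"
      proof cases
        case (2 t)
        then show ?thesis using var_index_inject[of "MVar y" t] by (simp add: var_of_index)
      qed (simp add: ffree_lam)
    qed
    then show "here x g \<turnstile> translate rho (SAll y \<chi>)"
      unfolding translate.simps ctx_def by (rule entails_mono) auto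
  next
    assume "\<not> forces x g (SAll y \<chi>)"
    then obtain d where d: "d < m" "here x (g(y := d)) \<turnstile> Neg (translate rho \<chi>)" using IH(2) by auto
    \<comment> \<open>The numeral of \<open>d\<close> belongs to class \<open>d\<close>, so
      substituting it turns the hypothesis about the quantified variable into a theorem and refutes
      that instance.\<close>
    let ?\<sigma> = "Var(2 * y := numeral_trm d)"
    let ?G = "insert (All_var (2 * y) (translate rho \<chi>)) (here x g)"
    have "fsubst ?\<sigma> ` here x (g(y := d)) \<turnstile> fsubst ?\<sigma> (Neg (translate rho \<chi>))"
      by (rule entails_fsubst[OF d(2)])
    then have "?G \<turnstile> fsubst ?\<sigma> (Neg (translate rho \<chi>))"
    proof (rule entails_trans)
      fix A assume "A \<in> fsubst ?\<sigma> ` here x (g(y := d))"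
      then consider "A = lam x" | t where "A = cls m (mval h (g(y := d)) t) (tsubst ?\<sigma> (var_of t))"
        unfolding ctx_def by auto
      then show "?G \<turnstile> A"
      proof cases
        case (2 t)
        show ?thesis
        proof (cases "t = MVar y")
          case True then show ?thesis using 2 entails_cls_numeral[OF d(1)] by simp
        next
          case False
          then have "var_index t \<noteq> 2 * y" using var_index_inject[of t "MVar y"] by simp
          then have "A = cls m (mval h g t) (var_of t)" using 2 False by (simp add: mval_upd var_of_index)
          then show ?thesis by (intro entails_assm) (auto simp: ctx_def)
        qed
      qed (simp add: entails_assm)
    qed
    moreover have "?G \<turnstile> fsubst ?\<sigma> (translate rho \<chi>)"
      by (rule entails_HA_mp[OF HA_All_var_finst]) simp
    ultimately have "?G \<turnstile> Bot" using entails_mp by auto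
    then show "here x g \<turnstile> Neg (translate rho (SAll y \<chi>))" by simp
  qed
next
  case (SDia \<chi>)
  have wf: "wf_spf ar C \<chi>" using SDia.prems(1) by simp
  let ?A = "translate rho \<chi>"
  show ?case
  proof (intro conjI impI)
    assume "forces x g (SDia \<chi>)"
    then obtain ys where ys: "ys \<noteq> []" "ys @ x \<in> set nodes" "forces (ys @ x) g \<chi>" by auto
    then have A: "here (ys @ x) g \<turnstile> ?A" using SDia.IH[of "ys @ x" g, OF wf ys(2) _ SDia.prems(4)] by simp
    let ?G = "insert (Box (Neg ?A)) (here x g)"
    \<comment> \<open>This sequent is moved under \<open>Box\<close>: the class assignments are
      decidable, hence provable, and \<open>Neg ?A\<close> is provable by assumption. The resulting
      refutability of a descendant contradicts \<open>lam x\<close>.\<close>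
    have "insert (Neg ?A) (ctx g) \<turnstile> Neg (lam (ys @ x))" unfolding entails_Imp[of _ "lam (ys @ x)"]
      by (rule entails_mp_assm[of ?A], simp) (rule entails_mono[OF A], auto)
    then have "?G \<turnstile> Box (Neg (lam (ys @ x)))"
    proof (rule entails_Box_context)
      fix B assume "B \<in> insert (Neg ?A) (ctx g)"
      then consider "B = Neg ?A" | "B \<in> ctx g" by blast
      then show "?G \<turnstile> Box B"
        by cases (simp, rule entails_sigma_Box[OF ctx_Box], auto intro: entails_assm)
    qed
    moreover have "?G \<turnstile> Neg (Box (Neg (lam (ys @ x))))"
      by (rule entails_HA_mp[OF entails_lam_Dia[OF ys(1,2)]]) simp
    ultimately have "?G \<turnstile> Bot" using entails_mp by blast
    then show "here x g \<turnstile> translate rho (SDia \<chi>)" by simp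
  next
    assume "\<not> forces x g (SDia \<chi>)"
    then have "here (ys @ x) g \<turnstile> Neg ?A" if "ys \<noteq> []" "ys @ x \<in> set nodes" for ys
      using SDia.IH[of "ys @ x" g, OF wf that(2) _ SDia.prems(4)] that by auto
    then have B: "here x g \<turnstile> Box (Neg ?A)"
      using lam_Box[OF SDia.prems(2,3), of "ctx g" ?A] ctx_Box by blast
    have "insert (translate rho (SDia \<chi>)) (here x g) \<turnstile> Bot"
      by (rule entails_mp_assm[of "Box (Neg ?A)"], simp) (rule entails_mono[OF B], auto)
    then show "here x g \<turnstile> Neg (translate rho (SDia \<chi>))" unfolding entails_Imp .
  qed
qed

lemma countermodel:
  assumes wf: "wf_spf ar C \<phi>" "wf_spf ar C \<psi>" and g: "\<And>y. g y < m"
    and f: "forces [root] g \<phi>" "\<not> forces [root] g \<psi>"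
  shows "\<not> HA (Imp (translate rho \<phi>) (translate rho \<psi>))"
proof
  assume "HA (Imp (translate rho \<phi>) (translate rho \<psi>))"
  have root: "[root] \<in> set nodes" using Nil_node node_Cons ch_Nil by simp
  have "here [root] g \<turnstile> translate rho \<phi>" using truth[of \<phi> "[root]" g, OF wf(1) root _ g] f by simp
  then have "here [root] g \<turnstile> translate rho \<psi>"
    by (rule entails_HA_mp[OF \<open>HA (Imp (translate rho \<phi>) (translate rho \<psi>))\<close>])
  moreover have "here [root] g \<turnstile> Neg (translate rho \<psi>)" using truth[of \<psi> "[root]" g, OF wf(2) root _ g] f by (simp del: entails_Imp)
  ultimately have Bot: "here [root] g \<turnstile> Bot" using entails_mp by blast
  \<comment> \<open>Each variable is replaced by the numeral representing its class. All class
    assignments become theorems, and only the sentence of the root remains as a hypothesis.\<close>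
  let ?\<sigma> = "\<lambda>i. numeral_trm (if even i then g (i div 2) else h (i div 2))"
  have \<sigma>: "tsubst ?\<sigma> (var_of t) = numeral_trm (mval h g t)" for t by (cases t) auto
  have "fsubst ?\<sigma> ` here [root] g \<turnstile> fsubst ?\<sigma> Bot" by (rule entails_fsubst[OF Bot])
  then have "{lam [root]} \<turnstile> fsubst ?\<sigma> Bot"
  proof (rule entails_trans)
    fix A assume "A \<in> fsubst ?\<sigma> ` here [root] g"
    then consider "A = lam [root]" | t where "A = cls m (mval h g t) (numeral_trm (mval h g t))"
      unfolding ctx_def by (auto simp: \<sigma>)
    then show "{lam [root]} \<turnstile> A"
      using entails_cls_numeral mval_less[OF g] by cases auto
  qed
  then show False using lam_root_consistent by (simp add: HA_Imp_iff)
qed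

end

theorem arithmetical_completeness:
  assumes "wf_spf ar C \<phi>" "wf_spf ar C \<psi>"
    and "\<And>\<rho>. realization ar \<rho> \<Longrightarrow> HA (Imp (translate \<rho> \<phi>) (translate \<rho> \<psi>))"
  shows "QRC1 ar C \<phi> \<psi>"
proof (rule ccontr)
  assume "\<not> QRC1 ar C \<phi> \<psi>"
  then show False
  proof (rule modal_completeness[OF assms(1,2)])
    fix nodes ch root m h g and I :: "nat list \<Rightarrow> 'a \<Rightarrow> nat list \<Rightarrow> bool"
    assume K: "tree nodes ch root" "\<And>c. h c < m" "\<And>y. g y < m"
      "force (set nodes) m h I [root] g \<phi>" "\<not> force (set nodes) m h I [root] g \<psi>"
    interpret tree nodes ch root by (rule K(1))
    obtain D lam where S: "\<And>x. delta0 (D x)" "\<And>x. ffree (lam x) = {}"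
      "\<And>x. x \<in> set nodes \<Longrightarrow> HA (Iff (lam x) (limit D ch x))"
      "\<And>x. HA (Iff (Exists (D x)) (Box (Neg (lam x))))"
      by (rule solovay_sentences) blast
    interpret solovay_model nodes ch root D lam ar C m h I
      by unfold_locales (fact S K(2))+
    show False using countermodel[OF assms(1,2) K(3-5)] assms(3)[OF realization_rho] by blast
  qed
qed

theorem theorem7p6:
  fixes ar :: "'r \<Rightarrow> nat option" and C :: "nat set" and \<phi> \<psi> :: "'r spf"
  assumes "wf_spf ar C \<phi>" and "wf_spf ar C \<psi>"
  shows "QRC1 ar C \<phi> \<psi> \<longleftrightarrow>
    (\<forall>\<rho>. realization ar \<rho> \<longrightarrow> HA (Imp (translate \<rho> \<phi>) (translate \<rho> \<psi>)))"
  using arithmetical_completeness[OF assms] realized.soundness[OF realized.intro] by blast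

end
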